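(* Let $X=G\backslash\tilde X$ be a regular quotient of a Hadamard space $\tilde X$. Let $\alpha$ be a quasi-ray on $X$ with origin $a$, and lift it to $\tilde\alpha$ in $\tilde X$, with origin $\tilde a$. Then, for all $x,y\in X$, $$B_\alpha(x,y)=\rho\big(H^{max}_{\tilde\alpha^+}(x),H^{max}_{\tilde\alpha^+}(y)\big).$$ In the particular case $x=a$, for any lift $\tilde y$ of $y$ to $\tilde X$, $$B_\alpha(a,y)=\sup_{g\in G}B_{\tilde\alpha}(\tilde a,g\tilde y)-\Delta(\alpha)=\rho\big(\tilde a,H^{max}_{\tilde\alpha^+}(y)\big)-\Delta(\alpha),$$ and, if $\alpha$ is a ray, $$B_\alpha(a,y)=\sup_{g\in G}B_{\tilde\alpha}(\tilde a,g\tilde y)=\rho\big(\tilde a,H^{max}_{\tilde\alpha^+}(y)\big).$$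
   Context: A Hadamard space is a complete simply connected Riemannian manifold $\tilde X$ of nonpositive sectional curvature; a regular quotient $X=G\backslash\tilde X$ is its quotient by a discrete, torsion-free group $G$ of isometries. Geodesics are parametrized by arc-length. The length excess of a half-geodesic $\alpha:[0,\infty)\to X$ is $\Delta(\alpha)=\sup_{t,s}\big(|t-s|-d(\alpha(t),\alpha(s))\big)$; $\alpha$ is a quasi-ray if $\Delta(\alpha)<\infty$ and a ray if $\Delta(\alpha)=0$. The Busemann function of a quasi-ray is $B_\alpha(x,y)=\lim_{t\to\infty}\big(d(x,\alpha(t))-d(\alpha(t),y)\big)$ (same definition for rays of $\tilde X$). For a ray $\tilde\alpha$ of $\tilde X$, $\tilde\alpha^+\in\partial\tilde X$ denotes its point at infinity, and $B_{\tilde\alpha^+}=B_{\tilde\alpha}$. Horoballs centered at $\xi\in\partial\tilde X$ are the sets $H_\xi(\tilde x)=\{\tilde y: B_\xi(\tilde x,\tilde y)\ge 0\}$, with boundary horospheres $\partial H_\xi(\tilde x)=\{\tilde y: B_\xi(\tilde x,\tilde y)=0\}$. If $\sup_{g\in G}B_\xi(\tilde x,g\tilde x)<\infty$ (which holds for $\xi=\tilde\alpha^+$ when $\alpha$ is a quasi-ray), the maximal horoball at $\xi$ relative to the projection $x$ of $\tilde x$ is $$H^{max}_\xi(x)=\{\tilde y\in\tilde X: B_\xi(\tilde x,\tilde y)\ge\sup_{g\in G}B_\xi(\tilde x,g\tilde x)\},$$ which depends only on $\xi$ and $x$. Signed distances, for horoballs $H,H'$ with the same center: $\rho(\tilde x,H)=d(\tilde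 x,\partial H)$ if $\tilde x\notin H$ and $-d(\tilde x,\partial H)$ otherwise; $\rho(H,H')=d(\partial H,\partial H')$ if $H\supset H'$ and $-d(\partial H,\partial H')$ otherwise. *)

theory Defs
  imports "HOL-Analysis.Analysis"
begin

section \<open>Riemannian manifolds\<close>

text \<open>Functions of class \<open>C\<^sup>k\<close> on an open set: all iterated directional derivatives up to
  order \<open>k\<close> exist (as values of Frechet derivatives) and are continuous.\<close>

primrec Ck_on :: "nat \<Rightarrow> ('m::real_normed_vector \<Rightarrow> 'n::real_normed_vector) \<Rightarrow> 'm set \<Rightarrow> bool" where
  "Ck_on 0 f S \<longleftrightarrow> continuous_on S f"
| "Ck_on (Suc k) f S \<longleftrightarrow> (\<forall>x\<in>S. f differentiable (at x)) \<and>
     (\<forall>v. Ck_on k (\<lambda>x. frechet_derivative f (at x) v) S)"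

definition smooth_on :: "'m::real_normed_vector set \<Rightarrow> ('m \<Rightarrow> 'n::real_normed_vector) \<Rightarrow> bool" where
  "smooth_on S f \<longleftrightarrow> (\<forall>k. Ck_on k f S)"

text \<open>A chart of a manifold modelled on the Euclidean space \<open>'e\<close>, together with the expression of
  the metric tensor in that chart: \<open>chart_metric c p v w\<close> is the inner product of the tangent
  vectors with coordinates \<open>v\<close> and \<open>w\<close> at the point with coordinates \<open>p\<close>.\<close>

datatype ('a, 'e) rchart =
  RChart (chart_dom: "'a set") (chart_map: "'a \<Rightarrow> 'e") (chart_metric: "'e \<Rightarrow> 'e \<Rightarrow> 'e \<Rightarrow> real")

definition riemannian_chart :: "('a::topological_space, 'e::euclidean_space) rchart \<Rightarrow> bool" where
  "riemannian_chart c \<longleftrightarrow>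
     open (chart_dom c) \<and> open (chart_map c ` chart_dom c) \<and>
     homeomorphism (chart_dom c) (chart_map c ` chart_dom c)
       (chart_map c) (inv_into (chart_dom c) (chart_map c)) \<and>
     (\<forall>p \<in> chart_map c ` chart_dom c.
        bilinear (chart_metric c p) \<and>
        (\<forall>v w. chart_metric c p v w = chart_metric c p w v) \<and>
        (\<forall>v. v \<noteq> 0 \<longrightarrow> chart_metric c p v v > 0)) \<and>
     (\<forall>v w. smooth_on (chart_map c ` chart_dom c) (\<lambda>p. chart_metric c p v w))"

definition transition :: "('a, 'e) rchart \<Rightarrow> ('a, 'e) rchart \<Rightarrow> 'e \<Rightarrow> 'e" where
  "transition c c' = chart_map c' \<circ> inv_into (chart_dom c) (chart_map c)"

definition compatible_charts :: "('a, 'e::euclidean_space) rchart \<Rightarrow> ('a, 'e) rchart \<Rightarrow> bool" where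
  "compatible_charts c c' \<longleftrightarrow>
     smooth_on (chart_map c ` (chart_dom c \<inter> chart_dom c')) (transition c c') \<and>
     (\<forall>p \<in> chart_map c ` (chart_dom c \<inter> chart_dom c'). \<forall>v w.
        chart_metric c p v w =
        chart_metric c' (transition c c' p)
          (frechet_derivative (transition c c') (at p) v)
          (frechet_derivative (transition c c') (at p) w))"

definition riemannian_atlas :: "('a::topological_space, 'e::euclidean_space) rchart set \<Rightarrow> bool" where
  "riemannian_atlas A \<longleftrightarrow>
     (\<Union>c\<in>A. chart_dom c) = UNIV \<and>
     (\<forall>c\<in>A. riemannian_chart c) \<and>
     (\<forall>c\<in>A. \<forall>c'\<in>A. compatible_charts c c')"

text \<open>Lengths of piecewise \<open>C\<^sup>1\<close> curves. On each closed interval between consecutive break points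
  (the finite set \<open>S\<close> below) the curve is \<open>C\<^sup>1\<close> up to the endpoints, with one-sided derivatives there.\<close>

definition C1_curve_on ::
  "('a::topological_space, 'e::euclidean_space) rchart set \<Rightarrow> real set \<Rightarrow> (real \<Rightarrow> 'a) \<Rightarrow> bool" where
  "C1_curve_on A I \<sigma> \<longleftrightarrow> continuous_on I \<sigma> \<and>
     (\<forall>c\<in>A. \<exists>D. continuous_on (I \<inter> \<sigma> -` chart_dom c) D \<and>
        (\<forall>t \<in> I \<inter> \<sigma> -` chart_dom c.
           ((chart_map c \<circ> \<sigma>) has_vector_derivative D t) (at t within I)))"

definition piecewise_C1_curve ::
  "('a::topological_space, 'e::euclidean_space) rchart set \<Rightarrow> (real \<Rightarrow> 'a) \<Rightarrow> bool" where
  "piecewise_C1_curve A \<sigma> \<longleftrightarrow> continuous_on {0..1} \<sigma> \<and>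
     (\<exists>S. finite S \<and>
        (\<forall>a b. 0 \<le> a \<and> a < b \<and> b \<le> 1 \<and> {a<..<b} \<inter> S = {} \<longrightarrow> C1_curve_on A {a..b} \<sigma>))"

text \<open>The speed does not depend on the chart selected around \<open>\<sigma> t\<close>; its values at the finitely many
  break points do not affect the length.\<close>

definition curve_speed ::
  "('a, 'e::euclidean_space) rchart set \<Rightarrow> (real \<Rightarrow> 'a) \<Rightarrow> real \<Rightarrow> real" where
  "curve_speed A \<sigma> t =
     (let c = (SOME c. c \<in> A \<and> \<sigma> t \<in> chart_dom c);
          v = vector_derivative (chart_map c \<circ> \<sigma>) (at t)
      in sqrt (chart_metric c (chart_map c (\<sigma> t)) v v))"

definition curve_length ::
  "('a, 'e::euclidean_space) rchart set \<Rightarrow> (real \<Rightarrow> 'a) \<Rightarrow> real" where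
  "curve_length A \<sigma> = integral {0..1} (curve_speed A \<sigma>)"

text \<open>A connected Riemannian manifold is presented as a metric space whose distance is the
  Riemannian distance. The topology of the manifold is then the metric one, so that it is
  automatically Hausdorff and second countable.\<close>

definition riemannian_manifold :: "('a::metric_space, 'e::euclidean_space) rchart set \<Rightarrow> bool" where
  "riemannian_manifold A \<longleftrightarrow>
     riemannian_atlas A \<and> connected (UNIV :: 'a set) \<and>
     (\<forall>x y. dist x y =
        Inf {curve_length A \<sigma> | \<sigma>. piecewise_C1_curve A \<sigma> \<and> \<sigma> 0 = x \<and> \<sigma> 1 = y})"

text \<open>Curvature in a chart, where \<open>g\<close> is the metric in coordinates. \<open>christoffel g p u v\<close> is the
  covariant derivative at \<open>p\<close>, in direction \<open>u\<close>, of the constant vector field \<open>v\<close> for the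
  Levi-Civita connection, characterized by the Koszul formula; \<open>curvature g p u v w\<close> is
  \<open>R(u,v)w = \<nabla>\<^sub>u \<nabla>\<^sub>v w - \<nabla>\<^sub>v \<nabla>\<^sub>u w\<close> for constant fields \<open>u\<close>, \<open>v\<close>, \<open>w\<close>, whose brackets vanish.
  With these signs round spheres have positive sectional curvature.\<close>

definition christoffel ::
  "('e::euclidean_space \<Rightarrow> 'e \<Rightarrow> 'e \<Rightarrow> real) \<Rightarrow> 'e \<Rightarrow> 'e \<Rightarrow> 'e \<Rightarrow> 'e" where
  "christoffel g p u v = (THE z. \<forall>w. 2 * g p z w =
       frechet_derivative (\<lambda>q. g q v w) (at p) u
     + frechet_derivative (\<lambda>q. g q u w) (at p) v
     - frechet_derivative (\<lambda>q. g q u v) (at p) w)"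

definition curvature ::
  "('e::euclidean_space \<Rightarrow> 'e \<Rightarrow> 'e \<Rightarrow> real) \<Rightarrow> 'e \<Rightarrow> 'e \<Rightarrow> 'e \<Rightarrow> 'e \<Rightarrow> 'e" where
  "curvature g p u v w =
       frechet_derivative (\<lambda>q. christoffel g q v w) (at p) u
     - frechet_derivative (\<lambda>q. christoffel g q u w) (at p) v
     + christoffel g p u (christoffel g p v w)
     - christoffel g p v (christoffel g p u w)"

definition sectional_curvature ::
  "('e::euclidean_space \<Rightarrow> 'e \<Rightarrow> 'e \<Rightarrow> real) \<Rightarrow> 'e \<Rightarrow> 'e \<Rightarrow> 'e \<Rightarrow> real" where
  "sectional_curvature g p u v =
     g p (curvature g p u v v) u / (g p u u * g p v v - (g p u v)\<^sup>2)"

definition nonpositively_curved :: "('a, 'e::euclidean_space) rchart set \<Rightarrow> bool" where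
  "nonpositively_curved A \<longleftrightarrow>
     (\<forall>c\<in>A. \<forall>p \<in> chart_map c ` chart_dom c. \<forall>u v. u \<noteq> v \<and> independent {u, v} \<longrightarrow>
        sectional_curvature (chart_metric c) p u v \<le> 0)"

definition hadamard_space :: "('a::metric_space, 'e::euclidean_space) rchart set \<Rightarrow> bool" where
  "hadamard_space A \<longleftrightarrow>
     riemannian_manifold A \<and> complete (UNIV :: 'a set) \<and>
     simply_connected (UNIV :: 'a set) \<and> nonpositively_curved A"

section \<open>Regular quotients\<close>

definition isometry_group :: "('a::metric_space \<Rightarrow> 'a) set \<Rightarrow> bool" where
  "isometry_group G \<longleftrightarrow>
     id \<in> G \<and> (\<forall>g\<in>G. \<forall>h\<in>G. g \<circ> h \<in> G) \<and> (\<forall>g\<in>G. inv g \<in> G) \<and>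
     (\<forall>g\<in>G. bij g \<and> (\<forall>x y. dist (g x) (g y) = dist x y))"

definition torsion_free :: "('a \<Rightarrow> 'a) set \<Rightarrow> bool" where
  "torsion_free G \<longleftrightarrow> (\<forall>g\<in>G. \<forall>n>0. g ^^ n = id \<longrightarrow> g = id)"

text \<open>The topology on \<open>'a \<Rightarrow> 'a\<close> is that of pointwise convergence, which on isometries
  coincides with the compact-open topology.\<close>

definition regular_group :: "('a::metric_space \<Rightarrow> 'a) set \<Rightarrow> bool" where
  "regular_group G \<longleftrightarrow> isometry_group G \<and> discrete G \<and> torsion_free G"

text \<open>Points of \<open>G\X\<close> are orbits, and the quotient distance between two of them is their
  distance \<^const>\<open>setdist\<close> as subsets.\<close>

definition orbit :: "('a \<Rightarrow> 'a) set \<Rightarrow> 'a \<Rightarrow> 'a set" where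
  "orbit G x = (\<lambda>g. g x) ` G"

section \<open>Rays and Busemann functions\<close>

text \<open>The distance function is a parameter below, to cover both the space (\<^const>\<open>dist\<close>) and its
  quotient (\<^const>\<open>setdist\<close>). Geodesics are the locally minimizing curves parametrized by
  arc-length; only the restriction to \<open>[0,\<infinity>)\<close> of the functions on \<^typ>\<open>real\<close> matters.\<close>

definition half_geodesic :: "('p \<Rightarrow> 'p \<Rightarrow> real) \<Rightarrow> (real \<Rightarrow> 'p) \<Rightarrow> bool" where
  "half_geodesic d \<alpha> \<longleftrightarrow>
     (\<forall>t\<ge>0. \<exists>\<epsilon>>0. \<forall>r\<ge>0. \<forall>s\<ge>0. \<bar>r - t\<bar> < \<epsilon> \<and> \<bar>s - t\<bar> < \<epsilon> \<longrightarrow> d (\<alpha> r) (\<alpha> s) = \<bar>r - s\<bar>)"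

definition length_excess :: "('p \<Rightarrow> 'p \<Rightarrow> real) \<Rightarrow> (real \<Rightarrow> 'p) \<Rightarrow> ereal" where
  "length_excess d \<alpha> = (SUP t\<in>{0..}. SUP s\<in>{0..}. ereal (\<bar>t - s\<bar> - d (\<alpha> t) (\<alpha> s)))"

definition quasi_ray :: "('p \<Rightarrow> 'p \<Rightarrow> real) \<Rightarrow> (real \<Rightarrow> 'p) \<Rightarrow> bool" where
  "quasi_ray d \<alpha> \<longleftrightarrow> half_geodesic d \<alpha> \<and> length_excess d \<alpha> < \<infinity>"

definition ray :: "('p \<Rightarrow> 'p \<Rightarrow> real) \<Rightarrow> (real \<Rightarrow> 'p) \<Rightarrow> bool" where
  "ray d \<alpha> \<longleftrightarrow> half_geodesic d \<alpha> \<and> length_excess d \<alpha> = 0"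

definition busemann :: "('p \<Rightarrow> 'p \<Rightarrow> real) \<Rightarrow> (real \<Rightarrow> 'p) \<Rightarrow> 'p \<Rightarrow> 'p \<Rightarrow> real" where
  "busemann d \<alpha> x y = Lim at_top (\<lambda>t. d x (\<alpha> t) - d (\<alpha> t) y)"

definition is_lift ::
  "('a::topological_space \<Rightarrow> 'a) set \<Rightarrow> (real \<Rightarrow> 'a set) \<Rightarrow> (real \<Rightarrow> 'a) \<Rightarrow> bool" where
  "is_lift G \<alpha> \<gamma> \<longleftrightarrow> continuous_on {0..} \<gamma> \<and> (\<forall>t\<ge>0. \<alpha> t = orbit G (\<gamma> t))"

section \<open>Horoballs\<close>

text \<open>The center \<open>\<xi>\<close> of a horoball is given by a ray \<open>\<gamma>\<close> with point at infinity \<open>\<xi>\<close>, the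
  Busemann function of \<open>\<xi>\<close> being that of \<open>\<gamma>\<close>.\<close>

definition horoball :: "(real \<Rightarrow> 'a::metric_space) \<Rightarrow> 'a \<Rightarrow> 'a set" where
  "horoball \<gamma> x = {y. busemann dist \<gamma> x y \<ge> 0}"

definition horosphere :: "(real \<Rightarrow> 'a::metric_space) \<Rightarrow> 'a \<Rightarrow> 'a set" where
  "horosphere \<gamma> x = {y. busemann dist \<gamma> x y = 0}"

text \<open>The boundary horosphere of a horoball \<open>H\<close> given as a mere set.\<close>

definition horoball_boundary :: "(real \<Rightarrow> 'a::metric_space) \<Rightarrow> 'a set \<Rightarrow> 'a set" where
  "horoball_boundary \<gamma> H = (\<Union>x \<in> {x. horoball \<gamma> x = H}. horosphere \<gamma> x)"

text \<open>The maximal horoball relative to the projection of \<open>x\<close>.\<close>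

definition max_horoball ::
  "('a::metric_space \<Rightarrow> 'a) set \<Rightarrow> (real \<Rightarrow> 'a) \<Rightarrow> 'a \<Rightarrow> 'a set" where
  "max_horoball G \<gamma> x =
     {y. ereal (busemann dist \<gamma> x y) \<ge> (SUP g\<in>G. ereal (busemann dist \<gamma> x (g x)))}"

definition signed_dist_point ::
  "(real \<Rightarrow> 'a::metric_space) \<Rightarrow> 'a \<Rightarrow> 'a set \<Rightarrow> real" where
  "signed_dist_point \<gamma> x H =
     (if x \<notin> H then infdist x (horoball_boundary \<gamma> H) else - infdist x (horoball_boundary \<gamma> H))"

definition signed_dist_horoballs ::
  "(real \<Rightarrow> 'a::metric_space) \<Rightarrow> 'a set \<Rightarrow> 'a set \<Rightarrow> real" where
  "signed_dist_horoballs \<gamma> H H' =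
     (if H \<supseteq> H' then setdist (horoball_boundary \<gamma> H) (horoball_boundary \<gamma> H')
      else - setdist (horoball_boundary \<gamma> H) (horoball_boundary \<gamma> H'))"

end

theory Submission
  imports Defs
begin

text \<open>Write \<open>b x = lim (d(x, \<gamma> t) - t)\<close> for the lift \<open>\<gamma>\<close> of the quasi-ray and \<open>\<beta> x = inf\<^sub>g b(g x)\<close>. The limits are monotone
  and the distance of the quotient is an infimum over \<open>G\<close>, so that \<open>B\<^sub>\<alpha>(x, y) = \<beta> x - \<beta> y\<close> and \<open>\<Delta>(\<alpha>) = - \<beta>(\<gamma> 0)\<close>, while the
  maximal horoball of \<open>x\<close> is \<open>{b \<le> \<beta> x}\<close>. Two level sets \<open>{b = c}\<close> and \<open>{b = c'}\<close> are at distance \<open>\<bar>c - c'\<bar>\<close>: \<open>b\<close> is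
  1-Lipschitz and decreases at unit speed from every point, by minimizing it on closed balls. It takes all positive
  values, at the right distances from \<open>\<gamma> 0\<close>, on backward extensions of \<open>\<gamma>\<close>.

  All this needs \<open>\<gamma>\<close> to be minimizing and extendible. A torsion-free discrete group acts freely, hence \<open>\<gamma>\<close> is
  locally minimizing. Local geodesics minimize because replacing the vertices of a polygon by the midpoints of their
  neighbours contracts the distance between polygons wherever the inequality of Bruhat and Tits holds locally; applied
  along a homotopy between \<open>\<gamma>\<close> and a short curve with the same ends, it makes the short curve converge to \<open>\<gamma>\<close>.
  The local inequality comes from the second variation of the energy in a chart: the curvature term has a sign, and a
  Riccati inequality bounds the rest from below. Reflection in a chart shows that every local geodesic extends.\<close>

section \<open>Locally CAT(0) length spaces\<close>

text \<open>The obstacle on the metric side is a circle among the constants. Shortening contracts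
  only where the inequality holds at a uniform scale, hence on a compact ball containing all
  iterates. The radius of that ball bounds the lengths of the polygons, which depend on the number
  of vertices; and since the curves of a homotopy need not be rectifiable, finer sampling could
  raise the bound. Inserting midpoints instead refines the polygons at constant length. In a chart,
  geodesics are determined by their two ends and not by initial data. The contraction that solves
  this boundary value problem yields Lipschitz dependence on the ends, which suffices to support the
  squared distance from below to second order; no derivative of a geodesic with respect to its ends
  occurs. The expansion of the energy serves twice: against arbitrary curves it identifies the
  energy with the squared distance, against neighbouring geodesics it yields the inequality.
  Reflection in a chart is correct only to first order. A maximum argument on compact balls turns
  this slope into an exact prolongation.\<close>

text \<open>The inequality of Bruhat and Tits.\<close>

definition cn_ball :: "'a::metric_space \<Rightarrow> real \<Rightarrow> bool" where
  "cn_ball p r \<longleftrightarrow> (\<forall>x\<in>ball p r. \<forall>y\<in>ball p r. \<exists>m. \<forall>z\<in>ball p r.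
     (dist z m)\<^sup>2 \<le> (dist z x)\<^sup>2 / 2 + (dist z y)\<^sup>2 / 2 - (dist x y)\<^sup>2 / 4)"

section \<open>Midpoints and convexity of the distance\<close>

definition is_mid :: "'a::metric_space \<Rightarrow> 'a \<Rightarrow> 'a \<Rightarrow> bool" where
  "is_mid x y m \<longleftrightarrow> dist x m = dist x y / 2 \<and> dist y m = dist x y / 2"

definition mid :: "'a::metric_space \<Rightarrow> 'a \<Rightarrow> 'a" where
  "mid x y = (SOME m. is_mid x y m)"

lemma cn_ball_subset: "cn_ball p r \<Longrightarrow> ball q s \<subseteq> ball p r \<Longrightarrow> cn_ball q s"
  unfolding cn_ball_def by (meson subsetD)

text \<open>Taking \<open>z = x\<close> and \<open>z = y\<close> in the inequality bounds both
  distances to \<open>m\<close> by half of \<open>dist x y\<close>, so the triangle inequality makes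
  \<open>m\<close> a midpoint; \<open>z = p\<close> shows that balls about \<open>p\<close> are
  closed under midpoints. For a second midpoint \<open>m'\<close>, the choice \<open>z = m'\<close>
  makes the right-hand side vanish. A priori \<open>m'\<close> is only known to lie in the doubled
  ball, hence the radius \<open>2 * r\<close>.\<close>

lemma cn_ball_mid_ex:
  assumes "cn_ball p (2 * r)" "x \<in> ball p r" "y \<in> ball p r"
  obtains m where "is_mid x y m" "m \<in> ball p r" "\<And>m'. is_mid x y m' \<Longrightarrow> m' = m"
    "\<And>z. z \<in> ball p (2 * r) \<Longrightarrow> (dist z m)\<^sup>2 \<le> (dist z x)\<^sup>2 / 2 + (dist z y)\<^sup>2 / 2 - (dist x y)\<^sup>2 / 4"
proof -
  have r: "r > 0" using assms(2) by (metis mem_ball zero_le_dist order.strict_trans1)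
  have xy: "x \<in> ball p (2 * r)" "y \<in> ball p (2 * r)" using assms(2,3) r by auto
  obtain m where m: "\<And>z. z \<in> ball p (2 * r) \<Longrightarrow>
      (dist z m)\<^sup>2 \<le> (dist z x)\<^sup>2 / 2 + (dist z y)\<^sup>2 / 2 - (dist x y)\<^sup>2 / 4"
    using assms(1) xy unfolding cn_ball_def by blast
  have "(dist x m)\<^sup>2 \<le> (dist x y / 2)\<^sup>2" using m[OF xy(1)] by (simp add: power_divide)
  then have 1: "dist x m \<le> dist x y / 2" by (rule power2_le_imp_le) simp
  have "(dist y m)\<^sup>2 \<le> (dist x y / 2)\<^sup>2" using m[OF xy(2)] by (simp add: power_divide dist_commute)
  then have 2: "dist y m \<le> dist x y / 2" by (rule power2_le_imp_le) simp
  have mm: "is_mid x y m" unfolding is_mid_def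
    using 1 2 dist_triangle[of x y m] by (simp add: dist_commute)
  have "(dist p m)\<^sup>2 \<le> (dist p x)\<^sup>2 / 2 + (dist p y)\<^sup>2 / 2"
    using m[of p] r zero_le_power2[of "dist x y"] by (simp add: order_trans[of _ "(dist p x)\<^sup>2 / 2 + (dist p y)\<^sup>2 / 2 - (dist x y)\<^sup>2 / 4"])
  also have "\<dots> < r\<^sup>2"
  proof -
    have "(dist p x)\<^sup>2 < r\<^sup>2" "(dist p y)\<^sup>2 < r\<^sup>2" using assms(2,3)
      by (auto intro!: power_strict_mono)
    then show ?thesis by simp
  qed
  finally have pm: "dist p m < r" using r by (simp add: power2_less_imp_less)
  have uniq: "m' = m" if "is_mid x y m'" for m'
  proof -
    have "dist p m' \<le> dist p x + dist x y / 2" using that dist_triangle[of p m' x] by (simp add: is_mid_def)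
    moreover have "dist x y \<le> dist p x + dist p y" by (metis dist_commute dist_triangle)
    ultimately have "m' \<in> ball p (2 * r)" using assms(2,3) by auto
    from m[OF this] that have "(dist m' m)\<^sup>2 \<le> 0"
      unfolding is_mid_def by (auto simp: dist_commute[of m'] power_divide)
    then show ?thesis by simp
  qed
  show thesis by (rule that[OF mm _ uniq m]) (use pm in auto)
qed

lemma mid_uniq:
  assumes "cn_ball p (2 * r)" "x \<in> ball p r" "y \<in> ball p r" "is_mid x y m"
  shows "mid x y = m"
  by (metis assms cn_ball_mid_ex mid_def someI)

lemma
  assumes "cn_ball p (2 * r)" "x \<in> ball p r" "y \<in> ball p r"
  shows mid_is_mid: "is_mid x y (mid x y)"
    and mid_in_ball: "mid x y \<in> ball p r"
    and mid_cn: "z \<in> ball p (2 * r) \<Longrightarrow>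
      (dist z (mid x y))\<^sup>2 \<le> (dist z x)\<^sup>2 / 2 + (dist z y)\<^sup>2 / 2 - (dist x y)\<^sup>2 / 4"
proof -
  obtain m where m: "is_mid x y m" "m \<in> ball p r"
    "\<And>z. z \<in> ball p (2 * r) \<Longrightarrow> (dist z m)\<^sup>2 \<le> (dist z x)\<^sup>2 / 2 + (dist z y)\<^sup>2 / 2 - (dist x y)\<^sup>2 / 4"
    by (rule cn_ball_mid_ex[OF assms]) (rule that)
  have "mid x y = m" using mid_uniq[OF assms m(1)] .
  then show "is_mid x y (mid x y)" "mid x y \<in> ball p r"
    "z \<in> ball p (2 * r) \<Longrightarrow>
      (dist z (mid x y))\<^sup>2 \<le> (dist z x)\<^sup>2 / 2 + (dist z y)\<^sup>2 / 2 - (dist x y)\<^sup>2 / 4"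
    using m by auto
qed

lemma mid_commute: "mid x y = mid y x"
  unfolding mid_def is_mid_def by (metis dist_commute)

text \<open>The inequality is used twice: for the distance from \<open>z\<close> to the midpoint of
  \<open>x\<close> and \<open>y\<close>, then for the distance from that midpoint to the one of
  \<open>x\<close> and \<open>z\<close>. All terms cancel except
  \<open>(dist y z)\<^sup>2 / 4\<close>.\<close>

lemma mid_triangle:
  assumes "cn_ball p (2 * r)" "x \<in> ball p r" "y \<in> ball p r" "z \<in> ball p r"
  shows "dist (mid x y) (mid x z) \<le> dist y z / 2"
proof -
  define m where "m = mid x y"
  have r: "r > 0" using assms(2) by (metis mem_ball zero_le_dist order.strict_trans1)
  have m: "m \<in> ball p (2 * r)" using mid_in_ball[OF assms(1-3)] r unfolding m_def by auto
  have z: "z \<in> ball p (2 * r)" using assms(4) r by auto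
  have a: "dist m x = dist x y / 2" 
    using mid_is_mid[OF assms(1-3)] unfolding m_def is_mid_def by (simp add: dist_commute)
  have b: "(dist m z)\<^sup>2 \<le> (dist z x)\<^sup>2 / 2 + (dist z y)\<^sup>2 / 2 - (dist x y)\<^sup>2 / 4"
    using mid_cn[OF assms(1-3) z] unfolding m_def by (simp add: dist_commute)
  have c: "(dist m (mid x z))\<^sup>2 \<le> (dist m x)\<^sup>2 / 2 + (dist m z)\<^sup>2 / 2 - (dist x z)\<^sup>2 / 4"
    using mid_cn[OF assms(1,2,4) m] .
  have "(dist m (mid x z))\<^sup>2 \<le> (dist y z / 2)\<^sup>2"
    using c b unfolding a by (simp add: power_divide dist_commute)
  then show ?thesis unfolding m_def by (rule power2_le_imp_le) simp
qed

text \<open>The quadrilateral is cut along the diagonal from \<open>x\<close> to \<open>y'\<close>.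
  This is convexity of the distance between two geodesics, tested at their midpoints.\<close>

lemma mid_convex:
  assumes "cn_ball p (2 * r)" "x \<in> ball p r" "y \<in> ball p r" "x' \<in> ball p r" "y' \<in> ball p r"
  shows "dist (mid x y) (mid x' y') \<le> (dist x x' + dist y y') / 2"
proof -
  have "dist (mid x y) (mid x y') \<le> dist y y' / 2" using mid_triangle[of p r x y y'] assms by simp
  moreover have "dist (mid x y') (mid x' y') \<le> dist x x' / 2"
    using mid_triangle[of p r y' x x'] assms by (simp add: mid_commute)
  ultimately show ?thesis using dist_triangle[of "mid x y" "mid x' y'" "mid x y'"] by simp
qed

section \<open>Polygons and their shortening\<close>

definition plen :: "nat \<Rightarrow> (nat \<Rightarrow> 'a::metric_space) \<Rightarrow> real" where
  "plen N P = (\<Sum>i<N. dist (P i) (P (Suc i)))"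

text \<open>All interior vertices move at once, each to the midpoint of its old neighbours: a
  discrete heat flow with fixed ends.\<close>

definition shorten :: "nat \<Rightarrow> (nat \<Rightarrow> 'a::metric_space) \<Rightarrow> nat \<Rightarrow> 'a" where
  "shorten N P i = (if 0 < i \<and> i < N then mid (P (i - 1)) (P (Suc i)) else P i)"

text \<open>The length bound confines the vertices to \<open>cball a C\<close>, where the inequality
  will hold at one scale; the mesh bound keeps neighbouring vertices inside one ball of that scale.
  Shortening preserves both.\<close>

definition admissible :: "nat \<Rightarrow> real \<Rightarrow> real \<Rightarrow> 'a::metric_space \<Rightarrow> 'a \<Rightarrow> (nat \<Rightarrow> 'a) \<Rightarrow> bool" where
  "admissible N \<mu> C a b P \<longleftrightarrow> P 0 = a \<and> P N = b \<and> (\<forall>i<N. dist (P i) (P (Suc i)) \<le> \<mu>) \<and> plen N P \<le> C"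

lemma plen_ge_dist: "i \<le> N \<Longrightarrow> dist (P 0) (P i) \<le> plen N P"
proof -
  assume i: "i \<le> N"
  have "dist (P 0) (P i) \<le> plen i P"
  proof (induction i)
    case 0 then show ?case by (simp add: plen_def)
  next
    case (Suc i) then show ?case
      using dist_triangle[of "P 0" "P (Suc i)" "P i"] by (simp add: plen_def)
  qed
  also have "\<dots> \<le> plen N P" unfolding plen_def using i by (intro sum_mono2) auto
  finally show ?thesis .
qed

lemma admissible_in_cball: "admissible N \<mu> C a b P \<Longrightarrow> i \<le> N \<Longrightarrow> P i \<in> cball a C"
  using plen_ge_dist[of i N P] unfolding admissible_def by auto

text \<open>Up to the factor 1/2, every \<open>f i\<close> occurs exactly twice on the right,
  because at either end the missing neighbour is replaced by the entry itself.\<close>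

lemma sum_shift_half:
  fixes f :: "nat \<Rightarrow> real"
  assumes "\<And>i. i < Suc (Suc n) \<Longrightarrow> h i \<le> (f (if i = 0 then 0 else i - 1) + f (if i = Suc n then i else Suc i)) / 2"
  shows "(\<Sum>i<Suc (Suc n). h i) \<le> (\<Sum>i<Suc (Suc n). f i)"
proof -
  let ?N = "Suc (Suc n)"
  have "(\<Sum>i<?N. h i) \<le> (\<Sum>i<?N. (f (if i = 0 then 0 else i - 1) + f (if i = Suc n then i else Suc i)) / 2)"
    using assms by (intro sum_mono) auto
  also have "\<dots> = ((\<Sum>i<?N. f (if i = 0 then 0 else i - 1)) + (\<Sum>i<?N. f (if i = Suc n then i else Suc i))) / 2"
    by (simp add: sum.distrib add_divide_distrib sum_divide_distrib)
  also have "(\<Sum>i<?N. f (if i = 0 then 0 else i - 1)) = f 0 + (\<Sum>i<Suc n. f i)"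
    by (subst sum.lessThan_Suc_shift) simp
  also have "(\<Sum>i<?N. f (if i = Suc n then i else Suc i)) = (\<Sum>i<Suc n. f (Suc i)) + f (Suc n)"
    by (simp add: sum.lessThan_Suc)
  also have "(f 0 + (\<Sum>i<Suc n. f i) + ((\<Sum>i<Suc n. f (Suc i)) + f (Suc n))) / 2 = (\<Sum>i<?N. f i)"
    using sum.lessThan_Suc_shift[of f "Suc n"] sum.lessThan_Suc[of f "Suc n"] by simp
  finally show ?thesis .
qed

text \<open>A new edge joins two midpoints, and \<open>mid_convex\<close> bounds it by the mean of
  the two old edges adjacent to the edge it replaces. This preserves the mesh bound, and summation
  preserves the length bound.\<close>

lemma shorten_admissible:
  assumes cn: "\<And>p. p \<in> cball a C \<Longrightarrow> cn_ball p (2 * \<rho>)" and \<mu>: "2 * \<mu> < \<rho>" "0 \<le> \<mu>"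
    and P: "admissible N \<mu> C a b P"
  shows "admissible N \<mu> C a b (shorten N P)"
proof -
  let ?T = "shorten N P"
  have mesh: "i < N \<Longrightarrow> dist (P i) (P (Suc i)) \<le> \<mu>" for i using P unfolding admissible_def by auto
  \<comment> \<open>The conditional indices let the first and the last edge obey the same estimate:
    there the edge itself takes the place of the missing neighbour.\<close>
  have edge: "dist (?T i) (?T (Suc i)) \<le> (dist (P (if i = 0 then 0 else i - 1)) (P (if i = 0 then 1 else i))
      + dist (P (if Suc i = N then i else Suc i)) (P (if Suc i = N then N else Suc (Suc i)))) / 2"
    if i: "i < N" for i
  proof -
    have c: "cn_ball (P i) (2 * \<rho>)" using cn admissible_in_cball[OF P] i by simp
    have b0: "P i \<in> ball (P i) \<rho>" using \<mu> by simp
    have b1: "P (Suc i) \<in> ball (P i) \<rho>" using mesh[OF i] \<mu> by simp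
    have b2: "P (i - 1) \<in> ball (P i) \<rho>" if "i > 0"
      using mesh[of "i - 1"] that i \<mu> by (simp add: dist_commute[of "P i"] less_imp_diff_less)
    have b3: "P (Suc (Suc i)) \<in> ball (P i) \<rho>" if "Suc i < N"
      using mesh[of "Suc i"] mesh[of i] that \<mu> dist_triangle[of "P i" "P (Suc (Suc i))" "P (Suc i)"] by simp
    consider "i = 0" "Suc i = N" | "i = 0" "Suc i < N" | "0 < i" "Suc i = N" | "0 < i" "Suc i < N" using i by linarith
    then show ?thesis
    proof cases
      case 1 then show ?thesis by (simp add: shorten_def)
    next
      case 2
      have "is_mid (P i) (P (Suc (Suc i))) (mid (P i) (P (Suc (Suc i))))"
        using mid_is_mid[OF c b0 b3] 2 by blast
      then have "dist (P i) (mid (P i) (P (Suc (Suc i)))) = dist (P i) (P (Suc (Suc i))) / 2"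
        by (simp add: is_mid_def)
      then show ?thesis using 2 dist_triangle[of "P i" "P (Suc (Suc i))" "P (Suc i)"]
        by (simp add: shorten_def)
    next
      case 3
      have "is_mid (P (i - 1)) (P (Suc i)) (mid (P (i - 1)) (P (Suc i)))"
        using mid_is_mid[OF c b2 b1] 3 by blast
      then have "dist (P (Suc i)) (mid (P (i - 1)) (P (Suc i))) = dist (P (i - 1)) (P (Suc i)) / 2"
        by (simp add: is_mid_def)
      then show ?thesis using 3 dist_triangle[of "P (i - 1)" "P (Suc i)" "P i"]
        by (auto simp add: shorten_def dist_commute)
    next
      case 4
      then show ?thesis using mid_convex[OF c b2 b1 b0 b3] 4 by (auto simp: shorten_def)
    qed
  qed
  have m: "dist (?T i) (?T (Suc i)) \<le> \<mu>" if "i < N" for i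
  proof -
    have "dist (P (if i = 0 then 0 else i - 1)) (P (if i = 0 then 1 else i)) \<le> \<mu>"
      using mesh[of "if i = 0 then 0 else i - 1"] that by (auto split: if_splits)
    moreover have "dist (P (if Suc i = N then i else Suc i)) (P (if Suc i = N then N else Suc (Suc i))) \<le> \<mu>"
      using mesh[of "if Suc i = N then i else Suc i"] that by (auto split: if_splits)
    ultimately have "(dist (P (if i = 0 then 0 else i - 1)) (P (if i = 0 then 1 else i))
      + dist (P (if Suc i = N then i else Suc i)) (P (if Suc i = N then N else Suc (Suc i)))) / 2 \<le> \<mu>"
      by (metis add_mono field_sum_of_halves add_divide_distrib divide_right_mono zero_le_numeral)
    then show ?thesis using edge[OF that] by (rule order_trans[rotated])
  qed
  have "plen N ?T \<le> plen N P"
  proof (cases "N \<le> 1")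
    case True then show ?thesis by (cases N) (auto simp: plen_def shorten_def)
  next
    case False
    then obtain n where n: "N = Suc (Suc n)" by (metis One_nat_def not_less_eq_eq old.nat.exhaust order_refl le0)
    show ?thesis unfolding plen_def n
    proof (rule sum_shift_half, goal_cases)
      case (1 i)
      show ?case using edge[of i] 1 unfolding n by (auto split: if_splits)
    qed
  qed
  then show ?thesis using P m unfolding admissible_def by (auto simp: shorten_def)
qed

text \<open>The weight \<open>i (N - i)\<close> exceeds the mean of its neighbours by 1 and is at most \<open>N\<^sup>2 / 4\<close>, whence the factor.\<close>

lemma shorten_contract:
  assumes cn: "\<And>p. p \<in> cball a C \<Longrightarrow> cn_ball p (2 * \<rho>)" and \<mu>: "\<mu> + \<delta> < \<rho>" "0 \<le> \<mu>" "0 \<le> \<delta>"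
    and P: "admissible N \<mu> C a b P" and Q: "admissible N \<mu> C a b Q"
    and close: "\<And>i. i \<le> N \<Longrightarrow> dist (P i) (Q i) \<le> \<delta>"
  shows "\<And>i. i \<le> N \<Longrightarrow> dist (shorten N P i) (shorten N Q i) \<le> \<delta>"
    and "(\<And>i. i \<le> N \<Longrightarrow> dist (P i) (Q i) \<le> L * (real i * (real N - real i))) \<Longrightarrow> 0 \<le> L \<Longrightarrow> i \<le> N \<Longrightarrow>
      dist (shorten N P i) (shorten N Q i) \<le> (1 - 4 / (real N)\<^sup>2) * L * (real i * (real N - real i))"
proof -
  have mesh: "i < N \<Longrightarrow> dist (P i) (P (Suc i)) \<le> \<mu>" for i using P unfolding admissible_def by auto
  have edge: "dist (shorten N P i) (shorten N Q i) \<le> (dist (P (i - 1)) (Q (i - 1)) + dist (P (Suc i)) (Q (Suc i))) / 2"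
    if i: "0 < i" "i < N" for i
  proof -
    have c: "cn_ball (P i) (2 * \<rho>)" using cn admissible_in_cball[OF P] i by simp
    have b1: "P (Suc i) \<in> ball (P i) \<rho>" using mesh[of i] i \<mu> by simp
    have b2: "P (i - 1) \<in> ball (P i) \<rho>" using mesh[of "i - 1"] i \<mu> by (simp add: dist_commute[of "P i"] less_imp_diff_less)
    have b3: "Q (Suc i) \<in> ball (P i) \<rho>"
      using mesh[of i] i \<mu> close[of "Suc i"] dist_triangle[of "P i" "Q (Suc i)" "P (Suc i)"] by simp
    have b4: "Q (i - 1) \<in> ball (P i) \<rho>"
      using mesh[of "i - 1"] i \<mu> close[of "i - 1"] dist_triangle[of "P i" "Q (i - 1)" "P (i - 1)"]
      by (simp add: dist_commute[of "P i"] less_imp_diff_less le_diff_conv)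
    show ?thesis using mid_convex[OF c b2 b1 b4 b3] i by (simp add: shorten_def)
  qed
  have ends: "dist (shorten N P i) (shorten N Q i) = 0" if "\<not> (0 < i \<and> i < N)" "i \<le> N" for i
  proof -
    have "i = 0 \<or> i = N" using that by auto
    then show ?thesis using P Q unfolding admissible_def shorten_def by auto
  qed
  show "dist (shorten N P i) (shorten N Q i) \<le> \<delta>" if "i \<le> N" for i
  proof (cases "0 < i \<and> i < N")
    case True
    then show ?thesis using edge[of i] close[of "i - 1"] close[of "Suc i"] by (simp add: le_diff_conv)
  next
    case False then show ?thesis using ends[OF False] that \<mu> by simp
  qed
  show "dist (shorten N P i) (shorten N Q i) \<le> (1 - 4 / (real N)\<^sup>2) * L * (real i * (real N - real i))"
    if w: "\<And>i. i \<le> N \<Longrightarrow> dist (P i) (Q i) \<le> L * (real i * (real N - real i))" and L: "0 \<le> L" and i: "i \<le> N"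
  proof (cases "0 < i \<and> i < N")
    case True
    then have i1: "real (i - 1) = real i - 1" by auto
    have "dist (shorten N P i) (shorten N Q i) \<le>
      (L * (real (i - 1) * (real N - real (i - 1))) + L * (real (Suc i) * (real N - real (Suc i)))) / 2"
      using edge[of i] w[of "i - 1"] w[of "Suc i"] True by (simp add: le_diff_conv)
    also have "\<dots> = L * (real i * (real N - real i)) - L" unfolding i1 by (simp add: field_simps)
    also have "\<dots> \<le> L * (real i * (real N - real i)) - L * (4 / (real N)\<^sup>2 * (real i * (real N - real i)))"
    proof -
      have "4 * (real i * (real N - real i)) \<le> (real N)\<^sup>2"
        using zero_le_power2[of "real N - 2 * real i"] by (simp add: power2_eq_square algebra_simps)
      then have "4 / (real N)\<^sup>2 * (real i * (real N - real i)) \<le> 1" using True by (simp add: divide_simps)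
      then show ?thesis using L mult_left_mono[of _ 1 L] by fastforce
    qed
    finally show ?thesis by (simp add: algebra_simps)
  next
    case False then show ?thesis using ends[OF False i] i by auto
  qed
qed

text \<open>At interior vertices the weight \<open>i * (N - i)\<close> is at least 1, so the uniform
  bound \<delta> is also a weighted one and decays geometrically. The uniform bound is carried along
  because the contraction applies only to polygons within \<delta> of each other.\<close>

lemma shorten_iterates_converge:
  assumes cn: "\<And>p. p \<in> cball a C \<Longrightarrow> cn_ball p (2 * \<rho>)" and \<mu>: "2 * \<mu> < \<rho>" "\<mu> + \<delta> < \<rho>" "0 \<le> \<mu>" "0 \<le> \<delta>"
    and P: "admissible N \<mu> C a b P" and Q: "admissible N \<mu> C a b Q"
    and close: "\<And>i. i \<le> N \<Longrightarrow> dist (P i) (Q i) \<le> \<delta>" and i: "i \<le> N"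
  shows "(\<lambda>n. dist ((shorten N ^^ n) P i) ((shorten N ^^ n) Q i)) \<longlonglongrightarrow> 0"
proof -
  define \<theta> where "\<theta> = 1 - 4 / (real N)\<^sup>2"
  have main: "admissible N \<mu> C a b ((shorten N ^^ n) P) \<and> admissible N \<mu> C a b ((shorten N ^^ n) Q) \<and>
      (\<forall>i\<le>N. dist ((shorten N ^^ n) P i) ((shorten N ^^ n) Q i) \<le> \<delta>)" for n
  proof (induction n)
    case 0 then show ?case using P Q close by simp
  next
    case (Suc n)
    then show ?case
      using shorten_admissible[OF cn \<mu>(1,3)] shorten_contract(1)[OF cn \<mu>(2-4), of a C N b "(shorten N ^^ n) P" "(shorten N ^^ n) Q"]
      by simp
  qed
  \<comment> \<open>With at most one edge there is no interior vertex; from two edges on, the factor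
    \<theta> is nonnegative.\<close>
  show ?thesis
  proof (cases "N \<ge> 2")
    case False
    have "i = 0 \<or> i = N" using False i by auto
    then have "dist ((shorten N ^^ n) P i) ((shorten N ^^ n) Q i) = 0" for n
      using main[of n] unfolding admissible_def by auto
    then show ?thesis by simp
  next
    case True
    have \<theta>: "0 \<le> \<theta>" "\<theta> < 1"
    proof -
      have "(2::real)\<^sup>2 \<le> (real N)\<^sup>2" using True by (intro power_mono) auto
      then show "0 \<le> \<theta>" "\<theta> < 1" unfolding \<theta>_def using True by (auto simp: divide_simps)
    qed
    have w: "\<forall>i\<le>N. dist ((shorten N ^^ n) P i) ((shorten N ^^ n) Q i) \<le> \<theta> ^ n * \<delta> * (real i * (real N - real i))" for n
    proof (induction n)
      case 0
      show ?case
      proof (intro allI impI)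
        fix i assume i: "i \<le> N"
        show "dist ((shorten N ^^ 0) P i) ((shorten N ^^ 0) Q i) \<le> \<theta> ^ 0 * \<delta> * (real i * (real N - real i))"
        proof (cases "0 < i \<and> i < N")
          case True
          then have "1 \<le> real i" "1 \<le> real N - real i" by auto
          then have "1 * 1 \<le> real i * (real N - real i)" by (intro mult_mono) auto
          then have "\<delta> * 1 \<le> \<delta> * (real i * (real N - real i))" using \<mu> by (intro mult_left_mono) auto
          then show ?thesis using close[OF i] by simp
        next
          case False
          then have "i = 0 \<or> i = N" using i by auto
          then have "P i = Q i" using P Q unfolding admissible_def by auto
          then show ?thesis using \<mu> i by simp
        qed
      qed
    next
      case (Suc n)
      show ?case
      proof (intro allI impI)
        fix i assume i: "i \<le> N"
        have "dist (shorten N ((shorten N ^^ n) P) i) (shorten N ((shorten N ^^ n) Q) i)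
            \<le> \<theta> * (\<theta> ^ n * \<delta>) * (real i * (real N - real i))"
          unfolding \<theta>_def
        proof (rule shorten_contract(2)[OF cn \<mu>(2-4)])
        qed (use main[of n] Suc i \<theta> \<mu> in \<open>auto simp: \<theta>_def\<close>)
        then show "dist ((shorten N ^^ Suc n) P i) ((shorten N ^^ Suc n) Q i) \<le> \<theta> ^ Suc n * \<delta> * (real i * (real N - real i))"
          by (simp add: mult.assoc)
      qed
    qed
    have "(\<lambda>n. \<theta> ^ n * \<delta> * (real i * (real N - real i))) \<longlonglongrightarrow> 0 * \<delta> * (real i * (real N - real i))"
      using \<theta> by (intro tendsto_intros LIMSEQ_realpow_zero) auto
    then have z: "(\<lambda>n. \<theta> ^ n * \<delta> * (real i * (real N - real i))) \<longlonglongrightarrow> 0" by simp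
    show ?thesis
    proof (rule Lim_null_comparison[OF _ z], rule always_eventually, rule allI)
      fix n show "norm (dist ((shorten N ^^ n) P i) ((shorten N ^^ n) Q i)) \<le> \<theta> ^ n * \<delta> * (real i * (real N - real i))"
        unfolding real_norm_def abs_of_nonneg[OF zero_le_dist] using w[of n] i by blast
    qed
  qed
qed

text \<open>Iterates of consecutive polygons approach each other, and \<open>P 0\<close> does not
  move, so by induction along the chain the iterates of \<open>P J\<close> converge to
  \<open>P 0\<close>. Length is continuous in the vertices and never increases under
  shortening.\<close>

lemma shorten_chain:
  assumes cn: "\<And>p. p \<in> cball a C \<Longrightarrow> cn_ball p (2 * \<rho>)" and \<mu>: "2 * \<mu> < \<rho>" "\<mu> + \<delta> < \<rho>" "0 \<le> \<mu>" "0 \<le> \<delta>"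
    and P: "\<And>j. j \<le> J \<Longrightarrow> admissible N \<mu> C a b (P j)"
    and close: "\<And>i j. i \<le> N \<Longrightarrow> j < J \<Longrightarrow> dist (P j i) (P (Suc j) i) \<le> \<delta>"
    and fixed: "shorten N (P 0) = P 0"
  shows "plen N (P 0) \<le> plen N (P J)"
proof -
  let ?T = "\<lambda>n. shorten N ^^ n"
  have fx: "?T n (P 0) = P 0" for n by (induction n) (auto simp: fixed)
  have conv: "(\<lambda>n. dist (P 0 i) (?T n (P j) i)) \<longlonglongrightarrow> 0" if "i \<le> N" "j \<le> J" for i j
    using that(2)
  proof (induction j)
    case 0 then show ?case by (simp add: fx)
  next
    case (Suc j)
    have 1: "(\<lambda>n. dist (?T n (P j) i) (?T n (P (Suc j)) i)) \<longlonglongrightarrow> 0"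
      using Suc.prems that by (intro shorten_iterates_converge[OF cn \<mu>]) (auto intro: P close)
    show ?case
      by (rule Lim_null_comparison[OF _ tendsto_add_zero[OF Suc.IH 1]])
        (use Suc.prems in \<open>auto intro!: always_eventually dist_triangle\<close>)
  qed
  have c2: "(\<lambda>n. ?T n (P J) i) \<longlonglongrightarrow> P 0 i" if "i \<le> N" for i
    using conv[OF that order_refl] by (subst tendsto_dist_iff) (simp add: dist_commute)
  have "(\<lambda>n. plen N (?T n (P J))) \<longlonglongrightarrow> plen N (P 0)"
    unfolding plen_def by (intro tendsto_intros c2) auto
  moreover have "plen N (?T n (P J)) \<le> plen N (P J)" for n
  proof -
    \<comment> \<open>Admissibility with the length of \<open>P J\<close> itself as the bound
      expresses that no iterate is longer.\<close>
    have "admissible N \<mu> (plen N (P J)) a b (?T n (P J))"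
    proof (induction n)
      case 0 then show ?case using P[of J] by (auto simp: admissible_def)
    next
      case (Suc n)
      have "cball a (plen N (P J)) \<subseteq> cball a C" using P[of J] by (auto simp: admissible_def)
      then have "cn_ball p (2 * \<rho>)" if "p \<in> cball a (plen N (P J))" for p using cn that by blast
      from shorten_admissible[OF this \<mu>(1,3) Suc] show ?case by simp
    qed
    then show ?thesis by (simp add: admissible_def)
  qed
  ultimately show ?thesis by (meson LIMSEQ_le_const2)
qed


section \<open>Refinement of polygons by midpoints\<close>

text \<open>The new vertices are midpoints of edges and not further points of a curve, so that the
  length, and with it the ball where the inequality is needed, stays fixed while the mesh is
  halved.\<close>

definition refine :: "(nat \<Rightarrow> 'a::metric_space) \<Rightarrow> nat \<Rightarrow> 'a" where
  "refine P i = (if even i then P (i div 2) else mid (P (i div 2)) (P (Suc (i div 2))))"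

text \<open>The centres are a parameter so that the edges number \<open>k\<close> of two polygons
  can be placed in the same ball, as \<open>refine_close\<close> requires.\<close>

definition in_balls :: "nat \<Rightarrow> real \<Rightarrow> (nat \<Rightarrow> 'a::metric_space) \<Rightarrow> (nat \<Rightarrow> 'a) \<Rightarrow> bool" where
  "in_balls N \<rho> c P \<longleftrightarrow> (\<forall>k<N. cn_ball (c k) (2 * \<rho>) \<and> P k \<in> ball (c k) \<rho> \<and> P (Suc k) \<in> ball (c k) \<rho>)"

lemma refine_even [simp]: "refine P (2 * k) = P k" and refine_odd [simp]: "refine P (Suc (2 * k)) = mid (P k) (P (Suc k))"
  by (auto simp: refine_def)

lemma even_odd_less_cases:
  assumes "\<And>k. k < N \<Longrightarrow> Q (2 * k)" "\<And>k. k < N \<Longrightarrow> Q (Suc (2 * k))"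
  shows "i < 2 * N \<Longrightarrow> Q i"
  using assms by (metis (no_types, lifting) Suc_less_eq less_SucI mult_less_cancel1 nat_mult_less_cancel_disj
      oddE evenE Suc_eq_plus1 Suc_lessD zero_less_numeral)

lemma refine_facts:
  assumes "in_balls N \<rho> c P" "k < N"
  shows "is_mid (P k) (P (Suc k)) (refine P (Suc (2 * k)))"
    and "refine P (Suc (2 * k)) \<in> ball (c k) \<rho>"
  using assms mid_is_mid[of "c k" \<rho> "P k" "P (Suc k)"] mid_in_ball[of "c k" \<rho> "P k" "P (Suc k)"]
  unfolding in_balls_def by auto

lemma refine_edges:
  assumes "in_balls N \<rho> c P" "k < N"
  shows "dist (refine P (2 * k)) (refine P (Suc (2 * k))) = dist (P k) (P (Suc k)) / 2"
    and "dist (refine P (Suc (2 * k))) (refine P (Suc (Suc (2 * k)))) = dist (P k) (P (Suc k)) / 2"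
proof -
  have m: "is_mid (P k) (P (Suc k)) (refine P (Suc (2 * k)))" using refine_facts(1)[OF assms] .
  then show "dist (refine P (2 * k)) (refine P (Suc (2 * k))) = dist (P k) (P (Suc k)) / 2"
    by (simp add: is_mid_def)
  have "refine P (Suc (Suc (2 * k))) = P (Suc k)" using refine_even[of P "Suc k"] by simp
  then show "dist (refine P (Suc (2 * k))) (refine P (Suc (Suc (2 * k)))) = dist (P k) (P (Suc k)) / 2"
    using m by (simp add: is_mid_def dist_commute)
qed

lemma refine_in_balls: "in_balls N \<rho> c P \<Longrightarrow> in_balls (2 * N) \<rho> (\<lambda>k. c (k div 2)) (refine P)"
  unfolding in_balls_def[of "2 * N"]
proof (intro allI impI)
  fix i assume P: "in_balls N \<rho> c P" and i: "i < 2 * N"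
  have e: "refine P (Suc (Suc (2 * k))) = P (Suc k)" for k using refine_even[of P "Suc k"] by simp
  show "cn_ball (c (i div 2)) (2 * \<rho>) \<and> refine P i \<in> ball (c (i div 2)) \<rho> \<and> refine P (Suc i) \<in> ball (c (i div 2)) \<rho>"
    by (rule even_odd_less_cases[OF _ _ i]) (use P refine_facts(2)[OF P] in \<open>auto simp: in_balls_def e simp del: refine_odd\<close>)
qed

lemma refine_mesh:
  assumes "in_balls N \<rho> c P" "\<And>k. k < N \<Longrightarrow> dist (P k) (P (Suc k)) \<le> \<mu>" "i < 2 * N"
  shows "dist (refine P i) (refine P (Suc i)) \<le> \<mu> / 2"
  by (rule even_odd_less_cases[OF _ _ assms(3)])
    (use assms refine_edges[OF assms(1)] in \<open>auto simp del: refine_odd refine_even\<close>)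

lemma sum_even_odd:
  fixes f :: "nat \<Rightarrow> real"
  shows "(\<Sum>i<2*N. f i) = (\<Sum>k<N. f (2 * k) + f (Suc (2 * k)))"
  by (induction N) (auto simp: algebra_simps)

lemma refine_plen:
  assumes "in_balls N \<rho> c P"
  shows "plen (2 * N) (refine P) = plen N P"
  unfolding plen_def sum_even_odd by (rule sum.cong) (auto simp add: refine_edges[OF assms] simp del: refine_odd refine_even)

lemma refine_close:
  assumes "in_balls N \<rho> c P" "in_balls N \<rho> c Q" "\<And>i. i \<le> N \<Longrightarrow> dist (P i) (Q i) \<le> \<delta>" "i \<le> 2 * N"
  shows "dist (refine P i) (refine Q i) \<le> \<delta>"
proof (cases "i = 2 * N")
  case True then show ?thesis using assms(3)[of N] by simp
next
  case False
  then have i: "i < 2 * N" using assms(4) by simp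
  have odd: "dist (refine P (Suc (2 * k))) (refine Q (Suc (2 * k))) \<le> \<delta>" if "k < N" for k
  proof -
    have "dist (mid (P k) (P (Suc k))) (mid (Q k) (Q (Suc k))) \<le> (dist (P k) (Q k) + dist (P (Suc k)) (Q (Suc k))) / 2"
      using assms(1,2) that unfolding in_balls_def by (intro mid_convex[of "c k" \<rho>]) auto
    also have "\<dots> \<le> \<delta>" using assms(3)[of k] assms(3)[of "Suc k"] that by auto
    finally show ?thesis by simp
  qed
  show ?thesis by (rule even_odd_less_cases[OF _ _ i]) (use assms(3) odd in \<open>auto simp del: refine_odd\<close>)
qed

lemma refine_iterate:
  assumes "in_balls N \<rho> c P"
  shows "in_balls (N * 2 ^ l) \<rho> (\<lambda>k. c (k div 2 ^ l)) ((refine ^^ l) P)"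
    and "plen (N * 2 ^ l) ((refine ^^ l) P) = plen N P"
    and "(\<And>k. k < N \<Longrightarrow> dist (P k) (P (Suc k)) \<le> \<mu>) \<Longrightarrow>
      \<forall>k<N * 2 ^ l. dist ((refine ^^ l) P k) ((refine ^^ l) P (Suc k)) \<le> \<mu> / 2 ^ l"
    and "(refine ^^ l) P 0 = P 0" "(refine ^^ l) P (N * 2 ^ l) = P N"
proof -
  have e: "N * (2 * 2 ^ l) = 2 * (N * 2 ^ l)" for l by simp
  show 1: "in_balls (N * 2 ^ l) \<rho> (\<lambda>k. c (k div 2 ^ l)) ((refine ^^ l) P)" for l
  proof (induction l)
    case 0 then show ?case using assms by simp
  next
    case (Suc l)
    show ?case using refine_in_balls[OF Suc] by (simp add: e div_mult2_eq)
  qed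
  show "plen (N * 2 ^ l) ((refine ^^ l) P) = plen N P"
  proof (induction l)
    case 0 then show ?case by simp
  next
    case (Suc l) then show ?case using refine_plen[OF 1[of l]] by (simp add: e)
  qed
  show "(refine ^^ l) P 0 = P 0"
    by (induction l) (simp_all add: refine_even[of _ 0, simplified])
  show "(refine ^^ l) P (N * 2 ^ l) = P N"
    by (induction l) (simp_all add: e)
  assume mesh: "\<And>k. k < N \<Longrightarrow> dist (P k) (P (Suc k)) \<le> \<mu>"
  show "\<forall>k<N * 2 ^ l. dist ((refine ^^ l) P k) ((refine ^^ l) P (Suc k)) \<le> \<mu> / 2 ^ l"
  proof (induction l)
    case 0 then show ?case using mesh by simp
  next
    case (Suc l)
    show ?case
    proof (intro allI impI)
      fix k assume "k < N * 2 ^ Suc l"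
      then show "dist ((refine ^^ Suc l) P k) ((refine ^^ Suc l) P (Suc k)) \<le> \<mu> / 2 ^ Suc l"
        using refine_mesh[OF 1[of l], of "\<mu> / 2 ^ l" k] Suc by (simp add: e divide_divide_eq_left mult.commute)
    qed
  qed
qed

lemma refine_iterate_close:
  assumes "in_balls N \<rho> c P" "in_balls N \<rho> c Q" "\<And>i. i \<le> N \<Longrightarrow> dist (P i) (Q i) \<le> \<delta>"
  shows "\<forall>i\<le>N * 2 ^ l. dist ((refine ^^ l) P i) ((refine ^^ l) Q i) \<le> \<delta>"
proof (induction l)
  case 0 then show ?case using assms by simp
next
  case (Suc l)
  have e: "N * (2 * 2 ^ l) = 2 * (N * 2 ^ l)" by simp
  show ?case
    using refine_close[OF refine_iterate(1)[OF assms(1), of l] refine_iterate(1)[OF assms(2), of l], of \<delta>] Suc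
    by (simp add: e)
qed

definition arc_geodesic :: "real \<Rightarrow> real \<Rightarrow> real \<Rightarrow> (real \<Rightarrow> 'a::metric_space) \<Rightarrow> bool" where
  "arc_geodesic \<epsilon> a b c \<longleftrightarrow> (\<forall>s\<in>{a..b}. \<forall>t\<in>{a..b}. \<bar>s - t\<bar> \<le> \<epsilon> \<longrightarrow> dist (c s) (c t) = \<bar>s - t\<bar>)"

text \<open>As long as \<open>h \<le> \<epsilon>\<close>, the point of \<gamma> half a step further
  is a midpoint of two consecutive samples, and midpoints are unique. Refinement therefore only
  samples the geodesic at half the step.\<close>

lemma refine_geodesic:
  assumes "in_balls N \<rho> c P" "arc_geodesic \<epsilon> 0 L \<gamma>" "0 \<le> h" "h \<le> \<epsilon>" "N * h \<le> L"
    and "\<And>i. i \<le> N \<Longrightarrow> P i = \<gamma> (i * h)" "i \<le> 2 * N"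
  shows "refine P i = \<gamma> (i * (h / 2))"
proof (cases "i = 2 * N")
  case True then show ?thesis using assms(6)[of N] by simp
next
  case False
  then have i: "i < 2 * N" using assms(7) by simp
  have odd: "refine P (Suc (2 * k)) = \<gamma> (Suc (2 * k) * (h / 2))" if k: "k < N" for k
  proof -
    have le: "real k * h \<le> N * h" "real (Suc k) * h \<le> N * h" using k assms(3) by (auto intro!: mult_right_mono)
    have eq: "real (Suc (2 * k)) * (h / 2) = k * h + h / 2" by (simp add: algebra_simps)
    have 1: "dist (\<gamma> (k * h)) (\<gamma> (k * h + h / 2)) = h / 2"
      and 2: "dist (\<gamma> (Suc k * h)) (\<gamma> (k * h + h / 2)) = h / 2"
      and 3: "dist (\<gamma> (k * h)) (\<gamma> (Suc k * h)) = h"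
      using assms(2-5) le unfolding arc_geodesic_def by (auto simp: algebra_simps)
    have "is_mid (P k) (P (Suc k)) (\<gamma> (k * h + h / 2))"
      using assms(6)[of k] assms(6)[of "Suc k"] k 1 2 3 unfolding is_mid_def by simp
    then have "mid (P k) (P (Suc k)) = \<gamma> (k * h + h / 2)"
      using assms(1) k unfolding in_balls_def by (intro mid_uniq[of "c k" \<rho>]) auto
    then show ?thesis unfolding eq by simp
  qed
  show ?thesis by (rule even_odd_less_cases[OF _ _ i]) (use assms(6) odd in \<open>auto simp del: refine_odd\<close>)
qed

lemma refine_iterate_geodesic:
  assumes "in_balls N \<rho> c P" "arc_geodesic \<epsilon> 0 L \<gamma>" "0 \<le> h" "h \<le> \<epsilon>" "N * h \<le> L"
    and "\<And>i. i \<le> N \<Longrightarrow> P i = \<gamma> (i * h)"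
  shows "\<forall>i\<le>N * 2 ^ l. (refine ^^ l) P i = \<gamma> (i * (h / 2 ^ l))"
proof (induction l)
  case 0 then show ?case using assms by simp
next
  case (Suc l)
  have "h / 2 ^ l \<le> h" using assms(3) by (simp add: divide_le_eq mult_le_cancel_left1)
  then have "refine ((refine ^^ l) P) i = \<gamma> (i * (h / 2 ^ l / 2))" if "i \<le> 2 * (N * 2 ^ l)" for i
    using assms Suc that by (intro refine_geodesic[OF refine_iterate(1)[OF assms(1), of l] assms(2)]) auto
  then show ?case by (simp add: mult.commute mult.left_commute)
qed

section \<open>Homotopies with fixed ends\<close>

text \<open>Simple connectedness contracts the loop \<open>p +++ reversepath q\<close> only as a
  free loop, whose base point may move. The square of that contraction is folded so that the track
  of the base point is pushed into the interior and the ends stay fixed.\<close>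

lemma simply_connected_fixed_endpoint_homotopy:
  fixes p q :: "real \<Rightarrow> 'a::topological_space"
  assumes "simply_connected (UNIV :: 'a set)" "path p" "path q" "p 0 = q 0" "p 1 = q 1"
  obtains F where "continuous_on ({0..1::real} \<times> {0..1::real}) F"
    "\<And>t. t \<in> {0..1} \<Longrightarrow> F (0, t) = p t" "\<And>t. t \<in> {0..1} \<Longrightarrow> F (1, t) = q t"
    "\<And>s. s \<in> {0..1} \<Longrightarrow> F (s, 0) = p 0" "\<And>s. s \<in> {0..1} \<Longrightarrow> F (s, 1) = p 1"
proof -
  let ?l = "p +++ reversepath q"
  have "path ?l"
    by (rule path_join_imp) (use assms path_reversepath[of q] in \<open>auto simp: pathstart_def pathfinish_def reversepath_def\<close>)
  moreover have "pathfinish ?l = pathstart ?l"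
    using assms by (auto simp: pathstart_def pathfinish_def joinpaths_def reversepath_def)
  ultimately have "homotopic_loops UNIV ?l (\<lambda>_. p 0)"
    using assms(1) unfolding simply_connected_def by (auto simp: path_def pathstart_def pathfinish_def)
  then obtain h where h: "continuous_on ({0..1::real} \<times> {0..1::real}) h"
    and h0: "\<And>x. x \<in> {0..1} \<Longrightarrow> h (0, x) = ?l x" and h1: "\<And>x. x \<in> {0..1} \<Longrightarrow> h (1, x) = p 0"
    and ends: "\<And>t. t \<in> {0..1} \<Longrightarrow> h (t, 1) = h (t, 0)"
    unfolding homotopic_loops o_def pathstart_def pathfinish_def by blast
  \<comment> \<open>On the middle line of the new square, \<open>(\<rho> t, \<theta> t)\<close>
    follows the track of the base point during the first third, the contracted edge during the
    second, and returns along height 1/2 during the last.\<close>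
  define \<rho> where "\<rho> t = min 1 (min (3 * t) (3 - 3 * t))" for t :: real
  define \<theta> where "\<theta> t = max 0 (min (1/2) ((3 * t - 1) / 2))" for t :: real
  have c: "continuous_on S (\<lambda>x. \<rho> (snd x))" "continuous_on S (\<lambda>x. \<theta> (snd x))" for S :: "(real \<times> real) set"
    unfolding \<rho>_def \<theta>_def by (intro continuous_intros ballI; simp)+
  have bd: "0 \<le> \<rho> t" "\<rho> t \<le> 1" "0 \<le> \<theta> t" "\<theta> t \<le> 1 / 2" if "t \<in> {0..1}" for t
    using that by (auto simp: \<rho>_def \<theta>_def)
  txt \<open>In the square, the two halves of the edge carrying the loop are pushed to three-sided paths through
    the contracted edge; these two paths have the same image because the sides are identified.\<close>
  define U where "U x = (2 * fst x * \<rho> (snd x), (1 - 2 * fst x) * (snd x / 2) + 2 * fst x * \<theta> (snd x))" for x :: "real \<times> real"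
  define V where "V x = (2 * (1 - fst x) * \<rho> (snd x), 1 - ((2 * fst x - 1) * (snd x / 2) + 2 * (1 - fst x) * \<theta> (snd x)))" for x :: "real \<times> real"
  have conv: "0 \<le> (1 - u) * x + u * y" "(1 - u) * x + u * y \<le> 1"
    if "0 \<le> u" "u \<le> 1" "0 \<le> x" "x \<le> 1 / 2" "0 \<le> y" "y \<le> 1 / 2" for u x y :: real
  proof -
    show "0 \<le> (1 - u) * x + u * y" using that by simp
    have "(1 - u) * x + u * y \<le> (1 - u) * (1/2) + u * (1/2)" using that by (intro add_mono mult_left_mono) auto
    then show "(1 - u) * x + u * y \<le> 1" by (simp add: field_simps)
  qed
  have U: "U x \<in> {0..1} \<times> {0..1}" if "x \<in> {0..1/2} \<times> {0..1}" for x
    using that bd[of "snd x"] conv[of "2 * fst x" "snd x / 2" "\<theta> (snd x)"] unfolding U_def by (auto intro: mult_le_one)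
  have V: "V x \<in> {0..1} \<times> {0..1}" if "x \<in> {1/2..1} \<times> {0..1}" for x
    using that bd[of "snd x"] conv[of "2 * (1 - fst x)" "snd x / 2" "\<theta> (snd x)"] mult_le_one[of "2 * (1 - fst x)" "\<rho> (snd x)"]
      mult_nonneg_nonneg[of "1 - fst x" "\<rho> (snd x)"]
    unfolding V_def by (auto simp: algebra_simps)
  define F where "F x = (if fst x \<le> 1/2 then h (U x) else h (V x))" for x
  have e: "{0..1} \<times> {0..1::real} = {0..1/2::real} \<times> {0..1} \<union> {1/2..1} \<times> {0..1}" by auto
  have "continuous_on ({0..1/2::real} \<times> {0..1::real} \<union> {1/2..1} \<times> {0..1}) F"
    unfolding F_def
  proof (rule continuous_on_cases)
    show "continuous_on ({0..1/2} \<times> {0..1}) (\<lambda>x. h (U x))"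
      by (rule continuous_on_compose2[OF h]) (use U in \<open>auto simp: U_def intro!: continuous_intros c\<close>)
    show "continuous_on ({1/2..1} \<times> {0..1}) (\<lambda>x. h (V x))"
      by (rule continuous_on_compose2[OF h]) (use V in \<open>auto simp: V_def intro!: continuous_intros c\<close>)
    show "\<forall>x. x \<in> {0..1/2} \<times> {0..1} \<and> \<not> fst x \<le> 1/2 \<or> x \<in> {1/2..1} \<times> {0..1} \<and> fst x \<le> 1/2 \<longrightarrow> h (U x) = h (V x)"
    proof (intro allI impI)
      fix x :: "real \<times> real"
      assume "x \<in> {0..1/2} \<times> {0..1} \<and> \<not> fst x \<le> 1/2 \<or> x \<in> {1/2..1} \<times> {0..1} \<and> fst x \<le> 1/2"
      then have x: "fst x = 1 / 2" "snd x \<in> {0..1}" by auto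
      then have UV: "U x = (\<rho> (snd x), \<theta> (snd x))" "V x = (\<rho> (snd x), 1 - \<theta> (snd x))"
        unfolding U_def V_def x(1) by auto
      consider "snd x \<le> 1/3" | "snd x \<ge> 1/3" "snd x \<le> 2/3" | "snd x \<ge> 2/3" by linarith
      then show "h (U x) = h (V x)"
      proof cases
        case 1 then show ?thesis unfolding UV using ends[of "\<rho> (snd x)"] bd[OF x(2)] by (simp add: \<theta>_def)
      next
        case 2
        then have "\<rho> (snd x) = 1" by (simp add: \<rho>_def)
        then show ?thesis unfolding UV using h1 bd[OF x(2)] by simp
      next
        case 3 then show ?thesis unfolding UV by (simp add: \<theta>_def)
      qed
    qed
  qed (auto intro!: closed_Times)
  then have "continuous_on ({0..1} \<times> {0..1}) F" unfolding e .
  moreover have "F (0, t) = p t" if "t \<in> {0..1}" for t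
    using that h0[of "t / 2"] by (auto simp: F_def U_def joinpaths_def)
  moreover have "F (1, t) = q t" if "t \<in> {0..1}" for t
    using that h0[of "1 - t / 2"] assms(4,5) by (auto simp: F_def V_def joinpaths_def reversepath_def algebra_simps)
  moreover have "F (s, 0) = p 0" if "s \<in> {0..1}" for s
    using that h0[of 0] h0[of 1] assms(4) by (auto simp: F_def V_def U_def joinpaths_def reversepath_def \<rho>_def \<theta>_def)
  moreover have "F (s, 1) = p 1" if "s \<in> {0..1}" for s
    using that h0[of "1/2"] by (auto simp: F_def V_def U_def joinpaths_def \<rho>_def \<theta>_def algebra_simps)
  ultimately show thesis by - (rule that[of F]; assumption)
qed

section \<open>Complete length spaces with the local inequality; compactness of closed balls\<close>

text \<open>These are the metric properties that the charts will have to supply. In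
  \<open>short_path\<close> the function \<open>l\<close> stands for arc length: its increments
  dominate distances. \<open>reflect\<close> is infinitesimal extendibility: up to a relative error
  \<eta>, some \<open>q\<close> lies opposite to \<open>x\<close> as seen from
  \<open>p\<close>.\<close>

locale nonpos_space =
  fixes X :: "'a::metric_space itself"
  assumes complete: "complete (UNIV :: 'a set)"
    and loc_compact: "\<exists>r>0. compact (cball (p :: 'a) r)"
    and short_path: "0 < e \<Longrightarrow> \<exists>\<sigma> l. continuous_on {0..1::real} \<sigma> \<and> \<sigma> 0 = (x :: 'a) \<and> \<sigma> 1 = y \<and>
      (\<forall>s t. 0 \<le> s \<longrightarrow> s \<le> t \<longrightarrow> t \<le> 1 \<longrightarrow> dist (\<sigma> s) (\<sigma> t) \<le> l t - l s) \<and> l 1 - l 0 \<le> dist x y + (e :: real)"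
    and cn: "\<exists>r>0. cn_ball (p :: 'a) r"
    and reflect: "0 < \<eta> \<Longrightarrow> \<exists>r>0. \<forall>x\<in>ball (p :: 'a) r. \<exists>q.
      dist p q \<le> (1 + \<eta>) * dist p x \<and> 2 * (1 - \<eta>) * dist p x \<le> dist x q"
    and simply_connected: "simply_connected (UNIV :: 'a set)"
begin

lemma approx_between:
  assumes "0 \<le> s" "s \<le> dist x y" "0 < e"
  obtains z :: 'a where "dist x z = s" "dist z y \<le> dist x y - s + e"
proof -
  obtain \<sigma> l where \<sigma>: "continuous_on {0..1::real} \<sigma>" "\<sigma> 0 = x" "\<sigma> 1 = y"
    "\<And>s t. 0 \<le> s \<Longrightarrow> s \<le> t \<Longrightarrow> t \<le> 1 \<Longrightarrow> dist (\<sigma> s) (\<sigma> t) \<le> l t - l s" "l 1 - l 0 \<le> dist x y + e"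
    using short_path[OF assms(3), of x y] by blast
  have "\<exists>t\<ge>0. t \<le> 1 \<and> dist x (\<sigma> t) = s"
    using assms \<sigma> by (intro IVT') (auto intro!: continuous_intros)
  then obtain t where t: "0 \<le> t" "t \<le> 1" "dist x (\<sigma> t) = s" by blast
  have "dist (\<sigma> 0) (\<sigma> t) \<le> l t - l 0" "dist (\<sigma> t) (\<sigma> 1) \<le> l 1 - l t" using \<sigma>(4) t by auto
  then show thesis using that[of "\<sigma> t"] t \<sigma> by auto
qed

text \<open>In the argument of Hopf and Rinow this is openness of the set of radii with compact
  balls. A Lebesgue number thickens \<open>cball a R\<close> inside finitely many compact sets, and
  \<open>approx_between\<close> shows that points slightly outside are close to the ball.\<close>

lemma compact_cball_extend:
  assumes "compact (cball (a :: 'a) R)" "0 \<le> R"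
  obtains e where "0 < e" "compact (cball a (R + e))"
proof -
  obtain r where r: "\<And>p :: 'a. 0 < r p \<and> compact (cball p (r p))" using loc_compact by metis
  obtain e where e: "0 < e" "\<And>x. x \<in> cball a R \<Longrightarrow> \<exists>G \<in> range (\<lambda>p. ball p (r p)). ball x e \<subseteq> G"
    by (rule Heine_Borel_lemma[OF assms(1), of "range (\<lambda>p. ball p (r p))"])
      (use r in \<open>auto, metis dist_self\<close>)
  obtain K where K: "finite K" "cball a R \<subseteq> (\<Union>x\<in>K. ball x (e / 4))" "K \<subseteq> cball a R"
    using compactE_image[OF assms(1), of "cball a R" "\<lambda>x. ball x (e / 4)"] e(1)
    by (metis (no_types, lifting) UN_I centre_in_ball divide_pos_pos open_ball subsetI zero_less_numeral)
  have "compact (closure (ball x e))" if "x \<in> K" for x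
  proof -
    obtain p where "ball x e \<subseteq> ball p (r p)" using e(2) K(3) \<open>x \<in> K\<close> by blast
    then have "closure (ball x e) \<subseteq> cball p (r p)"
      by (meson ball_subset_cball closed_cball closure_minimal order_trans)
    then show ?thesis using r[of p] compact_Int_closed[of "cball p (r p)" "closure (ball x e)"]
      by (simp add: inf.absorb2)
  qed
  then have comp: "compact (\<Union>x\<in>K. closure (ball x e))" using K(1) by (intro compact_UN) auto
  have "cball a (R + e / 4) \<subseteq> (\<Union>x\<in>K. closure (ball x e))"
  proof
    fix y assume y: "y \<in> cball a (R + e / 4)"
    obtain z where z: "z \<in> cball a R" "dist z y \<le> e / 2"
    proof (cases "dist a y \<le> R")
      case True then show ?thesis using that[of y] e(1) by auto
    next
      case False
      obtain z where "dist a z = R" "dist z y \<le> dist a y - R + e / 4"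
        by (rule approx_between[of R a y "e / 4"]) (use False assms e in auto)
      then show ?thesis using that[of z] y by auto
    qed
    obtain x where "x \<in> K" "dist x z < e / 4" using K(2) z(1) by auto
    then have "dist x y < e" using z(2) dist_triangle[of x y z] e(1) by linarith
    then have "y \<in> closure (ball x e)" using closure_subset[of "ball x e"] by auto
    then show "y \<in> (\<Union>x\<in>K. closure (ball x e))" using \<open>x \<in> K\<close> by blast
  qed
  then have "compact (cball a (R + e / 4))"
    using comp compact_Int_closed[OF comp closed_cball[of a "R + e / 4"]] by (simp add: inf.absorb2)
  then show thesis using that[of "e / 4"] e by simp
qed

text \<open>The corresponding closedness. A point of \<open>cball a R\<close> is within
  \<open>e / 2\<close> of the ball of radius \<open>R - e / 4\<close>, so a finite
  \<open>e / 2\<close>-net of the smaller ball is an \<open>e\<close>-net of the larger one.\<close>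

lemma compact_cball_limit:
  assumes "\<And>R'. 0 \<le> R' \<Longrightarrow> R' < R \<Longrightarrow> compact (cball (a :: 'a) R')" "0 \<le> R"
  shows "compact (cball a R)"
  unfolding compact_eq_totally_bounded
proof (intro conjI allI impI)
  show "complete (cball a R)" using complete_closed_subset[OF closed_cball _ complete] by auto
  fix e :: real assume e: "0 < e"
  show "\<exists>k. finite k \<and> cball a R \<subseteq> (\<Union>x\<in>k. ball x e)"
  proof (cases "R < e")
    case True
    then show ?thesis by (intro exI[of _ "{a}"]) auto
  next
    case False
    define R' where "R' = R - e / 4"
    have R': "0 \<le> R'" "R' < R" using False e by (auto simp: R'_def)
    from assms(1)[OF R'] obtain k where k: "finite k" "cball a R' \<subseteq> (\<Union>x\<in>k. ball x (e / 2))"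
      unfolding compact_eq_totally_bounded using e by (meson half_gt_zero)
    have "cball a R \<subseteq> (\<Union>x\<in>k. ball x e)"
    proof
      fix y assume y: "y \<in> cball a R"
      obtain z where z: "z \<in> cball a R'" "dist z y \<le> e / 2"
      proof (cases "dist a y \<le> R'")
        case True then show ?thesis using that[of y] e(1) by auto
      next
        case False
        obtain z where "dist a z = R'" "dist z y \<le> dist a y - R' + e / 4"
          by (rule approx_between[of R' a y "e / 4"]) (use False R' e in auto)
        then show ?thesis using that[of z] y by (auto simp: R'_def)
      qed
      obtain x where "x \<in> k" "dist x z < e / 2" using k(2) z(1) by auto
      then show "y \<in> (\<Union>x\<in>k. ball x e)" using z(2) dist_triangle[of x y z] by fastforce
    qed
    then show ?thesis using k by blast
  qed
qed

theorem proper: "compact (cball (a :: 'a) R)"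
proof -
  have sub: "compact (cball a R')" if "compact (cball a R)" "R' \<le> R" for R R'
    using compact_Int_closed[OF that(1) closed_cball[of a R']] subset_cball[OF that(2), of a] by (simp add: inf.absorb2)
  have "compact (cball a R)" if "0 \<le> R" for R
  proof (rule ccontr)
    assume R: "\<not> compact (cball a R)"
    define T where "T = {R. 0 \<le> R \<and> \<not> compact (cball a R)}"
    have T: "T \<noteq> {}" "bdd_below T" using R that by (auto simp: T_def intro: bdd_belowI[of _ 0])
    have m: "0 \<le> Inf T" using T by (intro cInf_greatest) (auto simp: T_def)
    have "compact (cball a R')" if "0 \<le> R'" "R' < Inf T" for R'
      using that cInf_lower[OF _ T(2), of R'] by (force simp: T_def)
    then have "compact (cball a (Inf T))" using compact_cball_limit m by blast
    then obtain e where "0 < e" "compact (cball a (Inf T + e))" using compact_cball_extend m by blast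
    moreover obtain t where "t \<in> T" "t < Inf T + e" using cInf_lessD[OF T(1), of "Inf T + e"] \<open>0 < e\<close> by auto
    ultimately show False using sub[of "Inf T + e" t] by (auto simp: T_def)
  qed
  then show ?thesis by (cases "0 \<le> R") auto
qed

text \<open>Compactness of the sphere about \<open>x\<close> removes the error of
  \<open>approx_between\<close>: a point of the sphere nearest to \<open>y\<close> serves.\<close>

lemma between:
  assumes "0 \<le> s" "s \<le> dist x y"
  obtains z :: 'a where "dist x z = s" "dist z y = dist x y - s"
proof -
  have c: "compact (cball x s \<inter> {z. dist x z = s})"
    by (intro compact_Int_closed proper closed_Collect_eq continuous_intros)
  have ne: "cball x s \<inter> {z. dist x z = s} \<noteq> {}"
  proof -
    obtain z where "dist x z = s" using approx_between[of s x y 1] assms by auto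
    then show ?thesis by auto
  qed
  obtain z where z: "dist x z = s" "\<And>z'. dist x z' = s \<Longrightarrow> dist z y \<le> dist z' y"
    using continuous_attains_inf[OF c ne, of "\<lambda>z. dist z y"] by (force intro: continuous_intros)
  have "dist z y \<le> dist x y - s + e" if "0 < e" for e
  proof -
    obtain z' where "dist x z' = s" "dist z' y \<le> dist x y - s + e" by (rule approx_between[OF assms \<open>0 < e\<close>])
    then show ?thesis using z(2)[of z'] by linarith
  qed
  then have "dist z y \<le> dist x y - s" by (rule field_le_epsilon)
  then show thesis using that[of z] z(1) dist_triangle[of x y z] by simp
qed

text \<open>A Lebesgue number for the cover by balls on which the inequality holds.\<close>

lemma unif_cn:
  assumes "compact (K :: 'a set)"
  obtains \<rho> where "0 < \<rho>" "\<And>p. p \<in> K \<Longrightarrow> cn_ball p (2 * \<rho>)"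
proof -
  obtain r where r: "\<And>p :: 'a. 0 < r p \<and> cn_ball p (r p)" using cn by metis
  obtain e where e: "0 < e" "\<And>x. x \<in> K \<Longrightarrow> \<exists>G \<in> range (\<lambda>p. ball p (r p)). ball x e \<subseteq> G"
    by (rule Heine_Borel_lemma[OF assms(1), of "range (\<lambda>p. ball p (r p))"])
      (use r in \<open>auto, metis dist_self\<close>)
  have "cn_ball p (2 * (e / 2))" if "p \<in> K" for p
  proof -
    obtain q where "ball p e \<subseteq> ball q (r q)" using e(2)[OF \<open>p \<in> K\<close>] by blast
    then show ?thesis using cn_ball_subset[of q "r q" p e] r by simp
  qed
  then show thesis using that[of "e / 2"] e(1) by simp
qed


section \<open>Local geodesics minimize\<close>

lemma arc_geodesic_continuous:
  assumes "arc_geodesic \<epsilon> a b (c :: real \<Rightarrow> 'a)" "0 < \<epsilon>"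
  shows "continuous_on {a..b} c"
proof (rule continuous_onI)
  fix x e :: real assume "x \<in> {a..b}" "0 < e"
  then have "dist (c x') (c x) \<le> e" if "x' \<in> {a..b}" "dist x' x < min \<epsilon> e" for x'
    using assms that unfolding arc_geodesic_def dist_real_def by auto
  then show "\<exists>d>0. \<forall>x'\<in>{a..b}. dist x' x < d \<longrightarrow> dist (c x') (c x) \<le> e"
    using \<open>0 < e\<close> assms(2) by (intro exI[of _ "min \<epsilon> e"]) auto
qed

lemma unif_step:
  fixes F :: "real \<times> real \<Rightarrow> 'a"
  assumes "continuous_on ({0..1} \<times> {0..1}) F" "0 < e"
  obtains n where "0 < n" "\<And>m s t s' t'. n \<le> m \<Longrightarrow> s \<in> {0..1} \<Longrightarrow> t \<in> {0..1} \<Longrightarrow> s' \<in> {0..1} \<Longrightarrow> t' \<in> {0..1} \<Longrightarrow>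
    \<bar>s - s'\<bar> + \<bar>t - t'\<bar> \<le> 1 / real m \<Longrightarrow> dist (F (s, t)) (F (s', t')) < e"
proof -
  have "uniformly_continuous_on ({0..1} \<times> {0..1}) F"
    using assms(1) by (intro compact_uniformly_continuous) (auto intro: compact_Times)
  then obtain d where d: "0 < d" "\<And>x x'. x \<in> {0..1} \<times> {0..1} \<Longrightarrow> x' \<in> {0..1} \<times> {0..1} \<Longrightarrow> dist x' x < d \<Longrightarrow> dist (F x') (F x) < e"
    using assms(2) unfolding uniformly_continuous_on_def by meson
  obtain n where n: "1 / real (Suc n) < d" using d(1) by (meson nat_approx_posE)
  show thesis
  proof (rule that[of "Suc n"])
    fix m s t s' t' assume a: "Suc n \<le> m" "s \<in> {0..1::real}" "t \<in> {0..1::real}" "s' \<in> {0..1}" "t' \<in> {0..1}"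
      "\<bar>s - s'\<bar> + \<bar>t - t'\<bar> \<le> 1 / real m"
    have "dist (s, t) (s', t') \<le> \<bar>s - s'\<bar> + \<bar>t - t'\<bar>"
      unfolding dist_prod_def dist_real_def by (rule order_trans[OF sqrt_sum_squares_le_sum_abs]) simp
    also have "\<dots> \<le> 1 / real (Suc n)" using a by (intro order_trans[OF a(6)] divide_left_mono) auto
    finally show "dist (F (s, t)) (F (s', t')) < e" using d(2)[of "(s',t')" "(s,t)"] a n by auto
  qed simp
qed

theorem arc_geodesic_minimizing:
  fixes \<gamma> :: "real \<Rightarrow> 'a"
  assumes geo: "arc_geodesic \<epsilon> 0 L \<gamma>" and \<epsilon>: "0 < \<epsilon>" and L: "0 \<le> L"
  shows "L \<le> dist (\<gamma> 0) (\<gamma> L)"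
proof (rule ccontr)
  assume "\<not> L \<le> dist (\<gamma> 0) (\<gamma> L)"
  then have less: "dist (\<gamma> 0) (\<gamma> L) < L" by simp
  then have L0: "0 < L" using zero_le_dist[of "\<gamma> 0" "\<gamma> L"] by linarith
  obtain \<sigma> l where \<sigma>: "continuous_on {0..1::real} \<sigma>" "\<sigma> 0 = \<gamma> 0" "\<sigma> 1 = \<gamma> L"
    "\<And>s t. 0 \<le> s \<Longrightarrow> s \<le> t \<Longrightarrow> t \<le> 1 \<Longrightarrow> dist (\<sigma> s) (\<sigma> t) \<le> l t - l s"
    "l 1 - l 0 \<le> dist (\<gamma> 0) (\<gamma> L) + (L - dist (\<gamma> 0) (\<gamma> L)) / 2"
    using short_path[of "(L - dist (\<gamma> 0) (\<gamma> L)) / 2" "\<gamma> 0" "\<gamma> L"] less by auto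
  have l: "l 1 - l 0 < L" using \<sigma>(5) less by argo
  have g: "continuous_on {0..1} (\<lambda>t. \<gamma> (t * L))"
    by (rule continuous_on_compose2[OF arc_geodesic_continuous[OF geo \<epsilon>]])
      (use L in \<open>auto intro!: continuous_intros simp: mult_left_le_one_le\<close>)
  obtain F :: "real \<times> real \<Rightarrow> 'a" where F: "continuous_on ({0..1} \<times> {0..1}) F"
    "\<And>t. t \<in> {0..1} \<Longrightarrow> F (0, t) = \<gamma> (t * L)" "\<And>t. t \<in> {0..1} \<Longrightarrow> F (1, t) = \<sigma> t"
    "\<And>s. s \<in> {0..1} \<Longrightarrow> F (s, 0) = \<gamma> 0" "\<And>s. s \<in> {0..1} \<Longrightarrow> F (s, 1) = \<gamma> L"
    by (rule simply_connected_fixed_endpoint_homotopy[OF simply_connected, of "\<lambda>t. \<gamma> (t * L)" \<sigma>])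
      (use g \<sigma> in \<open>auto simp: path_def\<close>)
  have "compact (F ` ({0..1} \<times> {0..1}))" using F(1) by (intro compact_continuous_image compact_Times compact_Icc)
  then obtain \<rho>1 where \<rho>1: "0 < \<rho>1" "\<And>p. p \<in> F ` ({0..1} \<times> {0..1}) \<Longrightarrow> cn_ball p (2 * \<rho>1)"
    by (rule unif_cn) (rule that)
  obtain n1 where n1: "0 < n1" "\<And>m s t s' t'. n1 \<le> m \<Longrightarrow> s \<in> {0..1} \<Longrightarrow> t \<in> {0..1} \<Longrightarrow> s' \<in> {0..1} \<Longrightarrow> t' \<in> {0..1} \<Longrightarrow>
    \<bar>s - s'\<bar> + \<bar>t - t'\<bar> \<le> 1 / real m \<Longrightarrow> dist (F (s, t)) (F (s', t')) < \<rho>1 / 2"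
    by (rule unif_step[OF F(1), of "\<rho>1 / 2"]) (use \<rho>1 in auto)
  obtain n2 where n2: "2 * L / \<epsilon> < real n2" using reals_Archimedean2 by blast
  define N0 where "N0 = n1 + n2"
  have N0: "0 < N0" "n1 \<le> N0" using n1 by (auto simp: N0_def)
  \<comment> \<open>Three consecutive samples must lie on one minimizing piece of \<gamma>, so that
    the middle one is the midpoint of the others and the sampled polygon is fixed by shortening.
    Hence two steps have to fit into \<epsilon>.\<close>
  have stp: "2 * (L / N0) \<le> \<epsilon>"
  proof -
    have "2 * L / \<epsilon> < real N0" using n2 by (simp add: N0_def)
    then show ?thesis using \<epsilon> N0 by (simp add: field_simps)
  qed
  \<comment> \<open>A bound for the length of every sampled polygon, whose edges are shorter than
    \<open>\<rho>1\<close>. It has to be known before \<rho>, the scale of the inequality on the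
    ball that will contain all iterates.\<close>
  define C where "C = N0 * \<rho>1"
  obtain \<rho> where \<rho>: "0 < \<rho>" "\<And>p. p \<in> cball (\<gamma> 0) C \<Longrightarrow> cn_ball p (2 * \<rho>)"
    by (rule unif_cn[OF proper]) (rule that)
  \<comment> \<open>This many refinements bring the mesh down to \<open>\<rho> / 4\<close>, while
    the bound \<open>C\<close> for the lengths persists.\<close>
  obtain l0 where l0: "\<rho>1 / 2 / 2 ^ l0 \<le> \<rho> / 4"
  proof -
    obtain n where "(1/2) ^ n < \<rho> / 2 / \<rho>1" using real_arch_pow_inv[of "\<rho> / 2 / \<rho>1" "1/2"] \<rho> \<rho>1 by auto
    then show thesis using \<rho>1 by (intro that[of n]) (simp add: field_simps power_divide)
  qed
  \<comment> \<open>The number of stages of the homotopy is chosen last. Closeness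
    \<open>\<rho> / 4\<close> is what shortening asks for; \<open>\<rho>1 / 2\<close> puts
    consecutive polygons into the same balls, as refinement requires.\<close>
  obtain J where J: "0 < J" "\<And>m s t s' t'. J \<le> m \<Longrightarrow> s \<in> {0..1} \<Longrightarrow> t \<in> {0..1} \<Longrightarrow> s' \<in> {0..1} \<Longrightarrow> t' \<in> {0..1} \<Longrightarrow>
    \<bar>s - s'\<bar> + \<bar>t - t'\<bar> \<le> 1 / real m \<Longrightarrow> dist (F (s, t)) (F (s', t')) < min (\<rho> / 4) (\<rho>1 / 2)"
    by (rule unif_step[OF F(1), of "min (\<rho> / 4) (\<rho>1 / 2)"]) (use \<rho> \<rho>1 in auto)
  define P where "P j i = F (real j / J, real i / N0)" for j i :: nat
  have unit: "real i / N0 \<in> {0..1}" if "i \<le> N0" for i using that N0 by auto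
  have unitJ: "real j / J \<in> {0..1}" if "j \<le> J" for j using that J by auto
  have dP: "dist (P j i) (P j (Suc i)) < \<rho>1 / 2" if "j \<le> J" "i < N0" for i j
    unfolding P_def using that unit[of i] unit[of "Suc i"] unitJ N0
    by (intro n1(2)[OF N0(2)]) (auto simp: diff_divide_distrib[symmetric])
  have dJ: "dist (P j i) (P (Suc j) i) < min (\<rho> / 4) (\<rho>1 / 2)" if "j < J" "i \<le> N0" for i j
    unfolding P_def using that unit[of i] unitJ[of j] unitJ[of "Suc j"] J(1)
    by (intro J(2)[OF order_refl]) (auto simp: diff_divide_distrib[symmetric])
  have cP: "cn_ball (P j i) (2 * \<rho>1)" if "j \<le> J" "i \<le> N0" for i j
    using unit[OF that(2)] unitJ[OF that(1)] unfolding P_def by (intro \<rho>1(2)) blast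
  have in1: "in_balls N0 \<rho>1 (P j) (P j)" if "j \<le> J" for j
    using that dP[OF that] cP[OF that] \<rho>1(1) unfolding in_balls_def by (force simp: less_imp_le)
  have in2: "in_balls N0 \<rho>1 (P j) (P (Suc j))" if "j < J" for j
    unfolding in_balls_def
  proof (intro allI impI conjI)
    fix k assume k: "k < N0"
    show "cn_ball (P j k) (2 * \<rho>1)" using cP that k by simp
    show "P (Suc j) k \<in> ball (P j k) \<rho>1" using dJ[OF that, of k] k \<rho>1(1) by simp
    show "P (Suc j) (Suc k) \<in> ball (P j k) \<rho>1"
      using dJ[OF that, of "Suc k"] dP[of j k] k that dist_triangle[of "P j k" "P (Suc j) (Suc k)" "P j (Suc k)"] by simp
  qed
  define Q where "Q j = (refine ^^ l0) (P j)" for j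
  define N where "N = N0 * 2 ^ l0"
  have adm: "admissible N (\<rho> / 4) C (\<gamma> 0) (\<gamma> L) (Q j)" if "j \<le> J" for j
    unfolding admissible_def
  proof (intro conjI allI impI)
    show "Q j 0 = \<gamma> 0" unfolding Q_def refine_iterate(4)[OF in1[OF that]] P_def using F(4) unitJ[OF that] by simp
    show "Q j N = \<gamma> L" unfolding Q_def N_def refine_iterate(5)[OF in1[OF that]] P_def using F(5) unitJ[OF that] N0 by simp
    show "dist (Q j i) (Q j (Suc i)) \<le> \<rho> / 4" if "i < N" for i
      using refine_iterate(3)[OF in1[OF \<open>j \<le> J\<close>], of "\<rho>1 / 2" l0] dP[OF \<open>j \<le> J\<close>] that l0
      unfolding Q_def N_def by (meson less_imp_le order_trans)
    have "plen N (Q j) = plen N0 (P j)" unfolding Q_def N_def using refine_iterate(2)[OF in1[OF that]] .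
    also have "\<dots> \<le> (\<Sum>i<N0. \<rho>1)" unfolding plen_def
      using dP[OF that] \<rho>1(1) by (intro sum_mono) (force simp: less_imp_le intro: order_trans[OF less_imp_le[OF dP[OF that]]])
    finally show "plen N (Q j) \<le> C" by (simp add: C_def)
  qed
  define \<eta> where "\<eta> = L / N0 / 2 ^ l0"
  have Q0: "Q 0 i = \<gamma> (i * \<eta>)" if "i \<le> N" for i
    unfolding Q_def \<eta>_def
  proof (rule refine_iterate_geodesic[OF in1[of 0] geo, rule_format])
    show "P 0 i = \<gamma> (i * (L / N0))" if "i \<le> N0" for i
      using F(2) unit[OF that] unfolding P_def by simp
    have "L / N0 \<ge> 0" using L by simp
    then show "L / N0 \<le> \<epsilon>" using stp by linarith
  qed (use that L N0 in \<open>auto simp: N_def\<close>)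
  have \<eta>: "0 < \<eta>" "2 * \<eta> \<le> \<epsilon>" "N * \<eta> = L"
  proof -
    show "0 < \<eta>" "N * \<eta> = L" using L0 N0 by (auto simp: \<eta>_def N_def)
    have "L / N0 / 2 ^ l0 \<le> L / N0" using L N0 by (simp add: divide_le_eq mult_le_cancel_left1)
    then show "2 * \<eta> \<le> \<epsilon>" using stp by (simp add: \<eta>_def)
  qed
  have N1: "0 < N" using N0 by (simp add: N_def)
  have ge: "dist (\<gamma> (real i * \<eta>)) (\<gamma> (real j * \<eta>)) = (real j - real i) * \<eta>" if "i \<le> j" "j \<le> i + 2" "j \<le> N" for i j
  proof -
    have le: "real i * \<eta> \<le> N * \<eta>" "real j * \<eta> \<le> N * \<eta>" using that \<eta> by (auto intro!: mult_right_mono)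
    have "(real j - real i) * \<eta> \<le> 2 * \<eta>" using that \<eta> by (intro mult_right_mono) auto
    then have "\<bar>real i * \<eta> - real j * \<eta>\<bar> \<le> \<epsilon>" "\<bar>real i * \<eta> - real j * \<eta>\<bar> = (real j - real i) * \<eta>"
      using \<eta> that by (auto simp: left_diff_distrib abs_minus_commute)
    then show ?thesis using geo le \<eta> unfolding arc_geodesic_def by auto
  qed
  have fixed: "shorten N (Q 0) = Q 0"
  proof
    fix i
    show "shorten N (Q 0) i = Q 0 i"
    proof (cases "0 < i \<and> i < N")
      case True
      have 1: "dist (Q 0 (i - 1)) (Q 0 i) = \<eta>" "dist (Q 0 i) (Q 0 (Suc i)) = \<eta>" "dist (Q 0 (i - 1)) (Q 0 (Suc i)) = 2 * \<eta>"
        using ge[of "i - 1" i] ge[of i "Suc i"] ge[of "i - 1" "Suc i"] True Q0 by (auto simp: of_nat_diff)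
      have "\<eta> < \<rho>" using 1(2) adm[of 0] \<rho>(1) True unfolding admissible_def by force
      have c: "cn_ball (Q 0 i) (2 * \<rho>)" using \<rho>(2) admissible_in_cball[OF adm[of 0]] True by simp
      have "mid (Q 0 (i - 1)) (Q 0 (Suc i)) = Q 0 i"
        by (rule mid_uniq[OF c]) (use 1 \<open>\<eta> < \<rho>\<close> in \<open>auto simp: is_mid_def dist_commute\<close>)
      then show ?thesis using True by (simp add: shorten_def)
    next
      case False then show ?thesis by (auto simp: shorten_def)
    qed
  qed
  have "plen N (Q 0) \<le> plen N (Q J)"
  proof (rule shorten_chain[where C = C and \<rho> = \<rho> and \<mu> = "\<rho> / 4" and \<delta> = "\<rho> / 4" and a = "\<gamma> 0" and b = "\<gamma> L"])
    fix i j assume ij: "i \<le> N" "j < J"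
    have "dist (P j i) (P (Suc j) i) \<le> \<rho> / 4" if "i \<le> N0" for i using dJ[OF ij(2) that] by simp
    then show "dist (Q j i) (Q (Suc j) i) \<le> \<rho> / 4"
      using refine_iterate_close[OF in1[of j] in2[OF ij(2)], of "\<rho> / 4" l0] ij unfolding Q_def N_def by simp
  qed (use \<rho> adm fixed in auto)
  moreover have "plen N (Q 0) = L"
  proof -
    have "plen N (Q 0) = (\<Sum>i<N. \<eta>)" unfolding plen_def
    proof (intro sum.cong refl)
      fix i assume "i \<in> {..<N}"
      then show "dist (Q 0 i) (Q 0 (Suc i)) = \<eta>" using ge[of i "Suc i"] Q0[of i] Q0[of "Suc i"] by simp
    qed
    then show ?thesis using \<eta> by simp
  qed
  moreover have "plen N (Q J) \<le> l 1 - l 0"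
  proof -
    have "plen N (Q J) = plen N0 (P J)" unfolding Q_def N_def using refine_iterate(2)[OF in1[of J]] by simp
    also have "\<dots> \<le> (\<Sum>i<N0. l (real (Suc i) / N0) - l (real i / N0))"
      unfolding plen_def
    proof (rule sum_mono)
      fix i assume "i \<in> {..<N0}"
      then show "dist (P J i) (P J (Suc i)) \<le> l (real (Suc i) / N0) - l (real i / N0)"
        using \<sigma>(4)[of "real i / N0" "real (Suc i) / N0"] F(3) unit[of i] unit[of "Suc i"] J(1)
        by (auto simp: P_def divide_right_mono)
    qed
    also have "\<dots> = l 1 - l 0" using sum_lessThan_telescope[of "\<lambda>i. l (real i / N0)" N0] N0 by simp
    finally show ?thesis .
  qed
  ultimately show False using l by linarith
qed

end

context nonpos_space
begin

text \<open>A Lebesgue number makes the local scale uniform on a compact interval of time.\<close>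

lemma half_geodesic_arc:
  assumes "half_geodesic dist (\<gamma> :: real \<Rightarrow> 'a)" "0 \<le> a"
  obtains \<epsilon> where "0 < \<epsilon>" "arc_geodesic \<epsilon> a b \<gamma>"
proof -
  obtain e where e: "\<And>t. 0 \<le> t \<Longrightarrow> 0 < e t \<and> (\<forall>r\<ge>0. \<forall>s\<ge>0. \<bar>r - t\<bar> < e t \<and> \<bar>s - t\<bar> < e t \<longrightarrow> dist (\<gamma> r) (\<gamma> s) = \<bar>r - s\<bar>)"
    using assms(1) unfolding half_geodesic_def by metis
  have "{a..b} \<subseteq> \<Union>((\<lambda>t. ball t (e t)) ` {a..b})" 
  proof
    fix t assume "t \<in> {a..b}"
    then show "t \<in> \<Union>((\<lambda>t. ball t (e t)) ` {a..b})" using e[of t] assms(2) by (intro UN_I[of t]) auto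
  qed
  then obtain d where d: "0 < d" "\<And>x. x \<in> {a..b} \<Longrightarrow> \<exists>G \<in> (\<lambda>t. ball t (e t)) ` {a..b}. ball x d \<subseteq> G"
    by (rule Heine_Borel_lemma[OF compact_Icc]) auto
  have "dist (\<gamma> s) (\<gamma> t) = \<bar>s - t\<bar>" if "s \<in> {a..b}" "t \<in> {a..b}" "\<bar>s - t\<bar> \<le> d / 2" for s t
  proof -
    obtain u where u: "u \<in> {a..b}" "ball s d \<subseteq> ball u (e u)" using d(2)[OF \<open>s \<in> {a..b}\<close>] by blast
    have "t \<in> ball s d" "s \<in> ball s d" using that d by (auto simp: dist_real_def)
    then have "t \<in> ball u (e u)" "s \<in> ball u (e u)" using u by blast+
    then show ?thesis using e[of u] u(1) that assms(2) by (auto simp: dist_real_def abs_minus_commute)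
  qed
  then show thesis using that[of "d / 2"] d(1) by (auto simp: arc_geodesic_def)
qed

text \<open>The lower bound is the global result on arcs; the upper bound adds up short pieces on
  which distance and parameter agree.\<close>

theorem half_geodesic_minimizing:
  assumes "half_geodesic dist (\<gamma> :: real \<Rightarrow> 'a)" "0 \<le> s" "0 \<le> t"
  shows "dist (\<gamma> s) (\<gamma> t) = \<bar>s - t\<bar>"
proof -
  have *: "t - s \<le> dist (\<gamma> s) (\<gamma> t)" if st: "0 \<le> s" "s \<le> t" for s t
  proof -
    obtain \<epsilon> where \<epsilon>: "0 < \<epsilon>" "arc_geodesic \<epsilon> s t \<gamma>" by (rule half_geodesic_arc[OF assms(1) st(1)])
    have "arc_geodesic \<epsilon> 0 (t - s) (\<lambda>u. \<gamma> (s + u))"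
      using \<epsilon>(2) unfolding arc_geodesic_def by auto
    from arc_geodesic_minimizing[OF this \<epsilon>(1)] st show ?thesis by simp
  qed
  have up: "dist (\<gamma> s) (\<gamma> t) \<le> t - s" if st: "0 \<le> s" "s \<le> t" for s t
  proof -
    obtain \<epsilon> where \<epsilon>: "0 < \<epsilon>" "arc_geodesic \<epsilon> s t \<gamma>" by (rule half_geodesic_arc[OF assms(1) st(1)])
    obtain n where n: "(t - s) / \<epsilon> < real n" using reals_Archimedean2 by blast
    have n0: "0 < n" using n st \<epsilon> by (cases n) (auto simp: divide_less_eq)
    define h where "h = (t - s) / n"
    have h: "0 \<le> h" "h \<le> \<epsilon>" "s + n * h = t" using n n0 \<epsilon> st by (auto simp: h_def field_simps)
    have "dist (\<gamma> (s + 0 * h)) (\<gamma> (s + real k * h)) \<le> k * h" if "k \<le> n" for k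
      using that
    proof (induction k)
      case (Suc k)
      have "real (Suc k) * h \<le> n * h" "real k * h \<le> n * h" using h Suc.prems by (auto intro!: mult_right_mono)
      then have "s + real (Suc k) * h \<le> t" "s + real k * h \<le> t" "\<bar>(s + real k * h) - (s + real (Suc k) * h)\<bar> = h" "0 \<le> real k * h"
        using h by (auto simp: algebra_simps)
      then have "dist (\<gamma> (s + real k * h)) (\<gamma> (s + real (Suc k) * h)) = h"
        using \<epsilon>(2) h unfolding arc_geodesic_def by (auto simp: algebra_simps)
      then show ?case
        using Suc dist_triangle[of "\<gamma> (s + 0 * h)" "\<gamma> (s + real (Suc k) * h)" "\<gamma> (s + real k * h)"] by (simp add: algebra_simps)
    qed simp
    from this[of n] h show ?thesis by simp
  qed
  show ?thesis
  proof (cases "s \<le> t")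
    case True then show ?thesis using *[of s t] up[of s t] assms by simp
  next
    case False then show ?thesis using *[of t s] up[of t s] assms by (simp add: dist_commute)
  qed
qed

section \<open>Extension of geodesics\<close>

text \<open>For each \<open>s\<close> a point at distances \<open>s\<close> and \<open>D - s\<close>
  from the ends is chosen. It is unique: the point which the inequality assigns to two distinct
  candidates would be strictly closer to both ends. Uniqueness makes the choices coherent, since a
  point between \<open>x\<close> and \<open>k t\<close> is also between \<open>x\<close> and
  \<open>y\<close>.\<close>

lemma geodesic_ball:
  assumes "cn_ball p (2 * r)" "x \<in> ball p r" "y \<in> ball p r"
  obtains k :: "real \<Rightarrow> 'a" where "k 0 = x" "k (dist x y) = y"
    "\<And>s t. s \<in> {0..dist x y} \<Longrightarrow> t \<in> {0..dist x y} \<Longrightarrow> dist (k s) (k t) = \<bar>s - t\<bar>"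
proof -
  define D where "D = dist x y"
  have D: "0 \<le> D" by (simp add: D_def)
  have uniq: "z = z'" if "dist x z = s" "dist z y = D - s" "dist x z' = s" "dist z' y = D - s" "0 \<le> s" "s \<le> D" for z z' s
  proof -
    note zs = that
    have r: "r > 0" using assms(2) by (metis mem_ball zero_le_dist order.strict_trans1)
    have near: "w \<in> ball p (2 * r)" if "dist x w = s" "dist w y = D - s" for w
    proof -
      have "dist p w \<le> dist p x + s" "dist p w \<le> dist p y + (D - s)" "D \<le> dist p x + dist p y"
        using dist_triangle[of p w x] dist_triangle[of p w y] dist_triangle[of x y p] that
        by (auto simp: dist_commute D_def)
      then show ?thesis using assms(2,3) by simp
    qed
    obtain m where m: "\<And>w. w \<in> ball p (2 * r) \<Longrightarrow>
        (dist w m)\<^sup>2 \<le> (dist w z)\<^sup>2 / 2 + (dist w z')\<^sup>2 / 2 - (dist z z')\<^sup>2 / 4"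
      using assms(1) near[OF zs(1,2)] near[OF zs(3,4)] unfolding cn_ball_def by blast
    have a: "(dist x m)\<^sup>2 \<le> s\<^sup>2 - (dist z z')\<^sup>2 / 4" "(dist y m)\<^sup>2 \<le> (D - s)\<^sup>2 - (dist z z')\<^sup>2 / 4"
      using m[of x] m[of y] assms(2,3) r that by (auto simp: dist_commute)
    show ?thesis
    proof (rule ccontr)
      assume "z \<noteq> z'"
      then have "0 < (dist z z')\<^sup>2 / 4" by simp
      then have "(dist x m)\<^sup>2 < s\<^sup>2" "(dist y m)\<^sup>2 < (D - s)\<^sup>2" using a by linarith+
      then have "dist x m < s" "dist y m < D - s" using that(5,6) by (auto intro: power2_less_imp_less)
      then show False using dist_triangle[of x y m] by (simp add: dist_commute D_def)
    qed
  qed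
  have "\<exists>z. dist x z = s \<and> dist z y = D - s" if "0 \<le> s" "s \<le> D" for s
    using between[of s x y] that unfolding D_def by metis
  then obtain k where k: "\<And>s. 0 \<le> s \<Longrightarrow> s \<le> D \<Longrightarrow> dist x (k s) = s \<and> dist (k s) y = D - s"
    by metis
  have kk: "dist (k s) (k t) = t - s" if st: "0 \<le> s" "s \<le> t" "t \<le> D" for s t
  proof -
    obtain z where z: "dist x z = s" "dist z (k t) = t - s"
      by (rule between[of s x "k t"]) (use k[of t] st in auto)
    have "dist z y \<le> D - s" using dist_triangle[of z y "k t"] z k[of t] st by simp
    moreover have "D - s \<le> dist z y" using dist_triangle[of x y z] z by (simp add: D_def)
    ultimately have "z = k s" using uniq[of z s "k s"] z k[of s] st by auto
    then show ?thesis using z by simp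
  qed
  show thesis
  proof (rule that[of k])
    show "k 0 = x" using k[of 0] D by simp
    show "k (dist x y) = y" using k[of D] D by (simp add: D_def)
    show "dist (k s) (k t) = \<bar>s - t\<bar>" if "s \<in> {0..dist x y}" "t \<in> {0..dist x y}" for s t
      using kk[of s t] kk[of t s] that by (cases "s \<le> t") (auto simp: D_def dist_commute)
  qed
qed

text \<open>Take \<open>x\<close> at a small distance from \<open>u\<close> towards
  \<open>z\<close>, and let \<open>q\<close> be its approximate reflection in \<open>u\<close>. The
  midpoint of \<open>x\<close> and \<open>q\<close> is close to \<open>u\<close>, and by convexity
  of the distance to \<open>z\<close> what is lost in going from \<open>u\<close> to
  \<open>x\<close> is almost regained in going from \<open>u\<close> to \<open>q\<close>.\<close>

lemma slope_up:
  assumes cn: "cn_ball p (2 * r)" and u: "u \<in> ball p r" and z: "z \<in> ball p r" "z \<noteq> (u :: 'a)"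
    and \<eta>: "0 < \<eta>" "\<eta> < 1" and d: "0 < d"
  obtains q h where "0 < h" "h < d" "dist u q \<le> h" "dist z u + (1 - \<eta>) * h \<le> dist z q"
proof -
  \<comment> \<open>The inequality bounds squares of distances, so a reflection with relative error
    \<open>\<kappa>\<^sup>2\<close> leaves the midpoint within \<open>2 * \<kappa> * e\<close> of
    \<open>u\<close>. This costs \<open>4 * \<kappa>\<close> in the slope; the fifth \<kappa> pays
    for the length \<open>h = (1 + \<kappa>\<^sup>2) * e\<close> of the step.\<close>
  define \<kappa> where "\<kappa> = \<eta> / 5"
  have \<kappa>: "0 < \<kappa>" "\<kappa> < 1" using \<eta> by (auto simp: \<kappa>_def)
  obtain r' where r': "0 < r'" "\<And>x. x \<in> ball u r' \<Longrightarrow> \<exists>q. dist u q \<le> (1 + \<kappa>\<^sup>2) * dist u x \<and> 2 * (1 - \<kappa>\<^sup>2) * dist u x \<le> dist x q"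
    using reflect[of "\<kappa>\<^sup>2" u] \<kappa> by auto
  define R where "R = r - dist p u"
  have R: "0 < R" using u by (simp add: R_def)
  define e where "e = min (min (r' / 2) (dist u z)) (min (R / 4) (d / 4))"
  have e: "0 < e" "e < r'" "e \<le> dist u z" "2 * e < R" "2 * e < d" using r' z(2) R d by (auto simp: e_def)
  obtain x where x: "dist u x = e" "dist x z = dist u z - e" by (rule between[of e u z]) (use e in auto)
  obtain q where q: "dist u q \<le> (1 + \<kappa>\<^sup>2) * e" "2 * (1 - \<kappa>\<^sup>2) * e \<le> dist x q"
    using r'(2)[of x] x e by auto
  have k2: "\<kappa>\<^sup>2 \<le> \<kappa>" "0 < \<kappa>\<^sup>2" using \<kappa> by (auto simp: power2_eq_square mult_left_le)
  have h: "(1 + \<kappa>\<^sup>2) * e \<le> 2 * e" using k2 \<kappa> e by (intro mult_right_mono) auto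
  have inb: "x \<in> ball p r" "q \<in> ball p r"
    using dist_triangle[of p x u] dist_triangle[of p q u] x(1) order_trans[OF q(1) h] e by (auto simp: R_def)
  define m where "m = mid x q"
  have "u \<in> ball p (2 * r)" using u zero_le_dist[of p u] by (simp del: zero_le_dist)
  then have "(dist u m)\<^sup>2 \<le> (dist u x)\<^sup>2 / 2 + (dist u q)\<^sup>2 / 2 - (dist x q)\<^sup>2 / 4"
    unfolding m_def by (rule mid_cn[OF cn inb])
  also have "\<dots> \<le> e\<^sup>2 / 2 + ((1 + \<kappa>\<^sup>2) * e)\<^sup>2 / 2 - (2 * (1 - \<kappa>\<^sup>2) * e)\<^sup>2 / 4"
  proof -
    have "(dist u q)\<^sup>2 \<le> ((1 + \<kappa>\<^sup>2) * e)\<^sup>2" using q by (intro power_mono) auto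
    moreover have "0 \<le> 2 * (1 - \<kappa>\<^sup>2) * e" using k2 \<kappa> e by simp
    then have "(2 * (1 - \<kappa>\<^sup>2) * e)\<^sup>2 \<le> (dist x q)\<^sup>2" using q by (intro power_mono) auto
    ultimately show ?thesis unfolding x(1) by linarith
  qed
  also have "\<dots> = 3 * \<kappa>\<^sup>2 * e\<^sup>2 - (\<kappa>\<^sup>2 * e)\<^sup>2 / 2" by (simp add: power2_eq_square field_simps)
  also have "\<dots> \<le> (2 * \<kappa> * e)\<^sup>2"
  proof -
    have "3 * \<kappa>\<^sup>2 * e\<^sup>2 = 3 * (\<kappa> * e)\<^sup>2" "(2 * \<kappa> * e)\<^sup>2 = 4 * (\<kappa> * e)\<^sup>2" by (simp_all add: power_mult_distrib)
    then show ?thesis using zero_le_power2[of "\<kappa>\<^sup>2 * e"] zero_le_power2[of "\<kappa> * e"] by linarith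
  qed
  finally have um: "dist u m \<le> 2 * \<kappa> * e" by (rule power2_le_imp_le) (use \<kappa> e in simp)
  have "dist (mid x q) (mid z z) \<le> (dist x z + dist q z) / 2"
    by (rule mid_convex[OF cn inb z(1) z(1)])
  moreover have "mid z z = z" by (rule mid_uniq[OF cn z(1) z(1)]) (simp add: is_mid_def)
  ultimately have "dist m z \<le> (dist x z + dist q z) / 2" by (simp add: m_def)
  then have "dist z u + e - 4 * \<kappa> * e \<le> dist z q"
    using um x dist_triangle[of u z m] by (simp add: dist_commute field_simps)
  moreover have "(1 - \<eta>) * ((1 + \<kappa>\<^sup>2) * e) \<le> e - 4 * \<kappa> * e"
  proof -
    have "(1 - \<eta>) * (1 + \<kappa>\<^sup>2) \<le> 1 - 4 * \<kappa>"
    proof -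
      have "\<eta> = 5 * \<kappa>" "0 \<le> \<eta> * \<kappa>\<^sup>2" using \<eta> by (auto simp: \<kappa>_def)
      moreover have "(1 - \<eta>) * (1 + \<kappa>\<^sup>2) = 1 + \<kappa>\<^sup>2 - \<eta> - \<eta> * \<kappa>\<^sup>2" by (simp add: algebra_simps)
      ultimately show ?thesis using k2 by linarith
    qed
    then show ?thesis using mult_right_mono[of _ _ e] e by (fastforce simp: algebra_simps)
  qed
  ultimately show thesis
    using that[of "(1 + \<kappa>\<^sup>2) * e" q] q h e k2 by (auto intro: mult_pos_pos add_pos_pos)
qed

text \<open>For fixed \<eta>, a point of \<open>A\<close> farthest from \<open>z\<close> must lie on
  the sphere of radius \<open>S\<close>, since \<open>slope_up\<close> would otherwise move it on
  inside \<open>A\<close>. A point of \<open>cball p S\<close> farthest from \<open>z\<close> then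
  satisfies the bound for every \<eta>.\<close>

lemma prolong:
  assumes cn: "cn_ball p (2 * r)" and z: "z \<in> ball p r" "z \<noteq> (p :: 'a)" and S: "0 \<le> S" "S < r"
  obtains q where "dist p q = S" "dist z q = dist z p + S"
proof -
  have *: "\<exists>q\<in>cball p S. dist z p + (1 - \<eta>) * S \<le> dist z q" if \<eta>: "0 < \<eta>" "\<eta> < 1" for \<eta>
  proof -
    define A where "A = cball p S \<inter> {q. dist z p + (1 - \<eta>) * dist p q \<le> dist z q}"
    have "compact A" unfolding A_def
      by (intro compact_Int_closed proper closed_Collect_le continuous_intros)
    moreover have "p \<in> A" using S by (simp add: A_def)
    ultimately obtain u where u: "u \<in> A" "\<And>y. y \<in> A \<Longrightarrow> dist z y \<le> dist z u"
      using continuous_attains_sup[of A "\<lambda>q. dist z q"] by (force intro: continuous_intros)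
    have "dist p u = S"
    proof (rule ccontr)
      assume "dist p u \<noteq> S"
      then have less: "0 < S - dist p u" using u(1) by (auto simp: A_def)
      have "u \<in> ball p r" using u(1) S by (auto simp: A_def)
      moreover have "z \<noteq> u" 
      proof
        assume "z = u"
        then have "dist z p + (1 - \<eta>) * dist p u \<le> 0" using u(1) by (auto simp: A_def)
        moreover have "0 \<le> (1 - \<eta>) * dist p u" "0 < dist z p" using \<eta> z by auto
        ultimately show False by linarith
      qed
      ultimately obtain q h where q: "0 < h" "h < S - dist p u" "dist u q \<le> h" "dist z u + (1 - \<eta>) * h \<le> dist z q"
        using slope_up[OF cn _ z(1) _ \<eta> less] by metis
      have "(1 - \<eta>) * dist p q \<le> (1 - \<eta>) * (dist p u + h)"
        using q dist_triangle[of p q u] \<eta> by (intro mult_left_mono) auto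
      moreover have "dist z p + (1 - \<eta>) * dist p u \<le> dist z u" using u(1) by (simp add: A_def)
      ultimately have "dist z p + (1 - \<eta>) * dist p q \<le> dist z q" using q(4) by (simp add: algebra_simps)
      moreover have "dist p q \<le> S" using q dist_triangle[of p q u] by simp
      ultimately have "q \<in> A" by (simp add: A_def)
      moreover have "0 < (1 - \<eta>) * h" using \<eta> q by simp
      ultimately show False using u(2)[of q] q by linarith
    qed
    then show ?thesis using u(1) by (auto simp: A_def)
  qed
  obtain q where q: "q \<in> cball p S" "\<And>y. y \<in> cball p S \<Longrightarrow> dist z y \<le> dist z q"
    using continuous_attains_sup[OF proper, of p S "\<lambda>q. dist z q"] S by (force intro: continuous_intros)
  have "dist z p + S \<le> dist z q + e" if "0 < e" for e
  proof -
    define \<eta> where "\<eta> = min (1/2) (e / (S + 1))"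
    have \<eta>: "0 < \<eta>" "\<eta> < 1" "\<eta> * S \<le> e"
    proof -
      show "0 < \<eta>" "\<eta> < 1" using that S by (auto simp: \<eta>_def)
      have "\<eta> * S \<le> e / (S + 1) * (S + 1)" using S that by (intro mult_mono) (auto simp: \<eta>_def)
      then show "\<eta> * S \<le> e" using S by simp
    qed
    then show ?thesis using *[OF \<eta>(1,2)] q(2) by (fastforce simp: algebra_simps)
  qed
  then have "dist z p + S \<le> dist z q" by (rule field_le_epsilon)
  then show thesis using that[of q] q(1) dist_triangle[of z q p] by (simp add: dist_commute)
qed

text \<open>A point \<open>q\<close> prolonging the segment from \<open>\<gamma> e\<close> to
  \<open>\<gamma> 0\<close> is joined to \<open>\<gamma> 0\<close> by a geodesic. Since the two
  lengths add up to the distance from \<open>q\<close> to \<open>\<gamma> e\<close>, the triangle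
  inequalities across the junction are equalities.\<close>

lemma extend_step:
  assumes \<gamma>: "half_geodesic dist (\<gamma> :: real \<Rightarrow> 'a)" and cn: "cn_ball (\<gamma> 0) (2 * r)" and S: "0 < S" "S < r"
  obtains \<gamma>' where "half_geodesic dist \<gamma>'" "\<And>t. 0 \<le> t \<Longrightarrow> \<gamma>' (S + t) = \<gamma> t"
proof -
  define e where "e = r / 2"
  have e: "0 < e" "e < r" using S by (auto simp: e_def)
  have d: "dist (\<gamma> 0) (\<gamma> e) = e" using half_geodesic_minimizing[OF \<gamma>, of 0 e] e by simp
  obtain q where q: "dist (\<gamma> 0) q = S" "dist (\<gamma> e) q = e + S"
    by (rule prolong[OF cn, of "\<gamma> e" S]) (use d e S in \<open>auto simp: dist_commute\<close>)
  obtain k where k: "k 0 = q" "k (dist q (\<gamma> 0)) = \<gamma> 0"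
    "\<And>s t. s \<in> {0..dist q (\<gamma> 0)} \<Longrightarrow> t \<in> {0..dist q (\<gamma> 0)} \<Longrightarrow> dist (k s) (k t) = \<bar>s - t\<bar>"
    by (rule geodesic_ball[OF cn, of q "\<gamma> 0"]) (use q S in auto)
  have D: "dist q (\<gamma> 0) = S" using q by (simp add: dist_commute)
  define c where "c t = (if t < S then k t else \<gamma> (t - S))" for t
  have low: "dist (c s) (c t) = \<bar>s - t\<bar>" if "s \<in> {0..S}" "t \<in> {0..S}" for s t
  proof -
    have "c t = k t" if "t \<in> {0..S}" for t using that k(2) D by (auto simp: c_def)
    then show ?thesis using k(3) that D by simp
  qed
  have high: "dist (c s) (c t) = \<bar>s - t\<bar>" if "S \<le> s" "S \<le> t" for s t
    using half_geodesic_minimizing[OF \<gamma>, of "s - S" "t - S"] that by (simp add: c_def)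
  have mix: "dist (c s) (c t) = t - s" if "0 \<le> s" "s \<le> S" "S \<le> t" "t \<le> S + e" for s t
  proof -
    have c: "c 0 = q" "c (S + e) = \<gamma> e" using k(1) S e by (auto simp: c_def)
    have "dist (c 0) (c s) = s" "dist (c s) (c S) = S - s" using low[of 0 s] low[of s S] that S by auto
    moreover have "dist (c S) (c t) = t - S" "dist (c t) (c (S + e)) = S + e - t"
      using high[of S t] high[of t "S + e"] that e by auto
    moreover have "dist (c 0) (c (S + e)) = S + e" unfolding c using q by (simp add: dist_commute)
    ultimately show ?thesis
      using dist_triangle[of "c s" "c t" "c S"] dist_triangle[of "c 0" "c (S + e)" "c s"] dist_triangle[of "c s" "c (S + e)" "c t"]
      by linarith
  qed
  have all: "dist (c s) (c t) = \<bar>s - t\<bar>" if "0 \<le> s" "s < S + e" "0 \<le> t" "t < S + e" for s t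
    using low[of s t] high[of s t] mix[of s t] mix[of t s] that
    by (cases "s \<le> S"; cases "t \<le> S") (auto simp: dist_commute)
  have "half_geodesic dist c"
    unfolding half_geodesic_def
  proof (intro allI impI)
    fix t :: real assume t: "0 \<le> t"
    show "\<exists>\<epsilon>>0. \<forall>r\<ge>0. \<forall>s\<ge>0. \<bar>r - t\<bar> < \<epsilon> \<and> \<bar>s - t\<bar> < \<epsilon> \<longrightarrow> dist (c r) (c s) = \<bar>r - s\<bar>"
    proof (cases "t < S + e")
      case True
      then show ?thesis by (intro exI[of _ "S + e - t"]) (auto intro!: all)
    next
      case False
      then show ?thesis using e by (intro exI[of _ e]) (auto intro!: high)
    qed
  qed
  then show thesis by (rule that) (use S in \<open>auto simp: c_def\<close>)
qed

text \<open>All steps can have the same length: the extended half-geodesics minimize, so their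
  origins stay in \<open>cball (\<gamma> 0) S\<close>, where the inequality holds at one
  scale.\<close>

theorem backward_extension:
  assumes \<gamma>: "half_geodesic dist (\<gamma> :: real \<Rightarrow> 'a)" and S: "0 \<le> S"
  obtains q where "\<And>t. 0 \<le> t \<Longrightarrow> dist q (\<gamma> t) = S + t"
proof -
  obtain \<rho> where \<rho>: "0 < \<rho>" "\<And>p. p \<in> cball (\<gamma> 0) S \<Longrightarrow> cn_ball p (2 * \<rho>)"
    by (rule unif_cn[OF proper]) (rule that)
  obtain n where n: "S / \<rho> < real n" using reals_Archimedean2 by blast
  have n0: "0 < n" using n S \<rho> by (cases n) (auto simp: divide_less_eq)
  define h where "h = S / n"
  have h: "0 \<le> h" "h < \<rho>" "n * h = S" using n n0 \<rho> S by (auto simp: h_def field_simps)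
  have "\<exists>c. half_geodesic dist c \<and> (\<forall>t\<ge>0. c (k * h + t) = \<gamma> t)" if "k \<le> n" for k :: nat
    using that
  proof (induction k)
    case 0 then show ?case using \<gamma> by auto
  next
    case (Suc k)
    then obtain c where c: "half_geodesic dist c" "\<And>t. 0 \<le> t \<Longrightarrow> c (k * h + t) = \<gamma> t" by auto
    show ?case
    proof (cases "h = 0")
      case True then show ?thesis using \<gamma> by auto
    next
      case False
      have kh: "0 \<le> k * h" "k * h \<le> S" using h Suc.prems mult_right_mono[of "real k" "real n" h] by auto
      then have "dist (c 0) (\<gamma> 0) \<le> S" using half_geodesic_minimizing[OF c(1), of 0 "k * h"] c(2)[of 0] by simp
      then have "cn_ball (c 0) (2 * \<rho>)" using \<rho>(2) by (simp add: dist_commute)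
      then obtain c' where c': "half_geodesic dist c'" "\<And>t. 0 \<le> t \<Longrightarrow> c' (h + t) = c t"
        by (rule extend_step[OF c(1)]) (use h False in auto)
      have "c' (real (Suc k) * h + t) = \<gamma> t" if "0 \<le> t" for t
        using c'(2)[of "k * h + t"] c(2)[OF that] kh that by (simp add: algebra_simps)
      then show ?thesis using c'(1) by blast
    qed
  qed
  from this[of n] h obtain c where c: "half_geodesic dist c" "\<And>t. 0 \<le> t \<Longrightarrow> c (S + t) = \<gamma> t" by auto
  show thesis
    by (rule that[of "c 0"]) (use half_geodesic_minimizing[OF c(1), of 0] c(2) S in \<open>simp add: c(2)[symmetric]\<close>)
qed

end

section \<open>Busemann functions on a quotient\<close>

lemma antimono_tendsto_Inf:
  fixes f :: "real \<Rightarrow> real"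
  assumes anti: "\<And>s t. 0 \<le> s \<Longrightarrow> s \<le> t \<Longrightarrow> f t \<le> f s" and lower: "\<And>t. 0 \<le> t \<Longrightarrow> m \<le> f t"
  shows "(f \<longlongrightarrow> (INF t\<in>{0..}. f t)) at_top" and "0 \<le> t \<Longrightarrow> (INF t\<in>{0..}. f t) \<le> f t"
    and "\<And>c. (\<And>t. 0 \<le> t \<Longrightarrow> c \<le> f t) \<Longrightarrow> c \<le> (INF t\<in>{0..}. f t)"
    and "(INF t\<in>{0..}. f t) < c \<Longrightarrow> \<exists>t\<ge>0. f t < c"
proof -
  let ?I = "INF t\<in>{0..}. f t"
  have bdd: "bdd_below (f ` {0..})" using lower by (auto intro: bdd_belowI[of _ m])
  show le: "?I \<le> f t" if "0 \<le> t" for t using that by (intro cINF_lower[OF bdd]) auto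
  show ge: "c \<le> ?I" if "\<And>t. 0 \<le> t \<Longrightarrow> c \<le> f t" for c using that by (intro cINF_greatest) auto
  have ex: "\<exists>t\<ge>0. f t < c" if "?I < c" for c using ge[of c] that by (meson not_le)
  then show "?I < c \<Longrightarrow> \<exists>t\<ge>0. f t < c" .
  show "(f \<longlongrightarrow> ?I) at_top"
  proof (rule order_tendstoI)
    fix a assume "a < ?I"
    then show "\<forall>\<^sub>F t in at_top. a < f t"
      using le by (intro eventually_at_top_linorderI[of 0]) (auto intro: less_le_trans)
  next
    fix a assume "?I < a"
    then obtain s where s: "0 \<le> s" "f s < a" using ex by blast
    then show "\<forall>\<^sub>F t in at_top. f t < a"
      using anti by (intro eventually_at_top_linorderI[of s]) (auto intro: le_less_trans)
  qed
qed

locale nonpos_quotient = nonpos_space X for X :: "'a::metric_space itself" +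
  fixes G :: "('a \<Rightarrow> 'a) set" and \<alpha> :: "real \<Rightarrow> 'a set" and \<gamma> :: "real \<Rightarrow> 'a"
  assumes regular: "regular_group G" and quasi: "quasi_ray setdist \<alpha>" and lift: "is_lift G \<alpha> \<gamma>"
begin

section \<open>The action of the group and the lift of the quasi-ray\<close>

lemma G: "id \<in> G" "g \<in> G \<Longrightarrow> h \<in> G \<Longrightarrow> g \<circ> h \<in> G" "g \<in> G \<Longrightarrow> inv g \<in> G" "g \<in> G \<Longrightarrow> bij g"
  "g \<in> G \<Longrightarrow> dist (g x) (g y) = dist x y" "g \<in> G \<Longrightarrow> 0 < n \<Longrightarrow> g ^^ n = id \<Longrightarrow> g = id" "discrete G"
  using regular unfolding regular_group_def isometry_group_def torsion_free_def by auto

lemma G_inv: "g \<in> G \<Longrightarrow> dist (g x) y = dist x (inv g y)"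
  by (metis G(3,4,5) bij_inv_eq_iff)

lemma G_pow: "g \<in> G \<Longrightarrow> g ^^ n \<in> G"
  using G(1,2) by (induction n) auto

text \<open>Discreteness unfolded: a basic neighbourhood of the identity for pointwise convergence
  restricts only finitely many values.\<close>

lemma near_id:
  obtains F e where "finite F" "0 < e" "\<And>g. g \<in> G \<Longrightarrow> (\<And>x. x \<in> F \<Longrightarrow> dist (g x) x < e) \<Longrightarrow> g = id"
proof -
  obtain U where U: "open U" "U \<inter> G = {id}"
    using G(7) discreteD[OF G(7) G(1)] unfolding isolated_in_def by auto
  have "id \<in> U" using U(2) by auto
  moreover have "openin (product_topology (\<lambda>_. euclidean) UNIV) U" using U(1) unfolding open_fun_def .
  ultimately obtain V where V: "id \<in> (\<Pi>\<^sub>E i\<in>UNIV. V i)" "\<And>i. open (V i)" "finite {i. V i \<noteq> UNIV}" "(\<Pi>\<^sub>E i\<in>UNIV. V i) \<subseteq> U"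
    using product_topology_open_contains_basis[of "\<lambda>_. euclidean" UNIV U id] by auto
  define F where "F = {i. V i \<noteq> UNIV}"
  have "\<exists>e>0. ball x e \<subseteq> V x" for x using V(1,2) open_contains_ball[of "V x"] by (auto simp: PiE_iff)
  then obtain e where e: "\<And>x. 0 < e x \<and> ball x (e x) \<subseteq> V x" by metis
  define m where "m = Min (insert 1 (e ` F))"
  have fin: "finite F" using V(3) by (simp add: F_def)
  have m: "0 < m" "\<And>x. x \<in> F \<Longrightarrow> m \<le> e x" using fin e by (auto simp: m_def)
  show thesis
  proof (rule that[OF fin m(1)])
    fix g assume g: "g \<in> G" "\<And>x. x \<in> F \<Longrightarrow> dist (g x) x < m"
    have "g x \<in> V x" for x
    proof (cases "x \<in> F")
      case True
      then have "g x \<in> ball x (e x)" using g(2)[OF True] m(2)[OF True] by (simp add: dist_commute)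
      then show ?thesis using e by blast
    next
      case False then show ?thesis by (simp add: F_def)
    qed
    then have "g \<in> U" using V(4) by auto
    then show "g = id" using U(2) g(1) by blast
  qed
qed

text \<open>Proper discontinuity. An element moving \<open>x\<close> by at most \<open>R\<close> is
  coded by points of finite nets near its values on \<open>F\<close>. Two elements with the same
  code differ by an element moving every point of \<open>F\<close> by less than \<open>e\<close>,
  that is, by the identity; and there are finitely many codes.\<close>

lemma finite_moves: "finite {g \<in> G. dist x (g x) \<le> R}"
proof -
  obtain F e where F: "finite F" "0 < e" "\<And>g. g \<in> G \<Longrightarrow> (\<And>x. x \<in> F \<Longrightarrow> dist (g x) x < e) \<Longrightarrow> g = id"
    by (rule near_id) blast
  let ?S = "{g \<in> G. dist x (g x) \<le> R}"
  have "\<exists>k. finite k \<and> cball x (R + dist x y) \<subseteq> (\<Union>z\<in>k. ball z (e / 2))" for y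
    using proper[of x "R + dist x y"] F(2) unfolding compact_eq_totally_bounded by (meson half_gt_zero)
  then obtain k where k: "\<And>y. finite (k y)" "\<And>y. cball x (R + dist x y) \<subseteq> (\<Union>z\<in>k y. ball z (e / 2))" by metis
  have "\<exists>z\<in>k y. dist z (g y) < e / 2" if "g \<in> ?S" for g y
  proof -
    have "dist x (g y) \<le> R + dist x y" using that G(5)[of g x y] dist_triangle[of x "g y" "g x"] by auto
    then show ?thesis using k(2)[of y] by fastforce
  qed
  note ex = this
  define c where "c g y = (SOME z. z \<in> k y \<and> dist z (g y) < e / 2)" for g y
  have c: "c g y \<in> k y \<and> dist (c g y) (g y) < e / 2" if "g \<in> ?S" for g y
    unfolding c_def by (rule someI_ex) (use ex[OF that] in blast)
  let ?c = "\<lambda>g. restrict (c g) F"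
  have "inj_on ?c ?S"
  proof (rule inj_onI)
    fix g h assume gh: "g \<in> ?S" "h \<in> ?S" "?c g = ?c h"
    have "dist ((inv h \<circ> g) y) y < e" if "y \<in> F" for y
    proof -
      have "c g y = c h y" using gh(3) that by (metis restrict_apply')
      then have "dist (g y) (h y) < e"
        using c[OF gh(1), of y] c[OF gh(2), of y] dist_triangle3[of "g y" "h y" "c g y"]
        by simp
      then show ?thesis using G(4)[of h] gh(2) G_inv[of h "y" "g y"] by (simp add: dist_commute)
    qed
    then have "inv h \<circ> g = id" using F(3)[of "inv h \<circ> g"] gh G(2,3) by blast
    then show "g = h" using G(4)[of h] gh(2) by (metis (no_types, lifting) bij_is_surj comp_assoc comp_id id_comp mem_Collect_eq surj_iff)
  qed
  moreover have "?c ` ?S \<subseteq> (\<Pi>\<^sub>E y\<in>F. k y)" using c by auto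
  moreover have "finite (\<Pi>\<^sub>E y\<in>F. k y)" using F(1) k(1) by (intro finite_PiE) auto
  ultimately show ?thesis by (rule inj_on_finite)
qed

text \<open>The powers of \<open>g\<close> fix \<open>x\<close>, so they are finite in number and
  two of them agree. A positive power of \<open>g\<close> is thus the identity, and the group has no
  torsion.\<close>

lemma free_action:
  assumes g: "g \<in> G" "g x = x"
  shows "g = id"
proof -
  have fix_pow: "(g ^^ n) x = x" for n using g(2) by (induction n) auto
  have "range (\<lambda>n. g ^^ n) \<subseteq> {h \<in> G. dist x (h x) \<le> 0}" using G_pow[OF g(1)] fix_pow by auto
  then have "finite (range (\<lambda>n. g ^^ n))" using finite_moves finite_subset by blast
  then have "\<not> inj (\<lambda>n. g ^^ n)" using finite_imageD[of "\<lambda>n. g ^^ n" UNIV] by auto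
  then obtain m n where mn: "g ^^ m = g ^^ n" "m < n" by (metis injI linorder_neqE_nat)
  have "g ^^ (n - m) = id"
  proof
    fix y
    have "bij (g ^^ m)" using G_pow[OF g(1)] G(4) by blast
    then obtain z where z: "y = (g ^^ m) z" by (metis bij_pointE)
    have "(g ^^ (n - m)) ((g ^^ m) z) = (g ^^ (n - m + m)) z" by (simp add: funpow_add)
    then show "(g ^^ (n - m)) y = id y" using mn z by simp
  qed
  then show ?thesis using G(6)[OF g(1), of "n - m"] mn by simp
qed

lemma separated:
  obtains r where "0 < r" "\<And>g. g \<in> G \<Longrightarrow> g \<noteq> id \<Longrightarrow> r \<le> dist x (g x)"
proof -
  let ?S = "{g \<in> G. dist x (g x) \<le> 1} - {id}"
  define r where "r = Min (insert 1 ((\<lambda>g. dist x (g x)) ` ?S))"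
  have fin: "finite ?S" using finite_moves by auto
  have pos: "0 < dist x (g x)" if "g \<in> ?S" for g using that free_action[of g x] by force
  show thesis
  proof (rule that[of r])
    show "0 < r" using fin pos by (auto simp: r_def)
    show "r \<le> dist x (g x)" if "g \<in> G" "g \<noteq> id" for g
    proof (cases "dist x (g x) \<le> 1")
      case True then show ?thesis using that fin unfolding r_def by (intro Min_le) auto
    next
      case False
      have "r \<le> 1" using fin by (auto simp: r_def)
      then show ?thesis using False by simp
    qed
  qed
qed

lemma orbit_dist_le: "g \<in> G \<Longrightarrow> h \<in> G \<Longrightarrow> setdist (orbit G x) (orbit G y) \<le> dist (g x) (h y)"
  by (intro setdist_le_dist) (auto simp: orbit_def)

lemma orbit_dist_le1: "g \<in> G \<Longrightarrow> setdist (orbit G x) (orbit G y) \<le> dist (g x) y"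
  using orbit_dist_le[of g id x y] G(1) by simp

text \<open>Applying \<open>inv h\<close> to both points replaces one of the two group elements by
  the identity, so the infimum over pairs is one over \<open>G\<close>.\<close>

lemma orbit_dist_ge:
  assumes "\<And>g. g \<in> G \<Longrightarrow> r \<le> dist (g x) y"
  shows "r \<le> setdist (orbit G x) (orbit G y)"
proof (rule le_setdistI)
  show "orbit G x \<noteq> {}" "orbit G y \<noteq> {}" using G(1) by (auto simp: orbit_def)
  fix p q assume "p \<in> orbit G x" "q \<in> orbit G y"
  then obtain g h where gh: "g \<in> G" "h \<in> G" "p = g x" "q = h y" by (auto simp: orbit_def)
  have "dist p q = dist ((inv h \<circ> g) x) y" using G_inv[of h y "g x"] gh by (simp add: dist_commute)
  then show "r \<le> dist p q" using assms[of "inv h \<circ> g"] gh G(2,3) by auto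
qed

lemma orbit_dist_less:
  assumes "setdist (orbit G x) (orbit G y) < r"
  obtains g where "g \<in> G" "dist (g x) y < r"
  using orbit_dist_ge[of r x y] assms by (meson not_le)

lemma \<alpha>: "0 \<le> t \<Longrightarrow> \<alpha> t = orbit G (\<gamma> t)"
  using lift unfolding is_lift_def by auto

text \<open>Near the parameter \<open>t\<close> the lift stays within \<open>R / 8\<close> of
  \<open>\<gamma> t\<close>, whereas every element other than the identity moves
  \<open>\<gamma> t\<close> by at least \<open>R\<close>. The quotient distance between nearby
  points is therefore realized by the identity.\<close>

lemma half_geodesic_lift: "half_geodesic dist \<gamma>"
  unfolding half_geodesic_def
proof (intro allI impI)
  fix t :: real assume t: "0 \<le> t"
  obtain e where e: "0 < e" "\<And>r s. 0 \<le> r \<Longrightarrow> 0 \<le> s \<Longrightarrow> \<bar>r - t\<bar> < e \<Longrightarrow> \<bar>s - t\<bar> < e \<Longrightarrow> setdist (\<alpha> r) (\<alpha> s) = \<bar>r - s\<bar>"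
    using quasi t unfolding quasi_ray_def half_geodesic_def by metis
  obtain R where R: "0 < R" "\<And>g. g \<in> G \<Longrightarrow> g \<noteq> id \<Longrightarrow> R \<le> dist (\<gamma> t) (g (\<gamma> t))" by (rule separated) (rule that)
  have "continuous_on {0..} \<gamma>" using lift by (simp add: is_lift_def)
  then obtain d where d: "0 < d" "\<And>s. 0 \<le> s \<Longrightarrow> \<bar>s - t\<bar> < d \<Longrightarrow> dist (\<gamma> s) (\<gamma> t) < R / 8"
    using t R(1) unfolding continuous_on_iff by (metis atLeast_iff dist_real_def zero_less_divide_iff zero_less_numeral)
  show "\<exists>\<epsilon>>0. \<forall>r\<ge>0. \<forall>s\<ge>0. \<bar>r - t\<bar> < \<epsilon> \<and> \<bar>s - t\<bar> < \<epsilon> \<longrightarrow> dist (\<gamma> r) (\<gamma> s) = \<bar>r - s\<bar>"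
  proof (intro exI[of _ "min e d"] conjI allI impI)
    fix r s :: real assume rs: "0 \<le> r" "0 \<le> s" "\<bar>r - t\<bar> < min e d \<and> \<bar>s - t\<bar> < min e d"
    have near: "dist (\<gamma> r) (\<gamma> t) < R / 8" "dist (\<gamma> s) (\<gamma> t) < R / 8" using d(2) rs by auto
    have "dist (\<gamma> r) (\<gamma> s) \<le> dist (g (\<gamma> r)) (\<gamma> s)" if g: "g \<in> G" for g
    proof (cases "g = id")
      case False
      have "R \<le> dist (\<gamma> t) (g (\<gamma> t))" using R(2)[OF g False] .
      also have "\<dots> \<le> dist (\<gamma> t) (\<gamma> s) + dist (\<gamma> s) (g (\<gamma> r)) + dist (g (\<gamma> r)) (g (\<gamma> t))"
        using dist_triangle[of "\<gamma> t" "g (\<gamma> t)" "\<gamma> s"] dist_triangle[of "\<gamma> s" "g (\<gamma> t)" "g (\<gamma> r)"] by linarith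
      finally have "R \<le> dist (\<gamma> s) (\<gamma> t) + dist (g (\<gamma> r)) (\<gamma> s) + dist (\<gamma> r) (\<gamma> t)"
        using G(5)[OF g] by (simp add: dist_commute)
      then show ?thesis using near R(1) dist_triangle2[of "\<gamma> r" "\<gamma> s" "\<gamma> t"] by linarith
    qed simp
    then have "dist (\<gamma> r) (\<gamma> s) \<le> setdist (orbit G (\<gamma> r)) (orbit G (\<gamma> s))" by (rule orbit_dist_ge)
    moreover have "setdist (orbit G (\<gamma> r)) (orbit G (\<gamma> s)) \<le> dist (\<gamma> r) (\<gamma> s)" using orbit_dist_le1[OF G(1)] by simp
    ultimately show "dist (\<gamma> r) (\<gamma> s) = \<bar>r - s\<bar>" using e(2)[of r s] rs \<alpha> by auto
  qed (use e d in auto)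
qed

lemma ray: "0 \<le> s \<Longrightarrow> 0 \<le> t \<Longrightarrow> dist (\<gamma> s) (\<gamma> t) = \<bar>s - t\<bar>"
  using half_geodesic_minimizing[OF half_geodesic_lift] by simp

section \<open>The Busemann function of the lift\<close>

text \<open>The horofunction that vanishes at \<open>\<gamma> 0\<close>, with the sign for which it
  decreases along \<gamma>. By \<open>b_anti\<close> the infimum is a limit.\<close>

definition b :: "'a \<Rightarrow> real" where "b x = (INF t\<in>{0..}. dist x (\<gamma> t) - t)"

lemma b_anti: "0 \<le> s \<Longrightarrow> s \<le> t \<Longrightarrow> dist x (\<gamma> t) - t \<le> dist x (\<gamma> s) - s"
  using ray[of s t] dist_triangle[of x "\<gamma> t" "\<gamma> s"] by simp

lemma b_lower: "0 \<le> t \<Longrightarrow> - dist x (\<gamma> 0) \<le> dist x (\<gamma> t) - t"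
  using ray[of 0 t] dist_triangle[of "\<gamma> 0" "\<gamma> t" x] by (simp add: dist_commute)

lemma b_limit:
  "((\<lambda>t. dist x (\<gamma> t) - t) \<longlongrightarrow> b x) at_top"
  "0 \<le> t \<Longrightarrow> b x \<le> dist x (\<gamma> t) - t"
  "(\<And>t. 0 \<le> t \<Longrightarrow> c \<le> dist x (\<gamma> t) - t) \<Longrightarrow> c \<le> b x"
proof -
  note * = antimono_tendsto_Inf[where f = "\<lambda>t. dist x (\<gamma> t) - t", OF b_anti b_lower, folded b_def]
  show "((\<lambda>t. dist x (\<gamma> t) - t) \<longlongrightarrow> b x) at_top" "0 \<le> t \<Longrightarrow> b x \<le> dist x (\<gamma> t) - t"
    "(\<And>t. 0 \<le> t \<Longrightarrow> c \<le> dist x (\<gamma> t) - t) \<Longrightarrow> c \<le> b x"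
    using *(1) *(2) *(3) by blast+
qed

lemma busemann_b: "busemann dist \<gamma> x y = b x - b y"
  unfolding busemann_def
proof (rule tendsto_Lim)
  have "((\<lambda>t. (dist x (\<gamma> t) - t) - (dist y (\<gamma> t) - t)) \<longlongrightarrow> b x - b y) at_top"
    by (intro tendsto_diff b_limit(1))
  then show "((\<lambda>t. dist x (\<gamma> t) - dist (\<gamma> t) y) \<longlongrightarrow> b x - b y) at_top" by (simp add: dist_commute)
qed simp

lemma b_lipschitz: "b x \<le> b y + dist x y"
proof -
  have "b x - dist x y \<le> dist y (\<gamma> t) - t" if "0 \<le> t" for t
    using b_limit(2)[OF that, of x] dist_triangle[of x "\<gamma> t" y] by linarith
  then have "b x - dist x y \<le> b y" by (rule b_limit(3))
  then show ?thesis by simp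
qed

lemma b_ray: "0 \<le> s \<Longrightarrow> b (\<gamma> s) = - s"
proof (rule antisym)
  assume s: "0 \<le> s"
  show "b (\<gamma> s) \<le> - s" using b_limit(2)[OF s, of "\<gamma> s"] by simp
  show "- s \<le> b (\<gamma> s)" by (rule b_limit(3)) (use ray s in \<open>auto simp: abs_if\<close>)
qed

lemma b_up:
  assumes "0 \<le> c"
  obtains q where "b q = c" "dist (\<gamma> 0) q = c"
proof -
  obtain q where q: "\<And>t. 0 \<le> t \<Longrightarrow> dist q (\<gamma> t) = c + t"
    by (rule backward_extension[OF half_geodesic_lift assms]) (rule that)
  have "b q \<le> c" using b_limit(2)[of 0 q] q[of 0] by simp
  moreover have "c \<le> b q" by (rule b_limit(3)) (use q in simp)
  ultimately show thesis using that[of q] q[of 0] by (simp add: dist_commute)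
qed

lemma b_surj: "\<exists>z. b z = c"
proof (cases "0 \<le> c")
  case True then show ?thesis by (metis b_up)
next
  case False then show ?thesis using b_ray[of "- c"] by auto
qed

text \<open>The minimum over the closed ball is compared with the point at distance \<open>s\<close>
  from \<open>x\<close> on the way to a far \<open>\<gamma> t'\<close>. At that point
  \<open>b\<close> is at most \<open>dist x (\<gamma> t') - s - t'\<close>, which tends to
  \<open>b x - s\<close>.\<close>

lemma b_down:
  assumes "c \<le> b x"
  obtains z where "b z = c" "dist x z = b x - c"
proof -
  define s where "s = b x - c"
  have s: "0 \<le> s" using assms by (simp add: s_def)
  have cont: "continuous_on A b" for A
  proof (rule continuous_onI)
    fix y e assume "y \<in> A" "0 < (e :: real)"
    have "dist (b z) (b y) \<le> e" if "dist z y < e" for z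
      using b_lipschitz[of z y] b_lipschitz[of y z] that by (auto simp: dist_real_def dist_commute abs_if)
    then show "\<exists>d>0. \<forall>z\<in>A. dist z y < d \<longrightarrow> dist (b z) (b y) \<le> e" using \<open>0 < e\<close> by blast
  qed
  obtain z where z: "z \<in> cball x s" "\<And>y. y \<in> cball x s \<Longrightarrow> b z \<le> b y"
    using continuous_attains_inf[OF proper _ cont, of x s] s by force
  have "b z + s \<le> dist x (\<gamma> t) - t" if t: "0 \<le> t" for t
  proof -
    \<comment> \<open>Far enough along \<gamma> for \<open>\<gamma> t'\<close> to be at distance at
      least \<open>s\<close> from \<open>x\<close>, so that \<open>between\<close> applies.\<close>
    define t' where "t' = t + s + dist x (\<gamma> 0)"
    have t': "t \<le> t'" "0 \<le> t'" using t s by (auto simp: t'_def)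
    have "s \<le> dist x (\<gamma> t')" using b_lower[OF t'(2), of x] t by (simp add: t'_def)
    then obtain w where w: "dist x w = s" "dist w (\<gamma> t') = dist x (\<gamma> t') - s"
      using between[OF s, of x "\<gamma> t'"] by metis
    have "b z \<le> b w" using z(2)[of w] w by simp
    also have "\<dots> \<le> dist x (\<gamma> t') - s - t'" using b_limit(2)[OF t'(2), of w] w by simp
    also have "\<dots> \<le> dist x (\<gamma> t) - t - s" using b_anti[OF t t'(1), of x] by simp
    finally show ?thesis by simp
  qed
  then have "b z + s \<le> b x" by (rule b_limit(3))
  then have "b z = c" "dist x z = s" using b_lipschitz[of x z] z(1) by (auto simp: s_def)
  then show thesis using that[of z] by (simp add: s_def)
qed

section \<open>The Busemann function of the quotient and the length excess\<close>

lemma excess_bound: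
  obtains E where "\<And>s t. 0 \<le> s \<Longrightarrow> 0 \<le> t \<Longrightarrow> \<bar>t - s\<bar> - setdist (\<alpha> t) (\<alpha> s) \<le> E"
proof -
  have le: "ereal (\<bar>t - s\<bar> - setdist (\<alpha> t) (\<alpha> s)) \<le> length_excess setdist \<alpha>" if "0 \<le> s" "0 \<le> t" for s t
    unfolding length_excess_def using that by (intro SUP_upper2[of t] SUP_upper2[of s]) auto
  have "length_excess setdist \<alpha> < \<infinity>" using quasi by (simp add: quasi_ray_def)
  moreover have "length_excess setdist \<alpha> \<noteq> - \<infinity>" using le[of 0 0] by auto
  ultimately obtain E where "length_excess setdist \<alpha> = ereal E" by (cases "length_excess setdist \<alpha>") auto
  then show thesis using that[of E] le by simp
qed

text \<open>Defined through the quotient distance, so that \<open>busemann setdist \<alpha>\<close>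
  can be read off directly; \<open>\<beta>_le\<close> and \<open>\<beta>_approx\<close> identify it
  with the infimum of \<open>b\<close> over the orbit.\<close>

definition \<beta> :: "'a \<Rightarrow> real" where "\<beta> x = (INF t\<in>{0..}. setdist (orbit G x) (orbit G (\<gamma> t)) - t)"

lemma \<beta>_anti:
  assumes "0 \<le> s" "s \<le> t"
  shows "setdist (orbit G x) (orbit G (\<gamma> t)) - t \<le> setdist (orbit G x) (orbit G (\<gamma> s)) - s"
proof -
  have "setdist (orbit G x) (orbit G (\<gamma> t)) - (t - s) \<le> dist (g x) (\<gamma> s)" if "g \<in> G" for g
    using orbit_dist_le1[OF that, of x "\<gamma> t"] b_anti[OF assms, of "g x"] by simp
  then have "setdist (orbit G x) (orbit G (\<gamma> t)) - (t - s) \<le> setdist (orbit G x) (orbit G (\<gamma> s))"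
    by (rule orbit_dist_ge)
  then show ?thesis by simp
qed

text \<open>Finiteness of the excess enters here: it keeps the distance from
  \<open>\<alpha> 0\<close> to \<open>\<alpha> t\<close> above \<open>t - E\<close>, so that the
  infimum defining \<beta> is taken over a set bounded below.\<close>

lemma \<beta>_lower: "\<exists>m. \<forall>t\<ge>0. m \<le> setdist (orbit G x) (orbit G (\<gamma> t)) - t"
proof -
  obtain E where E: "\<And>s t. 0 \<le> s \<Longrightarrow> 0 \<le> t \<Longrightarrow> \<bar>t - s\<bar> - setdist (\<alpha> t) (\<alpha> s) \<le> E" by (rule excess_bound) (rule that)
  have "t - E - dist x (\<gamma> 0) \<le> setdist (orbit G x) (orbit G (\<gamma> t))" if t: "0 \<le> t" for t
  proof (rule orbit_dist_ge)
    fix g assume g: "g \<in> G"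
    have "t - E \<le> setdist (orbit G (\<gamma> 0)) (orbit G (\<gamma> t))"
      using E[of t 0] \<alpha>[of t] \<alpha>[of 0] t by simp
    also have "\<dots> \<le> dist (g (\<gamma> 0)) (\<gamma> t)" using orbit_dist_le1[OF g] .
    also have "\<dots> \<le> dist x (\<gamma> 0) + dist (g x) (\<gamma> t)"
      using dist_triangle[of "g (\<gamma> 0)" "\<gamma> t" "g x"] G(5)[OF g, of x "\<gamma> 0"] by (simp add: dist_commute)
    finally show "t - E - dist x (\<gamma> 0) \<le> dist (g x) (\<gamma> t)" by simp
  qed
  then show ?thesis by (intro exI[of _ "- E - dist x (\<gamma> 0)"]) force
qed

lemma \<beta>_limit:
  "((\<lambda>t. setdist (orbit G x) (orbit G (\<gamma> t)) - t) \<longlongrightarrow> \<beta> x) at_top"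
  "0 \<le> t \<Longrightarrow> \<beta> x \<le> setdist (orbit G x) (orbit G (\<gamma> t)) - t"
  "(\<And>t. 0 \<le> t \<Longrightarrow> c \<le> setdist (orbit G x) (orbit G (\<gamma> t)) - t) \<Longrightarrow> c \<le> \<beta> x"
  "\<beta> x < c \<Longrightarrow> \<exists>t\<ge>0. setdist (orbit G x) (orbit G (\<gamma> t)) - t < c"
proof -
  obtain m where m: "\<And>t. 0 \<le> t \<Longrightarrow> m \<le> setdist (orbit G x) (orbit G (\<gamma> t)) - t" using \<beta>_lower[of x] by blast
  note * = antimono_tendsto_Inf[where f = "\<lambda>t. setdist (orbit G x) (orbit G (\<gamma> t)) - t" and m = m, OF \<beta>_anti m, folded \<beta>_def]
  show "((\<lambda>t. setdist (orbit G x) (orbit G (\<gamma> t)) - t) \<longlongrightarrow> \<beta> x) at_top"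
    "0 \<le> t \<Longrightarrow> \<beta> x \<le> setdist (orbit G x) (orbit G (\<gamma> t)) - t"
    "(\<And>t. 0 \<le> t \<Longrightarrow> c \<le> setdist (orbit G x) (orbit G (\<gamma> t)) - t) \<Longrightarrow> c \<le> \<beta> x"
    "\<beta> x < c \<Longrightarrow> \<exists>t\<ge>0. setdist (orbit G x) (orbit G (\<gamma> t)) - t < c"
    using *(1) *(2) *(3) *(4) by blast+
qed

lemma \<beta>_le: "g \<in> G \<Longrightarrow> \<beta> x \<le> b (g x)"
proof (rule b_limit(3))
  fix t :: real assume "g \<in> G" "0 \<le> t"
  then show "\<beta> x \<le> dist (g x) (\<gamma> t) - t" using \<beta>_limit(2)[of t x] orbit_dist_le1[of g x "\<gamma> t"] by simp
qed

lemma \<beta>_approx: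
  assumes "\<beta> x < c"
  obtains g where "g \<in> G" "b (g x) < c"
proof -
  obtain t where t: "0 \<le> t" "setdist (orbit G x) (orbit G (\<gamma> t)) < c + t" using \<beta>_limit(4)[OF assms] by (auto simp: algebra_simps)
  obtain g where "g \<in> G" "dist (g x) (\<gamma> t) < c + t" by (rule orbit_dist_less[OF t(2)])
  then show thesis using that[of g] b_limit(2)[OF t(1), of "g x"] by simp
qed

lemma busemann_\<beta>: "busemann setdist \<alpha> (orbit G x) (orbit G y) = \<beta> x - \<beta> y"
  unfolding busemann_def
proof (rule tendsto_Lim)
  have "((\<lambda>t. (setdist (orbit G x) (orbit G (\<gamma> t)) - t) - (setdist (orbit G y) (orbit G (\<gamma> t)) - t)) \<longlongrightarrow> \<beta> x - \<beta> y) at_top"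
    by (intro tendsto_diff \<beta>_limit(1))
  moreover have "\<forall>\<^sub>F t in at_top. (setdist (orbit G x) (orbit G (\<gamma> t)) - t) - (setdist (orbit G y) (orbit G (\<gamma> t)) - t)
      = setdist (orbit G x) (\<alpha> t) - setdist (\<alpha> t) (orbit G y)"
    by (rule eventually_at_top_linorderI[of 0]) (simp add: \<alpha> setdist_sym)
  ultimately show "((\<lambda>t. setdist (orbit G x) (\<alpha> t) - setdist (\<alpha> t) (orbit G y)) \<longlongrightarrow> \<beta> x - \<beta> y) at_top"
    by (rule Lim_transform_eventually)
qed simp

lemma SUP_busemann: "(SUP g\<in>G. ereal (busemann dist \<gamma> x (g y))) = ereal (b x - \<beta> y)"
proof (rule antisym)
  show "(SUP g\<in>G. ereal (busemann dist \<gamma> x (g y))) \<le> ereal (b x - \<beta> y)"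
    by (rule SUP_least) (simp add: busemann_b \<beta>_le)
  show "ereal (b x - \<beta> y) \<le> (SUP g\<in>G. ereal (busemann dist \<gamma> x (g y)))"
  proof (rule ereal_le_epsilon2)
    fix e :: real assume "0 < e"
    then obtain g where g: "g \<in> G" "b (g y) < \<beta> y + e" using \<beta>_approx[of y "\<beta> y + e"] by auto
    have "ereal (b x - \<beta> y) \<le> ereal (busemann dist \<gamma> x (g y)) + ereal e" using g by (simp add: busemann_b)
    also have "\<dots> \<le> (SUP g\<in>G. ereal (busemann dist \<gamma> x (g y))) + ereal e"
      using g(1) by (intro add_right_mono SUP_upper)
    finally show "ereal (b x - \<beta> y) \<le> (SUP g\<in>G. ereal (busemann dist \<gamma> x (g y))) + ereal e" .
  qed
qed

text \<open>Enlarging an interval from \<open>s\<close> to \<open>t\<close> into one from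
  \<open>0\<close> to \<open>t\<close> does not decrease the excess, by the triangle inequality. The
  supremum is therefore the limit of \<open>t\<close> minus the distance from
  \<open>\<alpha> 0\<close> to \<open>\<alpha> t\<close>.\<close>

lemma length_excess_\<beta>: "length_excess setdist \<alpha> = ereal (- \<beta> (\<gamma> 0))"
proof (rule antisym)
  have *: "t - s - setdist (\<alpha> t) (\<alpha> s) \<le> - \<beta> (\<gamma> 0)" if st: "0 \<le> s" "s \<le> t" for s t
  proof -
    have "setdist (orbit G (\<gamma> 0)) (orbit G (\<gamma> t)) - s \<le> setdist (orbit G (\<gamma> s)) (orbit G (\<gamma> t))"
    proof (rule orbit_dist_ge)
      fix g assume g: "g \<in> G"
      show "setdist (orbit G (\<gamma> 0)) (orbit G (\<gamma> t)) - s \<le> dist (g (\<gamma> s)) (\<gamma> t)"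
        using orbit_dist_le1[OF g, of "\<gamma> 0" "\<gamma> t"] dist_triangle[of "g (\<gamma> 0)" "\<gamma> t" "g (\<gamma> s)"] G(5)[OF g, of "\<gamma> 0" "\<gamma> s"]
          ray[of 0 s] st by simp
    qed
    then show ?thesis using \<beta>_limit(2)[of t "\<gamma> 0"] st \<alpha> by (simp add: setdist_sym)
  qed
  show "length_excess setdist \<alpha> \<le> ereal (- \<beta> (\<gamma> 0))"
    unfolding length_excess_def
  proof (intro SUP_least)
    fix s t :: real assume "t \<in> {0..}" "s \<in> {0..}"
    then show "ereal (\<bar>t - s\<bar> - setdist (\<alpha> t) (\<alpha> s)) \<le> ereal (- \<beta> (\<gamma> 0))"
      using *[of s t] *[of t s] by (cases "s \<le> t") (auto simp: setdist_sym)
  qed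
  show "ereal (- \<beta> (\<gamma> 0)) \<le> length_excess setdist \<alpha>"
  proof (rule ereal_le_epsilon2)
    fix e :: real assume "0 < e"
    then obtain t where t: "0 \<le> t" "setdist (orbit G (\<gamma> 0)) (orbit G (\<gamma> t)) - t < \<beta> (\<gamma> 0) + e"
      using \<beta>_limit(4)[of "\<gamma> 0" "\<beta> (\<gamma> 0) + e"] by auto
    have "ereal (- \<beta> (\<gamma> 0)) \<le> ereal (\<bar>0 - t\<bar> - setdist (\<alpha> 0) (\<alpha> t)) + ereal e" using t \<alpha> by simp
    also have "\<dots> \<le> length_excess setdist \<alpha> + ereal e"
      unfolding length_excess_def using t(1) by (intro add_right_mono SUP_upper2[of 0] SUP_upper2[of t]) auto
    finally show "ereal (- \<beta> (\<gamma> 0)) \<le> length_excess setdist \<alpha> + ereal e" .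
  qed
qed

section \<open>Horoballs and signed distances\<close>

lemma max_horoball_\<beta>: "max_horoball G \<gamma> x = {y. b y \<le> \<beta> x}"
  unfolding max_horoball_def SUP_busemann by (auto simp: busemann_b)

text \<open>Since \<open>b\<close> takes every value, a sublevel set determines its level. The base
  points of a horoball given as a mere set are therefore exactly the points of one level.\<close>

lemma horoball_boundary_b: "horoball_boundary \<gamma> {y. b y \<le> c} = {y. b y = c}"
proof -
  have "{x. horoball \<gamma> x = {y. b y \<le> c}} = {x. b x = c}"
  proof -
    obtain z where z: "b z = c" using b_surj by blast
    have "b x = c" if "{y. b y \<le> b x} = {y. b y \<le> c}" for x
    proof -
      have "x \<in> {y. b y \<le> b x}" "z \<in> {y. b y \<le> c}" using z by auto
      then have "x \<in> {y. b y \<le> c}" "z \<in> {y. b y \<le> b x}" using that by blast+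
      then show ?thesis using z by simp
    qed
    then show ?thesis by (auto simp: horoball_def busemann_b)
  qed
  then show ?thesis using b_surj[of c] by (auto simp: horoball_boundary_def horosphere_def busemann_b)
qed

lemma setdist_levels: "setdist {y. b y = c} {y. b y = c'} = \<bar>c - c'\<bar>"
proof -
  have *: "setdist {y. b y = c} {y. b y = c'} = c - c'" if "c' \<le> c" for c c'
  proof -
    obtain x where x: "b x = c" using b_surj by blast
    obtain z where z: "b z = c'" "dist x z = c - c'" using b_down[of c' x] x \<open>c' \<le> c\<close> by auto
    show ?thesis
    proof (rule antisym)
      show "setdist {y. b y = c} {y. b y = c'} \<le> c - c'" using setdist_le_dist[of x _ z] x z by auto
      show "c - c' \<le> setdist {y. b y = c} {y. b y = c'}"
        by (rule le_setdistI) (use x z b_lipschitz in \<open>auto simp: diff_le_eq add.commute\<close>)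
    qed
  qed
  show ?thesis using *[of c c'] *[of c' c] by (cases "c' \<le> c") (auto simp: setdist_sym)
qed

lemma infdist_level: "infdist (\<gamma> 0) {y. b y = c} = \<bar>c\<bar>"
proof (rule antisym)
  have b0: "b (\<gamma> 0) = 0" using b_ray[of 0] by simp
  obtain z where z: "b z = c" "dist (\<gamma> 0) z = \<bar>c\<bar>"
  proof (cases "0 \<le> c")
    case True then show ?thesis using b_up[OF True] that by auto
  next
    case False then show ?thesis using b_down[of c "\<gamma> 0"] b0 that by auto
  qed
  show "infdist (\<gamma> 0) {y. b y = c} \<le> \<bar>c\<bar>" using infdist_le[of z _ "\<gamma> 0"] z by simp
  have "setdist {y. b y = 0} {y. b y = c} \<le> setdist {\<gamma> 0} {y. b y = c}" using b0 by (intro setdist_subset_left) auto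
  then show "\<bar>c\<bar> \<le> infdist (\<gamma> 0) {y. b y = c}" by (simp add: setdist_levels infdist_eq_setdist)
qed

text \<open>Inclusion of the two horoballs amounts to \<open>\<beta> y \<le> \<beta> x\<close>,
  because \<open>b\<close> takes the value \<open>\<beta> y\<close>. The case distinction in the
  signed distance thus restores the sign of \<open>\<beta> x - \<beta> y\<close>.\<close>

lemma busemann_quotient:
  "busemann setdist \<alpha> (orbit G x) (orbit G y) = signed_dist_horoballs \<gamma> (max_horoball G \<gamma> x) (max_horoball G \<gamma> y)"
proof -
  have "{z. b z \<le> \<beta> y} \<subseteq> {z. b z \<le> \<beta> x} \<longleftrightarrow> \<beta> y \<le> \<beta> x"
  proof
    assume *: "{z. b z \<le> \<beta> y} \<subseteq> {z. b z \<le> \<beta> x}"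
    obtain z where "b z = \<beta> y" using b_surj by blast
    moreover from this have "z \<in> {z. b z \<le> \<beta> x}" by (intro subsetD[OF *]) simp
    ultimately show "\<beta> y \<le> \<beta> x" by simp
  qed auto
  then show ?thesis
    unfolding signed_dist_horoballs_def max_horoball_\<beta> horoball_boundary_b setdist_levels busemann_\<beta> by auto
qed

lemma busemann_origin:
  "ereal (busemann setdist \<alpha> (\<alpha> 0) (orbit G y)) =
    (SUP g\<in>G. ereal (busemann dist \<gamma> (\<gamma> 0) (g y))) - length_excess setdist \<alpha>"
  "ereal (busemann setdist \<alpha> (\<alpha> 0) (orbit G y)) =
    ereal (signed_dist_point \<gamma> (\<gamma> 0) (max_horoball G \<gamma> y)) - length_excess setdist \<alpha>"
proof -
  have b0: "b (\<gamma> 0) = 0" using b_ray[of 0] by simp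
  have "signed_dist_point \<gamma> (\<gamma> 0) (max_horoball G \<gamma> y) = - \<beta> y"
    unfolding signed_dist_point_def max_horoball_\<beta> horoball_boundary_b infdist_level using b0 by auto
  then show "ereal (busemann setdist \<alpha> (\<alpha> 0) (orbit G y)) =
      (SUP g\<in>G. ereal (busemann dist \<gamma> (\<gamma> 0) (g y))) - length_excess setdist \<alpha>"
    "ereal (busemann setdist \<alpha> (\<alpha> 0) (orbit G y)) =
      ereal (signed_dist_point \<gamma> (\<gamma> 0) (max_horoball G \<gamma> y)) - length_excess setdist \<alpha>"
    using \<alpha>[of 0] b0 by (auto simp: busemann_\<beta> SUP_busemann length_excess_\<beta>)
qed

end

section \<open>Geodesics in coordinates\<close>

lemma integral_primitive:
  fixes w :: "real \<Rightarrow> 'e::euclidean_space"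
  assumes "continuous_on {0..1} w"
  shows "continuous_on {0..1} (\<lambda>t. integral {0..t} w)"
    and "t \<in> {0..1} \<Longrightarrow> ((\<lambda>t. integral {0..t} w) has_vector_derivative w t) (at t within {0..1})"
    and "t \<in> {0..1} \<Longrightarrow> (\<And>s. s \<in> {0..1} \<Longrightarrow> norm (w s) \<le> B) \<Longrightarrow> norm (integral {0..t} w) \<le> B"
proof -
  show d: "((\<lambda>t. integral {0..t} w) has_vector_derivative w t) (at t within {0..1})" if "t \<in> {0..1}" for t
    using integral_has_vector_derivative[OF assms that] .
  show "continuous_on {0..1} (\<lambda>t. integral {0..t} w)"
    using d has_vector_derivative_continuous by (fastforce simp: continuous_on_eq_continuous_within)
  assume t: "t \<in> {0..1}" and B: "\<And>s. s \<in> {0..1} \<Longrightarrow> norm (w s) \<le> B"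
  have "norm (integral {0..t} w) \<le> B * (t - 0)"
    using t B assms by (intro integral_bound) (auto intro: continuous_on_subset)
  also have "\<dots> \<le> B * 1" using t B[of 0] norm_ge_zero[of "w 0"] by (intro mult_left_mono) (auto simp del: norm_ge_zero)
  finally show "norm (integral {0..t} w) \<le> B" by simp
qed

lemma integral_primitive_diff:
  fixes w w' :: "real \<Rightarrow> 'e::euclidean_space"
  assumes "continuous_on {0..1} w" "continuous_on {0..1} w'" "t \<in> {0..1}"
    "\<And>s. s \<in> {0..1} \<Longrightarrow> norm (w s - w' s) \<le> B"
  shows "norm (integral {0..t} w - integral {0..t} w') \<le> B"
proof -
  have "integral {0..t} w - integral {0..t} w' = integral {0..t} (\<lambda>s. w s - w' s)"
    using assms by (intro integral_diff[symmetric] integrable_continuous_real) (auto intro: continuous_on_subset)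
  then show ?thesis using assms by (auto intro!: integral_primitive(3) continuous_intros)
qed

text \<open>The unknown of the boundary value problem is the second derivative \<open>w\<close>; the curve with ends \<open>x\<close>, \<open>y\<close> and
  second derivative \<open>w\<close> is \<open>bvp_curve x y w\<close>.\<close>

definition bvp_velocity :: "'e::euclidean_space \<Rightarrow> 'e \<Rightarrow> (real \<Rightarrow> 'e) \<Rightarrow> real \<Rightarrow> 'e" where
  "bvp_velocity x y w t = y - x - integral {0..1} (\<lambda>s. integral {0..s} w) + integral {0..t} w"

definition bvp_curve :: "'e::euclidean_space \<Rightarrow> 'e \<Rightarrow> (real \<Rightarrow> 'e) \<Rightarrow> real \<Rightarrow> 'e" where
  "bvp_curve x y w t = x + t *\<^sub>R (y - x - integral {0..1} (\<lambda>s. integral {0..s} w)) + integral {0..t} (\<lambda>s. integral {0..s} w)"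

lemma bvp_curve_facts:
  fixes w :: "real \<Rightarrow> 'e::euclidean_space"
  assumes w: "continuous_on {0..1} w"
  shows "bvp_curve x y w 0 = x" "bvp_curve x y w 1 = y"
    and "t \<in> {0..1} \<Longrightarrow> (bvp_curve x y w has_vector_derivative bvp_velocity x y w t) (at t within {0..1})"
    and "t \<in> {0..1} \<Longrightarrow> (bvp_velocity x y w has_vector_derivative w t) (at t within {0..1})"
proof -
  show "bvp_curve x y w 0 = x" "bvp_curve x y w 1 = y" by (simp_all add: bvp_curve_def)
  show "(bvp_curve x y w has_vector_derivative bvp_velocity x y w t) (at t within {0..1})" if "t \<in> {0..1}"
    unfolding bvp_curve_def[abs_def] bvp_velocity_def
    using integral_primitive(2)[OF integral_primitive(1)[OF w] that]
    by (auto intro!: derivative_eq_intros)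
  show "(bvp_velocity x y w has_vector_derivative w t) (at t within {0..1})" if "t \<in> {0..1}"
    unfolding bvp_velocity_def[abs_def] using integral_primitive(2)[OF w that] by (auto intro!: derivative_eq_intros)
qed

text \<open>Both in the curve and in its velocity two integrals of \<open>w\<close> occur, and each
  contributes one \<open>B\<close>. The ends enter through the linear interpolation and its
  slope.\<close>

lemma bvp_diff:
  fixes w w' :: "real \<Rightarrow> 'e::euclidean_space"
  assumes w: "continuous_on {0..1} w" "continuous_on {0..1} w'" and t: "t \<in> {0..1}"
    and B: "\<And>s. s \<in> {0..1} \<Longrightarrow> norm (w s - w' s) \<le> B"
  shows "norm (bvp_curve x y w t - bvp_curve x' y' w' t) \<le> norm (x - x') + norm (y - y') + 2 * B"
    and "norm (bvp_velocity x y w t - bvp_velocity x' y' w' t) \<le> norm (x - x') + norm (y - y') + 2 * B"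
proof -
  let ?J = "\<lambda>w t. integral {0..t} (\<lambda>s. integral {0..s} w)"
  have P: "norm (integral {0..s} w - integral {0..s} w') \<le> B" if "s \<in> {0..1}" for s
    using integral_primitive_diff[OF w that B] .
  have Q: "norm (?J w s - ?J w' s) \<le> B" if "s \<in> {0..1}" for s
    by (rule integral_primitive_diff[OF integral_primitive(1)[OF w(1)] integral_primitive(1)[OF w(2)] that P])
  have Q1: "norm (?J w 1 - ?J w' 1) \<le> B" using Q[of 1] by simp
  have tri: "norm (a + b + (c - d)) \<le> norm a + norm b + (norm c + norm d)" for a b c d :: 'e
    by (intro order_trans[OF norm_triangle_ineq] add_mono norm_triangle_ineq norm_triangle_ineq4)
  have sc: "norm (t *\<^sub>R z) \<le> norm z" "norm ((1 - t) *\<^sub>R z) \<le> norm z" for z :: 'e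
    using t by (auto intro: mult_left_le_one_le)
  have e1: "bvp_curve x y w t - bvp_curve x' y' w' t =
      (1 - t) *\<^sub>R (x - x') + t *\<^sub>R (y - y') + ((?J w t - ?J w' t) - t *\<^sub>R (?J w 1 - ?J w' 1))"
    by (simp add: bvp_curve_def algebra_simps)
  show "norm (bvp_curve x y w t - bvp_curve x' y' w' t) \<le> norm (x - x') + norm (y - y') + 2 * B"
    unfolding e1
    using tri[of "(1 - t) *\<^sub>R (x - x')" "t *\<^sub>R (y - y')" "?J w t - ?J w' t" "t *\<^sub>R (?J w 1 - ?J w' 1)"]
      sc(2)[of "x - x'"] sc(1)[of "y - y'"] sc(1)[of "?J w 1 - ?J w' 1"] Q[OF t] Q1 by linarith
  have e2: "bvp_velocity x y w t - bvp_velocity x' y' w' t =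
      (x' - x) + (y - y') + ((integral {0..t} w - integral {0..t} w') - (?J w 1 - ?J w' 1))"
    by (simp add: bvp_velocity_def algebra_simps)
  show "norm (bvp_velocity x y w t - bvp_velocity x' y' w' t) \<le> norm (x - x') + norm (y - y') + 2 * B"
    unfolding e2
    using tri[of "x' - x" "y - y'" "integral {0..t} w - integral {0..t} w'" "?J w 1 - ?J w' 1"] P[OF t] Q1
    by (simp add: norm_minus_commute)
qed

text \<open>Comparison with the constant curve at \<open>p\<close>: each end contributes less than
  \<rho>, the second derivative \<open>2 * \<rho>\<close>.\<close>

lemma bvp_bound:
  fixes w :: "real \<Rightarrow> 'e::euclidean_space"
  assumes w: "continuous_on {0..1} w" and t: "t \<in> {0..1}" and B: "\<And>s. s \<in> {0..1} \<Longrightarrow> norm (w s) \<le> \<rho>"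
    and xy: "x \<in> ball p \<rho>" "y \<in> ball p \<rho>"
  shows "bvp_curve x y w t \<in> cball p (4 * \<rho>)" "bvp_velocity x y w t \<in> cball 0 (4 * \<rho>)"
proof -
  have 0: "bvp_curve p p (\<lambda>_. 0) t = p" "bvp_velocity p p (\<lambda>_. 0) t = 0"
    by (simp_all add: bvp_curve_def bvp_velocity_def)
  have xy': "norm (x - p) < \<rho>" "norm (y - p) < \<rho>" using xy by (auto simp: dist_norm norm_minus_commute)
  show "bvp_curve x y w t \<in> cball p (4 * \<rho>)"
    using bvp_diff(1)[OF w continuous_on_const t, of 0 \<rho> x y p p] B xy' by (simp add: 0 dist_norm norm_minus_commute)
  show "bvp_velocity x y w t \<in> cball 0 (4 * \<rho>)"
    using bvp_diff(2)[OF w continuous_on_const t, of 0 \<rho> x y p p] B xy' by (simp add: 0)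
qed

text \<open>Banach's fixed point theorem for the second derivative \<open>w\<close> in a ball of
  radius \<rho>. Position and velocity vary by at most twice the variation of \<open>w\<close>, so
  the constant 1/8 for \<open>F\<close> gives the contraction factor 1/2. Moving the ends moves the
  operator by a quarter of their displacement and the fixed point by half of it, whence the factor 2
  in the third conclusion.\<close>

lemma bvp_solution:
  fixes F :: "'e::euclidean_space \<Rightarrow> 'e \<Rightarrow> 'e"
  assumes \<rho>: "0 < \<rho>"
    and bound: "\<And>q u. q \<in> cball p (4 * \<rho>) \<Longrightarrow> u \<in> cball 0 (4 * \<rho>) \<Longrightarrow> norm (F q u) \<le> \<rho>"
    and lip: "\<And>q u q' u'. q \<in> cball p (4 * \<rho>) \<Longrightarrow> u \<in> cball 0 (4 * \<rho>) \<Longrightarrow> q' \<in> cball p (4 * \<rho>) \<Longrightarrow> u' \<in> cball 0 (4 * \<rho>) \<Longrightarrow>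
      norm (F q u - F q' u') \<le> (norm (q - q') + norm (u - u')) / 8"
    and F0: "\<And>q. q \<in> ball p \<rho> \<Longrightarrow> F q 0 = 0"
  obtains c v :: "'e \<Rightarrow> 'e \<Rightarrow> real \<Rightarrow> 'e" where
    "\<And>x y. x \<in> ball p \<rho> \<Longrightarrow> y \<in> ball p \<rho> \<Longrightarrow> c x y 0 = x \<and> c x y 1 = y"
    "\<And>x y t. x \<in> ball p \<rho> \<Longrightarrow> y \<in> ball p \<rho> \<Longrightarrow> t \<in> {0..1} \<Longrightarrow> c x y t \<in> cball p (4 * \<rho>) \<and> v x y t \<in> cball 0 (4 * \<rho>)
      \<and> (c x y has_vector_derivative v x y t) (at t within {0..1})
      \<and> (v x y has_vector_derivative F (c x y t) (v x y t)) (at t within {0..1})"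
    "\<And>x y x' y' t. x \<in> ball p \<rho> \<Longrightarrow> y \<in> ball p \<rho> \<Longrightarrow> x' \<in> ball p \<rho> \<Longrightarrow> y' \<in> ball p \<rho> \<Longrightarrow> t \<in> {0..1} \<Longrightarrow>
      norm (c x y t - c x' y' t) \<le> 2 * (norm (x - x') + norm (y - y')) \<and>
      norm (v x y t - v x' y' t) \<le> 2 * (norm (x - x') + norm (y - y'))"
    "\<And>x t. x \<in> ball p \<rho> \<Longrightarrow> c x x t = x \<and> v x x t = 0"
proof -
  define W where "W = {w :: real \<Rightarrow>\<^sub>C 'e. norm w \<le> \<rho>}"
  have wb: "norm (apply_bcontfun w s) \<le> \<rho>" if "w \<in> W" for w s
    using norm_bounded[of w s] that by (simp add: W_def)
  have wc: "continuous_on {0..1} (apply_bcontfun w)" for w :: "real \<Rightarrow>\<^sub>C 'e" by simp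
  \<comment> \<open>The fixed point is sought among bounded continuous functions on the whole line,
    so time is clamped to the unit interval.\<close>
  define cl where "cl t = max 0 (min 1 t)" for t :: real
  have cl: "cl t \<in> {0..1}" "continuous_on A cl" for t A unfolding cl_def by (auto intro!: continuous_intros)
  have cl_id: "cl t = t" if "t \<in> {0..1}" for t using that by (auto simp: cl_def)
  have inb: "bvp_curve x y (apply_bcontfun w) t \<in> cball p (4 * \<rho>)" "bvp_velocity x y (apply_bcontfun w) t \<in> cball 0 (4 * \<rho>)"
    if "x \<in> ball p \<rho>" "y \<in> ball p \<rho>" "w \<in> W" "t \<in> {0..1}" for x y w t
    using bvp_bound[OF wc that(4) wb[OF that(3)] that(1,2)] by auto
  define T0 where "T0 x y w t = F (bvp_curve x y (apply_bcontfun w) (cl t)) (bvp_velocity x y (apply_bcontfun w) (cl t))" for x y w t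
  have T0b: "norm (T0 x y w t) \<le> \<rho>" if "x \<in> ball p \<rho>" "y \<in> ball p \<rho>" "w \<in> W" for x y w t
    unfolding T0_def using inb[OF that cl(1)] bound by blast
  have T0c: "continuous_on UNIV (T0 x y w)" if "x \<in> ball p \<rho>" "y \<in> ball p \<rho>" "w \<in> W" for x y w
  proof -
    have Fc: "continuous_on (cball p (4 * \<rho>) \<times> cball 0 (4 * \<rho>)) (\<lambda>z. F (fst z) (snd z))"
    proof (rule continuous_onI)
      fix z :: "'e \<times> 'e" and e assume z: "z \<in> cball p (4 * \<rho>) \<times> cball 0 (4 * \<rho>)" and e: "0 < (e :: real)"
      have "dist (F (fst z') (snd z')) (F (fst z) (snd z)) \<le> e"
        if z': "z' \<in> cball p (4 * \<rho>) \<times> cball 0 (4 * \<rho>)" "dist z' z < e" for z' :: "'e \<times> 'e"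
      proof -
        have "norm (fst z' - fst z) \<le> dist z' z" "norm (snd z' - snd z) \<le> dist z' z"
          using dist_fst_le[of z' z] dist_snd_le[of z' z] by (auto simp: dist_norm)
        then show ?thesis using lip[of "fst z'" "snd z'" "fst z" "snd z"] z z' e by (auto simp: dist_norm)
      qed
      then show "\<exists>d>0. \<forall>z'\<in>cball p (4 * \<rho>) \<times> cball 0 (4 * \<rho>). dist z' z < d \<longrightarrow> dist (F (fst z') (snd z')) (F (fst z) (snd z)) \<le> e"
        using e by blast
    qed
    have "continuous_on {0..1} (bvp_curve x y (apply_bcontfun w))" "continuous_on {0..1} (bvp_velocity x y (apply_bcontfun w))"
      using bvp_curve_facts(3,4)[OF wc] has_vector_derivative_continuous
      by (fastforce simp: continuous_on_eq_continuous_within)+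
    note co = this
    have clU: "cl ` UNIV \<subseteq> {0..1}" using cl(1) by blast
    have "continuous_on UNIV (\<lambda>t. (bvp_curve x y (apply_bcontfun w) (cl t), bvp_velocity x y (apply_bcontfun w) (cl t)))"
      by (rule continuous_on_Pair[OF continuous_on_compose2[OF co(1) cl(2) clU] continuous_on_compose2[OF co(2) cl(2) clU]])
    from continuous_on_compose2[OF Fc this] show ?thesis
      unfolding T0_def using inb[OF that cl(1)] by (auto simp: image_subset_iff)
  qed
  define T where "T x y w = Bcontfun (T0 x y w)" for x y w
  have T: "apply_bcontfun (T x y w) t = T0 x y w t" if "x \<in> ball p \<rho>" "y \<in> ball p \<rho>" "w \<in> W" for x y w t
    unfolding T_def using bcontfun_normI[OF T0c[OF that] T0b[OF that]] by (simp add: Bcontfun_inverse)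
  have lipT: "norm (apply_bcontfun (T x y w) t - apply_bcontfun (T x' y' w') t)
      \<le> (norm (x - x') + norm (y - y')) / 4 + dist w w' / 2"
    if "x \<in> ball p \<rho>" "y \<in> ball p \<rho>" "x' \<in> ball p \<rho>" "y' \<in> ball p \<rho>" "w \<in> W" "w' \<in> W" for x y x' y' w w' t
  proof -
    have B: "norm (apply_bcontfun w s - apply_bcontfun w' s) \<le> dist w w'" for s
      using dist_bounded[of w s w'] by (simp add: dist_norm)
    show ?thesis
      unfolding T[OF that(1,2,5)] T[OF that(3,4,6)] T0_def
      using lip[OF inb[OF that(1,2,5) cl(1)[of t]] inb[OF that(3,4,6) cl(1)[of t]]]
        bvp_diff[OF wc wc cl(1)[of t] B, of x y x' y'] by argo
  qed
  have ex: "\<exists>!w. w \<in> W \<and> T x y w = w" if "x \<in> ball p \<rho>" "y \<in> ball p \<rho>" for x y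
  proof (rule Banach_fix[of W "1/2"])
    have "W = cball 0 \<rho>" by (auto simp: W_def)
    then show "Topological_Spaces.complete W" by (simp add: complete_eq_closed)
    show "W \<noteq> {}" using \<rho> by (auto simp: W_def intro!: exI[of _ 0])
    show "T x y ` W \<subseteq> W" using T0b[OF that] T[OF that] by (auto simp: W_def intro!: norm_bound)
    show "dist (T x y w) (T x y w') \<le> 1 / 2 * dist w w'" if "w \<in> W" "w' \<in> W" for w w'
      using lipT[OF \<open>x \<in> ball p \<rho>\<close> \<open>y \<in> ball p \<rho>\<close> \<open>x \<in> ball p \<rho>\<close> \<open>y \<in> ball p \<rho>\<close> that]
      by (intro dist_bound) (simp add: dist_norm)
  qed auto
  have T00: "T x x 0 = 0" if "x \<in> ball p \<rho>" for x
  proof (rule bcontfun_eqI)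
    have "0 \<in> W" using \<rho> by (simp add: W_def)
    from T[OF that that this] show "apply_bcontfun (T x x 0) t = apply_bcontfun 0 t" for t
      using F0[OF that] by (simp add: T0_def bvp_curve_def bvp_velocity_def)
  qed
  from ex obtain w where w: "\<And>x y. x \<in> ball p \<rho> \<Longrightarrow> y \<in> ball p \<rho> \<Longrightarrow> w x y \<in> W \<and> T x y (w x y) = w x y" by metis
  define c where "c x y = bvp_curve x y (apply_bcontfun (w x y))" for x y
  define v where "v x y = bvp_velocity x y (apply_bcontfun (w x y))" for x y
  show thesis
  proof (rule that[of c v])
    fix x y assume xy: "x \<in> ball p \<rho>" "y \<in> ball p \<rho>"
    show "c x y 0 = x \<and> c x y 1 = y" using bvp_curve_facts(1,2)[OF wc] by (simp add: c_def)
    fix t :: real assume t: "t \<in> {0..1}"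
    have "apply_bcontfun (w x y) t = F (c x y t) (v x y t)"
      using w[OF xy] T[OF xy, of "w x y" t] by (simp add: T0_def cl_id[OF t] c_def v_def)
    then show "c x y t \<in> cball p (4 * \<rho>) \<and> v x y t \<in> cball 0 (4 * \<rho>)
      \<and> (c x y has_vector_derivative v x y t) (at t within {0..1})
      \<and> (v x y has_vector_derivative F (c x y t) (v x y t)) (at t within {0..1})"
      using inb[OF xy _ t] w[OF xy] bvp_curve_facts(3,4)[OF wc t] unfolding c_def v_def by metis
  next
    fix x y x' y' t assume xy: "x \<in> ball p \<rho>" "y \<in> ball p \<rho>" "x' \<in> ball p \<rho>" "y' \<in> ball p \<rho>" "t \<in> {0..1::real}"
    have "dist (w x y) (w x' y') \<le> (norm (x - x') + norm (y - y')) / 4 + dist (w x y) (w x' y') / 2"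
      using lipT[OF xy(1-4), of "w x y" "w x' y'"] w[OF xy(1,2)] w[OF xy(3,4)]
      by (intro dist_bound) (simp add: dist_norm)
    then have D: "2 * dist (w x y) (w x' y') \<le> norm (x - x') + norm (y - y')" by argo
    have B: "norm (apply_bcontfun (w x y) s - apply_bcontfun (w x' y') s) \<le> dist (w x y) (w x' y')" for s
      using dist_bounded[of "w x y" s "w x' y'"] by (simp add: dist_norm)
    show "norm (c x y t - c x' y' t) \<le> 2 * (norm (x - x') + norm (y - y')) \<and>
      norm (v x y t - v x' y' t) \<le> 2 * (norm (x - x') + norm (y - y'))"
      using bvp_diff[OF wc wc xy(5) B, of x y x' y'] D unfolding c_def v_def by argo
  next
    fix x t assume x: "x \<in> ball p \<rho>"
    have "0 \<in> W" using \<rho> by (simp add: W_def)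
    then have "w x x = 0" using ex[OF x x] T00[OF x] w[OF x x] by blast
    then show "c x x t = x \<and> v x x t = 0" by (simp add: c_def v_def bvp_curve_def bvp_velocity_def)
  qed
qed

section \<open>Linear maps depending on a parameter; symmetry of second derivatives\<close>

lemma linear_Basis_expand:
  fixes f :: "'e::euclidean_space \<Rightarrow> 'b::real_vector"
  assumes "linear f"
  shows "f v = (\<Sum>b\<in>Basis. (v \<bullet> b) *\<^sub>R f b)"
  using linear_sum[OF assms, of "\<lambda>b. (v \<bullet> b) *\<^sub>R b" Basis] linear_cmul[OF assms]
  by (simp add: euclidean_representation)

text \<open>Expansion in a basis reduces a linear argument in finite dimension to finitely many
  fixed vectors, so separate continuity becomes joint continuity. The uniform bound and the product
  rule below use the same device.\<close>

lemma continuous_on_linear_param: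
  fixes f :: "'p::topological_space \<Rightarrow> 'e::euclidean_space \<Rightarrow> 'b::real_normed_vector"
  assumes "\<And>x. x \<in> A \<Longrightarrow> linear (f x)" "\<And>b. continuous_on A (\<lambda>x. f x b)" "continuous_on A V"
  shows "continuous_on A (\<lambda>x. f x (V x))"
proof -
  have "continuous_on A (\<lambda>x. \<Sum>b\<in>Basis. (V x \<bullet> b) *\<^sub>R f x b)"
    using assms(2,3) by (intro continuous_intros)
  then show ?thesis using linear_Basis_expand[OF assms(1)] by (subst continuous_on_cong[OF refl]) auto
qed

lemma linear_param_bound:
  fixes f :: "'p::topological_space \<Rightarrow> 'e::euclidean_space \<Rightarrow> 'b::real_normed_vector"
  assumes "compact K" "\<And>x. x \<in> K \<Longrightarrow> linear (f x)" "\<And>b. continuous_on K (\<lambda>x. f x b)"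
  obtains C where "0 < C" "\<And>x v. x \<in> K \<Longrightarrow> norm (f x v) \<le> C * norm v"
proof -
  have "\<exists>B. \<forall>x\<in>K. norm (f x b) \<le> B" for b
    using compact_imp_bounded[OF compact_continuous_image[OF assms(3) assms(1)]] by (auto simp: bounded_iff)
  then obtain B where B: "\<And>x b. x \<in> K \<Longrightarrow> norm (f x b) \<le> B b" by metis
  define C where "C = (\<Sum>b\<in>(Basis :: 'e set). \<bar>B b\<bar>) + 1"
  show thesis
  proof (rule that[of C])
    show "0 < C" unfolding C_def by (intro add_nonneg_pos sum_nonneg) auto
    show "norm (f x v) \<le> C * norm v" if "x \<in> K" for x v
    proof -
      have "norm (f x v) = norm (\<Sum>b\<in>Basis. (v \<bullet> b) *\<^sub>R f x b)"
        using linear_Basis_expand[OF assms(2)[OF that], of v] by simp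
      also have "\<dots> \<le> (\<Sum>b\<in>(Basis :: 'e set). norm v * \<bar>B b\<bar>)"
        using B[OF that] by (intro sum_norm_le) (auto intro!: mult_mono Basis_le_norm order_trans[OF B[OF that]])
      also have "\<dots> \<le> C * norm v" by (simp add: C_def sum_distrib_left[symmetric] algebra_simps)
      finally show ?thesis .
    qed
  qed
qed

lemma has_vector_derivative_linear_param:
  fixes f :: "real \<Rightarrow> 'e::euclidean_space \<Rightarrow> 'b::real_normed_vector"
  assumes lin: "\<And>x. x \<in> I \<Longrightarrow> linear (f x)" and t: "t \<in> I" and F: "linear F"
    and f: "\<And>b. ((\<lambda>x. f x b) has_vector_derivative F b) (at t within I)"
    and V: "(V has_vector_derivative V') (at t within I)"
  shows "((\<lambda>x. f x (V x)) has_vector_derivative F (V t) + f t V') (at t within I)"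
proof -
  have "((\<lambda>x. \<Sum>b\<in>Basis. (V x \<bullet> b) *\<^sub>R f x b) has_vector_derivative
      (\<Sum>b\<in>Basis. (V t \<bullet> b) *\<^sub>R F b + (V' \<bullet> b) *\<^sub>R f t b)) (at t within I)"
    using V by (intro has_vector_derivative_sum has_vector_derivative_scaleR f bounded_linear.has_vector_derivative[OF bounded_linear_inner_left, THEN has_real_derivative_iff_has_vector_derivative[THEN iffD2]])
  also have "(\<Sum>b\<in>Basis. (V t \<bullet> b) *\<^sub>R F b + (V' \<bullet> b) *\<^sub>R f t b) = F (V t) + f t V'"
    using linear_Basis_expand[OF F, of "V t"] linear_Basis_expand[OF lin[OF t], of V'] by (simp add: sum.distrib)
  finally show ?thesis
    by (rule has_vector_derivative_transform[OF t, rotated]) (use linear_Basis_expand[OF lin] in blast)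
qed

text \<open>The mean value theorem is applied in direction \<open>h\<close> to the increment in
  direction \<open>k\<close>, then in direction \<open>k\<close>.\<close>

lemma second_difference:
  fixes f :: "'e::real_normed_vector \<Rightarrow> real"
  assumes f1: "\<And>x. x \<in> ball q r \<Longrightarrow> (f has_derivative f1 x) (at x)"
    and f2: "\<And>x h. x \<in> ball q r \<Longrightarrow> ((\<lambda>x. f1 x h) has_derivative (\<lambda>k. f2 x k h)) (at x)"
    and s: "0 < s" "s * (norm h + norm k) < r"
  obtains x where "x \<in> ball q r"
    "f (q + s *\<^sub>R h + s *\<^sub>R k) - f (q + s *\<^sub>R h) - f (q + s *\<^sub>R k) + f q = s\<^sup>2 * f2 x k h"
proof -
  have inb: "q + a *\<^sub>R h + b *\<^sub>R k \<in> ball q r" if "0 \<le> a" "a \<le> s" "0 \<le> b" "b \<le> s" for a b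
  proof -
    have "norm (a *\<^sub>R h + b *\<^sub>R k) \<le> s * norm h + s * norm k"
      using that by (intro order_trans[OF norm_triangle_ineq] add_mono) (auto intro: mult_right_mono)
    moreover have "dist q (q + a *\<^sub>R h + b *\<^sub>R k) = norm (a *\<^sub>R h + b *\<^sub>R k)"
      by (metis add.assoc add_diff_cancel_left' dist_commute dist_norm)
    ultimately show ?thesis using s(2) by (simp add: algebra_simps)
  qed
  have d1: "((\<lambda>\<tau>. f (q + \<tau> *\<^sub>R h + b *\<^sub>R k)) has_real_derivative f1 (q + a *\<^sub>R h + b *\<^sub>R k) h) (at a)"
    if "0 \<le> a" "a \<le> s" "0 \<le> b" "b \<le> s" for a b
  proof -
    have "((\<lambda>\<tau>. f (q + \<tau> *\<^sub>R h + b *\<^sub>R k)) has_derivative (\<lambda>z. f1 (q + a *\<^sub>R h + b *\<^sub>R k) (z *\<^sub>R h))) (at a)"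
      by (rule has_derivative_compose[where g = f and g' = "f1 (q + a *\<^sub>R h + b *\<^sub>R k)" and f = "\<lambda>\<tau>. q + \<tau> *\<^sub>R h + b *\<^sub>R k" and f' = "\<lambda>z. z *\<^sub>R h"])
        (auto intro!: derivative_eq_intros f1 inb that)
    moreover have "f1 (q + a *\<^sub>R h + b *\<^sub>R k) (z *\<^sub>R h) = f1 (q + a *\<^sub>R h + b *\<^sub>R k) h * z" for z
      using linear_cmul[OF has_derivative_linear[OF f1[OF inb[OF that]]]] by simp
    ultimately show ?thesis by (simp add: has_field_derivative_def)
  qed
  have d2: "((\<lambda>\<sigma>. f1 (q + a *\<^sub>R h + \<sigma> *\<^sub>R k) h) has_real_derivative f2 (q + a *\<^sub>R h + b *\<^sub>R k) k h) (at b)"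
    if "0 \<le> a" "a \<le> s" "0 \<le> b" "b \<le> s" for a b
  proof -
    have "((\<lambda>\<sigma>. f1 (q + a *\<^sub>R h + \<sigma> *\<^sub>R k) h) has_derivative (\<lambda>z. f2 (q + a *\<^sub>R h + b *\<^sub>R k) (z *\<^sub>R k) h)) (at b)"
      by (rule has_derivative_compose[where g = "\<lambda>x. f1 x h" and g' = "\<lambda>z. f2 (q + a *\<^sub>R h + b *\<^sub>R k) z h" and f = "\<lambda>\<sigma>. q + a *\<^sub>R h + \<sigma> *\<^sub>R k" and f' = "\<lambda>z. z *\<^sub>R k"])
        (auto intro!: derivative_eq_intros f2 inb that)
    moreover have "f2 (q + a *\<^sub>R h + b *\<^sub>R k) (z *\<^sub>R k) h = f2 (q + a *\<^sub>R h + b *\<^sub>R k) k h * z" for z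
      using linear_cmul[OF has_derivative_linear[OF f2[OF inb[OF that], of h]]] by simp
    ultimately show ?thesis by (simp add: has_field_derivative_def)
  qed
  obtain a where a: "0 < a" "a < s" "(f (q + s *\<^sub>R h + s *\<^sub>R k) - f (q + s *\<^sub>R h + 0 *\<^sub>R k)) - (f (q + 0 *\<^sub>R h + s *\<^sub>R k) - f (q + 0 *\<^sub>R h + 0 *\<^sub>R k))
      = (s - 0) * (f1 (q + a *\<^sub>R h + s *\<^sub>R k) h - f1 (q + a *\<^sub>R h + 0 *\<^sub>R k) h)"
    using MVT2[of 0 s "\<lambda>\<tau>. f (q + \<tau> *\<^sub>R h + s *\<^sub>R k) - f (q + \<tau> *\<^sub>R h + 0 *\<^sub>R k)"
        "\<lambda>\<tau>. f1 (q + \<tau> *\<^sub>R h + s *\<^sub>R k) h - f1 (q + \<tau> *\<^sub>R h + 0 *\<^sub>R k) h"] s(1) d1 by (force intro!: DERIV_diff)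
  obtain b where b: "0 < b" "b < s" "f1 (q + a *\<^sub>R h + s *\<^sub>R k) h - f1 (q + a *\<^sub>R h + 0 *\<^sub>R k) h
      = (s - 0) * f2 (q + a *\<^sub>R h + b *\<^sub>R k) k h"
    using MVT2[of 0 s "\<lambda>\<sigma>. f1 (q + a *\<^sub>R h + \<sigma> *\<^sub>R k) h" "\<lambda>\<sigma>. f2 (q + a *\<^sub>R h + \<sigma> *\<^sub>R k) k h"] s(1) a d2
    by (meson less_eq_real_def)
  show thesis
    by (rule that[OF inb[of a b]]) (use a b in \<open>auto simp: power2_eq_square algebra_simps\<close>)
qed

text \<open>The second difference does not depend on the order of the directions. Computed in both
  orders it yields values of the two mixed derivatives at points near \<open>q\<close>, and
  continuity transfers the equality to \<open>q\<close>.\<close>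

lemma second_derivative_symmetric:
  fixes f :: "'e::real_normed_vector \<Rightarrow> real"
  assumes S: "open S" "q \<in> S" and f1: "\<And>x. x \<in> S \<Longrightarrow> (f has_derivative f1 x) (at x)"
    and f2: "\<And>x h. x \<in> S \<Longrightarrow> ((\<lambda>x. f1 x h) has_derivative (\<lambda>k. f2 x k h)) (at x)"
    and cont: "\<And>h k. continuous_on S (\<lambda>x. f2 x k h)"
  shows "f2 q k h = f2 q h k"
proof (rule ccontr)
  assume ne: "f2 q k h \<noteq> f2 q h k"
  define e where "e = \<bar>f2 q k h - f2 q h k\<bar> / 2"
  have e: "0 < e" using ne by (simp add: e_def)
  have "\<exists>r>0. ball q r \<subseteq> S \<and> (\<forall>x\<in>ball q r. \<bar>f2 x k h - f2 q k h\<bar> < e)" for k h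
  proof -
    obtain r1 where "r1 > 0" "ball q r1 \<subseteq> S" using S open_contains_ball by blast
    moreover obtain r2 where "r2 > 0" "\<And>x. x \<in> S \<Longrightarrow> dist x q < r2 \<Longrightarrow> dist (f2 x k h) (f2 q k h) < e"
      using cont[of k h] S(2) e unfolding continuous_on_iff by metis
    ultimately show ?thesis
      by (intro exI[of _ "min r1 r2"]) (auto simp: dist_real_def dist_commute subset_iff)
  qed
  then obtain r where r: "\<And>k h. 0 < r k h \<and> ball q (r k h) \<subseteq> S \<and> (\<forall>x\<in>ball q (r k h). \<bar>f2 x k h - f2 q k h\<bar> < e)"
    by metis
  define R where "R = min (r k h) (r h k)"
  have R: "0 < R" "ball q R \<subseteq> S" "\<And>x. x \<in> ball q R \<Longrightarrow> \<bar>f2 x k h - f2 q k h\<bar> < e" "\<And>x. x \<in> ball q R \<Longrightarrow> \<bar>f2 x h k - f2 q h k\<bar> < e"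
    using r[of k h] r[of h k] by (auto simp: R_def)
  define s where "s = R / (2 * (norm h + norm k + 1))"
  have n: "0 < norm h + norm k + 1" by (simp add: add_nonneg_pos)
  have s: "0 < s" using R n by (simp add: s_def)
  have s2: "s * (norm h + norm k) < R"
  proof -
    have "s * (norm h + norm k) \<le> s * (norm h + norm k + 1)" using s by simp
    also have "\<dots> = R / 2" using n by (simp add: s_def field_simps)
    finally show ?thesis using R(1) by simp
  qed
  obtain x where x: "x \<in> ball q R" "f (q + s *\<^sub>R h + s *\<^sub>R k) - f (q + s *\<^sub>R h) - f (q + s *\<^sub>R k) + f q = s\<^sup>2 * f2 x k h"
    by (rule second_difference[of q R f f1 f2 s h k]) (use R f1 f2 s s2 in auto)
  obtain y where y: "y \<in> ball q R" "f (q + s *\<^sub>R k + s *\<^sub>R h) - f (q + s *\<^sub>R k) - f (q + s *\<^sub>R h) + f q = s\<^sup>2 * f2 y h k"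
    by (rule second_difference[of q R f f1 f2 s k h]) (use R f1 f2 s s2 in \<open>auto simp: add.commute\<close>)
  have "s\<^sup>2 * f2 x k h = s\<^sup>2 * f2 y h k" using x(2) y(2) by (simp add: algebra_simps)
  then have "f2 x k h = f2 y h k" using s by simp
  then show False using R(3)[OF x(1)] R(4)[OF y(1)] abs_triangle_ineq4[of "f2 x k h - f2 q h k" "f2 x k h - f2 q k h"]
    unfolding e_def by (simp add: abs_minus_commute)
qed

section \<open>Metric, connection and curvature in coordinates\<close>

locale metric_field =
  fixes S :: "'e::euclidean_space set" and g :: "'e \<Rightarrow> 'e \<Rightarrow> 'e \<Rightarrow> real"
  assumes S: "open S"
    and g_lin: "q \<in> S \<Longrightarrow> linear (g q v)"
    and g_sym: "q \<in> S \<Longrightarrow> g q v w = g q w v"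
    and g_pos: "q \<in> S \<Longrightarrow> v \<noteq> 0 \<Longrightarrow> 0 < g q v v"
    and g_cont: "continuous_on S (\<lambda>q. g q v w)"
begin

lemma g_lin': "q \<in> S \<Longrightarrow> linear (\<lambda>v. g q v w)"
proof -
  assume q: "q \<in> S"
  have "(\<lambda>v. g q v w) = g q w" using g_sym[OF q] by auto
  then show ?thesis using g_lin[OF q, of w] by simp
qed

lemma cont_g:
  assumes Q: "continuous_on A Q" "Q ` A \<subseteq> S" and V: "continuous_on A V" and W: "continuous_on A W"
  shows "continuous_on A (\<lambda>x. g (Q x) (V x) (W x))"
proof -
  have in_S: "Q x \<in> S" if "x \<in> A" for x using that Q by auto
  have 0: "continuous_on A (\<lambda>x. g (Q x) a b)" for a b by (rule continuous_on_compose2[OF g_cont Q])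
  have 1: "continuous_on A (\<lambda>x. g (Q x) (V x) b)" for b
    by (rule continuous_on_linear_param[where f = "\<lambda>x v. g (Q x) v b", OF g_lin'[OF in_S] 0 V])
  show ?thesis by (rule continuous_on_linear_param[where f = "\<lambda>x. g (Q x) (V x)", OF g_lin[OF in_S] 1 W])
qed

lemma metric_lower_bound:
  assumes p: "p \<in> S"
  obtains r l where "0 < r" "0 < l" "cball p r \<subseteq> S" "\<And>q v. q \<in> cball p r \<Longrightarrow> l * (norm v)\<^sup>2 \<le> g q v v"
proof -
  obtain r where r: "0 < r" "cball p r \<subseteq> S" using S p open_contains_cball by blast
  have K: "compact (cball p r \<times> sphere (0 :: 'e) 1)" by (intro compact_Times compact_cball compact_sphere)
  have "sphere (0 :: 'e) 1 \<noteq> {}" by simp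
  then have ne: "cball p r \<times> sphere (0 :: 'e) 1 \<noteq> {}" using r by auto
  have "continuous_on (cball p r \<times> sphere (0 :: 'e) 1) (\<lambda>x. g (fst x) (snd x) (snd x))"
    by (intro cont_g continuous_intros) (use r in auto)
  from continuous_attains_inf[OF K ne this] obtain q0 v0 where m: "q0 \<in> cball p r" "norm v0 = 1"
    "\<And>q v. q \<in> cball p r \<Longrightarrow> norm v = 1 \<Longrightarrow> g q0 v0 v0 \<le> g q v v" by force
  have l: "0 < g q0 v0 v0" using g_pos[of q0 v0] m(1,2) r(2) by force
  have "g q0 v0 v0 * (norm v)\<^sup>2 \<le> g q v v" if q: "q \<in> cball p r" for q v
  proof -
    have qS: "q \<in> S" using q r(2) by blast
    define u where "u = (1 / norm v) *\<^sub>R v"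
    show ?thesis
    proof (cases "v = 0")
      case True then show ?thesis using linear_0[OF g_lin[OF qS]] by simp
    next
      case False
      then have "norm u = 1" "v = norm v *\<^sub>R u" by (simp_all add: u_def)
      then have "(norm v)\<^sup>2 * g q0 v0 v0 \<le> (norm v)\<^sup>2 * g q u u" using m(3)[OF q] by (intro mult_left_mono) auto
      also have "\<dots> = g q (norm v *\<^sub>R u) (norm v *\<^sub>R u)"
        using linear_cmul[OF g_lin[OF qS]] linear_cmul[OF g_lin'[OF qS]] by (simp add: power2_eq_square)
      also have "\<dots> = g q v v" using \<open>v = norm v *\<^sub>R u\<close> by simp
      finally show ?thesis by (simp add: mult.commute)
    qed
  qed
  then show thesis using that[OF r(1) l r(2)] by blast
qed

end

text \<open>Only the formal properties of the Christoffel symbols are kept: symmetry, compatibility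
  with the metric and one continuous derivative. \<open>D q h u v\<close> is the derivative of
  \<open>\<Gamma> q u v\<close> at \<open>q\<close> in direction \<open>h\<close>.\<close>

locale local_connection = metric_field S g
  for S :: "'e::euclidean_space set" and g :: "'e \<Rightarrow> 'e \<Rightarrow> 'e \<Rightarrow> real" +
  fixes \<Gamma> :: "'e \<Rightarrow> 'e \<Rightarrow> 'e \<Rightarrow> 'e" and D :: "'e \<Rightarrow> 'e \<Rightarrow> 'e \<Rightarrow> 'e \<Rightarrow> 'e"
  assumes \<Gamma>_lin: "q \<in> S \<Longrightarrow> linear (\<Gamma> q u)"
    and \<Gamma>_sym: "q \<in> S \<Longrightarrow> \<Gamma> q u v = \<Gamma> q v u"
    and g_deriv: "q \<in> S \<Longrightarrow> ((\<lambda>q. g q v w) has_derivative (\<lambda>h. g q (\<Gamma> q h v) w + g q v (\<Gamma> q h w))) (at q)"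
    and \<Gamma>_deriv: "q \<in> S \<Longrightarrow> ((\<lambda>q. \<Gamma> q u v) has_derivative (\<lambda>h. D q h u v)) (at q)"
    and D_cont: "continuous_on S (\<lambda>q. D q h u v)"
begin

lemma \<Gamma>_lin': "q \<in> S \<Longrightarrow> linear (\<lambda>u. \<Gamma> q u v)"
proof -
  assume q: "q \<in> S"
  have "(\<lambda>u. \<Gamma> q u v) = \<Gamma> q v" using \<Gamma>_sym[OF q] by auto
  then show ?thesis using \<Gamma>_lin[OF q, of v] by simp
qed

lemma D_unique:
  assumes "q \<in> S" "\<And>q. q \<in> S \<Longrightarrow> \<Gamma> q u v = f q" "(f has_derivative f') (at q)"
  shows "D q h u v = f' h"
proof -
  have "((\<lambda>q. \<Gamma> q u v) has_derivative f') (at q)"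
    by (rule has_derivative_transform_within_open[OF assms(3) S assms(1)]) (use assms(2) in simp)
  from has_derivative_unique[OF this \<Gamma>_deriv[OF assms(1)]] show ?thesis by metis
qed

lemma D_lin1: "q \<in> S \<Longrightarrow> linear (\<lambda>h. D q h u v)"
  using has_derivative_linear[OF \<Gamma>_deriv] .

lemma D_sym: "q \<in> S \<Longrightarrow> D q h u v = D q h v u"
  by (rule D_unique[of q u v "\<lambda>q. \<Gamma> q v u"]) (auto intro: \<Gamma>_sym \<Gamma>_deriv)

lemma D_lin3: "q \<in> S \<Longrightarrow> linear (D q h u)"
proof (rule linearI)
  fix v w c assume q: "q \<in> S"
  show "D q h u (v + w) = D q h u v + D q h u w"
    by (rule D_unique[OF q, of u "v + w" "\<lambda>q. \<Gamma> q u v + \<Gamma> q u w"])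
      (auto intro!: has_derivative_add \<Gamma>_deriv q linear_add[OF \<Gamma>_lin])
  show "D q h u (c *\<^sub>R v) = c *\<^sub>R D q h u v"
    by (rule D_unique[OF q, of u "c *\<^sub>R v" "\<lambda>q. c *\<^sub>R \<Gamma> q u v"])
      (auto intro!: has_derivative_scaleR_right \<Gamma>_deriv q linear_cmul[OF \<Gamma>_lin])
qed

lemma D_lin2: "q \<in> S \<Longrightarrow> linear (\<lambda>u. D q h u v)"
proof -
  assume q: "q \<in> S"
  have "(\<lambda>u. D q h u v) = D q h v" using D_sym[OF q] by auto
  then show ?thesis using D_lin3[OF q, of h v] by simp
qed

lemmas lin_simps = linear_add[OF g_lin] linear_add[OF g_lin'] linear_diff[OF g_lin] linear_diff[OF g_lin'] linear_cmul[OF g_lin] linear_cmul[OF g_lin']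
  linear_add[OF \<Gamma>_lin] linear_add[OF \<Gamma>_lin'] linear_diff[OF \<Gamma>_lin] linear_diff[OF \<Gamma>_lin'] linear_cmul[OF \<Gamma>_lin] linear_cmul[OF \<Gamma>_lin']
  linear_cmul[OF D_lin1] linear_cmul[OF D_lin2] linear_cmul[OF D_lin3] linear_0[OF g_lin] linear_0[OF g_lin'] linear_0[OF \<Gamma>_lin] linear_0[OF \<Gamma>_lin']

lemma \<Gamma>_cont: "continuous_on S (\<lambda>q. \<Gamma> q u v)"
  using has_derivative_continuous[OF \<Gamma>_deriv] by (simp add: continuous_on_eq_continuous_at[OF S])

lemma cont_\<Gamma>:
  assumes Q: "continuous_on A Q" "Q ` A \<subseteq> S" and V: "continuous_on A V" and W: "continuous_on A W"
  shows "continuous_on A (\<lambda>x. \<Gamma> (Q x) (V x) (W x))"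
proof -
  have in_S: "Q x \<in> S" if "x \<in> A" for x using that Q by auto
  have 0: "continuous_on A (\<lambda>x. \<Gamma> (Q x) a b)" for a b by (rule continuous_on_compose2[OF \<Gamma>_cont Q])
  have 1: "continuous_on A (\<lambda>x. \<Gamma> (Q x) (V x) b)" for b
    by (rule continuous_on_linear_param[where f = "\<lambda>x v. \<Gamma> (Q x) v b", OF \<Gamma>_lin'[OF in_S] 0 V])
  show ?thesis by (rule continuous_on_linear_param[where f = "\<lambda>x. \<Gamma> (Q x) (V x)", OF \<Gamma>_lin[OF in_S] 1 W])
qed

lemma cont_D:
  assumes Q: "continuous_on A Q" "Q ` A \<subseteq> S" and U: "continuous_on A U" and V: "continuous_on A V" and W: "continuous_on A W"
  shows "continuous_on A (\<lambda>x. D (Q x) (U x) (V x) (W x))"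
proof -
  have in_S: "Q x \<in> S" if "x \<in> A" for x using that Q by auto
  have 0: "continuous_on A (\<lambda>x. D (Q x) a b c)" for a b c by (rule continuous_on_compose2[OF D_cont Q])
  have 1: "continuous_on A (\<lambda>x. D (Q x) (U x) b c)" for b c
    by (rule continuous_on_linear_param[where f = "\<lambda>x v. D (Q x) v b c", OF D_lin1[OF in_S] 0 U])
  have 2: "continuous_on A (\<lambda>x. D (Q x) (U x) (V x) c)" for c
    by (rule continuous_on_linear_param[where f = "\<lambda>x v. D (Q x) (U x) v c", OF D_lin2[OF in_S] 1 V])
  show ?thesis by (rule continuous_on_linear_param[where f = "\<lambda>x. D (Q x) (U x) (V x)", OF D_lin3[OF in_S] 2 W])
qed

text \<open>Compatibility with the metric in covariant form:
  \<open>\<Gamma> (c t) c' (V t) + V'\<close> is the covariant derivative of \<open>V\<close> along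
  \<open>c\<close>.\<close>

lemma deriv_g:
  assumes t: "t \<in> I" and c: "c ` I \<subseteq> S" "(c has_vector_derivative c') (at t within I)"
    and V: "(V has_vector_derivative V') (at t within I)" and W: "(W has_vector_derivative W') (at t within I)"
  shows "((\<lambda>t. g (c t) (V t) (W t)) has_vector_derivative
      g (c t) (\<Gamma> (c t) c' (V t) + V') (W t) + g (c t) (V t) (\<Gamma> (c t) c' (W t) + W')) (at t within I)"
proof -
  have q: "c t \<in> S" using t c by auto
  have 0: "((\<lambda>t. g (c t) v w) has_vector_derivative g (c t) (\<Gamma> (c t) c' v) w + g (c t) v (\<Gamma> (c t) c' w)) (at t within I)" for v w
    using vector_derivative_diff_chain_within[OF c(2) has_derivative_at_withinI[OF g_deriv[OF q]]] by (simp add: o_def)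
  have 1: "((\<lambda>t. g (c t) (V t) w) has_vector_derivative (g (c t) (\<Gamma> (c t) c' (V t)) w + g (c t) (V t) (\<Gamma> (c t) c' w)) + g (c t) V' w) (at t within I)" for w
  proof (rule has_vector_derivative_linear_param[where f = "\<lambda>t v. g (c t) v w" and F = "\<lambda>v. g (c t) (\<Gamma> (c t) c' v) w + g (c t) v (\<Gamma> (c t) c' w)", OF _ t _ 0 V])
    show "linear (\<lambda>v. g (c t) (\<Gamma> (c t) c' v) w + g (c t) v (\<Gamma> (c t) c' w))"
      using q by (auto intro!: linearI simp: lin_simps algebra_simps)
  qed (use c g_lin' in auto)
  have "((\<lambda>t. g (c t) (V t) (W t)) has_vector_derivative ((g (c t) (\<Gamma> (c t) c' (V t)) (W t) + g (c t) (V t) (\<Gamma> (c t) c' (W t))) + g (c t) V' (W t)) + g (c t) (V t) W') (at t within I)"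
  proof (rule has_vector_derivative_linear_param[where f = "\<lambda>t w. g (c t) (V t) w" and F = "\<lambda>w. (g (c t) (\<Gamma> (c t) c' (V t)) w + g (c t) (V t) (\<Gamma> (c t) c' w)) + g (c t) V' w", OF _ t _ 1 W])
    show "linear (\<lambda>w. (g (c t) (\<Gamma> (c t) c' (V t)) w + g (c t) (V t) (\<Gamma> (c t) c' w)) + g (c t) V' w)"
      using q by (auto intro!: linearI simp: lin_simps algebra_simps)
  qed (use c g_lin in auto)
  then show ?thesis using q by (simp add: lin_simps algebra_simps)
qed

lemma deriv_\<Gamma>:
  assumes t: "t \<in> I" and c: "c ` I \<subseteq> S" "(c has_vector_derivative c') (at t within I)"
    and V: "(V has_vector_derivative V') (at t within I)" and W: "(W has_vector_derivative W') (at t within I)"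
  shows "((\<lambda>t. \<Gamma> (c t) (V t) (W t)) has_vector_derivative
      D (c t) c' (V t) (W t) + \<Gamma> (c t) V' (W t) + \<Gamma> (c t) (V t) W') (at t within I)"
proof -
  have q: "c t \<in> S" using t c by auto
  have 0: "((\<lambda>t. \<Gamma> (c t) v w) has_vector_derivative D (c t) c' v w) (at t within I)" for v w
    using vector_derivative_diff_chain_within[OF c(2) has_derivative_at_withinI[OF \<Gamma>_deriv[OF q]]] by (simp add: o_def)
  have 1: "((\<lambda>t. \<Gamma> (c t) (V t) w) has_vector_derivative D (c t) c' (V t) w + \<Gamma> (c t) V' w) (at t within I)" for w
    by (rule has_vector_derivative_linear_param[where f = "\<lambda>t v. \<Gamma> (c t) v w" and F = "\<lambda>v. D (c t) c' v w", OF _ t D_lin2[OF q] 0 V])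
      (use c \<Gamma>_lin' in auto)
  show ?thesis
  proof (rule has_vector_derivative_linear_param[where f = "\<lambda>t w. \<Gamma> (c t) (V t) w" and F = "\<lambda>w. D (c t) c' (V t) w + \<Gamma> (c t) V' w", OF _ t _ 1 W])
    show "linear (\<lambda>w. D (c t) c' (V t) w + \<Gamma> (c t) V' w)"
      using linear_compose_add[OF D_lin3[OF q] \<Gamma>_lin[OF q]] .
  qed (use c \<Gamma>_lin in auto)
qed

definition R :: "'e \<Rightarrow> 'e \<Rightarrow> 'e \<Rightarrow> 'e \<Rightarrow> 'e" where
  "R q u v w = D q u v w - D q v u w + \<Gamma> q u (\<Gamma> q v w) - \<Gamma> q v (\<Gamma> q u w)"

text \<open>For the constant field \<open>z\<close>, the second derivative of \<open>g q z z\<close>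
  is symmetric in \<open>h\<close> and \<open>k\<close>. The term
  \<open>g q (\<Gamma> q h z) (\<Gamma> q k z)\<close> is symmetric as well, so the difference of
  the two orders leaves twice the curvature term.\<close>

lemma R_null: 
  assumes q: "q \<in> S"
  shows "g q (R q h k z) z = 0"
proof -
  define f2 where "f2 q k h = 2 * (g q (\<Gamma> q k (\<Gamma> q h z) + D q k h z) z + g q (\<Gamma> q h z) (\<Gamma> q k z))" for q k h
  have "f2 q h k = f2 q k h"
  proof (rule second_derivative_symmetric[OF S q, of "\<lambda>q. g q z z" "\<lambda>q h. 2 * g q (\<Gamma> q h z) z"])
    fix x h assume x: "x \<in> S"
    show "((\<lambda>q. g q z z) has_derivative (\<lambda>h. 2 * g x (\<Gamma> x h z) z)) (at x)"
      using g_deriv[OF x, of z z] g_sym[OF x, of z] by simp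
    have "((\<lambda>q. g q (\<Gamma> q h z) z) has_derivative (\<lambda>k. g x (\<Gamma> x k (\<Gamma> x h z) + D x k h z) z + g x (\<Gamma> x h z) (\<Gamma> x k z))) (at x)"
    proof -
      \<comment> \<open>The field inserted into \<open>g\<close> now varies with \<open>q\<close>,
        so it is expanded in the basis before differentiation.\<close>
      have eq: "g q (\<Gamma> q h z) z = (\<Sum>b\<in>Basis. (\<Gamma> q h z \<bullet> b) * g q b z)" if "q \<in> S" for q
        using linear_Basis_expand[OF g_lin'[OF that], of "\<Gamma> q h z" z] by simp
      have "((\<lambda>q. \<Sum>b\<in>Basis. (\<Gamma> q h z \<bullet> b) * g q b z) has_derivative
          (\<lambda>k. \<Sum>b\<in>Basis. (\<Gamma> x h z \<bullet> b) * (g x (\<Gamma> x k b) z + g x b (\<Gamma> x k z)) + (D x k h z \<bullet> b) * g x b z)) (at x)"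
        by (intro has_derivative_sum has_derivative_mult g_deriv[OF x] has_derivative_inner_left \<Gamma>_deriv[OF x])
      then have *: "((\<lambda>q. g q (\<Gamma> q h z) z) has_derivative
          (\<lambda>k. \<Sum>b\<in>Basis. (\<Gamma> x h z \<bullet> b) * (g x (\<Gamma> x k b) z + g x b (\<Gamma> x k z)) + (D x k h z \<bullet> b) * g x b z)) (at x)"
        by (rule has_derivative_transform_within_open[OF _ S x]) (simp add: eq)
      have l: "linear (\<lambda>v. g x (\<Gamma> x k v) z + g x v (\<Gamma> x k z))" for k
        using x by (auto intro!: linearI simp: lin_simps algebra_simps)
      have "(\<Sum>b\<in>Basis. (\<Gamma> x h z \<bullet> b) * (g x (\<Gamma> x k b) z + g x b (\<Gamma> x k z)) + (D x k h z \<bullet> b) * g x b z)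
          = g x (\<Gamma> x k (\<Gamma> x h z) + D x k h z) z + g x (\<Gamma> x h z) (\<Gamma> x k z)" for k
        using linear_Basis_expand[OF l, of k "\<Gamma> x h z"] linear_Basis_expand[OF g_lin'[OF x], of "D x k h z" z] x
        by (simp add: sum.distrib lin_simps)
      then show ?thesis using * by simp
    qed
    then show "((\<lambda>q. 2 * g q (\<Gamma> q h z) z) has_derivative (\<lambda>k. f2 x k h)) (at x)"
      unfolding f2_def by (rule has_derivative_mult_right)
  next
    fix h k show "continuous_on S (\<lambda>x. f2 x k h)" unfolding f2_def
      by (intro continuous_intros cont_g cont_\<Gamma> D_cont) auto
  qed
  then show ?thesis using q g_sym[OF q] by (simp add: f2_def R_def lin_simps)
qed

text \<open>Polarization of \<open>R_null\<close>.\<close>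

lemma R_skew:
  assumes q: "q \<in> S"
  shows "g q (R q h k v) w = - g q v (R q h k w)"
proof -
  have lin: "linear (R q h k)"
    unfolding R_def using q linear_add[OF D_lin3[OF q]] linear_cmul[OF D_lin3[OF q]]
    by (auto intro!: linearI simp: lin_simps algebra_simps)
  have "g q (R q h k (v + w)) (v + w) = g q (R q h k v) v + g q (R q h k v) w + g q (R q h k w) v + g q (R q h k w) w"
    using q by (simp add: linear_add[OF lin] lin_simps)
  then have "g q (R q h k v) w + g q (R q h k w) v = 0" using R_null[OF q, of h k] by simp
  then show ?thesis using g_sym[OF q, of v] by simp
qed

end

locale local_metric = local_connection S g \<Gamma> D
  for S :: "'e::euclidean_space set" and g :: "'e \<Rightarrow> 'e \<Rightarrow> 'e \<Rightarrow> real"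
    and \<Gamma> :: "'e \<Rightarrow> 'e \<Rightarrow> 'e \<Rightarrow> 'e" and D :: "'e \<Rightarrow> 'e \<Rightarrow> 'e \<Rightarrow> 'e \<Rightarrow> 'e" +
  assumes curvature_nonpos: "q \<in> S \<Longrightarrow> g q (R q u v v) u \<le> 0"

section \<open>Second variation of the energy\<close>

context local_metric
begin

text \<open>\<open>Phi\<close> is the second derivative of half the squared speed when the curve \<open>c\<close>, with \<open>c t = q\<close> and \<open>c' t = u\<close>,
  is moved linearly in the direction of a field with value \<open>j\<close> and derivative \<open>w\<close>. Along a geodesic \<open>c\<close> and for a
  field \<open>J\<close>, \<open>varX\<close> is the derivative of \<open>g(c', J + \<Gamma>(J,J)/2)\<close> and \<open>varY\<close> that of \<open>g(J,J)\<close>.\<close>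

definition Phi :: "'e \<Rightarrow> 'e \<Rightarrow> 'e \<Rightarrow> 'e \<Rightarrow> real" where
  "Phi q u j w = g q (w + \<Gamma> q j u) (w + \<Gamma> q j u) + g q u (2 *\<^sub>R \<Gamma> q j w + D q j j u + \<Gamma> q j (\<Gamma> q j u))"

definition varX :: "'e \<Rightarrow> 'e \<Rightarrow> 'e \<Rightarrow> 'e \<Rightarrow> real" where
  "varX q u j w = g q u (w + \<Gamma> q u j + (1/2) *\<^sub>R (D q u j j + 2 *\<^sub>R \<Gamma> q j w + \<Gamma> q u (\<Gamma> q j j)))"

definition varY :: "'e \<Rightarrow> 'e \<Rightarrow> 'e \<Rightarrow> 'e \<Rightarrow> real" where
  "varY q u j w = 2 * g q j (w + \<Gamma> q u j)"

text \<open>The left side collects the first- and second-order terms of the energy when position and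
  velocity are displaced by \<open>j\<close> and \<open>w\<close>. A straight displacement has
  covariant acceleration \<open>\<Gamma> q j j\<close>, half of which is the correction in
  \<open>varX\<close>; skew-symmetry of the curvature brings the remainder to a square and a
  curvature term.\<close>

lemma second_variation_identity:
  assumes q: "q \<in> S"
  shows "g q u (w + \<Gamma> q j u) + Phi q u j w / 2 =
    varX q u j w + g q (w + \<Gamma> q u j) (w + \<Gamma> q u j) / 2 - g q (R q j u u) j / 2"
proof -
  have sk: "g q (R q j u u) j = - g q u (R q j u j)" using R_skew[OF q] .
  have r: "g q u (R q j u j) = g q u (D q j j u) - g q u (D q u j j) + g q u (\<Gamma> q j (\<Gamma> q u j)) - g q u (\<Gamma> q u (\<Gamma> q j j))"
    using q D_sym[OF q, of j u j] by (simp add: R_def lin_simps)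
  show ?thesis
    unfolding sk r Phi_def varX_def \<Gamma>_sym[OF q, of j u] using q by (simp add: lin_simps algebra_simps add_divide_distrib diff_divide_distrib)
qed

lemma energy_taylor:
  assumes seg: "\<And>\<tau>. \<tau> \<in> {0..1} \<Longrightarrow> q + \<tau> *\<^sub>R j \<in> S"
  obtains \<theta> where "\<theta> \<in> {0..1}" "g (q + j) (u + w) (u + w) / 2 =
    g q u u / 2 + g q u (w + \<Gamma> q j u) + Phi (q + \<theta> *\<^sub>R j) (u + \<theta> *\<^sub>R w) j w / 2"
proof -
  \<comment> \<open>An open set of parameters containing the unit interval, so that derivatives are
    two-sided at 0 and 1 as well.\<close>
  define I where "I = {\<tau>. q + \<tau> *\<^sub>R j \<in> S}"
  have I: "open I" 
  proof -
    have "continuous_on UNIV (\<lambda>\<tau>. q + \<tau> *\<^sub>R j)" by (intro continuous_intros)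
    from open_vimage[OF S this] show ?thesis by (simp add: I_def vimage_def)
  qed
  define c where "c \<tau> = q + \<tau> *\<^sub>R j" for \<tau>
  define V where "V \<tau> = u + \<tau> *\<^sub>R w" for \<tau>
  have cI: "c ` I \<subseteq> S" by (auto simp: c_def I_def)
  have dc: "(c has_vector_derivative j) (at t within I)" "(V has_vector_derivative w) (at t within I)" for t
    unfolding c_def[abs_def] V_def[abs_def] by (auto intro!: derivative_eq_intros)
  have q: "c t \<in> S" if "t \<in> I" for t using cI that by auto
  define e where "e \<tau> = g (c \<tau>) (V \<tau>) (V \<tau>) / 2" for \<tau>
  define e' where "e' \<tau> = g (c \<tau>) (V \<tau>) (w + \<Gamma> (c \<tau>) j (V \<tau>))" for \<tau>
  define e'' where "e'' \<tau> = Phi (c \<tau>) (V \<tau>) j w" for \<tau>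
  have d1: "(e has_real_derivative e' t) (at t)" if t: "t \<in> I" for t
  proof -
    have "(e has_vector_derivative e' t) (at t within I)"
      unfolding e_def[abs_def] e'_def
      using has_vector_derivative_divide[OF deriv_g[OF t cI dc(1)[of t] dc(2)[of t] dc(2)[of t]], of 2] q[OF t] g_sym[OF q[OF t], of _ "V t"]
      by (simp add: add.commute)
    then show ?thesis using at_within_open[OF t I] by (simp add: has_real_derivative_iff_has_vector_derivative)
  qed
  have d2: "(e' has_real_derivative e'' t) (at t)" if t: "t \<in> I" for t
  proof -
    have "((\<lambda>\<tau>. w + \<Gamma> (c \<tau>) j (V \<tau>)) has_vector_derivative D (c t) j j (V t) + \<Gamma> (c t) 0 (V t) + \<Gamma> (c t) j w) (at t within I)"
      using has_vector_derivative_add[OF has_vector_derivative_const deriv_\<Gamma>[OF t cI dc(1)[of t] has_vector_derivative_const[of j] dc(2)[of t]], of w]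
      by simp
    from deriv_g[OF t cI dc(1)[of t] dc(2)[of t] this]
    have "(e' has_vector_derivative e'' t) (at t within I)"
      unfolding e'_def[abs_def] e''_def Phi_def using q[OF t] by (simp add: lin_simps algebra_simps scaleR_2)
    then show ?thesis using at_within_open[OF t I] by (simp add: has_real_derivative_iff_has_vector_derivative)
  qed
  have sub: "t \<in> I" if "0 \<le> t" "t \<le> 1" for t using seg[of t] that by (simp add: I_def)
  have "\<exists>t>0. t < 1 \<and> e 1 = (\<Sum>m<2. ((\<lambda>m. if m = 0 then e else if m = 1 then e' else e'') m 0 / fact m) * (1 - 0) ^ m)
      + ((\<lambda>m. if m = 0 then e else if m = (1::nat) then e' else e'') 2 t / fact 2) * (1 - 0)\<^sup>2"
  proof (rule Taylor_up)
    show "\<forall>m t. m < 2 \<and> 0 \<le> t \<and> t \<le> 1 \<longrightarrow>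
        ((if m = 0 then e else if m = 1 then e' else e'') has_real_derivative (if Suc m = 0 then e else if Suc m = 1 then e' else e'') t) (at t)"
      using d1 d2 sub by (auto simp: less_2_cases_iff)
  qed auto
  then obtain \<theta> where "0 < \<theta>" "\<theta> < 1" "e 1 = e 0 + e' 0 + e'' \<theta> / 2"
    by (auto simp: numeral_2_eq_2)
  then show thesis using that[of \<theta>] by (simp add: e_def e'_def e''_def c_def V_def)
qed

lemma Phi_scale:
  assumes q: "q \<in> S"
  shows "Phi q u (a *\<^sub>R j) (a *\<^sub>R w) = a\<^sup>2 * Phi q u j w"
proof -
  have "D q (a *\<^sub>R j) (a *\<^sub>R j) u = a\<^sup>2 *\<^sub>R D q j j u" "\<Gamma> q (a *\<^sub>R j) (a *\<^sub>R w) = a\<^sup>2 *\<^sub>R \<Gamma> q j w"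
    "\<Gamma> q (a *\<^sub>R j) (\<Gamma> q (a *\<^sub>R j) u) = a\<^sup>2 *\<^sub>R \<Gamma> q j (\<Gamma> q j u)" "a *\<^sub>R w + \<Gamma> q (a *\<^sub>R j) u = a *\<^sub>R (w + \<Gamma> q j u)"
    using q by (simp_all add: lin_simps power2_eq_square scaleR_right_distrib)
  then show ?thesis unfolding Phi_def using q by (simp add: lin_simps power2_eq_square algebra_simps)
qed

text \<open>\<open>Phi\<close> is homogeneous of degree 2 in \<open>(j, w)\<close>, so these may be
  normalized, and on the compact set of normalized data \<open>Phi\<close> is uniformly continuous.
  Scaling back makes the error relative to the squared norm.\<close>

lemma Phi_uniform:
  assumes \<rho>: "0 < \<rho>" "cball p (2 * \<rho>) \<subseteq> S" "2 * \<rho> \<le> 1" and \<epsilon>: "0 < \<epsilon>"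
  obtains e where "0 < e" "e \<le> \<rho>"
    "\<And>q u j w \<theta>. q \<in> cball p \<rho> \<Longrightarrow> norm u \<le> \<rho> \<Longrightarrow> norm j \<le> e \<Longrightarrow> norm w \<le> e \<Longrightarrow> \<theta> \<in> {0..1} \<Longrightarrow>
      \<bar>Phi (q + \<theta> *\<^sub>R j) (u + \<theta> *\<^sub>R w) j w - Phi q u j w\<bar> \<le> \<epsilon> * ((norm j)\<^sup>2 + (norm w)\<^sup>2)"
proof -
  define K where "K = (cball p (2 * \<rho>) \<times> cball (0 :: 'e) 1) \<times> (cball (0 :: 'e) 1 \<times> cball (0 :: 'e) 1)"
  have K: "compact K" unfolding K_def by (intro compact_Times compact_cball)
  have "continuous_on K (\<lambda>z. Phi (fst (fst z)) (snd (fst z)) (fst (snd z)) (snd (snd z)))"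
    unfolding Phi_def
    by (intro continuous_intros cont_g cont_\<Gamma> cont_D) (use \<rho> in \<open>auto simp: K_def\<close>)
  from compact_uniformly_continuous[OF this K] obtain d where d: "0 < d"
    "\<And>z z'. z \<in> K \<Longrightarrow> z' \<in> K \<Longrightarrow> dist z' z < d \<Longrightarrow>
      dist (Phi (fst (fst z')) (snd (fst z')) (fst (snd z')) (snd (snd z'))) (Phi (fst (fst z)) (snd (fst z)) (fst (snd z)) (snd (snd z))) < \<epsilon>"
    unfolding uniformly_continuous_on_def using \<epsilon> by meson
  note sub = \<rho>(2)
  define e where "e = min \<rho> (d / 4)"
  have e: "0 < e" "e \<le> \<rho>" "4 * e \<le> d" using \<rho> d by (auto simp: e_def)
  show thesis
  proof (rule that[OF e(1,2)])
    fix q u j w :: 'e and \<theta> assume a: "q \<in> cball p \<rho>" "norm u \<le> \<rho>" "norm j \<le> e" "norm w \<le> e" "\<theta> \<in> {0..1::real}"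
    have the: "norm (\<theta> *\<^sub>R j) \<le> e" "norm (\<theta> *\<^sub>R w) \<le> e"
      using a by (auto intro: order_trans[OF mult_left_le_one_le])
    then have th: "norm (\<theta> *\<^sub>R j) \<le> \<rho>" "norm (\<theta> *\<^sub>R w) \<le> \<rho>" using e by linarith+
    have q': "q + \<theta> *\<^sub>R j \<in> cball p (2 * \<rho>)"
      using a(1) th(1) norm_triangle_ineq[of "q - p" "\<theta> *\<^sub>R j"] by (simp add: dist_norm norm_minus_commute algebra_simps)
    have q: "q \<in> cball p (2 * \<rho>)" using a(1) \<rho> by auto
    have u': "norm (u + \<theta> *\<^sub>R w) \<le> 2 * \<rho>" using a(2) th(2) norm_triangle_ineq[of u "\<theta> *\<^sub>R w"] by simp
    define n where "n = norm (j, w)"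
    show "\<bar>Phi (q + \<theta> *\<^sub>R j) (u + \<theta> *\<^sub>R w) j w - Phi q u j w\<bar> \<le> \<epsilon> * ((norm j)\<^sup>2 + (norm w)\<^sup>2)"
    proof (cases "n = 0")
      case True
      then have "j = 0" "w = 0" by (auto simp: n_def zero_prod_def)
      then show ?thesis by simp
    next
      case False
      then have n: "0 < n" by (simp add: n_def)
      have n2: "n\<^sup>2 = (norm j)\<^sup>2 + (norm w)\<^sup>2" by (simp add: n_def norm_prod_def)
      define j' where "j' = (1 / n) *\<^sub>R j" define w' where "w' = (1 / n) *\<^sub>R w"
      have jw: "j = n *\<^sub>R j'" "w = n *\<^sub>R w'" using n by (auto simp: j'_def w'_def)
      have "norm j \<le> n" "norm w \<le> n" unfolding n_def by (rule norm_fst_le, rule norm_snd_le)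
      then have unit: "norm j' \<le> 1" "norm w' \<le> 1" using n by (auto simp: j'_def w'_def)
      have in_K: "((q + \<theta> *\<^sub>R j, u + \<theta> *\<^sub>R w), (j', w')) \<in> K" "((q, u), (j', w')) \<in> K"
        using unit q q' u' a(2) \<rho> unfolding K_def by auto
      have "dist ((q + \<theta> *\<^sub>R j, u + \<theta> *\<^sub>R w), (j', w')) ((q, u), (j', w')) = norm (\<theta> *\<^sub>R j, \<theta> *\<^sub>R w)"
        by (simp add: dist_prod_def dist_norm norm_prod_def)
      also have "\<dots> \<le> norm (\<theta> *\<^sub>R j) + norm (\<theta> *\<^sub>R w)" by (rule norm_Pair_le)
      also have "\<dots> < d" using the e by linarith
      finally have "\<bar>Phi (q + \<theta> *\<^sub>R j) (u + \<theta> *\<^sub>R w) j' w' - Phi q u j' w'\<bar> < \<epsilon>"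
        using d(2)[OF in_K(2,1)] by (simp add: dist_real_def)
      then have "n\<^sup>2 * \<bar>Phi (q + \<theta> *\<^sub>R j) (u + \<theta> *\<^sub>R w) j' w' - Phi q u j' w'\<bar> \<le> n\<^sup>2 * \<epsilon>"
        by (intro mult_left_mono) auto
      moreover have "Phi (q + \<theta> *\<^sub>R j) (u + \<theta> *\<^sub>R w) j w - Phi q u j w = n\<^sup>2 * (Phi (q + \<theta> *\<^sub>R j) (u + \<theta> *\<^sub>R w) j' w' - Phi q u j' w')"
      proof -
        have "Phi x v j w = n\<^sup>2 * Phi x v j' w'" if "x \<in> S" for x v
          using Phi_scale[OF that, of v n j' w'] jw by simp
        from this[of q u] this[of "q + \<theta> *\<^sub>R j" "u + \<theta> *\<^sub>R w"] show ?thesis using q q' sub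
          by (simp only: subsetD right_diff_distrib)
      qed
      ultimately show ?thesis by (simp add: abs_mult n2 mult.commute)
    qed
  qed
qed

text \<open>The Taylor remainder is replaced by its value at the unperturbed point, where the
  identity applies, and the curvature term is dropped by its sign.\<close>

lemma second_variation:
  assumes \<rho>: "0 < \<rho>" "cball p (2 * \<rho>) \<subseteq> S" "2 * \<rho> \<le> 1" and \<epsilon>: "0 < \<epsilon>"
  obtains e where "0 < e" "e \<le> \<rho>"
    "\<And>q u j w. q \<in> cball p \<rho> \<Longrightarrow> norm u \<le> \<rho> \<Longrightarrow> norm j \<le> e \<Longrightarrow> norm w \<le> e \<Longrightarrow>
      varX q u j w + g q (w + \<Gamma> q u j) (w + \<Gamma> q u j) / 2 - \<epsilon> * ((norm j)\<^sup>2 + (norm w)\<^sup>2)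
      \<le> g (q + j) (u + w) (u + w) / 2 - g q u u / 2"
proof -
  obtain e where e: "0 < e" "e \<le> \<rho>"
    "\<And>q u j w \<theta>. q \<in> cball p \<rho> \<Longrightarrow> norm u \<le> \<rho> \<Longrightarrow> norm j \<le> e \<Longrightarrow> norm w \<le> e \<Longrightarrow> \<theta> \<in> {0..1} \<Longrightarrow>
      \<bar>Phi (q + \<theta> *\<^sub>R j) (u + \<theta> *\<^sub>R w) j w - Phi q u j w\<bar> \<le> \<epsilon> * ((norm j)\<^sup>2 + (norm w)\<^sup>2)"
    by (rule Phi_uniform[OF \<rho> \<epsilon>]) blast
  show thesis
  proof (rule that[OF e(1,2)])
    fix q u j w :: 'e assume a: "q \<in> cball p \<rho>" "norm u \<le> \<rho>" "norm j \<le> e" "norm w \<le> e"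
    have q: "q \<in> S" using a(1) \<rho>(1,2) by (auto simp: subset_iff)
    have seg: "q + \<tau> *\<^sub>R j \<in> S" if "\<tau> \<in> {0..1}" for \<tau>
    proof -
      have "norm (\<tau> *\<^sub>R j) \<le> \<rho>" using a(3) e(2) that by (auto intro: order_trans[OF mult_left_le_one_le])
      then have "q + \<tau> *\<^sub>R j \<in> cball p (2 * \<rho>)"
        using a(1) norm_triangle_ineq[of "q - p" "\<tau> *\<^sub>R j"] by (simp add: dist_norm norm_minus_commute algebra_simps)
      then show ?thesis using \<rho>(2) by blast
    qed
    obtain \<theta> where \<theta>: "\<theta> \<in> {0..1}" "g (q + j) (u + w) (u + w) / 2 =
        g q u u / 2 + g q u (w + \<Gamma> q j u) + Phi (q + \<theta> *\<^sub>R j) (u + \<theta> *\<^sub>R w) j w / 2"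
      by (rule energy_taylor[OF seg])
    have "0 \<le> \<epsilon> * ((norm j)\<^sup>2 + (norm w)\<^sup>2)" using \<epsilon> by simp
    then show "varX q u j w + g q (w + \<Gamma> q u j) (w + \<Gamma> q u j) / 2 - \<epsilon> * ((norm j)\<^sup>2 + (norm w)\<^sup>2)
      \<le> g (q + j) (u + w) (u + w) / 2 - g q u u / 2"
      using \<theta>(2) e(3)[OF a \<theta>(1)] second_variation_identity[OF q, of u w j] curvature_nonpos[OF q, of j u]
      unfolding abs_le_iff by linarith
  qed
qed

lemma local_bounds:
  assumes p: "p \<in> S"
  obtains r l C where "0 < r" "0 < l" "0 < C" "cball p r \<subseteq> S"
    "\<And>q v. q \<in> cball p r \<Longrightarrow> l * (norm v)\<^sup>2 \<le> g q v v"
    "\<And>q v w. q \<in> cball p r \<Longrightarrow> \<bar>g q v w\<bar> \<le> C * norm v * norm w"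
    "\<And>q v w. q \<in> cball p r \<Longrightarrow> norm (\<Gamma> q v w) \<le> C * norm v * norm w"
    "\<And>q h v w. q \<in> cball p r \<Longrightarrow> norm (D q h v w) \<le> C * norm h * norm v * norm w"
proof -
  obtain r l where rl: "0 < r" "0 < l" "cball p r \<subseteq> S" "\<And>q v. q \<in> cball p r \<Longrightarrow> l * (norm v)\<^sup>2 \<le> g q v v"
    by (rule metric_lower_bound[OF p]) blast
  note r = rl(1,3)
  have qS: "q \<in> S" if "q \<in> cball p r" for q using r that by auto
  define K1 where "K1 = cball p r \<times> cball (0 :: 'e) 1"
  define K2 where "K2 = cball p r \<times> (cball (0 :: 'e) 1 \<times> cball (0 :: 'e) 1)"
  have K: "compact K1" "compact K2" unfolding K1_def K2_def by (intro compact_Times compact_cball)+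
  obtain C1 where C1: "0 < C1" "\<And>x v. x \<in> K1 \<Longrightarrow> norm (g (fst x) (snd x) v) \<le> C1 * norm v"
  proof (rule linear_param_bound[OF K(1), of "\<lambda>x. g (fst x) (snd x)"])
    show "continuous_on K1 (\<lambda>x. g (fst x) (snd x) b)" for b
      by (intro cont_g continuous_intros) (use r in \<open>auto simp: K1_def\<close>)
  qed (use qS g_lin in \<open>auto simp: K1_def\<close>)
  obtain C2 where C2: "0 < C2" "\<And>x v. x \<in> K1 \<Longrightarrow> norm (\<Gamma> (fst x) (snd x) v) \<le> C2 * norm v"
  proof (rule linear_param_bound[OF K(1), of "\<lambda>x. \<Gamma> (fst x) (snd x)"])
    show "continuous_on K1 (\<lambda>x. \<Gamma> (fst x) (snd x) b)" for b
      by (intro cont_\<Gamma> continuous_intros) (use r in \<open>auto simp: K1_def\<close>)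
  qed (use qS \<Gamma>_lin in \<open>auto simp: K1_def\<close>)
  obtain C3 where C3: "0 < C3" "\<And>x v. x \<in> K2 \<Longrightarrow> norm (D (fst x) (fst (snd x)) (snd (snd x)) v) \<le> C3 * norm v"
  proof (rule linear_param_bound[OF K(2), of "\<lambda>x. D (fst x) (fst (snd x)) (snd (snd x))"])
    show "continuous_on K2 (\<lambda>x. D (fst x) (fst (snd x)) (snd (snd x)) b)" for b
      by (intro cont_D continuous_intros) (use r in \<open>auto simp: K2_def\<close>)
  qed (use qS D_lin3 in \<open>auto simp: K2_def\<close>)
  define C where "C = max C1 (max C2 C3)"
  have C: "0 < C" "C1 \<le> C" "C2 \<le> C" "C3 \<le> C" using C1 by (auto simp: C_def)
  \<comment> \<open>Division by zero gives 0, so \<open>unit 0 = 0\<close>; bounding norms by 1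
    covers the zero vector too.\<close>
  define unit :: "'e \<Rightarrow> 'e" where "unit v = (1 / norm v) *\<^sub>R v" for v
  have un: "norm (unit v) \<le> 1" "v = norm v *\<^sub>R unit v" for v by (auto simp: unit_def)
  show thesis
  proof (rule that[OF rl(1,2) C(1) rl(3)])
    fix q assume q: "q \<in> cball p r"
    show "l * (norm v)\<^sup>2 \<le> g q v v" for v using rl(4)[OF q] .
    show "\<bar>g q v w\<bar> \<le> C * norm v * norm w" for v w
    proof -
      have "g q v w = norm v * g q (unit v) w" using qS[OF q] un(2)[of v] linear_cmul[OF g_lin'[OF qS[OF q]], of "norm v" "unit v" w] by simp
      moreover have "\<bar>g q (unit v) w\<bar> \<le> C * norm w"
        using C1(2)[of "(q, unit v)" w] q un(1)[of v] mult_right_mono[OF C(2) norm_ge_zero[of w]] by (auto simp: K1_def)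
      ultimately show ?thesis using mult_left_mono[of "\<bar>g q (unit v) w\<bar>" "C * norm w" "norm v"] by (simp add: abs_mult mult.commute mult.left_commute)
    qed
    show "norm (\<Gamma> q v w) \<le> C * norm v * norm w" for v w
    proof -
      have "\<Gamma> q v w = norm v *\<^sub>R \<Gamma> q (unit v) w" using qS[OF q] un(2)[of v] linear_cmul[OF \<Gamma>_lin'[OF qS[OF q]], of "norm v" "unit v" w] by simp
      moreover have "norm (\<Gamma> q (unit v) w) \<le> C * norm w"
        using C2(2)[of "(q, unit v)" w] q un(1)[of v] mult_right_mono[OF C(3) norm_ge_zero[of w]] by (auto simp: K1_def)
      ultimately show ?thesis using mult_left_mono[of "norm (\<Gamma> q (unit v) w)" "C * norm w" "norm v"] by (simp add: mult.commute mult.left_commute)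
    qed
    show "norm (D q h v w) \<le> C * norm h * norm v * norm w" for h v w
    proof -
      have "D q h v w = norm h *\<^sub>R norm v *\<^sub>R D q (unit h) (unit v) w"
        using un(2)[of v] un(2)[of h] linear_cmul[OF D_lin1[OF qS[OF q]], of "norm h" "unit h" v w]
          linear_cmul[OF D_lin2[OF qS[OF q]], of "unit h" "norm v" "unit v" w] by simp
      moreover have "norm (D q (unit h) (unit v) w) \<le> C * norm w"
        using C3(2)[of "(q, (unit h, unit v))" w] q un(1) mult_right_mono[OF C(4) norm_ge_zero[of w]] by (auto simp: K2_def)
      ultimately show ?thesis using mult_left_mono[of "norm (D q (unit h) (unit v) w)" "C * norm w" "norm h * norm v"] by (simp add: mult.commute mult.left_commute)
    qed
  qed
qed

text \<open>The square of \<open>w + \<Gamma> q u j - \<phi> *\<^sub>R j\<close> is nonnegative. If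
  \<phi> varies in time with \<open>\<phi>' \<le> - \<phi>\<^sup>2\<close>, the left side dominates
  the derivative of \<open>\<phi> * g q j j\<close> along the curve, an exact term that depends only
  on the ends.\<close>

lemma riccati:
  assumes q: "q \<in> S"
  shows "\<phi> * varY q u j w - \<phi>\<^sup>2 * g q j j \<le> g q (w + \<Gamma> q u j) (w + \<Gamma> q u j)"
proof -
  let ?d = "w + \<Gamma> q u j"
  have "0 \<le> g q (?d - \<phi> *\<^sub>R j) (?d - \<phi> *\<^sub>R j)"
    using g_pos[OF q, of "?d - \<phi> *\<^sub>R j"] linear_0[OF g_lin[OF q]] by (cases "?d - \<phi> *\<^sub>R j = 0") auto
  also have "\<dots> = g q ?d ?d - \<phi> * (2 * g q j ?d) + \<phi>\<^sup>2 * g q j j"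
    using g_sym[OF q, of j ?d] by (simp only: linear_diff[OF g_lin[OF q]] linear_diff[OF g_lin'[OF q]] linear_cmul[OF g_lin[OF q]] linear_cmul[OF g_lin'[OF q]])
      (simp add: power2_eq_square algebra_simps)
  finally show ?thesis unfolding varY_def by linarith
qed

text \<open>Riccati's inequality is applied with \<open>\<phi> s = 1 / (s + 1) - s / 4\<close>. Since \<open>\<phi>' + \<phi>\<^sup>2 < 0\<close> on \<open>[0, 1]\<close>, it leaves a
  margin that absorbs the remainder of the Taylor expansion.\<close>

lemma second_variation_minimal:
  assumes p: "p \<in> S"
  obtains \<rho> where "0 < \<rho>" "cball p (2 * \<rho>) \<subseteq> S"
    "\<And>q u j w s. q \<in> cball p \<rho> \<Longrightarrow> norm u \<le> \<rho> \<Longrightarrow> norm j \<le> \<rho> \<Longrightarrow> norm w \<le> \<rho> \<Longrightarrow> s \<in> {0..1} \<Longrightarrow>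
      varX q u j w + ((- 1 / (s + 1)\<^sup>2 - 1 / 4) * g q j j + (1 / (s + 1) - s / 4) * varY q u j w) / 4
      \<le> g (q + j) (u + w) (u + w) / 2 - g q u u / 2"
proof -
  obtain r l C where b: "0 < r" "0 < l" "0 < C" "cball p r \<subseteq> S"
    "\<And>q v. q \<in> cball p r \<Longrightarrow> l * (norm v)\<^sup>2 \<le> g q v v"
    "\<And>q v w. q \<in> cball p r \<Longrightarrow> norm (\<Gamma> q v w) \<le> C * norm v * norm w"
    by (rule local_bounds[OF p]) blast
  \<comment> \<open>This makes the Taylor error at most a sixteenth of the squared covariant
    derivative plus \<open>g q j j / 32\<close>. Of the available half square, a quarter is spent on
    Riccati's inequality, whose margin \<open>g q j j / 8\<close> becomes exactly
    \<open>g q j j / 32\<close>; the rest absorbs the sixteenth.\<close>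
  define \<epsilon> where "\<epsilon> = l / (32 * (1 + 2 * C\<^sup>2))"
  have CC: "0 < 1 + 2 * C\<^sup>2" by (simp add: add_pos_nonneg)
  have \<epsilon>: "0 < \<epsilon>" using b CC by (simp add: \<epsilon>_def)
  define \<rho>0 where "\<rho>0 = min (1 / 2) (r / 2)"
  have \<rho>0: "0 < \<rho>0" "cball p (2 * \<rho>0) \<subseteq> S" "2 * \<rho>0 \<le> 1" "\<rho>0 \<le> r"
    using b subset_cball[of "2 * \<rho>0" r p] by (auto simp: \<rho>0_def)
  obtain e where e: "0 < e" "e \<le> \<rho>0"
    "\<And>q u j w. q \<in> cball p \<rho>0 \<Longrightarrow> norm u \<le> \<rho>0 \<Longrightarrow> norm j \<le> e \<Longrightarrow> norm w \<le> e \<Longrightarrow>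
      varX q u j w + g q (w + \<Gamma> q u j) (w + \<Gamma> q u j) / 2 - \<epsilon> * ((norm j)\<^sup>2 + (norm w)\<^sup>2)
      \<le> g (q + j) (u + w) (u + w) / 2 - g q u u / 2"
    by (rule second_variation[OF \<rho>0(1-3) \<epsilon>]) blast
  define \<rho> where "\<rho> = e"
  have \<rho>: "0 < \<rho>" "\<rho> \<le> \<rho>0" "\<rho> \<le> r" "\<rho> \<le> 1" using \<rho>0 e by (auto simp: \<rho>_def)
  show thesis
  proof (rule that[OF \<rho>(1)])
    show "cball p (2 * \<rho>) \<subseteq> S" using \<rho>0(2) \<rho>(2) subset_cball[of "2 * \<rho>" "2 * \<rho>0" p] by auto
    fix q u j w :: 'e and s assume a: "q \<in> cball p \<rho>" "norm u \<le> \<rho>" "norm j \<le> \<rho>" "norm w \<le> \<rho>" "s \<in> {0..1::real}"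
    have q: "q \<in> S" "q \<in> cball p r" using a(1) b(4) \<rho> by auto
    let ?d = "w + \<Gamma> q u j"
    let ?\<phi> = "1 / (s + 1) - s / 4"
    have nn: "0 \<le> g q j j" "0 \<le> g q ?d ?d" using b(5)[OF q(2)] b(2) by (meson order_trans mult_nonneg_nonneg zero_le_power2 less_imp_le)+
    have "norm w \<le> norm ?d + norm (\<Gamma> q u j)" by (metis norm_triangle_sub add_diff_cancel_left' norm_minus_commute add.commute)
    also have "norm (\<Gamma> q u j) \<le> C * norm j"
    proof -
      have "C * norm u * norm j \<le> C * 1 * norm j" using a \<rho> b by (intro mult_right_mono mult_left_mono) auto
      then show ?thesis using b(6)[OF q(2), of u j] by simp
    qed
    finally have "(norm w)\<^sup>2 \<le> (norm ?d + C * norm j)\<^sup>2" by (intro power_mono) auto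
    also have "\<dots> \<le> 2 * (norm ?d)\<^sup>2 + 2 * C\<^sup>2 * (norm j)\<^sup>2"
      using zero_le_power2[of "norm ?d - C * norm j"] by (simp add: power2_eq_square algebra_simps)
    finally have "l * ((norm j)\<^sup>2 + (norm w)\<^sup>2) \<le> l * (2 * (norm ?d)\<^sup>2 + (1 + 2 * C\<^sup>2) * (norm j)\<^sup>2)"
      using b(2) by (intro mult_left_mono) (auto simp: algebra_simps)
    also have "\<dots> = 2 * (l * (norm ?d)\<^sup>2) + (1 + 2 * C\<^sup>2) * (l * (norm j)\<^sup>2)" by (simp add: algebra_simps)
    also have "\<dots> \<le> 2 * g q ?d ?d + (1 + 2 * C\<^sup>2) * g q j j"
      using b(5)[OF q(2)] CC by (intro add_mono mult_left_mono) auto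
    also have "\<dots> \<le> 2 * ((1 + 2 * C\<^sup>2) * g q ?d ?d) + (1 + 2 * C\<^sup>2) * g q j j"
      using nn(2) by (intro add_right_mono mult_left_mono) (auto simp: algebra_simps)
    finally have "l * ((norm j)\<^sup>2 + (norm w)\<^sup>2) \<le> (1 + 2 * C\<^sup>2) * (2 * g q ?d ?d + g q j j)" by (simp add: algebra_simps)
    then have err: "\<epsilon> * ((norm j)\<^sup>2 + (norm w)\<^sup>2) \<le> (2 * g q ?d ?d + g q j j) / 32"
      using CC unfolding \<epsilon>_def by (simp add: field_simps)
    have phi: "- 1 / (s + 1)\<^sup>2 - 1 / 4 + ?\<phi>\<^sup>2 \<le> - 1 / 8"
    proof -
      have s1: "0 < s + 1" using a(5) by simp
      define x where "x = 1 / (s + 1)"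
      have x: "?\<phi>\<^sup>2 = x\<^sup>2 - x * s / 2 + s\<^sup>2 / 16" "- 1 / (s + 1)\<^sup>2 = - x\<^sup>2"
      proof -
        show "?\<phi>\<^sup>2 = x\<^sup>2 - x * s / 2 + s\<^sup>2 / 16"
          unfolding x_def[symmetric] power2_diff by (simp add: power_divide)
      qed (simp add: x_def power_divide)
      have "0 \<le> x * s" using a(5) by (simp add: x_def)
      moreover have "s\<^sup>2 \<le> 1" using a(5) by (simp add: power_le_one)
      ultimately show ?thesis unfolding x by linarith
    qed
    define Z where "Z = (- 1 / (s + 1)\<^sup>2 - 1 / 4) * g q j j + ?\<phi> * varY q u j w"
    have "Z + g q j j / 8 \<le> g q ?d ?d"
      using riccati[OF q(1), of ?\<phi> u j w] mult_right_mono[OF phi nn(1)]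
      unfolding Z_def distrib_right by linarith
    moreover have "varX q u j w + g q ?d ?d / 2 - \<epsilon> * ((norm j)\<^sup>2 + (norm w)\<^sup>2) \<le> g (q + j) (u + w) (u + w) / 2 - g q u u / 2"
      using e(3)[of q u j w] a \<rho> by (auto simp: \<rho>_def)
    ultimately have "varX q u j w + Z / 4 \<le> g (q + j) (u + w) (u + w) / 2 - g q u u / 2"
      using err nn by argo
    then show "varX q u j w + ((- 1 / (s + 1)\<^sup>2 - 1 / 4) * g q j j + ?\<phi> * varY q u j w) / 4
      \<le> g (q + j) (u + w) (u + w) / 2 - g q u u / 2"
      by (simp only: Z_def)
  qed
qed

end

section \<open>Geodesics of a chart: minimization and comparison of energies\<close>

context local_metric
begin

definition geodesic :: "(real \<Rightarrow> 'e) \<Rightarrow> (real \<Rightarrow> 'e) \<Rightarrow> bool" where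
  "geodesic c v \<longleftrightarrow> (\<forall>t\<in>{0..1}. c t \<in> S \<and> (c has_vector_derivative v t) (at t within {0..1}) \<and>
     (v has_vector_derivative - \<Gamma> (c t) (v t) (v t)) (at t within {0..1}))"

lemma geodesicD:
  assumes "geodesic c v" "t \<in> {0..1}"
  shows "c t \<in> S" "(c has_vector_derivative v t) (at t within {0..1})"
    "(v has_vector_derivative - \<Gamma> (c t) (v t) (v t)) (at t within {0..1})"
  using assms unfolding geodesic_def by auto

lemma geodesic_continuous:
  assumes "geodesic c v"
  shows "continuous_on {0..1} c" "continuous_on {0..1} v" "c ` {0..1} \<subseteq> S"
  using geodesicD[OF assms] has_vector_derivative_continuous by (fastforce simp: continuous_on_eq_continuous_within)+

lemma geodesic_constant_speed:
  assumes geo: "geodesic c v" and t: "t \<in> {0..1}"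
  shows "g (c t) (v t) (v t) = g (c 0) (v 0) (v 0)"
proof -
  have "((\<lambda>t. g (c t) (v t) (v t)) has_vector_derivative 0) (at t within {0..1})" if t: "t \<in> {0..1}" for t
    using deriv_g[OF t geodesic_continuous(3)[OF geo] geodesicD(2)[OF geo t] geodesicD(3)[OF geo t] geodesicD(3)[OF geo t]]
      geodesicD(1)[OF geo t] by (simp add: lin_simps)
  then have "((\<lambda>t. g (c t) (v t) (v t)) has_derivative (\<lambda>_. 0)) (at t within {0..1})" if "t \<in> {0..1}" for t
    using that by (simp add: has_vector_derivative_def)
  from has_derivative_zero_constant[OF convex_real_interval(5) this] obtain k
    where "\<And>t. t \<in> {0..1} \<Longrightarrow> g (c t) (v t) (v t) = k" by blast
  then show ?thesis using t by simp
qed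

text \<open>The factor \<open>r\<close> is the rate of a change of parameter: \<open>q\<close> and
  \<open>u\<close> are a geodesic and its velocity, traversed at rate \<open>r\<close>. This allows
  comparison with curves of variable speed.\<close>

lemma deriv_variation:
  assumes t: "t \<in> I" and q: "q ` I \<subseteq> S" "(q has_vector_derivative r *\<^sub>R u t) (at t within I)"
    and u: "(u has_vector_derivative r *\<^sub>R - \<Gamma> (q t) (u t) (u t)) (at t within I)"
    and j: "(j has_vector_derivative r *\<^sub>R w) (at t within I)"
  shows "((\<lambda>t. g (q t) (u t) (j t + (1/2) *\<^sub>R \<Gamma> (q t) (j t) (j t))) has_vector_derivative r * varX (q t) (u t) (j t) w) (at t within I)"
    and "((\<lambda>t. g (q t) (j t) (j t)) has_vector_derivative r * varY (q t) (u t) (j t) w) (at t within I)"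
proof -
  have qS: "q t \<in> S" using q t by auto
  have "((\<lambda>t. j t + (1/2) *\<^sub>R \<Gamma> (q t) (j t) (j t)) has_vector_derivative
      r *\<^sub>R w + (1/2) *\<^sub>R (D (q t) (r *\<^sub>R u t) (j t) (j t) + \<Gamma> (q t) (r *\<^sub>R w) (j t) + \<Gamma> (q t) (j t) (r *\<^sub>R w))) (at t within I)"
    using has_vector_derivative_scaleR[OF DERIV_const deriv_\<Gamma>[OF t q j j], of "1/2"]
    by (intro has_vector_derivative_add[OF j]) simp
  from deriv_g[OF t q u this]
  show "((\<lambda>t. g (q t) (u t) (j t + (1/2) *\<^sub>R \<Gamma> (q t) (j t) (j t))) has_vector_derivative r * varX (q t) (u t) (j t) w) (at t within I)"
    by (rule has_vector_derivative_eq_rhs)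
      (use qS \<Gamma>_sym[OF qS, of "j t" w] in \<open>simp add: lin_simps varX_def algebra_simps\<close>)
  show "((\<lambda>t. g (q t) (j t) (j t)) has_vector_derivative r * varY (q t) (u t) (j t) w) (at t within I)"
    by (rule has_vector_derivative_eq_rhs[OF deriv_g[OF t q j j]])
      (use qS g_sym[OF qS, of _ "j t"] in \<open>simp add: lin_simps varY_def algebra_simps\<close>)
qed

text \<open>The competitor \<open>\<sigma>\<close> need not have constant speed; it is compared with the geodesic \<open>c \<circ> s\<close>, where \<open>s\<close>
  is proportional to the arc length of \<open>\<sigma>\<close>, perturbed so as to have positive derivative.\<close>

lemma geodesic_minimizes_length:
  assumes p: "p \<in> S"
  obtains \<rho> \<kappa> where "0 < \<rho>" "0 < \<kappa>" "cball p (2 * \<rho>) \<subseteq> S"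
    "\<And>c v \<sigma> \<sigma>' sp F. geodesic c v \<Longrightarrow> (\<And>t. t \<in> {0..1} \<Longrightarrow> c t \<in> cball p \<rho> \<and> norm (v t) \<le> \<rho>) \<Longrightarrow>
      continuous_on {0..1} \<sigma> \<Longrightarrow> \<sigma> 0 = c 0 \<Longrightarrow> \<sigma> 1 = c 1 \<Longrightarrow> (\<And>t. t \<in> {0..1} \<Longrightarrow> \<sigma> t \<in> cball p \<rho>) \<Longrightarrow> finite F \<Longrightarrow>
      (\<And>t. t \<in> {0<..<1} - F \<Longrightarrow> (\<sigma> has_vector_derivative \<sigma>' t) (at t) \<and> sp t = sqrt (g (\<sigma> t) (\<sigma>' t) (\<sigma>' t)) \<and> continuous (at t) sp) \<Longrightarrow>
      sp integrable_on {0..1} \<Longrightarrow> (\<And>t. 0 \<le> sp t) \<Longrightarrow> integral {0..1} sp < \<kappa> \<Longrightarrow>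
      sqrt (g (c 0) (v 0) (v 0)) \<le> integral {0..1} sp"
proof -
  obtain r l where b: "0 < r" "0 < l" "cball p r \<subseteq> S" "\<And>q v. q \<in> cball p r \<Longrightarrow> l * (norm v)\<^sup>2 \<le> g q v v"
    by (rule local_bounds[OF p]) blast
  obtain \<rho>0 where \<rho>0: "0 < \<rho>0" "cball p (2 * \<rho>0) \<subseteq> S"
    "\<And>q u j w s. q \<in> cball p \<rho>0 \<Longrightarrow> norm u \<le> \<rho>0 \<Longrightarrow> norm j \<le> \<rho>0 \<Longrightarrow> norm w \<le> \<rho>0 \<Longrightarrow> s \<in> {0..1} \<Longrightarrow>
      varX q u j w + ((- 1 / (s + 1)\<^sup>2 - 1 / 4) * g q j j + (1 / (s + 1) - s / 4) * varY q u j w) / 4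
      \<le> g (q + j) (u + w) (u + w) / 2 - g q u u / 2"
    by (rule second_variation_minimal[OF p]) blast
  define \<rho> where "\<rho> = min r (\<rho>0 / 2)"
  have \<rho>: "0 < \<rho>" "\<rho> \<le> r" "2 * \<rho> \<le> \<rho>0" using b \<rho>0 by (auto simp: \<rho>_def)
  \<comment> \<open>For a competitor shorter than \<kappa>, the coordinate speed in the new
    parameter is at most \<rho>, which keeps \<open>w\<close> in the range of the second
    variation.\<close>
  define \<kappa> where "\<kappa> = \<rho> * sqrt l / 2"
  have \<kappa>: "0 < \<kappa>" using \<rho> b by (simp add: \<kappa>_def)
  show thesis
  proof (rule that[OF \<rho>(1) \<kappa>])
    show "cball p (2 * \<rho>) \<subseteq> S" using \<rho>0(1,2) \<rho> subset_cball[of "2 * \<rho>" "2 * \<rho>0" p] by auto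
    fix c v \<sigma> \<sigma>' sp F
    assume geo: "geodesic c v" and cb: "\<And>t. t \<in> {0..1} \<Longrightarrow> c t \<in> cball p \<rho> \<and> norm (v t) \<le> \<rho>"
      and \<sigma>: "continuous_on {0..1} \<sigma>" "\<sigma> 0 = c 0" "\<sigma> 1 = c 1" "\<And>t. t \<in> {0..1} \<Longrightarrow> \<sigma> t \<in> cball p \<rho>"
      and F: "finite F"
      and d: "\<And>t. t \<in> {0<..<1} - F \<Longrightarrow> (\<sigma> has_vector_derivative \<sigma>' t) (at t) \<and> sp t = sqrt (g (\<sigma> t) (\<sigma>' t) (\<sigma>' t)) \<and> continuous (at t) sp"
      and sp: "sp integrable_on {0..1}" "\<And>t. 0 \<le> sp t" "integral {0..1} sp < \<kappa>"
    define len where "len = integral {0..1} sp"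
    define L where "L = sqrt (g (c 0) (v 0) (v 0))"
    have len: "0 \<le> len" "len < \<kappa>" using sp by (auto simp: len_def intro: integral_nonneg)
    have c0: "c 0 \<in> S" "c ` {0..1} \<subseteq> S" using geodesic_continuous[OF geo] by auto
    have L2: "L\<^sup>2 = g (c 0) (v 0) (v 0)"
      using g_pos[OF c0(1), of "v 0"] linear_0[OF g_lin[OF c0(1)]] by (cases "v 0 = 0") (auto simp: L_def)
    have main: "L\<^sup>2 \<le> len * (len + e)" if e: "0 < e" "e < \<kappa>" for e
    proof -
      define S0 where "S0 t = integral {0..t} sp" for t
      define s where "s t = (S0 t + e * t) / (len + e)" for t
      define s' where "s' t = (sp t + e) / (len + e)" for t
      have le: "0 < len + e" using len e by simp
      have S0: "0 \<le> S0 t" "S0 t \<le> len" if "t \<in> {0..1}" for t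
      proof -
        have "sp integrable_on {0..t}" using integrable_subinterval_real[OF sp(1), of 0 t] that by auto
        then show "0 \<le> S0 t" "S0 t \<le> len" unfolding S0_def len_def
          using that sp by (auto intro!: integral_nonneg integral_subset_le)
      qed
      have s01: "s t \<in> {0..1}" if "t \<in> {0..1}" for t
      proof -
        have "e * t \<le> e" using that e by simp
        moreover have "0 \<le> e * t" using that e by simp
        ultimately have "0 \<le> S0 t + e * t" "S0 t + e * t \<le> len + e" using S0[OF that] by linarith+
        then show ?thesis using le by (simp add: s_def)
      qed
      have s_ends: "s 0 = 0" "s 1 = 1" using le by (auto simp: s_def S0_def len_def)
      have s'pos: "0 < s' t" for t using sp(2)[of t] e le by (simp add: s'_def add_nonneg_pos)
      have ds: "(s has_real_derivative s' t) (at t)" if t: "t \<in> {0<..<1} - F" for t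
      proof -
        have "(S0 has_vector_derivative sp t) (at t within {0..1})"
          unfolding S0_def[abs_def]
          using integral_has_vector_derivative_continuous_at[OF sp(1), of t "{}"] t d[OF t]
          by (auto intro: continuous_at_imp_continuous_at_within)
        then have "(S0 has_real_derivative sp t) (at t)"
          using t at_within_Icc_at[of 0 t 1] by (simp add: has_real_derivative_iff_has_vector_derivative)
        then show ?thesis unfolding s_def[abs_def] s'_def
          using le by (auto intro!: derivative_eq_intros)
      qed
      define q where "q t = c (s t)" for t
      define u where "u t = v (s t)" for t
      define j where "j t = \<sigma> t - q t" for t
      define w where "w t = (1 / s' t) *\<^sub>R \<sigma>' t - u t" for t
      \<comment> \<open>The exact part of the second variation. It vanishes at both ends, where
        \<open>j = 0\<close>, so its derivative has integral zero and the pointwise bound by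
        \<open>rr\<close> integrates to a comparison of \<open>L\<close> with the length.\<close>
      define \<Psi> where "\<Psi> t = g (q t) (u t) (j t + (1/2) *\<^sub>R \<Gamma> (q t) (j t) (j t)) + (1 / (s t + 1) - s t / 4) * g (q t) (j t) (j t) / 4" for t
      define \<Psi>' where "\<Psi>' t = s' t * varX (q t) (u t) (j t) (w t) +
        ((- 1 / (s t + 1)\<^sup>2 - 1 / 4) * s' t * g (q t) (j t) (j t) + (1 / (s t + 1) - s t / 4) * (s' t * varY (q t) (u t) (j t) (w t))) / 4" for t
      have qS: "q ` {0<..<1} \<subseteq> S" using c0(2) s01 by (force simp: q_def)
      have dPsi: "(\<Psi> has_vector_derivative \<Psi>' t) (at t)" if t: "t \<in> {0<..<1} - F" for t
      proof -
        let ?I = "{0<..<1::real}"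
        have tI: "t \<in> ?I" "t \<in> {0..1}" using t by auto
        have at: "at t within ?I = at t" using at_within_open[OF tI(1)] by simp
        have ds': "(s has_vector_derivative s' t) (at t within ?I)"
          using ds[OF t] unfolding at by (simp add: has_real_derivative_iff_has_vector_derivative)
        have sub: "s ` ?I \<subseteq> {0..1}" using s01 by force
        have dq: "(q has_vector_derivative s' t *\<^sub>R u t) (at t within ?I)"
          using vector_diff_chain_within[OF ds' has_vector_derivative_within_subset[OF geodesicD(2)[OF geo s01[OF tI(2)]] sub]]
          by (simp add: q_def[abs_def] u_def o_def)
        have du: "(u has_vector_derivative s' t *\<^sub>R - \<Gamma> (q t) (u t) (u t)) (at t within ?I)"
          using vector_diff_chain_within[OF ds' has_vector_derivative_within_subset[OF geodesicD(3)[OF geo s01[OF tI(2)]] sub]]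
          by (simp add: q_def u_def[abs_def] o_def)
        have "(\<sigma> has_vector_derivative \<sigma>' t) (at t within ?I)" using d[OF t] unfolding at by blast
        then have dj: "(j has_vector_derivative s' t *\<^sub>R w t) (at t within ?I)"
          unfolding j_def[abs_def] w_def using has_vector_derivative_diff[OF _ dq] s'pos[of t] by (simp add: algebra_simps)
        note 1 = deriv_variation[OF tI(1) qS dq du dj]
        have s1: "s t + 1 \<noteq> 0" using s01[OF tI(2)] by auto
        have dphi: "((\<lambda>t. 1 / (s t + 1) - s t / 4) has_real_derivative (- 1 / (s t + 1)\<^sup>2 - 1 / 4) * s' t) (at t within ?I)"
        proof -
          have "((\<lambda>t. 1 / (s t + 1) - s t / 4) has_real_derivative - (s' t / ((s t + 1) * (s t + 1))) - s' t / 4) (at t within ?I)"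
            using ds[OF t] s1 unfolding at by (auto intro!: derivative_eq_intros)
          then show ?thesis by (simp add: power2_eq_square algebra_simps)
        qed
        have "(\<Psi> has_vector_derivative \<Psi>' t) (at t within ?I)"
          unfolding \<Psi>_def[abs_def] \<Psi>'_def
          by (rule has_vector_derivative_eq_rhs[OF has_vector_derivative_add[OF 1(1)
                has_vector_derivative_divide[OF has_vector_derivative_mult[OF dphi[unfolded has_real_derivative_iff_has_vector_derivative] 1(2)]]]])
            (simp add: algebra_simps)
        then show ?thesis unfolding at .
      qed
      have S0c: "continuous_on {0..1} S0" unfolding S0_def[abs_def] by (rule indefinite_integral_continuous_1[OF sp(1)])
      then have sc: "continuous_on {0..1} s" unfolding s_def[abs_def] using le by (intro continuous_intros) auto
      have ssub: "s ` {0..1} \<subseteq> {0..1}" using s01 by blast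
      have qc: "continuous_on {0..1} q" "continuous_on {0..1} u"
        unfolding q_def[abs_def] u_def[abs_def]
        using continuous_on_compose2[OF geodesic_continuous(1)[OF geo] sc ssub] continuous_on_compose2[OF geodesic_continuous(2)[OF geo] sc ssub] .
      have jc: "continuous_on {0..1} j" unfolding j_def[abs_def] by (intro continuous_intros \<sigma>(1) qc)
      have qS1: "q ` {0..1} \<subseteq> S" using c0(2) s01 by (force simp: q_def)
      have "continuous_on {0..1} \<Psi>" unfolding \<Psi>_def[abs_def]
        by (intro continuous_intros cont_g cont_\<Gamma> qc jc qS1 sc) (use s01 in force)+
      from fundamental_theorem_of_calculus_interior_strong[OF F _ dPsi this]
      have int1: "(\<Psi>' has_integral \<Psi> 1 - \<Psi> 0) {0..1}" by simp
      have "j 0 = 0" "j 1 = 0" using \<sigma>(2,3) s_ends by (auto simp: j_def q_def)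
      moreover have "q 0 \<in> S" "q 1 \<in> S" using qS1 by auto
      ultimately have "\<Psi> 1 - \<Psi> 0 = 0" by (simp add: \<Psi>_def lin_simps)
      \<comment> \<open>The difference of energies after the change of parameter, with
        \<open>(sp t)\<^sup>2 / s' t\<close> replaced by \<open>sp t * (len + e)\<close>; this is an
        upper bound because \<open>sp t \<le> (len + e) * s' t\<close>, and its integral is
        explicit.\<close>
      define rr where "rr t = sp t * (len + e) / 2 - L\<^sup>2 / 2 * s' t" for t
      have int2: "(rr has_integral len * (len + e) / 2 - L\<^sup>2 / 2 * 1) {0..1}"
        unfolding rr_def
      proof (intro has_integral_diff has_integral_mult_right has_integral_divide has_integral_mult_left)
        show hs: "(sp has_integral len) {0..1}" unfolding len_def using sp(1) by (rule integrable_integral)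
        have "((\<lambda>t. (sp t + e) / (len + e)) has_integral (len + e) / (len + e)) {0..1}"
          using has_integral_const_real[of e 0 1] by (intro has_integral_divide has_integral_add hs) simp
        then show "(s' has_integral 1) {0..1}" unfolding s'_def[abs_def] using le by simp
      qed
      have pw: "\<Psi>' t \<le> rr t" if t: "t \<in> {0<..<1} - F" for t
      proof -
        have t1: "t \<in> {0..1}" using t by auto
        have qb: "q t \<in> cball p \<rho>" "norm (u t) \<le> \<rho>" using cb[OF s01[OF t1]] by (auto simp: q_def u_def)
        have q0: "q t \<in> cball p \<rho>0" using qb \<rho> by auto
        have jb: "norm (j t) \<le> \<rho>0"
          using qb(1) \<sigma>(4)[OF t1] \<rho> norm_triangle_ineq4[of "\<sigma> t - p" "q t - p"] by (simp add: j_def dist_norm norm_minus_commute)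
        have spt: "sp t = sqrt (g (\<sigma> t) (\<sigma>' t) (\<sigma>' t))" using d[OF t] by blast
        have \<sigma>r: "\<sigma> t \<in> cball p r" using \<sigma>(4)[OF t1] \<rho> by auto
        then have \<sigma>S: "\<sigma> t \<in> S" using b by auto
        have lb: "l * (norm (\<sigma>' t))\<^sup>2 \<le> g (\<sigma> t) (\<sigma>' t) (\<sigma>' t)" using b(4)[OF \<sigma>r] .
        have sp2: "(sp t)\<^sup>2 = g (\<sigma> t) (\<sigma>' t) (\<sigma>' t)" unfolding spt using lb b(2)
          by (intro real_sqrt_pow2) (meson less_imp_le mult_nonneg_nonneg order_trans zero_le_power2)
        have "sqrt l * norm (\<sigma>' t) \<le> sp t"
          unfolding spt using lb b(2) real_sqrt_le_mono[OF lb] by (simp add: real_sqrt_mult)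
        also have "\<dots> \<le> s' t * (len + e)" using le e by (simp add: s'_def)
        finally have "sqrt l * (norm (\<sigma>' t) / s' t) \<le> len + e" using s'pos[of t] by (simp add: field_simps)
        also have "\<dots> \<le> sqrt l * \<rho>" using len e unfolding \<kappa>_def by (simp add: mult.commute[of "sqrt l"])
        finally have "norm (\<sigma>' t) / s' t \<le> \<rho>" using b(2) mult_le_cancel_left_pos[of "sqrt l" "norm (\<sigma>' t) / s' t" \<rho>] by simp
        then have wb: "norm (w t) \<le> \<rho>0"
          using norm_triangle_ineq4[of "(1 / s' t) *\<^sub>R \<sigma>' t" "u t"] qb(2) \<rho> s'pos[of t] by (simp add: w_def)
        have ub: "norm (u t) \<le> \<rho>0" using qb(2) \<rho> by simp
        have gq: "g (q t) (u t) (u t) = L\<^sup>2" using geodesic_constant_speed[OF geo s01[OF t1]] by (simp add: q_def u_def L2)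
        have qj: "q t + j t = \<sigma> t" "u t + w t = (1 / s' t) *\<^sub>R \<sigma>' t" by (auto simp: j_def w_def)
        have "g (\<sigma> t) ((1 / s' t) *\<^sub>R \<sigma>' t) ((1 / s' t) *\<^sub>R \<sigma>' t) = (sp t)\<^sup>2 / (s' t)\<^sup>2"
          using \<sigma>S by (simp add: lin_simps sp2) (simp add: power2_eq_square)
        then have "varX (q t) (u t) (j t) (w t) + ((- 1 / (s t + 1)\<^sup>2 - 1 / 4) * g (q t) (j t) (j t) + (1 / (s t + 1) - s t / 4) * varY (q t) (u t) (j t) (w t)) / 4
          \<le> (sp t)\<^sup>2 / (s' t)\<^sup>2 / 2 - L\<^sup>2 / 2"
          using \<rho>0(3)[OF q0 ub jb wb s01[OF t1]] unfolding qj gq by simp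
        then have "s' t * (varX (q t) (u t) (j t) (w t) + ((- 1 / (s t + 1)\<^sup>2 - 1 / 4) * g (q t) (j t) (j t) + (1 / (s t + 1) - s t / 4) * varY (q t) (u t) (j t) (w t)) / 4)
          \<le> s' t * ((sp t)\<^sup>2 / (s' t)\<^sup>2 / 2 - L\<^sup>2 / 2)"
          using s'pos[of t] by (intro mult_left_mono) auto
        also have "\<dots> = (sp t)\<^sup>2 / s' t / 2 - L\<^sup>2 / 2 * s' t" using s'pos[of t] by (simp add: power2_eq_square field_simps)
        also have "(sp t)\<^sup>2 / s' t \<le> sp t * (len + e)"
        proof -
          have "sp t / s' t \<le> len + e" using s'pos[of t] le e sp(2)[of t] by (simp add: s'_def divide_simps)
          then show ?thesis using mult_left_mono[OF _ sp(2)[of t]] by (fastforce simp: power2_eq_square)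
        qed
        finally show ?thesis by (simp add: \<Psi>'_def rr_def algebra_simps)
      qed
      \<comment> \<open>At the ends and the finitely many exceptional times the integrand is
        replaced by \<open>rr\<close>, so that the inequality holds everywhere.\<close>
      have "((\<lambda>t. if t \<in> {0<..<1} - F then \<Psi>' t else rr t) has_integral \<Psi> 1 - \<Psi> 0) {0..1}"
        by (rule has_integral_spike_finite[OF _ _ int1, of "F \<union> {0, 1}"]) (use F in auto)
      from has_integral_le[OF this int2] pw have "\<Psi> 1 - \<Psi> 0 \<le> len * (len + e) / 2 - L\<^sup>2 / 2 * 1" by auto
      then show ?thesis using \<open>\<Psi> 1 - \<Psi> 0 = 0\<close> by simp
    qed
    have "L\<^sup>2 \<le> len\<^sup>2"
    proof (rule field_le_epsilon)
      fix e :: real assume e: "0 < e"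
      define e' where "e' = min (\<kappa> / 2) (e / (len + 1))"
      have e': "0 < e'" "e' < \<kappa>" using e \<kappa> len by (auto simp: e'_def)
      have "len * e' \<le> (len + 1) * (e / (len + 1))" using len e e' by (intro mult_mono) (auto simp: e'_def)
      also have "\<dots> = e" using len by simp
      finally show "L\<^sup>2 \<le> len\<^sup>2 + e" using main[OF e'] by (simp add: power2_eq_square algebra_simps)
    qed
    then show "sqrt (g (c 0) (v 0) (v 0)) \<le> integral {0..1} sp"
      using len(1) power2_le_imp_le unfolding L_def[symmetric] len_def[symmetric] by blast
  qed
qed

text \<open>For two geodesics issuing from one point, Riccati's inequality is used with
  \<open>1 / (t + \<eta>)\<close>, which satisfies \<open>\<phi>' = - \<phi>\<^sup>2\<close>; the
  pole arising at 0 as \<eta> tends to 0 is harmless because \<open>j 0 = 0\<close>. At time 1 there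
  remain the first variation and half of \<open>g j j\<close>: the Hessian of half the squared
  distance is at least the metric.\<close>

lemma geodesic_energy_comparison:
  assumes \<rho>: "0 < \<rho>" "cball p (2 * \<rho>) \<subseteq> S" "2 * \<rho> \<le> 1" and \<epsilon>: "0 < \<epsilon>"
  obtains e where "0 < e"
    "\<And>c v c' v' B. geodesic c v \<Longrightarrow> geodesic c' v' \<Longrightarrow> (\<And>t. t \<in> {0..1} \<Longrightarrow> c t \<in> cball p \<rho> \<and> norm (v t) \<le> \<rho>) \<Longrightarrow>
      (\<And>t. t \<in> {0..1} \<Longrightarrow> norm (c' t - c t) \<le> B \<and> norm (v' t - v t) \<le> B) \<Longrightarrow> B \<le> e \<Longrightarrow> c' 0 = c 0 \<Longrightarrow>
      g (c 0) (v 0) (v 0) / 2 + g (c 1) (v 1) ((c' 1 - c 1) + (1/2) *\<^sub>R \<Gamma> (c 1) (c' 1 - c 1) (c' 1 - c 1))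
        + g (c 1) (c' 1 - c 1) (c' 1 - c 1) / 2 - 2 * \<epsilon> * B\<^sup>2 \<le> g (c' 0) (v' 0) (v' 0) / 2"
proof -
  obtain e where e: "0 < e" "e \<le> \<rho>"
    "\<And>q u j w. q \<in> cball p \<rho> \<Longrightarrow> norm u \<le> \<rho> \<Longrightarrow> norm j \<le> e \<Longrightarrow> norm w \<le> e \<Longrightarrow>
      varX q u j w + g q (w + \<Gamma> q u j) (w + \<Gamma> q u j) / 2 - \<epsilon> * ((norm j)\<^sup>2 + (norm w)\<^sup>2)
      \<le> g (q + j) (u + w) (u + w) / 2 - g q u u / 2"
    by (rule second_variation[OF \<rho> \<epsilon>]) blast
  show thesis
  proof (rule that[OF e(1)])
    fix c v c' v' B
    assume geo: "geodesic c v" "geodesic c' v'" and cb: "\<And>t. t \<in> {0..1} \<Longrightarrow> c t \<in> cball p \<rho> \<and> norm (v t) \<le> \<rho>"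
      and B: "\<And>t. t \<in> {0..1} \<Longrightarrow> norm (c' t - c t) \<le> B \<and> norm (v' t - v t) \<le> B" "B \<le> e" and c0: "c' 0 = c 0"
    define j where "j t = c' t - c t" for t
    define w where "w t = v' t - v t" for t
    define E where "E = g (c' 0) (v' 0) (v' 0) / 2 - g (c 0) (v 0) (v 0) / 2"
    define a where "a = g (c 1) (v 1) (j 1 + (1/2) *\<^sub>R \<Gamma> (c 1) (j 1) (j 1))"
    define b where "b = g (c 1) (j 1) (j 1) / 2"
    have cS: "c ` {0..1} \<subseteq> S" using geodesic_continuous(3)[OF geo(1)] .
    have bn: "0 \<le> b" using cS g_pos[of "c 1" "j 1"] linear_0[OF g_lin[of "c 1"]] unfolding b_def
      by (cases "j 1 = 0") (auto simp: image_subset_iff less_imp_le)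
    have main: "a + b / (1 + \<eta>) \<le> E + 2 * \<epsilon> * B\<^sup>2" if \<eta>: "0 < \<eta>" for \<eta>
    proof -
      define \<Psi> where "\<Psi> t = g (c t) (v t) (j t + (1/2) *\<^sub>R \<Gamma> (c t) (j t) (j t)) + 1 / (t + \<eta>) * g (c t) (j t) (j t) / 2" for t
      define \<Psi>' where "\<Psi>' t = varX (c t) (v t) (j t) (w t) + (- (1 / (t + \<eta>))\<^sup>2 * g (c t) (j t) (j t) + 1 / (t + \<eta>) * varY (c t) (v t) (j t) (w t)) / 2" for t
      have d: "(\<Psi> has_vector_derivative \<Psi>' t) (at t within {0..1})" if t: "t \<in> {0..1}" for t
      proof -
        have dj: "(j has_vector_derivative w t) (at t within {0..1})"
          unfolding j_def[abs_def] w_def using geodesicD(2)[OF geo(1) t] geodesicD(2)[OF geo(2) t] by (intro has_vector_derivative_diff)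
        note 1 = deriv_variation[OF t cS, where r = 1, simplified, OF geodesicD(2)[OF geo(1) t] geodesicD(3)[OF geo(1) t] dj]
        have "((\<lambda>t. 1 / (t + \<eta>)) has_real_derivative - (1 / (t + \<eta>))\<^sup>2) (at t within {0..1})"
          using \<eta> t by (auto intro!: derivative_eq_intros simp: power2_eq_square)
        note 2 = this[unfolded has_real_derivative_iff_has_vector_derivative]
        show ?thesis unfolding \<Psi>_def[abs_def] \<Psi>'_def
          using has_vector_derivative_add[OF 1(1) has_vector_derivative_divide[OF has_vector_derivative_mult[OF 2 1(2)], of 2]]
          by (rule has_vector_derivative_eq_rhs) (simp add: algebra_simps)
      qed
      have int1: "(\<Psi>' has_integral \<Psi> 1 - \<Psi> 0) {0..1}"
        by (rule fundamental_theorem_of_calculus) (use d in auto)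
      have int2: "((\<lambda>_::real. E + 2 * \<epsilon> * B\<^sup>2) has_integral (E + 2 * \<epsilon> * B\<^sup>2)) {0..1}"
        using has_integral_const_real[of "E + 2 * \<epsilon> * B\<^sup>2" 0 1] by simp
      have pw: "\<Psi>' t \<le> E + 2 * \<epsilon> * B\<^sup>2" if t: "t \<in> {0..1}" for t
      proof -
        have qS: "c t \<in> S" using cS t by auto
        have jw: "norm (j t) \<le> B" "norm (w t) \<le> B" using B(1)[OF t] by (auto simp: j_def w_def)
        have "varX (c t) (v t) (j t) (w t) + g (c t) (w t + \<Gamma> (c t) (v t) (j t)) (w t + \<Gamma> (c t) (v t) (j t)) / 2 - \<epsilon> * ((norm (j t))\<^sup>2 + (norm (w t))\<^sup>2)
            \<le> g (c t + j t) (v t + w t) (v t + w t) / 2 - g (c t) (v t) (v t) / 2"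
          by (rule e(3)) (use cb[OF t] jw B(2) in auto)
        moreover have "g (c t + j t) (v t + w t) (v t + w t) / 2 - g (c t) (v t) (v t) / 2 = E"
          using geodesic_constant_speed[OF geo(1) t] geodesic_constant_speed[OF geo(2) t] by (simp add: E_def j_def w_def)
        moreover have "\<epsilon> * ((norm (j t))\<^sup>2 + (norm (w t))\<^sup>2) \<le> \<epsilon> * (B\<^sup>2 + B\<^sup>2)"
          using jw \<epsilon> by (intro mult_left_mono add_mono power_mono) auto
        moreover have "1 / (t + \<eta>) * varY (c t) (v t) (j t) (w t) - (1 / (t + \<eta>))\<^sup>2 * g (c t) (j t) (j t)
            \<le> g (c t) (w t + \<Gamma> (c t) (v t) (j t)) (w t + \<Gamma> (c t) (v t) (j t))"
          by (rule riccati[OF qS])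
        ultimately show ?thesis unfolding \<Psi>'_def by argo
      qed
      have "\<Psi> 1 - \<Psi> 0 \<le> E + 2 * \<epsilon> * B\<^sup>2" by (rule has_integral_le[OF int1 int2]) (rule pw)
      moreover have "\<Psi> 0 = 0"
      proof -
        have "j 0 = 0" "c 0 \<in> S" using c0 cS by (auto simp: j_def)
        then show ?thesis by (simp add: \<Psi>_def lin_simps)
      qed
      moreover have "\<Psi> 1 = a + b / (1 + \<eta>)" by (simp add: \<Psi>_def a_def b_def)
      ultimately show ?thesis by simp
    qed
    have "a + b \<le> E + 2 * \<epsilon> * B\<^sup>2"
    proof (rule field_le_epsilon)
      fix z :: real assume z: "0 < z"
      define \<eta> where "\<eta> = z / (b + 1)"
      have \<eta>: "0 < \<eta>" using z bn by (simp add: \<eta>_def)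
      have "b - b * \<eta> \<le> b / (1 + \<eta>)"
      proof -
        have "(b - b * \<eta>) * (1 + \<eta>) = b - b * \<eta>\<^sup>2" by (simp add: algebra_simps power2_eq_square)
        also have "\<dots> \<le> b" using bn by simp
        finally show ?thesis using \<eta> by (simp add: pos_le_divide_eq)
      qed
      moreover have "b * \<eta> \<le> z" using bn z by (simp add: \<eta>_def divide_simps algebra_simps)
      ultimately show "a + b \<le> E + 2 * \<epsilon> * B\<^sup>2 + z" using main[OF \<eta>] by linarith
    qed
    then show "g (c 0) (v 0) (v 0) / 2 + g (c 1) (v 1) ((c' 1 - c 1) + (1/2) *\<^sub>R \<Gamma> (c 1) (c' 1 - c 1) (c' 1 - c 1))
        + g (c 1) (c' 1 - c 1) (c' 1 - c 1) / 2 - 2 * \<epsilon> * B\<^sup>2 \<le> g (c' 0) (v' 0) (v' 0) / 2"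
      by (simp add: a_def b_def E_def j_def)
  qed
qed

end

section \<open>Convexity from second-order support\<close>

text \<open>Peano's form of the remainder. The mean value inequality is applied to the difference
  from the quadratic, whose derivative is controlled by differentiability of \<open>h'\<close> at
  the single point \<open>t0\<close>.\<close>

lemma second_order_expansion:
  fixes h :: "real \<Rightarrow> real"
  assumes h: "\<And>t. \<bar>t - t0\<bar> < r \<Longrightarrow> (h has_real_derivative h' t) (at t)" and r: "0 < r"
    and h': "(h' has_real_derivative D) (at t0)" and \<kappa>: "0 < \<kappa>"
  obtains d where "0 < d" "\<And>\<delta>. \<bar>\<delta>\<bar> < d \<Longrightarrow> \<bar>h (t0 + \<delta>) - h t0 - h' t0 * \<delta> - D / 2 * \<delta>\<^sup>2\<bar> \<le> \<kappa> * \<delta>\<^sup>2"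
proof -
  have "(h' has_derivative (\<lambda>x. D * x)) (at t0)" using h' by (simp add: has_field_derivative_def)
  then obtain d where d: "0 < d" "\<And>t. \<bar>t - t0\<bar> < d \<Longrightarrow> \<bar>h' t - h' t0 - D * (t - t0)\<bar> \<le> \<kappa> * \<bar>t - t0\<bar>"
    using \<kappa> unfolding has_derivative_at_alt by (metis real_norm_def)
  show thesis
  proof (rule that[of "min d r"])
    show "0 < min d r" using d r by simp
    fix \<delta> :: real assume \<delta>: "\<bar>\<delta>\<bar> < min d r"
    define \<psi> where "\<psi> t = h t - h' t0 * (t - t0) - D / 2 * (t - t0)\<^sup>2" for t
    have "norm (\<psi> (t0 + \<delta>) - \<psi> t0) \<le> (\<kappa> * \<bar>\<delta>\<bar>) * norm ((t0 + \<delta>) - t0)"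
    proof (rule field_differentiable_bound[where S = "cball t0 \<bar>\<delta>\<bar>" and f' = "\<lambda>t. h' t - h' t0 - D * (t - t0)"])
      fix t assume "t \<in> cball t0 \<bar>\<delta>\<bar>"
      then have t: "\<bar>t - t0\<bar> \<le> \<bar>\<delta>\<bar>" by (simp add: dist_real_def abs_minus_commute)
      have "(\<psi> has_real_derivative h' t - h' t0 - D * (t - t0)) (at t)"
        unfolding \<psi>_def[abs_def] using h[of t] t \<delta> by (auto intro!: derivative_eq_intros)
      then show "(\<psi> has_real_derivative h' t - h' t0 - D * (t - t0)) (at t within cball t0 \<bar>\<delta>\<bar>)"
        by (rule has_field_derivative_at_within)
      have "\<bar>h' t - h' t0 - D * (t - t0)\<bar> \<le> \<kappa> * \<bar>t - t0\<bar>" using d(2) t \<delta> by simp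
      also have "\<dots> \<le> \<kappa> * \<bar>\<delta>\<bar>" using t \<kappa> by simp
      finally show "norm (h' t - h' t0 - D * (t - t0)) \<le> \<kappa> * \<bar>\<delta>\<bar>" by simp
    qed (auto simp: dist_real_def)
    then show "\<bar>h (t0 + \<delta>) - h t0 - h' t0 * \<delta> - D / 2 * \<delta>\<^sup>2\<bar> \<le> \<kappa> * \<delta>\<^sup>2"
      by (simp add: \<psi>_def power2_eq_square algebra_simps flip: abs_mult)
  qed
qed

text \<open>If the inequality failed, the difference between \<open>f\<close> and its comparison
  parabola, perturbed by a small multiple of \<open>t * (t - 1)\<close>, would have an interior
  maximum. The lower support makes the perturbed function grow quadratically on at least one side of
  that point.\<close>

lemma midpoint_convex_of_support:
  fixes f :: "real \<Rightarrow> real"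
  assumes cont: "continuous_on {0..1} f"
    and supp: "\<And>t. t \<in> {0<..<1} \<Longrightarrow> \<exists>a. \<forall>\<kappa>>0. \<exists>d>0. \<forall>\<delta>. \<bar>\<delta>\<bar> < d \<longrightarrow> f t + a * \<delta> + l * \<delta>\<^sup>2 / 2 - \<kappa> * \<delta>\<^sup>2 \<le> f (t + \<delta>)"
  shows "f (1/2) \<le> f 0 / 2 + f 1 / 2 - l / 8"
proof (rule ccontr)
  assume "\<not> ?thesis"
  then have pos: "0 < f (1/2) - (f 0 / 2 + f 1 / 2 - l / 8)" by simp
  \<comment> \<open>At \<open>1/2\<close> the perturbation costs \<open>\<kappa> / 4\<close>, half
    of the assumed violation, so \<open>h (1/2)\<close> stays positive.\<close>
  define \<kappa> where "\<kappa> = 2 * (f (1/2) - (f 0 / 2 + f 1 / 2 - l / 8))"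
  have \<kappa>: "0 < \<kappa>" using pos by (simp add: \<kappa>_def)
  define h where "h t = f t - l / 2 * t\<^sup>2 - (f 0 * (1 - t) + (f 1 - l / 2) * t) + \<kappa> * (t * (t - 1))" for t
  have h: "h 0 = 0" "h 1 = 0" "0 < h (1/2)" using \<kappa> by (auto simp: h_def \<kappa>_def power2_eq_square field_simps)
  have "continuous_on {0..1} h" unfolding h_def[abs_def] by (intro continuous_intros cont)
  from continuous_attains_sup[OF compact_Icc _ this] obtain t where t: "t \<in> {0..1}" "\<And>s. s \<in> {0..1} \<Longrightarrow> h s \<le> h t"
    by auto
  have "0 < h t" using t(2)[of "1/2"] h by auto
  then have t01: "t \<in> {0<..<1}" using t(1) h by (cases "t = 0 \<or> t = 1") auto
  obtain a d where d: "0 < d" "\<And>\<delta>. \<bar>\<delta>\<bar> < d \<Longrightarrow> f t + a * \<delta> + l * \<delta>\<^sup>2 / 2 - \<kappa> / 2 * \<delta>\<^sup>2 \<le> f (t + \<delta>)"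
    using supp[OF t01] \<kappa> by (meson half_gt_zero)
  define e where "e = min (d / 2) (min (t / 2) ((1 - t) / 2))"
  have "0 < e" "e \<le> d / 2" "e \<le> t / 2" "e \<le> (1 - t) / 2" using d t01 unfolding e_def by (simp, simp, simp, linarith)
  then have e: "0 < e" "e < d" "t - e \<in> {0..1}" "t + e \<in> {0..1}" using d t01 by auto
  have hd: "h t + (a - l * t + f 0 - f 1 + l / 2 + \<kappa> * (2 * t - 1)) * \<delta> + \<kappa> / 2 * \<delta>\<^sup>2 \<le> h (t + \<delta>)" if "\<bar>\<delta>\<bar> < d" for \<delta>
  proof -
    have "h (t + \<delta>) - h t - (a - l * t + f 0 - f 1 + l / 2 + \<kappa> * (2 * t - 1)) * \<delta> - \<kappa> / 2 * \<delta>\<^sup>2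
        = f (t + \<delta>) - (f t + a * \<delta> + l * \<delta>\<^sup>2 / 2 - \<kappa> / 2 * \<delta>\<^sup>2)"
      by (simp add: h_def power2_eq_square field_simps)
    then show ?thesis using d(2)[OF that] by simp
  qed
  define A where "A = a - l * t + f 0 - f 1 + l / 2 + \<kappa> * (2 * t - 1)"
  have "h t + A * e + \<kappa> / 2 * e\<^sup>2 \<le> h t" using hd[of e] t(2)[OF e(4)] e by (simp add: A_def)
  moreover have "h t - A * e + \<kappa> / 2 * e\<^sup>2 \<le> h t" using hd[of "- e"] t(2)[OF e(3)] e by (simp add: A_def)
  moreover have "0 < \<kappa> / 2 * e\<^sup>2" using \<kappa> e by simp
  ultimately show False by linarith
qed

section \<open>The inequality of Bruhat and Tits in coordinates\<close>

context local_metric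
begin

lemma bvp_local:
  assumes p: "p \<in> S" and \<tau>: "0 < \<tau>"
  obtains \<rho> c v where "0 < \<rho>" "4 * \<rho> \<le> \<tau>" "cball p (4 * \<rho>) \<subseteq> S"
    "\<And>x y. x \<in> ball p \<rho> \<Longrightarrow> y \<in> ball p \<rho> \<Longrightarrow> geodesic (c x y) (v x y) \<and> c x y 0 = x \<and> c x y 1 = y"
    "\<And>x y t. x \<in> ball p \<rho> \<Longrightarrow> y \<in> ball p \<rho> \<Longrightarrow> t \<in> {0..1} \<Longrightarrow> c x y t \<in> cball p (4 * \<rho>) \<and> norm (v x y t) \<le> 4 * \<rho>"
    "\<And>x y x' y' t. x \<in> ball p \<rho> \<Longrightarrow> y \<in> ball p \<rho> \<Longrightarrow> x' \<in> ball p \<rho> \<Longrightarrow> y' \<in> ball p \<rho> \<Longrightarrow> t \<in> {0..1} \<Longrightarrow>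
      norm (c x y t - c x' y' t) \<le> 2 * (norm (x - x') + norm (y - y')) \<and>
      norm (v x y t - v x' y' t) \<le> 2 * (norm (x - x') + norm (y - y'))"
    "\<And>x y t. x \<in> ball p \<rho> \<Longrightarrow> y \<in> ball p \<rho> \<Longrightarrow> t \<in> {0..1} \<Longrightarrow>
      norm (c x y t - x) \<le> 2 * norm (x - y) \<and> norm (v x y t) \<le> 2 * norm (x - y)"
proof -
  obtain r C where b: "0 < r" "0 < C" "cball p r \<subseteq> S"
    "\<And>q v w. q \<in> cball p r \<Longrightarrow> norm (\<Gamma> q v w) \<le> C * norm v * norm w"
    "\<And>q h v w. q \<in> cball p r \<Longrightarrow> norm (D q h v w) \<le> C * norm h * norm v * norm w"
    by (rule local_bounds[OF p]) blast
  \<comment> \<open>With \<open>64 * C * \<rho> \<le> 1\<close>, the right-hand side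
    \<open>- \<Gamma> q u u\<close> is bounded by \<rho> and Lipschitz with constant 1/8 on balls of
    radius \<open>4 * \<rho>\<close>; the larger contribution to that constant is
    \<open>8 * C * \<rho>\<close>, from the velocity.\<close>
  define \<rho> where "\<rho> = min (min (r / 4) (\<tau> / 4)) (min (1 / 4) (1 / (64 * C)))"
  have \<rho>: "0 < \<rho>" "4 * \<rho> \<le> r" "4 * \<rho> \<le> \<tau>" "4 * \<rho> \<le> 1" using b \<tau> by (auto simp: \<rho>_def)
  have C\<rho>: "64 * C * \<rho> \<le> 1"
  proof -
    have "\<rho> \<le> 1 / (64 * C)" by (simp add: \<rho>_def)
    then show ?thesis using b(2) by (simp add: field_simps)
  qed
  define F where "F q u = - \<Gamma> q u u" for q u
  have sub: "cball p (4 * \<rho>) \<subseteq> cball p r" using \<rho> by (intro subset_cball) simp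
  have inS: "q \<in> S" if "q \<in> cball p (4 * \<rho>)" for q using that sub b by auto
  have bnd: "norm (\<Gamma> q v w) \<le> C * norm v * norm w" if "q \<in> cball p (4 * \<rho>)" for q v w using b(4) sub that by auto
  have *: "norm (F q u - F q' u') \<le> (norm (q - q') + norm (u - u')) / 8"
    if a: "q \<in> cball p (4 * \<rho>)" "u \<in> cball 0 (4 * \<rho>)" "q' \<in> cball p (4 * \<rho>)" "u' \<in> cball 0 (4 * \<rho>)" for q u q' u'
  proof -
    have u: "norm u \<le> 4 * \<rho>" "norm u' \<le> 4 * \<rho>" using a by auto
    have 1: "norm (\<Gamma> q u u - \<Gamma> q' u u) \<le> C * (4 * \<rho>) * norm (q - q')"
    proof (rule differentiable_bound[where S = "cball p (4 * \<rho>)" and f = "\<lambda>q. \<Gamma> q u u" and f' = "\<lambda>q h. D q h u u"])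
      fix x assume x: "x \<in> cball p (4 * \<rho>)"
      show "((\<lambda>q. \<Gamma> q u u) has_derivative (\<lambda>h. D x h u u)) (at x within cball p (4 * \<rho>))"
        by (rule has_derivative_at_withinI[OF \<Gamma>_deriv[OF inS[OF x]]])
      have "norm (D x h u u) \<le> C * (4 * \<rho>) * norm h" for h
      proof -
        have "norm (D x h u u) \<le> C * norm h * norm u * norm u" using b(5) x sub by blast
        also have "\<dots> \<le> C * norm h * (4 * \<rho>) * 1" using u \<rho> b(2) by (intro mult_mono) auto
        finally show ?thesis by (simp add: mult_ac)
      qed
      then show "onorm (\<lambda>h. D x h u u) \<le> C * (4 * \<rho>)" by (rule onorm_le)
    qed (use a in auto)
    have "\<Gamma> q' u u - \<Gamma> q' u' u' = \<Gamma> q' (u - u') u + \<Gamma> q' u' (u - u')"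
      using inS[OF a(3)] by (simp add: lin_simps)
    then have "norm (\<Gamma> q' u u - \<Gamma> q' u' u') \<le> C * norm (u - u') * norm u + C * norm u' * norm (u - u')"
      using norm_triangle_ineq[of "\<Gamma> q' (u - u') u" "\<Gamma> q' u' (u - u')"] bnd[OF a(3), of "u - u'" u] bnd[OF a(3), of u' "u - u'"]
      by (simp only:)
    also have "\<dots> \<le> C * norm (u - u') * (4 * \<rho>) + C * (4 * \<rho>) * norm (u - u')"
      using u b(2) \<rho>(1) by (intro add_mono mult_mono) auto
    finally have 2: "norm (\<Gamma> q' u u - \<Gamma> q' u' u') \<le> 8 * C * \<rho> * norm (u - u')" by (simp add: algebra_simps)
    have "4 * C * \<rho> \<le> 1 / 8" "8 * C * \<rho> \<le> 1 / 8" using C\<rho> b(2) \<rho>(1) by auto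
    then have "C * (4 * \<rho>) * norm (q - q') \<le> 1 / 8 * norm (q - q')" "8 * C * \<rho> * norm (u - u') \<le> 1 / 8 * norm (u - u')"
      by (intro mult_right_mono; simp)+
    moreover have "norm (F q u - F q' u') \<le> norm (\<Gamma> q u u - \<Gamma> q' u u) + norm (\<Gamma> q' u u - \<Gamma> q' u' u')"
    proof -
      have "norm (F q u - F q' u') = norm ((\<Gamma> q u u - \<Gamma> q' u u) + (\<Gamma> q' u u - \<Gamma> q' u' u'))"
        by (simp add: F_def norm_minus_commute)
      then show ?thesis by (metis norm_triangle_ineq)
    qed
    ultimately show ?thesis using 1 2 by argo
  qed
  have **: "norm (F q u) \<le> \<rho>" if "q \<in> cball p (4 * \<rho>)" "u \<in> cball 0 (4 * \<rho>)" for q u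
  proof -
    have "norm (F q u) \<le> C * norm u * norm u" using bnd[OF that(1), of u u] by (simp add: F_def)
    also have "\<dots> \<le> C * (4 * \<rho>) * (4 * \<rho>)" using that b(2) \<rho>(1) by (intro mult_mono) auto
    also have "\<dots> = (64 * C * \<rho>) * \<rho> / 4" by simp
    also have "\<dots> \<le> 1 * \<rho> / 4" using C\<rho> \<rho>(1) by (intro divide_right_mono mult_right_mono) auto
    finally show ?thesis using \<rho>(1) by simp
  qed
  have F0: "F q 0 = 0" if "q \<in> ball p \<rho>" for q
  proof -
    have "q \<in> S" using that \<rho>(1) by (intro inS) auto
    then show ?thesis by (simp add: F_def lin_simps)
  qed
  obtain c v where cv: "\<And>x y. x \<in> ball p \<rho> \<Longrightarrow> y \<in> ball p \<rho> \<Longrightarrow> c x y 0 = x \<and> c x y 1 = y"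
    "\<And>x y t. x \<in> ball p \<rho> \<Longrightarrow> y \<in> ball p \<rho> \<Longrightarrow> t \<in> {0..1} \<Longrightarrow> c x y t \<in> cball p (4 * \<rho>) \<and> v x y t \<in> cball 0 (4 * \<rho>)
      \<and> (c x y has_vector_derivative v x y t) (at t within {0..1})
      \<and> (v x y has_vector_derivative F (c x y t) (v x y t)) (at t within {0..1})"
    "\<And>x y x' y' t. x \<in> ball p \<rho> \<Longrightarrow> y \<in> ball p \<rho> \<Longrightarrow> x' \<in> ball p \<rho> \<Longrightarrow> y' \<in> ball p \<rho> \<Longrightarrow> t \<in> {0..1} \<Longrightarrow>
      norm (c x y t - c x' y' t) \<le> 2 * (norm (x - x') + norm (y - y')) \<and>
      norm (v x y t - v x' y' t) \<le> 2 * (norm (x - x') + norm (y - y'))"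
    "\<And>x t. x \<in> ball p \<rho> \<Longrightarrow> c x x t = x \<and> v x x t = 0"
    by (rule bvp_solution[OF \<rho>(1) ** * F0]) (assumption+, rule that, assumption+)
  show thesis
  proof (rule that[OF \<rho>(1,3), of c v])
    show "cball p (4 * \<rho>) \<subseteq> S" using inS by blast
    fix x y assume xy: "x \<in> ball p \<rho>" "y \<in> ball p \<rho>"
    show "geodesic (c x y) (v x y) \<and> c x y 0 = x \<and> c x y 1 = y"
      unfolding geodesic_def using cv(1)[OF xy] cv(2)[OF xy] inS by (auto simp: F_def)
    fix t :: real assume t: "t \<in> {0..1}"
    show "c x y t \<in> cball p (4 * \<rho>) \<and> norm (v x y t) \<le> 4 * \<rho>" using cv(2)[OF xy t] by auto
    show "norm (c x y t - x) \<le> 2 * norm (x - y) \<and> norm (v x y t) \<le> 2 * norm (x - y)"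
      using cv(3)[OF xy xy(1) xy(1) t] cv(4)[OF xy(1), of t] by (simp add: norm_minus_commute)
  qed (use cv(3) in blast)
qed

text \<open>\<open>E x y\<close> is the squared speed of the geodesic from \<open>x\<close> to
  \<open>y\<close>, to be identified with the squared distance in \<open>local_distance\<close>.
  Along \<open>c x y\<close>, half of \<open>E z\<close> is supported from below by
  \<open>geodesic_energy_comparison\<close>. The second derivative of the support is
  \<open>E x y\<close>, because the term with \<open>(1/2) *\<^sub>R \<Gamma>\<close> compensates
  the acceleration of \<open>c x y\<close>.\<close>

lemma coordinate_cn:
  assumes \<rho>: "0 < \<rho>" "cball p (8 * \<rho>) \<subseteq> S" "8 * \<rho> \<le> 1"
    and geo: "\<And>x y. x \<in> ball p \<rho> \<Longrightarrow> y \<in> ball p \<rho> \<Longrightarrow> geodesic (c x y) (v x y) \<and> c x y 0 = x \<and> c x y 1 = y"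
    and inb: "\<And>x y t. x \<in> ball p \<rho> \<Longrightarrow> y \<in> ball p \<rho> \<Longrightarrow> t \<in> {0..1} \<Longrightarrow> c x y t \<in> cball p (4 * \<rho>) \<and> norm (v x y t) \<le> 4 * \<rho>"
    and stab: "\<And>x y x' y' t. x \<in> ball p \<rho> \<Longrightarrow> y \<in> ball p \<rho> \<Longrightarrow> x' \<in> ball p \<rho> \<Longrightarrow> y' \<in> ball p \<rho> \<Longrightarrow> t \<in> {0..1} \<Longrightarrow>
      norm (c x y t - c x' y' t) \<le> 2 * (norm (x - x') + norm (y - y')) \<and>
      norm (v x y t - v x' y' t) \<le> 2 * (norm (x - x') + norm (y - y'))"
    and xyz: "x \<in> ball p \<rho>" "y \<in> ball p \<rho>" "z \<in> ball p \<rho>" and cb: "\<And>t. t \<in> {0..1} \<Longrightarrow> c x y t \<in> ball p \<rho>"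
  defines "E \<equiv> \<lambda>x y. g x (v x y 0) (v x y 0)"
  shows "E z (c x y (1/2)) \<le> E z x / 2 + E z y / 2 - E x y / 4"
proof -
  define f where "f t = E z (c x y t) / 2" for t
  have gxy: "geodesic (c x y) (v x y)" using geo xyz by blast
  have zS: "z \<in> S" using \<rho>(1,2) xyz(3) by auto
  have fc: "continuous_on {0..1} f"
  proof -
    have "continuous_on {0..1} (\<lambda>t. v z (c x y t) 0)"
    proof (rule continuous_onI)
      fix t e :: real assume t: "t \<in> {0..1}" and e: "0 < e"
      obtain d where d: "0 < d" "\<And>t'. t' \<in> {0..1} \<Longrightarrow> dist t' t < d \<Longrightarrow> dist (c x y t') (c x y t) < e / 2"
        using geodesic_continuous(1)[OF gxy] t e unfolding continuous_on_iff by (metis half_gt_zero)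
      have "dist (v z (c x y t') 0) (v z (c x y t) 0) \<le> e" if "t' \<in> {0..1}" "dist t' t < d" for t'
        using stab[OF xyz(3) cb[OF that(1)] xyz(3) cb[OF t], of 0] d(2)[OF that] by (simp add: dist_norm)
      then show "\<exists>d>0. \<forall>t'\<in>{0..1}. dist t' t < d \<longrightarrow> dist (v z (c x y t') 0) (v z (c x y t) 0) \<le> e" using d(1) by blast
    qed
    then show ?thesis unfolding f_def E_def using zS by (intro continuous_intros cont_g) auto
  qed
  have "f (1/2) \<le> f 0 / 2 + f 1 / 2 - E x y / 8"
  proof (rule midpoint_convex_of_support[OF fc])
    fix t0 :: real assume t0: "t0 \<in> {0<..<1}"
    then have t01: "t0 \<in> {0..1}" by auto
    define y0 where "y0 = c x y t0"
    have y0: "y0 \<in> ball p \<rho>" "y0 \<in> S" using cb[OF t01] \<rho>(1,2) by (auto simp: y0_def)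
    define V where "V = v z y0 1"
    \<comment> \<open>The endpoint terms of the comparison as a function of the moving end, with
      metric and connection frozen at \<open>y0\<close>.\<close>
    define h where "h t = g y0 V ((c x y t - y0) + (1/2) *\<^sub>R \<Gamma> y0 (c x y t - y0) (c x y t - y0)) + g y0 (c x y t - y0) (c x y t - y0) / 2" for t
    define h' where "h' t = g y0 V (v x y t + \<Gamma> y0 (v x y t) (c x y t - y0)) + g y0 (v x y t) (c x y t - y0)" for t
    let ?I = "{0<..<1::real}"
    have at: "at t within ?I = at t" if "t \<in> ?I" for t using at_within_open[OF that] by simp
    have dc: "(c x y has_vector_derivative v x y t) (at t within ?I)" "(v x y has_vector_derivative - \<Gamma> (c x y t) (v x y t) (v x y t)) (at t within ?I)"
      if "t \<in> ?I" for t
      using geodesicD(2,3)[OF gxy, of t] that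
      by (auto intro: has_vector_derivative_within_subset)
    have yI: "(\<lambda>_. y0) ` ?I \<subseteq> S" using y0 by auto
    have dj: "((\<lambda>t. c x y t - y0) has_vector_derivative v x y t) (at t within ?I)" if "t \<in> ?I" for t
      using has_vector_derivative_diff[OF dc(1)[OF that] has_vector_derivative_const] by simp
    have zero: "\<Gamma> y0 0 u = 0" "D y0 0 u w = 0" "g y0 0 w = 0" "g y0 w 0 = 0" "\<Gamma> y0 u 0 = 0" for u w
      using y0(2) linear_0[OF D_lin1[OF y0(2)]] by (auto simp: lin_simps)
    have dh: "(h has_real_derivative h' t) (at t)" if t: "t \<in> ?I" for t
    proof -
      note G1 = deriv_\<Gamma>[OF t yI has_vector_derivative_const dj[OF t] dj[OF t]]
      note G2 = has_vector_derivative_add[OF dj[OF t] has_vector_derivative_scaleR[OF DERIV_const[of "1/2"] G1]]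
      note G3 = has_vector_derivative_add[OF deriv_g[OF t yI has_vector_derivative_const has_vector_derivative_const[of V] G2]
          has_vector_derivative_divide[OF deriv_g[OF t yI has_vector_derivative_const dj[OF t] dj[OF t]], of 2]]
      have "(h has_vector_derivative h' t) (at t within ?I)" unfolding h_def[abs_def]
        by (rule has_vector_derivative_eq_rhs[OF G3])
          (use y0(2) \<Gamma>_sym[OF y0(2), of "c x y t - y0" "v x y t"] g_sym[OF y0(2), of "c x y t - y0" "v x y t"] in
            \<open>simp add: h'_def zero linear_add[OF g_lin] linear_add[OF g_lin'] linear_cmul[OF g_lin]\<close>)
      then show ?thesis unfolding at[OF t] by (simp add: has_real_derivative_iff_has_vector_derivative)
    qed
    have "(h' has_vector_derivative E x y) (at t0 within ?I)"
    proof -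
      note G1 = deriv_\<Gamma>[OF t0 yI has_vector_derivative_const dc(2)[OF t0] dj[OF t0]]
      note G2 = has_vector_derivative_add[OF dc(2)[OF t0] G1]
      note G3 = has_vector_derivative_add[OF deriv_g[OF t0 yI has_vector_derivative_const has_vector_derivative_const[of V] G2]
          deriv_g[OF t0 yI has_vector_derivative_const dc(2)[OF t0] dj[OF t0]]]
      have "E x y = g y0 (v x y t0) (v x y t0)"
        using geodesic_constant_speed[OF gxy t01] geo[OF xyz(1,2)] by (simp add: E_def y0_def)
      then show ?thesis unfolding h'_def[abs_def]
        by (intro has_vector_derivative_eq_rhs[OF G3]) (simp add: zero y0_def[symmetric])
    qed
    then have dh': "(h' has_real_derivative E x y) (at t0)"
      unfolding at[OF t0] by (simp add: has_real_derivative_iff_has_vector_derivative)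
    have h0: "h t0 = 0" by (simp add: h_def y0_def[symmetric] zero)
    show "\<exists>a. \<forall>\<kappa>>0. \<exists>d>0. \<forall>\<delta>. \<bar>\<delta>\<bar> < d \<longrightarrow> f t0 + a * \<delta> + E x y * \<delta>\<^sup>2 / 2 - \<kappa> * \<delta>\<^sup>2 \<le> f (t0 + \<delta>)"
    proof (rule exI[of _ "h' t0"], intro allI impI)
      fix \<kappa> :: real assume \<kappa>: "0 < \<kappa>"
      define r where "r = min t0 (1 - t0)"
      have r: "0 < r" "\<And>t. \<bar>t - t0\<bar> < r \<Longrightarrow> t \<in> ?I" using t0 by (auto simp: r_def)
      obtain d where d: "0 < d" "\<And>\<delta>. \<bar>\<delta>\<bar> < d \<Longrightarrow> \<bar>h (t0 + \<delta>) - h t0 - h' t0 * \<delta> - E x y / 2 * \<delta>\<^sup>2\<bar> \<le> \<kappa> / 2 * \<delta>\<^sup>2"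
        by (rule second_order_expansion[OF dh[OF r(2)] r(1) dh', of "\<kappa> / 2"]) (use \<kappa> in auto)
      define \<rho>' where "\<rho>' = 4 * \<rho>"
      have \<rho>': "0 < \<rho>'" "cball p (2 * \<rho>') \<subseteq> S" "2 * \<rho>' \<le> 1" using \<rho> by (auto simp: \<rho>'_def)
      \<comment> \<open>Neighbouring geodesics from \<open>z\<close> differ by at most
        \<open>2 * norm (y1 - y0)\<close>, hence by \<open>2 * \<bar>\<delta>\<bar>\<close>. With
        \<open>\<kappa> / 16\<close> the error is at most
        \<open>\<kappa> / 2 * \<delta>\<^sup>2\<close>, and the other half is left for the expansion
        of \<open>h\<close>.\<close>
      obtain e where e: "0 < e"
        "\<And>c v c' v' B. geodesic c v \<Longrightarrow> geodesic c' v' \<Longrightarrow> (\<And>t. t \<in> {0..1} \<Longrightarrow> c t \<in> cball p \<rho>' \<and> norm (v t) \<le> \<rho>') \<Longrightarrow>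
          (\<And>t. t \<in> {0..1} \<Longrightarrow> norm (c' t - c t) \<le> B \<and> norm (v' t - v t) \<le> B) \<Longrightarrow> B \<le> e \<Longrightarrow> c' 0 = c 0 \<Longrightarrow>
          g (c 0) (v 0) (v 0) / 2 + g (c 1) (v 1) ((c' 1 - c 1) + (1/2) *\<^sub>R \<Gamma> (c 1) (c' 1 - c 1) (c' 1 - c 1))
            + g (c 1) (c' 1 - c 1) (c' 1 - c 1) / 2 - 2 * (\<kappa> / 16) * B\<^sup>2 \<le> g (c' 0) (v' 0) (v' 0) / 2"
        by (rule geodesic_energy_comparison[OF \<rho>', of "\<kappa> / 16"]) (use \<kappa> in auto)
      show "\<exists>d>0. \<forall>\<delta>. \<bar>\<delta>\<bar> < d \<longrightarrow> f t0 + h' t0 * \<delta> + E x y * \<delta>\<^sup>2 / 2 - \<kappa> * \<delta>\<^sup>2 \<le> f (t0 + \<delta>)"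
      proof (intro exI[of _ "min d (min r (e / 2))"] conjI allI impI)
        show "0 < min d (min r (e / 2))" using d r e by simp
        fix \<delta> :: real assume \<delta>: "\<bar>\<delta>\<bar> < min d (min r (e / 2))"
        then have t1: "t0 + \<delta> \<in> {0..1}" using r(2)[of "t0 + \<delta>"] by auto
        define y1 where "y1 = c x y (t0 + \<delta>)"
        have y1: "y1 \<in> ball p \<rho>" using cb[OF t1] by (simp add: y1_def)
        have "norm (c x y (t0 + \<delta>) - c x y t0) \<le> 1 * norm ((t0 + \<delta>) - t0)"
        proof (rule differentiable_bound[where S = "{0..1}" and f' = "\<lambda>t s. s *\<^sub>R v x y t"])
          fix t :: real assume t: "t \<in> {0..1}"
          show "(c x y has_derivative (\<lambda>s. s *\<^sub>R v x y t)) (at t within {0..1})"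
            using geodesicD(2)[OF gxy t] by (simp add: has_vector_derivative_def)
          show "onorm (\<lambda>s. s *\<^sub>R v x y t) \<le> 1"
          proof (rule onorm_le)
            fix s :: real
            have "norm (v x y t) \<le> 1" using inb[OF xyz(1,2) t] \<rho> by simp
            then have "\<bar>s\<bar> * norm (v x y t) \<le> \<bar>s\<bar> * 1" by (intro mult_left_mono) auto
            then show "norm (s *\<^sub>R v x y t) \<le> 1 * norm s" by simp
          qed
        qed (use t01 t1 in auto)
        then have j: "norm (y1 - y0) \<le> \<bar>\<delta>\<bar>" by (simp add: y1_def y0_def)
        define B where "B = 2 * norm (y1 - y0)"
        have B: "norm (c z y1 t - c z y0 t) \<le> B \<and> norm (v z y1 t - v z y0 t) \<le> B" if "t \<in> {0..1}" for t
          using stab[OF xyz(3) y1 xyz(3) y0(1) that] by (simp add: B_def)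
        have "g (c z y0 0) (v z y0 0) (v z y0 0) / 2 + g (c z y0 1) (v z y0 1) ((c z y1 1 - c z y0 1) + (1/2) *\<^sub>R \<Gamma> (c z y0 1) (c z y1 1 - c z y0 1) (c z y1 1 - c z y0 1))
            + g (c z y0 1) (c z y1 1 - c z y0 1) (c z y1 1 - c z y0 1) / 2 - 2 * (\<kappa> / 16) * B\<^sup>2 \<le> g (c z y1 0) (v z y1 0) (v z y1 0) / 2"
          by (rule e(2)) (use geo[OF xyz(3) y0(1)] geo[OF xyz(3) y1] inb[OF xyz(3) y0(1)] B j \<delta> in \<open>auto simp: \<rho>'_def B_def\<close>)
        then have "f t0 + h (t0 + \<delta>) - \<kappa> / 8 * B\<^sup>2 \<le> f (t0 + \<delta>)"
          using geo[OF xyz(3) y0(1)] geo[OF xyz(3) y1] by (simp add: f_def E_def h_def V_def y0_def[symmetric] y1_def[symmetric])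
        moreover have "\<kappa> / 8 * B\<^sup>2 \<le> \<kappa> / 2 * \<delta>\<^sup>2"
        proof -
          have "(norm (y1 - y0))\<^sup>2 \<le> \<bar>\<delta>\<bar>\<^sup>2" using j by (intro power_mono) auto
          then have "\<kappa> / 2 * (norm (y1 - y0))\<^sup>2 \<le> \<kappa> / 2 * \<delta>\<^sup>2" using \<kappa> by (intro mult_left_mono) auto
          then show ?thesis by (simp add: B_def power_mult_distrib)
        qed
        moreover have "\<bar>h (t0 + \<delta>) - h t0 - h' t0 * \<delta> - E x y / 2 * \<delta>\<^sup>2\<bar> \<le> \<kappa> / 2 * \<delta>\<^sup>2" using d(2) \<delta> by simp
        ultimately show "f t0 + h' t0 * \<delta> + E x y * \<delta>\<^sup>2 / 2 - \<kappa> * \<delta>\<^sup>2 \<le> f (t0 + \<delta>)"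
          using h0 unfolding abs_le_iff by argo
      qed
    qed
  qed
  then show ?thesis using geo[OF xyz(1,2)] by (simp add: f_def)
qed

end

section \<open>The Levi-Civita connection of a smooth metric tensor\<close>

lemma smooth_on_differentiable: "smooth_on S f \<Longrightarrow> x \<in> S \<Longrightarrow> f differentiable (at x)"
  unfolding smooth_on_def by (metis Ck_on.simps(2))

lemma smooth_on_frechet_derivative: "smooth_on S f \<Longrightarrow> smooth_on S (\<lambda>x. frechet_derivative f (at x) v)"
  unfolding smooth_on_def by (metis Ck_on.simps(2))

lemma smooth_on_continuous: "smooth_on S f \<Longrightarrow> continuous_on S f"
  unfolding smooth_on_def by (metis Ck_on.simps(1))

lemma smooth_on_has_derivative: "smooth_on S f \<Longrightarrow> x \<in> S \<Longrightarrow> (f has_derivative frechet_derivative f (at x)) (at x)"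
  using smooth_on_differentiable frechet_derivative_works by blast

text \<open>Replacing \<psi> by its value at \<open>q\<close> changes the product only to higher
  order, because \<phi> vanishes there; continuity of \<psi> suffices. It is applied with \<psi> a
  coordinate of a solution whose differentiability is still to be shown.\<close>

lemma has_derivative_mult_null:
  fixes \<phi> \<psi> :: "'e::real_normed_vector \<Rightarrow> real"
  assumes \<phi>: "(\<phi> has_derivative \<phi>') (at q)" "\<phi> q = 0" and \<psi>: "isCont \<psi> q"
  shows "((\<lambda>x. \<psi> x * \<phi> x) has_derivative (\<lambda>h. \<psi> q * \<phi>' h)) (at q)"
proof -
  obtain C where C: "\<And>h. norm (\<phi>' h) \<le> norm h * C" "C > 0"
    using bounded_linear.pos_bounded[OF has_derivative_bounded_linear[OF \<phi>(1)]] by blast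
  obtain d0 where d0: "0 < d0" "\<And>x. norm (x - q) < d0 \<Longrightarrow> norm (\<phi> x - \<phi> q - \<phi>' (x - q)) \<le> 1 * norm (x - q)"
    using \<phi>(1) unfolding has_derivative_at_alt by (metis zero_less_one)
  have 0: "((\<lambda>x. (\<psi> x - \<psi> q) * \<phi> x) has_derivative (\<lambda>_. 0)) (at q)"
    unfolding has_derivative_at_alt
  proof (intro conjI allI impI)
    fix e :: real assume e: "0 < e"
    obtain d1 where d1: "0 < d1" "\<And>x. norm (x - q) < d1 \<Longrightarrow> \<bar>\<psi> x - \<psi> q\<bar> < e / (C + 1)"
      using \<psi> e C(2) unfolding continuous_at_eps_delta dist_norm real_norm_def by (metis add_pos_pos divide_pos_pos zero_less_one)
    show "\<exists>d>0. \<forall>y. norm (y - q) < d \<longrightarrow> norm ((\<psi> y - \<psi> q) * \<phi> y - (\<psi> q - \<psi> q) * \<phi> q - 0) \<le> e * norm (y - q)"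
    proof (intro exI[of _ "min d0 d1"] conjI allI impI)
      fix y assume y: "norm (y - q) < min d0 d1"
      have "\<bar>\<phi> y\<bar> \<le> (C + 1) * norm (y - q)"
        using d0(2)[of y] C(1)[of "y - q"] y \<phi>(2) by (simp add: algebra_simps)
      then have "\<bar>\<psi> y - \<psi> q\<bar> * \<bar>\<phi> y\<bar> \<le> e / (C + 1) * ((C + 1) * norm (y - q))"
        using d1(2)[of y] y C(2) e by (intro mult_mono) auto
      then show "norm ((\<psi> y - \<psi> q) * \<phi> y - (\<psi> q - \<psi> q) * \<phi> q - 0) \<le> e * norm (y - q)"
        using C(2) by (simp add: abs_mult)
    qed (use d0 d1 in auto)
  qed auto
  have "((\<lambda>x. \<psi> q * \<phi> x + (\<psi> x - \<psi> q) * \<phi> x) has_derivative (\<lambda>h. \<psi> q * \<phi>' h + 0)) (at q)"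
    by (intro has_derivative_add has_derivative_mult_right \<phi>(1) 0)
  then show ?thesis by (simp add: algebra_simps)
qed

section \<open>Linear systems with the metric as matrix\<close>

context metric_field
begin

lemma linear_eqI:
  assumes q: "q \<in> S" and eq: "\<And>b. b \<in> Basis \<Longrightarrow> g q x b = g q y b"
  shows "x = y"
proof (rule ccontr)
  assume "x \<noteq> y"
  have "g q (x - y) (x - y) = (\<Sum>b\<in>Basis. ((x - y) \<bullet> b) *\<^sub>R g q (x - y) b)"
    by (rule linear_Basis_expand[OF g_lin[OF q]])
  also have "\<dots> = 0" using eq linear_diff[OF g_lin'[OF q]] by (intro sum.neutral) auto
  finally show False using g_pos[OF q, of "x - y"] \<open>x \<noteq> y\<close> by simp
qed

text \<open>Lowering an index is injective by definiteness, hence invertible; \<open>B\<close>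
  raises it.\<close>

lemma metric_isomorphism: "q \<in> S \<Longrightarrow> \<exists>B. linear B \<and> (\<forall>x. B (\<Sum>b\<in>Basis. g q x b *\<^sub>R b) = x) \<and> (\<forall>x. (\<Sum>b\<in>Basis. g q (B x) b *\<^sub>R b) = x)"
proof -
  assume q: "q \<in> S"
  define A where "A x = (\<Sum>b\<in>Basis. g q x b *\<^sub>R b)" for x
  have lin: "linear A" unfolding A_def[abs_def]
    by (intro linear_compose_sum ballI linear_compose[OF g_lin'[OF q], unfolded o_def] linear_scale_left linearI)
      (auto simp: linear_add[OF g_lin'[OF q]] linear_cmul[OF g_lin'[OF q]] scaleR_add_left)
  have "inj A"
  proof (rule injI)
    fix x y assume eq: "A x = A y"
    show "x = y"
    proof (rule linear_eqI[OF q])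
      fix b :: 'e assume b: "b \<in> Basis"
      have "A x \<bullet> b = g q x b" for x unfolding A_def using b by simp
      then show "g q x b = g q y b" using eq by metis
    qed
  qed
  from linear_injective_isomorphism[OF lin this] show ?thesis unfolding A_def by blast
qed

lemma metric_represents:
  assumes q: "q \<in> S" and k: "linear k"
  obtains z where "\<And>w. g q z w = k w"
proof -
  obtain B where B: "\<And>x. (\<Sum>b\<in>Basis. g q (B x) b *\<^sub>R b) = x" using metric_isomorphism[OF q] by blast
  define z where "z = B (\<Sum>b\<in>Basis. k b *\<^sub>R b)"
  have "g q z b = k b" if "b \<in> Basis" for b
  proof -
    have "(\<Sum>b\<in>Basis. g q z b *\<^sub>R b) \<bullet> b = (\<Sum>b\<in>Basis. k b *\<^sub>R b) \<bullet> b" unfolding z_def B ..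
    then show ?thesis using that by simp
  qed
  then have "g q z w = k w" for w
    using linear_Basis_expand[OF g_lin[OF q], of z w] linear_Basis_expand[OF k, of w] by simp
  then show thesis by (rule that)
qed

text \<open>Coercivity of \<open>g\<close> near \<open>q0\<close> bounds \<open>z q - z q0\<close>
  by the residual that the constant vector \<open>z q0\<close> leaves in the equations at
  \<open>q\<close>. That residual is continuous and vanishes at \<open>q0\<close>.\<close>

lemma solution_continuous:
  assumes z: "\<And>q b. q \<in> S \<Longrightarrow> b \<in> Basis \<Longrightarrow> g q (z q) b = k q b" and k: "\<And>b. b \<in> Basis \<Longrightarrow> continuous_on S (\<lambda>q. k q b)"
  shows "continuous_on S z"
  unfolding continuous_on_eq_continuous_at[OF S]
proof
  fix q0 assume q0: "q0 \<in> S"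
  obtain r l where b: "0 < r" "0 < l" "cball q0 r \<subseteq> S" "\<And>q v. q \<in> cball q0 r \<Longrightarrow> l * (norm v)\<^sup>2 \<le> g q v v"
    by (rule metric_lower_bound[OF q0]) blast
  define \<eta> where "\<eta> q = (\<Sum>b\<in>Basis. \<bar>k q b - g q (z q0) b\<bar>) / l" for q
  have "continuous_on S \<eta>" unfolding \<eta>_def[abs_def] using b(2) by (intro continuous_intros k g_cont) auto
  then have "isCont \<eta> q0" using q0 by (simp add: continuous_on_eq_continuous_at[OF S])
  moreover have "\<eta> q0 = 0" unfolding \<eta>_def using z[OF q0] by simp
  ultimately have \<eta>: "\<eta> \<midarrow>q0\<rightarrow> 0" by (simp add: isCont_def)
  have bound: "norm (z q - z q0) \<le> \<eta> q" if q: "q \<in> cball q0 r" for q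
  proof -
    define d where "d = z q - z q0"
    have qS: "q \<in> S" using q b(3) by blast
    have "l * (norm d)\<^sup>2 \<le> g q d d" using b(4)[OF q] .
    also have "\<dots> = (\<Sum>b\<in>Basis. (d \<bullet> b) * (k q b - g q (z q0) b))"
      using linear_Basis_expand[OF g_lin[OF qS], of d d] z[OF qS] by (simp add: d_def linear_diff[OF g_lin'[OF qS]])
    also have "\<dots> \<le> (\<Sum>b\<in>Basis. norm d * \<bar>k q b - g q (z q0) b\<bar>)"
    proof (rule sum_mono)
      fix b :: 'e assume "b \<in> Basis"
      then have "\<bar>d \<bullet> b\<bar> * \<bar>k q b - g q (z q0) b\<bar> \<le> norm d * \<bar>k q b - g q (z q0) b\<bar>"
        by (intro mult_right_mono Basis_le_norm) auto
      then show "(d \<bullet> b) * (k q b - g q (z q0) b) \<le> norm d * \<bar>k q b - g q (z q0) b\<bar>"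
        by (metis abs_ge_self abs_mult order_trans)
    qed
    also have "\<dots> = norm d * (l * \<eta> q)" using b(2) by (simp add: \<eta>_def flip: sum_distrib_left)
    finally have "norm d * (l * norm d) \<le> norm d * (l * \<eta> q)" by (simp add: power2_eq_square mult_ac)
    then show ?thesis
    proof (cases "norm d = 0")
      case True
      have "0 \<le> \<eta> q" unfolding \<eta>_def using b(2) by (intro divide_nonneg_nonneg sum_nonneg) auto
      then show ?thesis using True by (simp add: d_def)
    next
      case False
      then have "l * norm d \<le> l * \<eta> q" using \<open>norm d * (l * norm d) \<le> norm d * (l * \<eta> q)\<close> by simp
      then show ?thesis using b(2) by (simp add: d_def)
    qed
  qed
  have ev: "\<forall>\<^sub>F q in at q0. norm (z q - z q0) \<le> \<eta> q"
  proof (rule eventually_mono)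
    show "\<forall>\<^sub>F q in at q0. dist q q0 < r" using b(1) by (auto simp: eventually_at)
  qed (use bound in \<open>simp add: dist_commute\<close>)
  have "(\<lambda>q. z q - z q0) \<midarrow>q0\<rightarrow> 0" by (rule Lim_null_comparison[OF ev \<eta>])
  then show "isCont z q0" by (simp add: isCont_def LIM_zero_iff)
qed

text \<open>With the metric frozen at \<open>q\<close>, \<open>z x\<close> solves a system whose
  right-hand side \<open>\<eta> x\<close> contains \<open>z x\<close> only multiplied by
  \<open>g x - g q\<close>, which vanishes at \<open>x = q\<close>; so continuity of
  \<open>z\<close> already gives differentiability. The derivative solves a system of the same kind
  and is therefore continuous.\<close>

lemma solution_differentiable:
  assumes z: "\<And>q b. q \<in> S \<Longrightarrow> b \<in> Basis \<Longrightarrow> g q (z q) b = k q b"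
    and k: "\<And>q b. q \<in> S \<Longrightarrow> b \<in> Basis \<Longrightarrow> ((\<lambda>q. k q b) has_derivative k' q b) (at q)"
    and g: "\<And>q a b. q \<in> S \<Longrightarrow> ((\<lambda>q. g q a b) has_derivative g' q a b) (at q)"
    and g': "\<And>h a b. continuous_on S (\<lambda>q. g' q a b h)" and k': "\<And>h b. b \<in> Basis \<Longrightarrow> continuous_on S (\<lambda>q. k' q b h)"
  obtains z' where "\<And>q. q \<in> S \<Longrightarrow> (z has_derivative z' q) (at q)" "\<And>h. continuous_on S (\<lambda>q. z' q h)"
proof -
  have zc: "continuous_on S z"
  proof (rule solution_continuous[OF z])
    fix b :: 'e assume "b \<in> Basis"
    then show "continuous_on S (\<lambda>q. k q b)"
      using has_derivative_continuous[OF k] by (simp add: continuous_at_imp_continuous_on)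
  qed
  define m where "m q h b = k' q b h - (\<Sum>a\<in>Basis. (z q \<bullet> a) * g' q a b h)" for q h b
  have ex: "\<exists>z'. (z has_derivative z') (at q) \<and> (\<forall>h. \<forall>b\<in>Basis. g q (z' h) b = m q h b)" if q: "q \<in> S" for q
  proof -
    obtain B where B: "linear B" "\<And>x. B (\<Sum>b\<in>Basis. g q x b *\<^sub>R b) = x" "\<And>x. (\<Sum>b\<in>Basis. g q (B x) b *\<^sub>R b) = x"
      using metric_isomorphism[OF q] by blast
    define \<eta> where "\<eta> x b = k x b - (\<Sum>a\<in>Basis. (z x \<bullet> a) * (g x a b - g q a b))" for x b
    have z\<eta>: "z x = B (\<Sum>b\<in>Basis. \<eta> x b *\<^sub>R b)" if x: "x \<in> S" for x
    proof -
      have "\<eta> x b = g q (z x) b" if "b \<in> Basis" for b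
        using linear_Basis_expand[OF g_lin'[OF q], of "z x" b] linear_Basis_expand[OF g_lin'[OF x], of "z x" b] z[OF x that]
        by (simp add: \<eta>_def right_diff_distrib sum_subtractf)
      then show ?thesis using B(2)[of "z x"] by simp
    qed
    have zi: "isCont (\<lambda>x. z x \<bullet> a) q" for a
      using zc q by (intro continuous_intros) (simp add: continuous_on_eq_continuous_at[OF S])
    have d\<eta>: "((\<lambda>x. \<eta> x b) has_derivative (\<lambda>h. m q h b)) (at q)" if b: "b \<in> Basis" for b
      unfolding \<eta>_def m_def
    proof (intro has_derivative_diff has_derivative_sum)
      show "((\<lambda>x. k x b) has_derivative (\<lambda>h. k' q b h)) (at q)" using k[OF q b] by simp
      fix a :: 'e
      have "((\<lambda>x. g x a b - g q a b) has_derivative (\<lambda>h. g' q a b h)) (at q)"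
        using has_derivative_diff[OF g[OF q] has_derivative_const] by simp
      from has_derivative_mult_null[OF this _ zi]
      show "((\<lambda>x. (z x \<bullet> a) * (g x a b - g q a b)) has_derivative (\<lambda>h. (z q \<bullet> a) * g' q a b h)) (at q)" by simp
    qed
    have "((\<lambda>x. B (\<Sum>b\<in>Basis. \<eta> x b *\<^sub>R b)) has_derivative (\<lambda>h. B (\<Sum>b\<in>Basis. m q h b *\<^sub>R b))) (at q)"
      by (rule bounded_linear.has_derivative[OF linear_conv_bounded_linear[THEN iffD1, OF B(1)]])
        (intro has_derivative_sum has_derivative_scaleR_left d\<eta>)
    then have "(z has_derivative (\<lambda>h. B (\<Sum>b\<in>Basis. m q h b *\<^sub>R b))) (at q)"
      by (rule has_derivative_transform_within_open[OF _ S q]) (simp add: z\<eta>)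
    moreover have "g q (B (\<Sum>b\<in>Basis. m q h b *\<^sub>R b)) b = m q h b" if "b \<in> Basis" for h b
    proof -
      have "(\<Sum>b\<in>Basis. g q (B (\<Sum>b\<in>Basis. m q h b *\<^sub>R b)) b *\<^sub>R b) \<bullet> b = (\<Sum>b\<in>Basis. m q h b *\<^sub>R b) \<bullet> b"
        unfolding B(3) ..
      then show ?thesis using that by simp
    qed
    ultimately show ?thesis by blast
  qed
  then obtain z' where z': "\<And>q. q \<in> S \<Longrightarrow> (z has_derivative z' q) (at q)" "\<And>q h b. q \<in> S \<Longrightarrow> b \<in> Basis \<Longrightarrow> g q (z' q h) b = m q h b"
    by metis
  have "continuous_on S (\<lambda>q. z' q h)" for h
    by (rule solution_continuous[OF z'(2)]) (auto simp: m_def intro!: continuous_intros g' k' zc)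
  then show thesis using that z'(1) by blast
qed

end

section \<open>Christoffel symbols from the Koszul formula\<close>

locale smooth_metric =
  fixes S :: "'e::euclidean_space set" and g :: "'e \<Rightarrow> 'e \<Rightarrow> 'e \<Rightarrow> real"
  assumes S: "open S" and bil: "q \<in> S \<Longrightarrow> bilinear (g q)" and sym: "q \<in> S \<Longrightarrow> g q v w = g q w v"
    and pos: "q \<in> S \<Longrightarrow> v \<noteq> 0 \<Longrightarrow> 0 < g q v v" and smooth: "smooth_on S (\<lambda>q. g q v w)"
begin

sublocale metric_field S g
proof (rule metric_field.intro)
  show "linear (g q v)" if "q \<in> S" for q v using bil[OF that] unfolding bilinear_def by blast
qed (use S sym pos smooth_on_continuous[OF smooth] in auto)

definition dg :: "'e \<Rightarrow> 'e \<Rightarrow> 'e \<Rightarrow> 'e \<Rightarrow> real" where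
  "dg q v w h = frechet_derivative (\<lambda>q. g q v w) (at q) h"

lemma dg: "q \<in> S \<Longrightarrow> ((\<lambda>q. g q v w) has_derivative dg q v w) (at q)"
  unfolding dg_def[abs_def] using smooth_on_has_derivative[OF smooth] .

lemma dg_unique:
  assumes "q \<in> S" "\<And>q. q \<in> S \<Longrightarrow> g q v w = f q" "(f has_derivative f') (at q)"
  shows "dg q v w h = f' h"
proof -
  have "((\<lambda>q. g q v w) has_derivative f') (at q)"
    by (rule has_derivative_transform_within_open[OF assms(3) S assms(1)]) (use assms(2) in simp)
  from has_derivative_unique[OF this dg[OF assms(1)]] show ?thesis by metis
qed

lemma dg_sym: "q \<in> S \<Longrightarrow> dg q v w h = dg q w v h"
  by (rule dg_unique[of q v w "\<lambda>q. g q w v"]) (auto intro: sym dg)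

lemma dg_lin: "q \<in> S \<Longrightarrow> linear (\<lambda>w. dg q v w h)"
proof (rule linearI)
  fix w w' c assume q: "q \<in> S"
  show "dg q v (w + w') h = dg q v w h + dg q v w' h"
    by (rule dg_unique[OF q, of v "w + w'" "\<lambda>q. g q v w + g q v w'"]) (auto intro!: has_derivative_add dg q linear_add[OF g_lin])
  show "dg q v (c *\<^sub>R w) h = c *\<^sub>R dg q v w h"
    unfolding real_scaleR_def
    by (rule dg_unique[OF q, of v "c *\<^sub>R w" "\<lambda>q. c * g q v w"]) (auto intro!: has_derivative_mult_right dg q simp: linear_cmul[OF g_lin])
qed

lemma dg_lin_dir: "q \<in> S \<Longrightarrow> linear (dg q v w)"
  using has_derivative_linear[OF dg] .

definition koszul :: "'e \<Rightarrow> 'e \<Rightarrow> 'e \<Rightarrow> 'e \<Rightarrow> real" where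
  "koszul q u v w = (dg q v w u + dg q u w v - dg q u v w) / 2"

lemma koszul_lin: "q \<in> S \<Longrightarrow> linear (koszul q u v)"
  by (rule linearI) (auto simp: koszul_def linear_add[OF dg_lin] linear_cmul[OF dg_lin] linear_add[OF dg_lin_dir] linear_cmul[OF dg_lin_dir]
      add_divide_distrib diff_divide_distrib algebra_simps)

lemma christoffel_unique:
  assumes q: "q \<in> S" and z: "\<And>w. g q z w = koszul q u v w"
  shows "christoffel g q u v = z"
  unfolding christoffel_def
proof (rule the_equality)
  show "\<forall>w. 2 * g q z w = frechet_derivative (\<lambda>q. g q v w) (at q) u + frechet_derivative (\<lambda>q. g q u w) (at q) v - frechet_derivative (\<lambda>q. g q u v) (at q) w"
    using z by (simp add: koszul_def dg_def mult.commute)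
  fix z' assume "\<forall>w. 2 * g q z' w = frechet_derivative (\<lambda>q. g q v w) (at q) u + frechet_derivative (\<lambda>q. g q u w) (at q) v - frechet_derivative (\<lambda>q. g q u v) (at q) w"
  then have "2 * g q z' w = 2 * g q z w" for w using z by (simp add: koszul_def dg_def mult.commute)
  then show "z' = z" by (intro linear_eqI[OF q]) simp
qed

lemma christoffel: "q \<in> S \<Longrightarrow> g q (christoffel g q u v) w = koszul q u v w"
  using metric_represents[OF _ koszul_lin] christoffel_unique by metis

text \<open>The Koszul formula presents the Christoffel symbols as the solution of a linear system
  with matrix \<open>g\<close>, so \<open>solution_differentiable\<close> applies.\<close>

lemma christoffel_derivative:
  obtains z' where "\<And>q. q \<in> S \<Longrightarrow> ((\<lambda>q. christoffel g q u v) has_derivative z' q) (at q)" "\<And>h. continuous_on S (\<lambda>q. z' q h)"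
proof -
  have ddg: "((\<lambda>q. dg q v w u) has_derivative frechet_derivative (\<lambda>q. dg q v w u) (at q)) (at q)" if "q \<in> S" for q v w u
    unfolding dg_def by (rule smooth_on_has_derivative[OF smooth_on_frechet_derivative[OF smooth] that])
  have cdg: "continuous_on S (\<lambda>q. dg q v w u)" for v w u
    unfolding dg_def by (rule smooth_on_continuous[OF smooth_on_frechet_derivative[OF smooth]])
  have cddg: "continuous_on S (\<lambda>q. frechet_derivative (\<lambda>q. dg q v w u) (at q) h)" for v w u h
    unfolding dg_def by (rule smooth_on_continuous[OF smooth_on_frechet_derivative[OF smooth_on_frechet_derivative[OF smooth]]])
  let ?k' = "\<lambda>q b h. (frechet_derivative (\<lambda>q. dg q v b u) (at q) h + frechet_derivative (\<lambda>q. dg q u b v) (at q) h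
      - frechet_derivative (\<lambda>q. dg q u v b) (at q) h) / 2"
  show thesis
  proof (rule solution_differentiable[of "\<lambda>q. christoffel g q u v" "\<lambda>q. koszul q u v" ?k' dg])
    show "((\<lambda>q. koszul q u v b) has_derivative ?k' q b) (at q)" if "q \<in> S" for q b
      unfolding koszul_def using ddg[OF that] by (auto intro!: derivative_eq_intros)
  qed (use christoffel dg cdg cddg in \<open>auto intro!: continuous_intros that\<close>)
qed

text \<open>Linearity and symmetry are tested against basis vectors in the Koszul formula;
  compatibility with the metric is the sum of two Koszul expressions, in which the other derivatives
  cancel.\<close>

sublocale local_connection S g "christoffel g" "\<lambda>q h u v. frechet_derivative (\<lambda>q. christoffel g q u v) (at q) h"
proof (intro local_connection.intro local_connection_axioms.intro metric_field_axioms)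
  fix q u v w h assume q: "q \<in> S"
  show "linear (christoffel g q u)"
  proof (rule linearI; rule linear_eqI[OF q])
    fix x y b :: 'e and c :: real
    have l: "koszul q u (x + y) b = koszul q u x b + koszul q u y b" "koszul q u (c *\<^sub>R x) b = c * koszul q u x b"
      using dg_sym[OF q] linear_add[OF dg_lin[OF q]] linear_cmul[OF dg_lin[OF q]] linear_add[OF dg_lin_dir[OF q]] linear_cmul[OF dg_lin_dir[OF q]]
      by (simp_all add: koszul_def dg_sym[OF q, of _ b] add_divide_distrib diff_divide_distrib algebra_simps)
    show "g q (christoffel g q u (x + y)) b = g q (christoffel g q u x + christoffel g q u y) b"
      using q by (simp add: christoffel linear_add[OF g_lin'] l)
    show "g q (christoffel g q u (c *\<^sub>R x)) b = g q (c *\<^sub>R christoffel g q u x) b"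
      using q by (simp add: christoffel linear_cmul[OF g_lin'] l)
  qed
  show "christoffel g q u v = christoffel g q v u"
    by (rule linear_eqI[OF q]) (use q dg_sym[OF q, of u v] in \<open>simp add: christoffel koszul_def\<close>)
  have "dg q v w h = g q (christoffel g q h v) w + g q v (christoffel g q h w)" for h
    using q g_sym[OF q, of v] dg_sym[OF q] by (simp add: christoffel koszul_def field_simps)
  then show "((\<lambda>q. g q v w) has_derivative (\<lambda>h. g q (christoffel g q h v) w + g q v (christoffel g q h w))) (at q)"
    using dg[OF q, of v w] by (metis (no_types, lifting) ext)
  show "((\<lambda>q. christoffel g q u v) has_derivative (\<lambda>h. frechet_derivative (\<lambda>q. christoffel g q u v) (at q) h)) (at q)"
    using christoffel_derivative[of u v] q frechet_derivative_works by (metis differentiable_def)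
next
  fix h u v
  obtain z' where z': "\<And>q. q \<in> S \<Longrightarrow> ((\<lambda>q. christoffel g q u v) has_derivative z' q) (at q)" "\<And>h. continuous_on S (\<lambda>q. z' q h)"
    by (rule christoffel_derivative) blast
  have "frechet_derivative (\<lambda>q. christoffel g q u v) (at q) = z' q" if "q \<in> S" for q
    using frechet_derivative_at[OF z'(1)[OF that]] by simp
  then show "continuous_on S (\<lambda>q. frechet_derivative (\<lambda>q. christoffel g q u v) (at q) h)"
    using z'(2)[of h] by (simp cong: continuous_on_cong)
qed

lemma curvature_R: "curvature g q u v w = R q u v w"
  by (simp add: curvature_def R_def)

text \<open>For independent vectors the Gram determinant is positive, so the sectional curvature has
  the sign of its numerator. For dependent ones the numerator vanishes by antisymmetry in the first
  two arguments.\<close>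

lemma nonpos_local_metric:
  assumes "\<And>q u v. q \<in> S \<Longrightarrow> u \<noteq> v \<Longrightarrow> independent {u, v} \<Longrightarrow> sectional_curvature g q u v \<le> 0"
  shows "local_metric S g (christoffel g) (\<lambda>q h u v. frechet_derivative (\<lambda>q. christoffel g q u v) (at q) h)"
proof (intro local_metric.intro local_metric_axioms.intro local_connection_axioms)
  fix q u v assume q: "q \<in> S"
  show "g q (R q u v v) u \<le> 0"
  proof (cases "u \<noteq> v \<and> independent {u, v}")
    case True
    have v0: "v \<noteq> 0" using True dependent_zero[of "{u, v}"] by auto
    then have gv: "0 < g q v v" using g_pos[OF q] by blast
    define t where "t = g q u v / g q v v"
    have "u - t *\<^sub>R v \<noteq> 0"
    proof
      assume "u - t *\<^sub>R v = 0"
      then have "u \<in> span {v}" by (metis eq_iff_diff_eq_0 insertI1 span_base span_scale)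
      moreover have "u \<notin> span ({u, v} - {u})" using True unfolding dependent_def by blast
      ultimately show False using True insert_Diff_if[of u "{v}" "{u}"] by (auto simp: insert_Diff_if)
    qed
    from g_pos[OF q this] have "0 < g q u u - 2 * t * g q u v + t\<^sup>2 * g q v v"
      using q g_sym[OF q, of v u] by (simp add: lin_simps power2_eq_square algebra_simps)
    also have "\<dots> = (g q u u * g q v v - (g q u v)\<^sup>2) / g q v v"
      using gv by (simp add: t_def power2_eq_square field_simps)
    finally have den: "0 < g q u u * g q v v - (g q u v)\<^sup>2" using gv by (simp add: zero_less_divide_iff)
    have "g q (R q u v v) u / (g q u u * g q v v - (g q u v)\<^sup>2) \<le> 0"
      using assms[OF q] True by (simp add: sectional_curvature_def curvature_R)
    then show ?thesis using den by (simp add: divide_le_0_iff)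
  next
    case False
    \<comment> \<open>For \<open>u = v\<close> the set \<open>{u, v}\<close> is a singleton and may
      well be independent, so this case stands apart.\<close>
    then consider "u = v" | "dependent {u, v}" "u \<noteq> v" by blast
    then have "R q u v v = 0"
    proof cases
      case 1 then show ?thesis by (simp add: R_def)
    next
      case 2
      then have "\<exists>c. u = c *\<^sub>R v \<or> v = c *\<^sub>R u"
      proof -
        obtain a where "a \<in> {u, v}" "a \<in> span ({u, v} - {a})" using 2(1) unfolding dependent_def by blast
        then show ?thesis using 2(2) by (auto simp: insert_Diff_if span_singleton split: if_splits)
      qed
      then obtain c where "u = c *\<^sub>R v \<or> v = c *\<^sub>R u" by blast
      then show ?thesis
        using q \<Gamma>_sym[OF q] by (auto simp: R_def lin_simps)
    qed
    then show ?thesis using linear_0[OF g_lin'[OF q]] by simp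
  qed
qed

end

section \<open>Curves and distances in a Riemannian manifold\<close>

lemma integrable_on_pieces:
  fixes f :: "real \<Rightarrow> real"
  assumes "finite F" "a \<le> b"
    and "\<And>a' b'. a \<le> a' \<Longrightarrow> a' < b' \<Longrightarrow> b' \<le> b \<Longrightarrow> {a'<..<b'} \<inter> F = {} \<Longrightarrow> f integrable_on {a'..b'}"
  shows "f integrable_on {a..b}"
  using assms
proof (induction F arbitrary: a b rule: finite_induct)
  case empty
  show ?case
  proof (cases "a = b")
    case True then show ?thesis using integrable_on_refl[of f b] by (simp add: box_real)
  next
    case False then show ?thesis using empty by simp
  qed
next
  case (insert x F)
  show ?case
  proof (cases "a < x \<and> x < b")
    case True
    have "f integrable_on {a..x}" by (rule insert.IH) (use True insert.prems(2) in auto)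
    moreover have "f integrable_on {x..b}" by (rule insert.IH) (use True insert.prems(2) in auto)
    ultimately show ?thesis using True Henstock_Kurzweil_Integration.integrable_combine[of a x b f] by simp
  next
    case False
    show ?thesis
    proof (rule insert.IH[OF insert.prems(1)])
      fix a' b' assume *: "a \<le> a'" "a' < b'" "b' \<le> b" "{a'<..<b'} \<inter> F = {}"
      have "x \<notin> {a'<..<b'}" using False * by auto
      then show "f integrable_on {a'..b'}" using insert.prems(2)[of a' b'] * by simp
    qed
  qed
qed

section \<open>Charts and the speed of curves\<close>

locale riemannian =
  fixes A :: "('a::metric_space, 'e::euclidean_space) rchart set"
  assumes man: "riemannian_manifold A"
begin

abbreviation coord :: "('a, 'e) rchart \<Rightarrow> 'e \<Rightarrow> 'a" where
  "coord c \<equiv> inv_into (chart_dom c) (chart_map c)"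

abbreviation img :: "('a, 'e) rchart \<Rightarrow> 'e set" where
  "img c \<equiv> chart_map c ` chart_dom c"

lemma chart_ex: "\<exists>c. c \<in> A \<and> x \<in> chart_dom c"
  using man unfolding riemannian_manifold_def riemannian_atlas_def by blast

lemma chart:
  assumes "c \<in> A"
  shows "open (chart_dom c)" "open (img c)" "continuous_on (chart_dom c) (chart_map c)" "continuous_on (img c) (coord c)"
    "x \<in> chart_dom c \<Longrightarrow> coord c (chart_map c x) = x" "p \<in> img c \<Longrightarrow> chart_map c (coord c p) = p"
    "p \<in> img c \<Longrightarrow> coord c p \<in> chart_dom c" "smooth_metric (img c) (chart_metric c)"
proof -
  have c: "riemannian_chart c" using man assms unfolding riemannian_manifold_def riemannian_atlas_def by blast
  then show "open (chart_dom c)" "open (img c)" unfolding riemannian_chart_def by auto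
  have h: "homeomorphism (chart_dom c) (img c) (chart_map c) (coord c)" using c unfolding riemannian_chart_def by blast
  then show "continuous_on (chart_dom c) (chart_map c)" "continuous_on (img c) (coord c)"
    "x \<in> chart_dom c \<Longrightarrow> coord c (chart_map c x) = x" "p \<in> img c \<Longrightarrow> chart_map c (coord c p) = p"
    "p \<in> img c \<Longrightarrow> coord c p \<in> chart_dom c"
    unfolding homeomorphism_def by blast+
  show "smooth_metric (img c) (chart_metric c)"
    using c unfolding riemannian_chart_def smooth_metric_def by blast
qed

lemma transition:
  assumes "c \<in> A" "c' \<in> A" "x \<in> chart_dom c \<inter> chart_dom c'"
  shows "(transition c c' has_derivative frechet_derivative (transition c c') (at (chart_map c x))) (at (chart_map c x))"
    "chart_metric c (chart_map c x) v w = chart_metric c' (chart_map c' x)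
      (frechet_derivative (transition c c') (at (chart_map c x)) v) (frechet_derivative (transition c c') (at (chart_map c x)) w)"
    "smooth_on (chart_map c ` (chart_dom c \<inter> chart_dom c')) (transition c c')"
proof -
  have cc: "compatible_charts c c'" using man assms unfolding riemannian_manifold_def riemannian_atlas_def by blast
  then show sm: "smooth_on (chart_map c ` (chart_dom c \<inter> chart_dom c')) (transition c c')"
    unfolding compatible_charts_def by blast
  show "(transition c c' has_derivative frechet_derivative (transition c c') (at (chart_map c x))) (at (chart_map c x))"
    by (rule smooth_on_has_derivative[OF sm]) (use assms in blast)
  have "transition c c' (chart_map c x) = chart_map c' x" using chart(5)[OF assms(1)] assms(3) by (simp add: transition_def)
  then show "chart_metric c (chart_map c x) v w = chart_metric c' (chart_map c' x)
      (frechet_derivative (transition c c') (at (chart_map c x)) v) (frechet_derivative (transition c c') (at (chart_map c x)) w)"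
    using cc assms(3) unfolding compatible_charts_def by (metis imageI)
qed

lemma chart_change:
  assumes c: "c \<in> A" "c' \<in> A" and x: "\<sigma> t \<in> chart_dom c \<inter> chart_dom c'" and t: "t \<in> I"
    and \<sigma>: "continuous (at t within I) \<sigma>" and v: "((chart_map c \<circ> \<sigma>) has_vector_derivative v) (at t within I)"
  defines "v' \<equiv> frechet_derivative (transition c c') (at (chart_map c (\<sigma> t))) v"
  shows "((chart_map c' \<circ> \<sigma>) has_vector_derivative v') (at t within I)"
    and "chart_metric c' (chart_map c' (\<sigma> t)) v' v' = chart_metric c (chart_map c (\<sigma> t)) v v"
proof -
  show "chart_metric c' (chart_map c' (\<sigma> t)) v' v' = chart_metric c (chart_map c (\<sigma> t)) v v"
    using transition(2)[OF c x] unfolding v'_def by simp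
  have 1: "((transition c c' \<circ> (chart_map c \<circ> \<sigma>)) has_vector_derivative v') (at t within I)"
    unfolding v'_def by (rule vector_derivative_diff_chain_within[OF v]) (use transition(1)[OF c x] in \<open>auto intro: has_derivative_at_withinI\<close>)
  have ev: "\<forall>\<^sub>F s in at t within I. \<sigma> s \<in> chart_dom c"
    using \<sigma> x chart(1)[OF c(1)] unfolding continuous_within by (intro topological_tendstoD) auto
  have eq: "(transition c c' \<circ> (chart_map c \<circ> \<sigma>)) s = (chart_map c' \<circ> \<sigma>) s" if "\<sigma> s \<in> chart_dom c" for s
    using chart(5)[OF c(1) that] by (simp add: transition_def)
  show "((chart_map c' \<circ> \<sigma>) has_vector_derivative v') (at t within I)"
    unfolding has_vector_derivative_def
    by (rule has_derivative_transform_eventually[OF 1[unfolded has_vector_derivative_def]])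
      (use ev eq x t in \<open>auto elim: eventually_mono\<close>)
qed

lemma curve_speed_eq:
  assumes c: "c \<in> A" "\<sigma> t \<in> chart_dom c" and \<sigma>: "continuous (at t) \<sigma>" and v: "((chart_map c \<circ> \<sigma>) has_vector_derivative v) (at t)"
  shows "curve_speed A \<sigma> t = sqrt (chart_metric c (chart_map c (\<sigma> t)) v v)"
proof -
  define c' where "c' = (SOME c. c \<in> A \<and> \<sigma> t \<in> chart_dom c)"
  have c': "c' \<in> A" "\<sigma> t \<in> chart_dom c'" using someI_ex[OF chart_ex[of "\<sigma> t"]] unfolding c'_def by auto
  have x: "\<sigma> t \<in> chart_dom c \<inter> chart_dom c'" using c c' by auto
  note ch = chart_change[OF c(1) c'(1) x UNIV_I \<sigma> v]
  show ?thesis unfolding curve_speed_def c'_def[symmetric] Let_def vector_derivative_at[OF ch(1)] ch(2) ..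
qed

lemma curve_speed_nonneg: "0 \<le> curve_speed A \<sigma> t"
proof -
  define c where "c = (SOME c. c \<in> A \<and> \<sigma> t \<in> chart_dom c)"
  have c: "c \<in> A" "\<sigma> t \<in> chart_dom c" using someI_ex[OF chart_ex[of "\<sigma> t"]] unfolding c_def by auto
  interpret smooth_metric "img c" "chart_metric c" using chart(8)[OF c(1)] .
  have "0 \<le> chart_metric c (chart_map c (\<sigma> t)) v v" for v
    using g_pos[of "chart_map c (\<sigma> t)" v] linear_0[OF g_lin] c(2) by (cases "v = 0") (auto simp: less_imp_le)
  then show ?thesis unfolding curve_speed_def c_def[symmetric] Let_def by simp
qed

text \<open>\<open>curve_speed\<close> relies on a chart chosen anew at each time and on two-sided
  derivatives, so its continuity cannot be read off. \<open>sp\<close> uses the one-sided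
  derivatives; it is independent of the chart and, around each time, equals its expression in one
  fixed chart.\<close>

lemma C1_curve_speed:
  assumes \<sigma>: "C1_curve_on A {a..b} \<sigma>" and ab: "a < b"
  obtains sp where "continuous_on {a..b} sp" "\<And>t. t \<in> {a<..<b} \<Longrightarrow> curve_speed A \<sigma> t = sp t"
proof -
  have \<sigma>c: "continuous_on {a..b} \<sigma>" using \<sigma> by (simp add: C1_curve_on_def)
  obtain D where D: "\<And>c. c \<in> A \<Longrightarrow> continuous_on ({a..b} \<inter> \<sigma> -` chart_dom c) (D c)"
    "\<And>c t. c \<in> A \<Longrightarrow> t \<in> {a..b} \<inter> \<sigma> -` chart_dom c \<Longrightarrow> ((chart_map c \<circ> \<sigma>) has_vector_derivative D c t) (at t within {a..b})"
    using \<sigma> unfolding C1_curve_on_def by metis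
  define ch where "ch t = (SOME c. c \<in> A \<and> \<sigma> t \<in> chart_dom c)" for t
  have ch: "ch t \<in> A" "\<sigma> t \<in> chart_dom (ch t)" for t using someI_ex[OF chart_ex[of "\<sigma> t"]] unfolding ch_def by auto
  define sp where "sp t = sqrt (chart_metric (ch t) (chart_map (ch t) (\<sigma> t)) (D (ch t) t) (D (ch t) t))" for t
  have eq: "sp t = sqrt (chart_metric c (chart_map c (\<sigma> t)) (D c t) (D c t))"
    if t: "t \<in> {a..b}" and c: "c \<in> A" "\<sigma> t \<in> chart_dom c" for t c
  proof -
    have x: "\<sigma> t \<in> chart_dom c \<inter> chart_dom (ch t)" using c ch by auto
    have cont: "continuous (at t within {a..b}) \<sigma>" using \<sigma>c t by (simp add: continuous_on_eq_continuous_within)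
    have d: "((chart_map c \<circ> \<sigma>) has_vector_derivative D c t) (at t within {a..b})" using D(2)[OF c(1)] t c(2) by auto
    note cc = chart_change[OF c(1) ch(1) x t cont d]
    have "((chart_map (ch t) \<circ> \<sigma>) has_vector_derivative D (ch t) t) (at t within {a..b})" using D(2)[OF ch(1)] t ch(2) by auto
    then have "D (ch t) t = frechet_derivative (transition c (ch t)) (at (chart_map c (\<sigma> t))) (D c t)"
      using vector_derivative_unique_within_closed_interval[of a b t] ab t cc(1) unfolding box_real by blast
    then show ?thesis using cc(2) by (simp add: sp_def)
  qed
  have "continuous_on {a..b} sp"
    unfolding continuous_on_eq_continuous_within
  proof
    fix t assume t: "t \<in> {a..b}"
    define c where "c = ch t"
    have c: "c \<in> A" "\<sigma> t \<in> chart_dom c" using ch by (auto simp: c_def)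
    interpret smooth_metric "img c" "chart_metric c" using chart(8)[OF c(1)] .
    define J where "J = {a..b} \<inter> \<sigma> -` chart_dom c"
    have "continuous_on J (\<lambda>t. chart_map c (\<sigma> t))"
      by (rule continuous_on_compose2[OF chart(3)[OF c(1)] continuous_on_subset[OF \<sigma>c]]) (auto simp: J_def)
    then have "continuous_on J (\<lambda>t. sqrt (chart_metric c (chart_map c (\<sigma> t)) (D c t) (D c t)))"
      using D(1)[OF c(1)] by (intro continuous_intros cont_g) (auto simp: J_def)
    then have "continuous_on J sp"
      by (rule continuous_on_eq) (use eq c(1) in \<open>auto simp: J_def\<close>)
    then have sJ: "continuous (at t within J) sp" using t c(2) by (auto simp: continuous_on_eq_continuous_within J_def)
    obtain V where V: "open V" "J = {a..b} \<inter> V"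
      using continuous_openin_preimage_gen[OF \<sigma>c chart(1)[OF c(1)]] unfolding J_def openin_open by auto
    have "at t within J = at t within {a..b}"
    proof (rule at_within_nhd[OF _ V(1)])
      have "t \<in> J" using t c(2) by (simp add: J_def)
      then show "t \<in> V" using V(2) by blast
      show "J \<inter> V - {t} = {a..b} \<inter> V - {t}" using V(2) by blast
    qed
    then show "continuous (at t within {a..b}) sp" using sJ by simp
  qed
  moreover have "curve_speed A \<sigma> t = sp t" if t: "t \<in> {a<..<b}" for t
  proof -
    have at: "at t within {a..b} = at t" using t by (simp add: at_within_Icc_at)
    have t1: "t \<in> {a..b}" using t by auto
    have "continuous (at t) \<sigma>" using \<sigma>c t1 at by (metis continuous_on_eq_continuous_within)
    moreover have "((chart_map (ch t) \<circ> \<sigma>) has_vector_derivative D (ch t) t) (at t)"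
    proof -
      have "t \<in> {a..b} \<inter> \<sigma> -` chart_dom (ch t)" using t1 ch(2)[of t] by simp
      from D(2)[OF ch(1) this] show ?thesis unfolding at .
    qed
    ultimately show ?thesis using curve_speed_eq[where c = "ch t" and \<sigma> = \<sigma> and t = t, OF ch] by (simp add: sp_def)
  qed
  ultimately show thesis by (rule that)
qed

lemma piecewise_C1_facts:
  assumes \<sigma>: "piecewise_C1_curve A \<sigma>"
  obtains F where "finite F" "curve_speed A \<sigma> integrable_on {0..1}" "continuous_on {0..1} \<sigma>"
    "\<And>t. t \<in> {0<..<1} - F \<Longrightarrow> continuous (at t) (curve_speed A \<sigma>) \<and> continuous (at t) \<sigma>"
    "\<And>t c. t \<in> {0<..<1} - F \<Longrightarrow> c \<in> A \<Longrightarrow> \<sigma> t \<in> chart_dom c \<Longrightarrow> \<exists>v. ((chart_map c \<circ> \<sigma>) has_vector_derivative v) (at t)"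
proof -
  obtain F where F: "finite F" "\<And>a b. 0 \<le> a \<Longrightarrow> a < b \<Longrightarrow> b \<le> 1 \<Longrightarrow> {a<..<b} \<inter> F = {} \<Longrightarrow> C1_curve_on A {a..b} \<sigma>"
    and c: "continuous_on {0..1} \<sigma>" using \<sigma> unfolding piecewise_C1_curve_def by blast
  have int: "curve_speed A \<sigma> integrable_on {0..1}"
  proof (rule integrable_on_pieces[OF F(1)])
    fix a b :: real assume ab: "0 \<le> a" "a < b" "b \<le> 1" "{a<..<b} \<inter> F = {}"
    obtain sp where sp: "continuous_on {a..b} sp" "\<And>t. t \<in> {a<..<b} \<Longrightarrow> curve_speed A \<sigma> t = sp t"
      by (rule C1_curve_speed[OF F(2)[OF ab] ab(2)]) blast
    have "sp integrable_on {a..b}" by (rule integrable_continuous_real[OF sp(1)])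
    then show "curve_speed A \<sigma> integrable_on {a..b}"
      by (rule integrable_spike_finite[of "{a, b}", rotated 2]) (use sp(2) in auto)
  qed simp
  have piece: "\<exists>a b. 0 \<le> a \<and> a < t \<and> t < b \<and> b \<le> 1 \<and> C1_curve_on A {a..b} \<sigma>" if t: "t \<in> {0<..<1} - F" for t
  proof -
    have "open ({0<..<1} - F)" using F(1) by (intro open_Diff finite_imp_closed) auto
    then obtain e where e: "0 < e" "cball t e \<subseteq> {0<..<1} - F" using t open_contains_cball by blast
    have "t - e \<in> cball t e" "t + e \<in> cball t e" "{t - e<..<t + e} \<subseteq> cball t e" using e(1) by (auto simp: dist_real_def)
    then have "t - e \<in> {0<..<1}" "t + e \<in> {0<..<1}" and FF: "{t - e<..<t + e} \<inter> F = {}" using e(2) by blast+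
    then have "0 \<le> t - e" "t + e \<le> 1" by simp_all
    note this FF
    then show ?thesis using F(2)[of "t - e" "t + e"] e(1) by (intro exI[of _ "t - e"] exI[of _ "t + e"]) auto
  qed
  show thesis
  proof (rule that[OF F(1) int c])
    fix t assume t: "t \<in> {0<..<1} - F"
    obtain a b where ab: "0 \<le> a" "a < t" "t < b" "b \<le> 1" "C1_curve_on A {a..b} \<sigma>" using piece[OF t] by blast
    have at: "at t within {a..b} = at t" using ab by (simp add: at_within_Icc_at)
    obtain sp where sp: "continuous_on {a..b} sp" "\<And>t. t \<in> {a<..<b} \<Longrightarrow> curve_speed A \<sigma> t = sp t"
      by (rule C1_curve_speed[OF ab(5)]) (use ab in auto)
    have "continuous_on {a<..<b} (curve_speed A \<sigma>)"
    proof (rule continuous_on_eq)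
      show "continuous_on {a<..<b} sp" by (rule continuous_on_subset[OF sp(1)]) (rule greaterThanLessThan_subseteq_atLeastAtMost_iff[THEN iffD2], simp)
    qed (use sp(2) in simp)
    then have "continuous (at t) (curve_speed A \<sigma>)" using ab by (simp add: continuous_on_eq_continuous_at)
    moreover have "continuous (at t) \<sigma>"
      using ab(5) ab(2,3) at unfolding C1_curve_on_def by (metis atLeastAtMost_iff continuous_on_eq_continuous_within less_imp_le)
    ultimately show "continuous (at t) (curve_speed A \<sigma>) \<and> continuous (at t) \<sigma>" by blast
    fix c assume "c \<in> A" "\<sigma> t \<in> chart_dom c"
    then show "\<exists>v. ((chart_map c \<circ> \<sigma>) has_vector_derivative v) (at t)"
      using ab(5) ab(2,3) at unfolding C1_curve_on_def by (metis IntI atLeastAtMost_iff less_imp_le vimageI2)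
  qed
qed

section \<open>Restriction, charts and joining of curves\<close>

lemma C1_curve_affine:
  assumes \<sigma>: "C1_curve_on A {k * a + m..k * b + m} \<sigma>" and k: "0 < k"
  shows "C1_curve_on A {a..b} (\<lambda>u. \<sigma> (k * u + m))"
proof -
  have sub: "(\<lambda>u. k * u + m) ` {a..b} \<subseteq> {k * a + m..k * b + m}" using k by (auto intro: mult_left_mono)
  have aff: "continuous_on J (\<lambda>u. k * u + m)" for J by (intro continuous_intros)
  show ?thesis
    unfolding C1_curve_on_def
  proof (intro conjI ballI)
    show "continuous_on {a..b} (\<lambda>u. \<sigma> (k * u + m))"
      using \<sigma> continuous_on_compose2[OF _ aff sub] unfolding C1_curve_on_def by blast
    fix c assume "c \<in> A"
    then obtain D where D: "continuous_on ({k * a + m..k * b + m} \<inter> \<sigma> -` chart_dom c) D"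
      "\<And>t. t \<in> {k * a + m..k * b + m} \<inter> \<sigma> -` chart_dom c \<Longrightarrow> ((chart_map c \<circ> \<sigma>) has_vector_derivative D t) (at t within {k * a + m..k * b + m})"
      using \<sigma> unfolding C1_curve_on_def by metis
    show "\<exists>D. continuous_on ({a..b} \<inter> (\<lambda>u. \<sigma> (k * u + m)) -` chart_dom c) D \<and>
        (\<forall>t\<in>{a..b} \<inter> (\<lambda>u. \<sigma> (k * u + m)) -` chart_dom c. ((chart_map c \<circ> (\<lambda>u. \<sigma> (k * u + m))) has_vector_derivative D t) (at t within {a..b}))"
    proof (intro exI[of _ "\<lambda>u. k *\<^sub>R D (k * u + m)"] conjI ballI)
      show "continuous_on ({a..b} \<inter> (\<lambda>u. \<sigma> (k * u + m)) -` chart_dom c) (\<lambda>u. k *\<^sub>R D (k * u + m))"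
        by (intro continuous_intros continuous_on_compose2[OF D(1)]) (use sub in auto)
      fix t assume t: "t \<in> {a..b} \<inter> (\<lambda>u. \<sigma> (k * u + m)) -` chart_dom c"
      then have t': "k * t + m \<in> {k * a + m..k * b + m} \<inter> \<sigma> -` chart_dom c" using sub by blast
      have "((\<lambda>u. k * u + m) has_vector_derivative k) (at t within {a..b})" by (auto intro!: derivative_eq_intros)
      from vector_diff_chain_within[OF this has_vector_derivative_within_subset[OF D(2)[OF t'] sub]]
      show "((chart_map c \<circ> (\<lambda>u. \<sigma> (k * u + m))) has_vector_derivative k *\<^sub>R D (k * t + m)) (at t within {a..b})"
        by (simp add: o_def)
    qed
  qed
qed

lemma C1_curve_cong:
  assumes "C1_curve_on A I \<sigma>" "\<And>t. t \<in> I \<Longrightarrow> \<sigma> t = \<tau> t"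
  shows "C1_curve_on A I \<tau>"
proof -
  have e: "I \<inter> \<tau> -` X = I \<inter> \<sigma> -` X" for X using assms(2) by auto
  show ?thesis
    unfolding C1_curve_on_def e
  proof (intro conjI ballI)
    show "continuous_on I \<tau>" using assms unfolding C1_curve_on_def by (metis continuous_on_cong)
    fix c assume "c \<in> A"
    then obtain D where D: "continuous_on (I \<inter> \<sigma> -` chart_dom c) D"
      "\<And>t. t \<in> I \<inter> \<sigma> -` chart_dom c \<Longrightarrow> ((chart_map c \<circ> \<sigma>) has_vector_derivative D t) (at t within I)"
      using assms(1) unfolding C1_curve_on_def by metis
    have "((chart_map c \<circ> \<tau>) has_vector_derivative D t) (at t within I)" if "t \<in> I \<inter> \<sigma> -` chart_dom c" for t
      by (rule has_vector_derivative_transform[OF _ _ D(2)[OF that]]) (use that assms(2) in auto)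
    then show "\<exists>D. continuous_on (I \<inter> \<sigma> -` chart_dom c) D \<and> (\<forall>t\<in>I \<inter> \<sigma> -` chart_dom c. ((chart_map c \<circ> \<tau>) has_vector_derivative D t) (at t within I))"
      using D(1) by blast
  qed
qed

text \<open>Rescaled pieces of a curve make it possible to bound the distance between two of its
  intermediate points by the integral of the speed between them.\<close>

lemma subcurve:
  assumes \<sigma>: "piecewise_C1_curve A \<sigma>" and st: "0 \<le> s" "s < t" "t \<le> 1"
  defines "\<tau> \<equiv> \<lambda>u. \<sigma> ((t - s) * u + s)"
  shows "piecewise_C1_curve A \<tau>" "curve_length A \<tau> = integral {s..t} (curve_speed A \<sigma>)"
proof -
  define k where "k = t - s"
  have k: "0 < k" "k + s = t" using st by (auto simp: k_def)
  have sub: "k * u + s \<in> {0..1}" if "u \<in> {0..1}" for u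
  proof -
    have "0 \<le> k * u" "k * u \<le> k" using k that mult_left_mono[of u 1 k] by simp_all
    then have "0 \<le> k * u + s" "k * u + s \<le> 1" using st k by linarith+
    then show ?thesis by simp
  qed
  obtain F where F: "finite F" "\<And>a b. 0 \<le> a \<Longrightarrow> a < b \<Longrightarrow> b \<le> 1 \<Longrightarrow> {a<..<b} \<inter> F = {} \<Longrightarrow> C1_curve_on A {a..b} \<sigma>"
    and c: "continuous_on {0..1} \<sigma>" using \<sigma> unfolding piecewise_C1_curve_def by blast
  have "finite ((\<lambda>u. k * u + s) -` F)" using F(1) k by (intro finite_vimageI) (auto simp: inj_on_def)
  moreover have "C1_curve_on A {a..b} \<tau>" if ab: "0 \<le> a" "a < b" "b \<le> 1" "{a<..<b} \<inter> (\<lambda>u. k * u + s) -` F = {}" for a b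
    unfolding \<tau>_def k_def[symmetric]
  proof (rule C1_curve_affine[OF F(2) k(1)])
    show "0 \<le> k * a + s" "k * b + s \<le> 1" using sub[of a] sub[of b] ab by auto
    show "k * a + s < k * b + s" using ab k by simp
    show "{k * a + s<..<k * b + s} \<inter> F = {}"
    proof (rule ccontr)
      assume "\<not> ?thesis"
      then obtain x where x: "x \<in> {k * a + s<..<k * b + s}" "x \<in> F" by blast
      then have "(x - s) / k \<in> {a<..<b} \<inter> (\<lambda>u. k * u + s) -` F" using k by (auto simp: field_simps)
      then show False using ab(4) by blast
    qed
  qed
  moreover have "continuous_on {0..1} \<tau>" unfolding \<tau>_def k_def[symmetric]
    by (rule continuous_on_compose2[OF c]) (intro continuous_intros, use sub in blast)
  ultimately show "piecewise_C1_curve A \<tau>" unfolding piecewise_C1_curve_def by blast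
  obtain F' where F': "finite F'" "curve_speed A \<sigma> integrable_on {0..1}"
    "\<And>t. t \<in> {0<..<1} - F' \<Longrightarrow> continuous (at t) (curve_speed A \<sigma>) \<and> continuous (at t) \<sigma>"
    "\<And>t c. t \<in> {0<..<1} - F' \<Longrightarrow> c \<in> A \<Longrightarrow> \<sigma> t \<in> chart_dom c \<Longrightarrow> \<exists>v. ((chart_map c \<circ> \<sigma>) has_vector_derivative v) (at t)"
    by (rule piecewise_C1_facts[OF \<sigma>]) blast
  have speed: "curve_speed A \<tau> u = k * curve_speed A \<sigma> (k * u + s)" if u: "u \<in> {0<..<1} - (\<lambda>u. k * u + s) -` F'" for u
  proof -
    have "0 < k * u" "k * u < k" using k u mult_strict_left_mono[of u 1 k] by simp_all
    then have "0 < k * u + s" "k * u + s < 1" using st k by linarith+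
    then have x: "k * u + s \<in> {0<..<1} - F'" using u by simp
    define ch where "ch = (SOME c. c \<in> A \<and> \<tau> u \<in> chart_dom c)"
    have ch: "ch \<in> A" "\<tau> u \<in> chart_dom ch" using someI_ex[OF chart_ex[of "\<tau> u"]] unfolding ch_def by auto
    have ch': "\<sigma> (k * u + s) \<in> chart_dom ch" using ch(2) by (simp add: \<tau>_def k_def)
    obtain v where v: "((chart_map ch \<circ> \<sigma>) has_vector_derivative v) (at (k * u + s))" using F'(4)[OF x ch(1) ch'] by blast
    have d: "((\<lambda>u. k * u + s) has_vector_derivative k) (at u)" by (auto intro!: derivative_eq_intros)
    have "((chart_map ch \<circ> \<tau>) has_vector_derivative k *\<^sub>R v) (at u)"
      using vector_diff_chain_at[OF d v] by (simp add: \<tau>_def k_def o_def)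
    moreover have "continuous (at u) \<tau>"
      unfolding \<tau>_def k_def[symmetric] using F'(3)[OF x] by (intro continuous_at_compose[of u "\<lambda>u. k * u + s" \<sigma>, unfolded o_def]) (auto intro!: continuous_intros)
    ultimately have "curve_speed A \<tau> u = sqrt (chart_metric ch (chart_map ch (\<tau> u)) (k *\<^sub>R v) (k *\<^sub>R v))"
      using curve_speed_eq[where c = ch and \<sigma> = \<tau> and t = u, OF ch] by blast
    also have "\<dots> = k * sqrt (chart_metric ch (chart_map ch (\<sigma> (k * u + s))) v v)"
    proof -
      interpret smooth_metric "img ch" "chart_metric ch" using chart(8)[OF ch(1)] .
      have "chart_metric ch (chart_map ch (\<tau> u)) (k *\<^sub>R v) (k *\<^sub>R v) = k\<^sup>2 * chart_metric ch (chart_map ch (\<tau> u)) v v"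
        using ch(2) linear_cmul[OF g_lin] linear_cmul[OF g_lin'] by (simp add: power2_eq_square)
      then show ?thesis using k by (simp add: real_sqrt_mult \<tau>_def k_def)
    qed
    also have "\<dots> = k * curve_speed A \<sigma> (k * u + s)" using curve_speed_eq[where c = ch and \<sigma> = \<sigma> and t = "k * u + s", OF ch(1) ch' _ v] F'(3)[OF x] by simp
    finally show ?thesis .
  qed
  have "curve_speed A \<sigma> integrable_on {s..t}" by (rule integrable_subinterval_real[OF F'(2)]) (use st in auto)
  then have "(curve_speed A \<sigma> has_integral integral {s..t} (curve_speed A \<sigma>)) (cbox s t)" by (simp add: integrable_integral)
  from has_integral_affinity[OF this, of k s] k
  have "((\<lambda>u. curve_speed A \<sigma> (k * u + s)) has_integral (1 / k) * integral {s..t} (curve_speed A \<sigma>)) ((\<lambda>x. (1 / k) * x + - ((1 / k) * s)) ` {s..t})"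
    by simp
  moreover have "(\<lambda>x. (1 / k) * x + - ((1 / k) * s)) ` {s..t} = {0..1}"
    using k st image_affinity_atLeastAtMost[of "1 / k" "- ((1 / k) * s)" s t] by (auto simp: field_simps)
  ultimately have "((\<lambda>u. k * curve_speed A \<sigma> (k * u + s)) has_integral integral {s..t} (curve_speed A \<sigma>)) {0..1}"
    using k has_integral_mult_right[of "\<lambda>u. curve_speed A \<sigma> (k * u + s)" "(1 / k) * integral {s..t} (curve_speed A \<sigma>)" "{0..1}" k] by simp
  then have "(curve_speed A \<tau> has_integral integral {s..t} (curve_speed A \<sigma>)) {0..1}"
  proof (rule has_integral_spike_finite[where S = "(\<lambda>u. k * u + s) -` F' \<union> {0, 1}", rotated 2])
    show "finite ((\<lambda>u. k * u + s) -` F' \<union> {0, 1})" using F'(1) k by (intro finite_UnI finite_vimageI) (auto simp: inj_on_def)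
    show "curve_speed A \<tau> x = k * curve_speed A \<sigma> (k * x + s)" if "x \<in> {0..1} - ((\<lambda>u. k * u + s) -` F' \<union> {0, 1})" for x
      by (rule speed) (use that in auto)
  qed
  then show "curve_length A \<tau> = integral {s..t} (curve_speed A \<sigma>)" unfolding curve_length_def by (rule integral_unique)
qed

section \<open>The Riemannian distance\<close>

lemma dist_Inf: "dist x y = Inf {curve_length A \<sigma> | \<sigma>. piecewise_C1_curve A \<sigma> \<and> \<sigma> 0 = x \<and> \<sigma> 1 = y}"
  using man unfolding riemannian_manifold_def by blast

lemma curve_length_nonneg: "0 \<le> curve_length A \<sigma>"
  unfolding curve_length_def by (cases "curve_speed A \<sigma> integrable_on {0..1}")
    (auto intro: integral_nonneg curve_speed_nonneg simp: not_integrable_integral)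

lemma dist_le_curve_length: "piecewise_C1_curve A \<sigma> \<Longrightarrow> dist (\<sigma> 0) (\<sigma> 1) \<le> curve_length A \<sigma>"
  unfolding dist_Inf by (rule cInf_lower) (auto intro!: bdd_belowI[of _ 0] curve_length_nonneg)

lemma dist_le_integral_speed:
  assumes \<sigma>: "piecewise_C1_curve A \<sigma>" and st: "0 \<le> s" "s \<le> t" "t \<le> 1"
  shows "dist (\<sigma> s) (\<sigma> t) \<le> integral {s..t} (curve_speed A \<sigma>)"
proof (cases "s = t")
  case False
  then have "s < t" using st by simp
  from subcurve[OF \<sigma> st(1) this st(3)] dist_le_curve_length show ?thesis by fastforce
qed simp

lemma chart_curve:
  assumes c: "c \<in> A" and k: "\<And>t. t \<in> {0..1} \<Longrightarrow> (k has_vector_derivative k' t) (at t within {0..1})"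
    and k': "continuous_on {0..1} k'" and img: "k ` {0..1} \<subseteq> img c"
  shows "piecewise_C1_curve A (coord c \<circ> k)"
    and "curve_length A (coord c \<circ> k) = integral {0..1} (\<lambda>t. sqrt (chart_metric c (k t) (k' t) (k' t)))"
proof -
  have kc: "continuous_on {0..1} k"
    using k has_vector_derivative_continuous by (fastforce simp: continuous_on_eq_continuous_within)
  have \<sigma>c: "continuous_on {0..1} (coord c \<circ> k)"
    unfolding o_def by (rule continuous_on_compose2[OF chart(4)[OF c] kc img])
  have kd: "chart_map c ((coord c \<circ> k) t) = k t" "(coord c \<circ> k) t \<in> chart_dom c" if "t \<in> {0..1}" for t
  proof -
    have "k t \<in> img c" using img that by blast
    then show "chart_map c ((coord c \<circ> k) t) = k t" "(coord c \<circ> k) t \<in> chart_dom c" using chart(6,7)[OF c] by simp_all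
  qed
  have "C1_curve_on A {a..b} (coord c \<circ> k)" if ab: "0 \<le> a" "a < b" "b \<le> 1" for a b
    unfolding C1_curve_on_def
  proof (intro conjI ballI)
    have sub: "{a..b} \<subseteq> {0..1}" using ab by auto
    show "continuous_on {a..b} (coord c \<circ> k)" using \<sigma>c sub continuous_on_subset by blast
    fix c' assume c': "c' \<in> A"
    let ?J = "{a..b} \<inter> (coord c \<circ> k) -` chart_dom c'"
    let ?D = "\<lambda>t. frechet_derivative (transition c c') (at (k t)) (k' t)"
    have x: "(coord c \<circ> k) t \<in> chart_dom c \<inter> chart_dom c'" if "t \<in> ?J" for t using that kd(2) sub by auto
    have kx: "k t \<in> chart_map c ` (chart_dom c \<inter> chart_dom c')" if "t \<in> ?J" for t
    proof -
      have "k t = chart_map c ((coord c \<circ> k) t)" using kd(1)[of t] that sub by auto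
      then show ?thesis using x[OF that] by blast
    qed
    show "\<exists>D. continuous_on ?J D \<and> (\<forall>t\<in>?J. ((chart_map c' \<circ> (coord c \<circ> k)) has_vector_derivative D t) (at t within {a..b}))"
    proof (intro exI[of _ ?D] conjI ballI)
      show "continuous_on ?J ?D"
      proof (cases "?J = {}")
        case False
        then obtain t0 where t0: "t0 \<in> ?J" by blast
        note sm = transition(3)[OF c c' x[OF t0]]
        show ?thesis
        proof (rule continuous_on_linear_param[where f = "\<lambda>t v. frechet_derivative (transition c c') (at (k t)) v"])
          show "linear (\<lambda>v. frechet_derivative (transition c c') (at (k t)) v)" if "t \<in> ?J" for t
            using linear_frechet_derivative[OF smooth_on_differentiable[OF sm kx[OF that]]] by simp
          show "continuous_on ?J (\<lambda>t. frechet_derivative (transition c c') (at (k t)) v)" for v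
            by (rule continuous_on_compose2[OF smooth_on_continuous[OF smooth_on_frechet_derivative[OF sm]] continuous_on_subset[OF kc]])
              (use kx sub in auto)
          show "continuous_on ?J k'" using k' sub continuous_on_subset by blast
        qed
      qed simp
      fix t assume t: "t \<in> ?J"
      have d: "((chart_map c \<circ> (coord c \<circ> k)) has_vector_derivative k' t) (at t within {a..b})"
        by (rule has_vector_derivative_transform[OF _ _ has_vector_derivative_within_subset[OF k sub]]) (use t sub kd in auto)
      show "((chart_map c' \<circ> (coord c \<circ> k)) has_vector_derivative ?D t) (at t within {a..b})"
      proof -
        have t': "t \<in> {a..b}" "t \<in> {0..1}" using t sub by auto
        have "continuous (at t within {a..b}) (coord c \<circ> k)"
          using continuous_on_subset[OF \<sigma>c sub] t'(1) unfolding continuous_on_eq_continuous_within by blast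
        from chart_change(1)[OF c c' x[OF t] t'(1) this d] show ?thesis unfolding kd(1)[OF t'(2)] .
      qed
    qed
  qed
  then show "piecewise_C1_curve A (coord c \<circ> k)" unfolding piecewise_C1_curve_def using \<sigma>c by blast
  have sp: "curve_speed A (coord c \<circ> k) t = sqrt (chart_metric c (k t) (k' t) (k' t))" if t: "t \<in> {0..1} - {0, 1}" for t
  proof -
    have at: "at t within {0..1} = at t" using t by (simp add: at_within_Icc_at)
    have t1: "t \<in> {0..1}" using t by auto
    have "((chart_map c \<circ> (coord c \<circ> k)) has_vector_derivative k' t) (at t within {0..1})"
      by (rule has_vector_derivative_transform[OF t1 _ k[OF t1]]) (use kd in auto)
    moreover have "continuous (at t within {0..1}) (coord c \<circ> k)" using \<sigma>c t1 continuous_on_eq_continuous_within by blast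
    ultimately show ?thesis using curve_speed_eq[where c = c and \<sigma> = "coord c \<circ> k" and t = t, OF c kd(2)[OF t1]] kd(1)[OF t1] unfolding at by simp
  qed
  show "curve_length A (coord c \<circ> k) = integral {0..1} (\<lambda>t. sqrt (chart_metric c (k t) (k' t) (k' t)))"
    unfolding curve_length_def by (rule integral_spike[of "{0, 1}"]) (use sp in auto)
qed

lemma piecewise_C1_join:
  assumes \<sigma>: "piecewise_C1_curve A \<sigma>" and \<tau>: "piecewise_C1_curve A \<tau>" and eq: "\<sigma> 1 = \<tau> 0"
  shows "piecewise_C1_curve A (\<sigma> +++ \<tau>)"
proof -
  obtain F where F: "finite F" "\<And>a b. 0 \<le> a \<Longrightarrow> a < b \<Longrightarrow> b \<le> 1 \<Longrightarrow> {a<..<b} \<inter> F = {} \<Longrightarrow> C1_curve_on A {a..b} \<sigma>"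
    and c: "continuous_on {0..1} \<sigma>" using \<sigma> unfolding piecewise_C1_curve_def by blast
  obtain F' where F': "finite F'" "\<And>a b. 0 \<le> a \<Longrightarrow> a < b \<Longrightarrow> b \<le> 1 \<Longrightarrow> {a<..<b} \<inter> F' = {} \<Longrightarrow> C1_curve_on A {a..b} \<tau>"
    and c': "continuous_on {0..1} \<tau>" using \<tau> unfolding piecewise_C1_curve_def by blast
  let ?K = "{1/2} \<union> ((\<lambda>x. x / 2) ` F \<union> (\<lambda>x. (x + 1) / 2) ` F')"
  have "continuous_on {0..1} (\<sigma> +++ \<tau>)"
    using path_join_imp[of \<sigma> \<tau>] c c' eq by (simp add: path_def pathfinish_def pathstart_def)
  moreover have "finite ?K" using F(1) F'(1) by simp
  moreover have "C1_curve_on A {a..b} (\<sigma> +++ \<tau>)" if ab: "0 \<le> a" "a < b" "b \<le> 1" "{a<..<b} \<inter> ?K = {}" for a b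
  proof -
    have "1/2 \<notin> {a<..<b}" using ab(4) by blast
    then consider "b \<le> 1/2" | "1/2 \<le> a" by force
    then show ?thesis
    proof cases
      case 1
      have n: "{2 * a + 0<..<2 * b + 0} \<inter> F = {}"
      proof (rule ccontr)
        assume "\<not> ?thesis"
        then obtain x where "x \<in> {2 * a + 0<..<2 * b + 0}" "x \<in> F" by blast
        then have "x / 2 \<in> {a<..<b} \<inter> ?K" by auto
        then show False using ab(4) by blast
      qed
      have "C1_curve_on A {a..b} (\<lambda>u. \<sigma> (2 * u + 0))"
        by (rule C1_curve_affine[OF F(2)[OF _ _ _ n]]) (use ab 1 in auto)
      then show ?thesis by (rule C1_curve_cong) (use 1 in \<open>auto simp: joinpaths_def\<close>)
    next
      case 2
      have n: "{2 * a + (- 1)<..<2 * b + (- 1)} \<inter> F' = {}"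
      proof (rule ccontr)
        assume "\<not> ?thesis"
        then obtain x where "x \<in> {2 * a + (- 1)<..<2 * b + (- 1)}" "x \<in> F'" by blast
        then have "(x + 1) / 2 \<in> {a<..<b} \<inter> ?K" by auto
        then show False using ab(4) by blast
      qed
      have "C1_curve_on A {a..b} (\<lambda>u. \<tau> (2 * u + (- 1)))"
        by (rule C1_curve_affine[OF F'(2)[OF _ _ _ n]]) (use ab 2 in auto)
      moreover have "\<tau> (2 * u + (- 1)) = (\<sigma> +++ \<tau>) u" if "u \<in> {a..b}" for u
      proof (cases "u = 1/2")
        case True then show ?thesis using eq unfolding True joinpaths_def by simp
      next
        case False
        then have "\<not> u \<le> 1/2" using that 2 by auto
        then show ?thesis by (simp add: joinpaths_def)
      qed
      ultimately show ?thesis by (rule C1_curve_cong)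
    qed
  qed
  ultimately have "continuous_on {0..1} (\<sigma> +++ \<tau>) \<and> (\<exists>S. finite S \<and> (\<forall>a b. 0 \<le> a \<and> a < b \<and> b \<le> 1 \<and> {a<..<b} \<inter> S = {} \<longrightarrow>
      C1_curve_on A {a..b} (\<sigma> +++ \<tau>)))"
    by (intro conjI exI[of _ ?K] allI impI) (assumption, assumption, elim conjE, assumption)
  then show ?thesis unfolding piecewise_C1_curve_def .
qed

lemma chart_segment:
  assumes c: "c \<in> A" and V: "convex V" "V \<subseteq> img c" and xy: "x \<in> chart_dom c" "y \<in> chart_dom c" "chart_map c x \<in> V" "chart_map c y \<in> V"
  shows "\<exists>\<sigma>. piecewise_C1_curve A \<sigma> \<and> \<sigma> 0 = x \<and> \<sigma> 1 = y"
proof -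
  let ?k = "linepath (chart_map c x) (chart_map c y)"
  have "?k ` {0..1} \<subseteq> img c"
    using closed_segment_subset[OF xy(3,4) V(1)] V(2) unfolding path_image_def[symmetric] by simp
  then have "piecewise_C1_curve A (coord c \<circ> ?k)"
    by (rule chart_curve(1)[OF c has_vector_derivative_linepath_within continuous_on_const])
  moreover have "(coord c \<circ> ?k) 0 = x" "(coord c \<circ> ?k) 1 = y"
    using chart(5)[OF c xy(1)] chart(5)[OF c xy(2)] by (simp_all add: linepath_def)
  ultimately show ?thesis by blast
qed

text \<open>Otherwise the infimum defining the distance could be taken over the empty set. Segments
  in a chart join every point to its neighbours and joining is transitive, so the points joined to
  \<open>x\<close> form a set that is open and closed.\<close>

lemma curve_ex: "\<exists>\<sigma>. piecewise_C1_curve A \<sigma> \<and> \<sigma> 0 = x \<and> \<sigma> 1 = y"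
proof -
  define joined where "joined x y \<longleftrightarrow> (\<exists>\<sigma>. piecewise_C1_curve A \<sigma> \<and> \<sigma> 0 = x \<and> \<sigma> 1 = y)" for x y
  have trans: "joined x z" if xy: "joined x y" and yz: "joined y z" for x y z
  proof -
    obtain \<sigma> where \<sigma>: "piecewise_C1_curve A \<sigma>" "\<sigma> 0 = x" "\<sigma> 1 = y" using xy unfolding joined_def by blast
    obtain \<tau> where \<tau>: "piecewise_C1_curve A \<tau>" "\<tau> 0 = y" "\<tau> 1 = z" using yz unfolding joined_def by blast
    have "piecewise_C1_curve A (\<sigma> +++ \<tau>)" by (rule piecewise_C1_join) (use \<sigma> \<tau> in auto)
    moreover have "(\<sigma> +++ \<tau>) 0 = x" "(\<sigma> +++ \<tau>) 1 = z" using \<sigma> \<tau> by (simp_all add: joinpaths_def)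
    ultimately show ?thesis unfolding joined_def by blast
  qed
  have local: "\<exists>U. open U \<and> y \<in> U \<and> (\<forall>u\<in>U. joined y u \<and> joined u y)" for y
  proof -
    obtain c where c: "c \<in> A" "y \<in> chart_dom c" using chart_ex by blast
    obtain e where e: "0 < e" "ball (chart_map c y) e \<subseteq> img c"
      using chart(2)[OF c(1)] c(2) open_contains_ball by blast
    define U where "U = chart_map c -` ball (chart_map c y) e \<inter> chart_dom c"
    have "open U" unfolding U_def
      using continuous_on_open_vimage[OF chart(1)[OF c(1)]] chart(3)[OF c(1)] open_ball by blast
    moreover have "y \<in> U" using c e by (simp add: U_def)
    moreover have "joined y u \<and> joined u y" if "u \<in> U" for u
    proof -
      have u: "u \<in> chart_dom c" "chart_map c u \<in> ball (chart_map c y) e" using that by (auto simp: U_def)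
      have y: "chart_map c y \<in> ball (chart_map c y) e" using e(1) by simp
      show ?thesis unfolding joined_def
        using chart_segment[OF c(1) convex_ball e(2) c(2) u(1) y u(2)] chart_segment[OF c(1) convex_ball e(2) u(1) c(2) u(2) y] by blast
    qed
    ultimately show ?thesis by blast
  qed
  define C where "C = {y. joined x y}"
  have "\<exists>U. open U \<and> y \<in> U \<and> U \<subseteq> C" if y: "y \<in> C" for y
  proof -
    obtain U where U: "open U" "y \<in> U" "\<And>u. u \<in> U \<Longrightarrow> joined y u" using local[of y] by blast
    have "u \<in> C" if "u \<in> U" for u using trans[OF _ U(3)[OF that], of x] y unfolding C_def by simp
    then show ?thesis using U by blast
  qed
  then have "open C" unfolding open_subopen[of C] by blast
  moreover have "\<exists>U. open U \<and> y \<in> U \<and> U \<subseteq> - C" if y: "y \<in> - C" for y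
  proof -
    obtain U where U: "open U" "y \<in> U" "\<And>u. u \<in> U \<Longrightarrow> joined u y" using local[of y] by blast
    have "u \<notin> C" if "u \<in> U" for u using trans[OF _ U(3)[OF that], of x] y unfolding C_def by auto
    then show ?thesis using U by blast
  qed
  then have "open (- C)" unfolding open_subopen[of "- C"] by blast
  moreover have "x \<in> C" using local[of x] unfolding C_def by blast
  moreover have "connected (UNIV :: 'a set)" using man unfolding riemannian_manifold_def by blast
  ultimately have "- C = {}" using connectedD[of UNIV C "- C"] by auto
  then show ?thesis unfolding C_def joined_def by auto
qed

lemma short_curve:
  fixes x y :: 'a
  assumes "0 < e"
  obtains \<sigma> where "piecewise_C1_curve A \<sigma>" "\<sigma> 0 = x" "\<sigma> 1 = y" "curve_length A \<sigma> < dist x y + e"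
proof -
  let ?L = "{curve_length A \<sigma> | \<sigma>. piecewise_C1_curve A \<sigma> \<and> \<sigma> 0 = x \<and> \<sigma> 1 = y}"
  obtain \<sigma> where "piecewise_C1_curve A \<sigma> \<and> \<sigma> 0 = x \<and> \<sigma> 1 = y" using curve_ex[of x y] ..
  then have "curve_length A \<sigma> \<in> ?L" by blast
  then have "?L \<noteq> {}" by (metis empty_iff)
  moreover have "Inf ?L < dist x y + e" using assms dist_Inf[of x y] by simp
  ultimately obtain l where l: "l \<in> ?L" "l < dist x y + e" by (rule cInf_lessD[elim_format]) blast
  from l(1) obtain \<tau> where "l = curve_length A \<tau>" "piecewise_C1_curve A \<tau>" "\<tau> 0 = x" "\<tau> 1 = y" by blast
  then show thesis using that[of \<tau>] l(2) by simp
qed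

lemma short_path:
  fixes x y :: 'a
  assumes "0 < e"
  shows "\<exists>(\<sigma> :: real \<Rightarrow> 'a) (l :: real \<Rightarrow> real). continuous_on {0..1} \<sigma> \<and> \<sigma> 0 = x \<and> \<sigma> 1 = y \<and>
    (\<forall>s t. 0 \<le> s \<longrightarrow> s \<le> t \<longrightarrow> t \<le> 1 \<longrightarrow> dist (\<sigma> s) (\<sigma> t) \<le> l t - l s) \<and> l 1 - l 0 \<le> dist x y + (e :: real)"
proof -
  obtain \<sigma> where \<sigma>: "piecewise_C1_curve A \<sigma>" "\<sigma> 0 = x" "\<sigma> 1 = y" "curve_length A \<sigma> < dist x y + e"
    by (rule short_curve[OF assms]) blast
  obtain F where F: "curve_speed A \<sigma> integrable_on {0..1}" "continuous_on {0..1} \<sigma>"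
    by (rule piecewise_C1_facts[OF \<sigma>(1)]) blast
  define l where "l t = integral {0..t} (curve_speed A \<sigma>)" for t
  have "dist (\<sigma> s) (\<sigma> t) \<le> l t - l s" if st: "0 \<le> s" "s \<le> t" "t \<le> 1" for s t
  proof -
    have "curve_speed A \<sigma> integrable_on {0..t}" by (rule integrable_subinterval_real[OF F(1)]) (use st in auto)
    from Henstock_Kurzweil_Integration.integral_combine[OF st(1,2) this] dist_le_integral_speed[OF \<sigma>(1) st]
    show ?thesis unfolding l_def by linarith
  qed
  moreover have "l 1 - l 0 \<le> dist x y + e" using \<sigma>(4) unfolding l_def curve_length_def by simp
  ultimately show ?thesis using F(2) \<sigma>(2,3) by - (rule exI[of _ \<sigma>], rule exI[of _ l], simp)
qed

end

section \<open>Short curves stay in a chart\<close>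

lemma vector_mean_value:
  fixes f :: "real \<Rightarrow> 'b::real_inner"
  assumes t: "0 < t" "t \<le> 1" and f: "\<And>s. s \<in> {0..1} \<Longrightarrow> (f has_vector_derivative f' s) (at s within {0..1})"
  obtains s where "s \<in> {0<..<t}" "norm (f t - f 0) \<le> t * norm (f' s)"
proof -
  have "\<exists>s\<in>{0<..<t}. norm (f t - f 0) \<le> norm ((\<lambda>h. h *\<^sub>R f' s) (t - 0))"
  proof (rule mvt_general[OF t(1)])
    have "continuous_on {0..1} f"
      using f has_vector_derivative_continuous by (fastforce simp: continuous_on_eq_continuous_within)
    then show "continuous_on {0..t} f" by (rule continuous_on_subset) (use t in auto)
    fix s assume "0 < s" "s < t"
    then have "s \<in> {0<..<1}" "s \<in> {0..1}" using t by auto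
    then show "(f has_derivative (\<lambda>h. h *\<^sub>R f' s)) (at s)"
      using f[of s] by (simp add: has_vector_derivative_def at_within_Icc_at)
  qed
  then show thesis using that t by auto
qed

context riemannian
begin

text \<open>By the lower bound on the metric, \<open>sqrt l\<close> times the coordinate speed is at
  most the Riemannian speed; this is integrated.\<close>

lemma coordinate_displacement_le:
  assumes c: "c \<in> A" and \<sigma>: "piecewise_C1_curve A \<sigma>" and t: "0 \<le> t" "t \<le> 1" and l: "0 \<le> l"
    and \<sigma>c: "\<And>s. s \<in> {0..t} \<Longrightarrow> \<sigma> s \<in> chart_dom c"
    and low: "\<And>s v. s \<in> {0..t} \<Longrightarrow> l * (norm v)\<^sup>2 \<le> chart_metric c (chart_map c (\<sigma> s)) v v"
  shows "sqrt l * norm (chart_map c (\<sigma> t) - chart_map c (\<sigma> 0)) \<le> integral {0..t} (curve_speed A \<sigma>)"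
proof -
  obtain F where F: "finite F" "curve_speed A \<sigma> integrable_on {0..1}" "continuous_on {0..1} \<sigma>"
    "\<And>t. t \<in> {0<..<1} - F \<Longrightarrow> continuous (at t) (curve_speed A \<sigma>) \<and> continuous (at t) \<sigma>"
    "\<And>t c. t \<in> {0<..<1} - F \<Longrightarrow> c \<in> A \<Longrightarrow> \<sigma> t \<in> chart_dom c \<Longrightarrow> \<exists>v. ((chart_map c \<circ> \<sigma>) has_vector_derivative v) (at t)"
    by (rule piecewise_C1_facts[OF \<sigma>]) blast
  define f where "f = chart_map c \<circ> \<sigma>"
  \<comment> \<open>At exceptional times the derivative is set to 0, which keeps the pointwise bound
    by the speed valid there.\<close>
  define f' where "f' s = (if s \<in> {0<..<t} - F then vector_derivative f (at s) else 0)" for s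
  have fd: "(f has_vector_derivative f' s) (at s)" if s: "s \<in> {0<..<t} - F" for s
  proof -
    have s': "s \<in> {0<..<1} - F" "s \<in> {0..t}" using s t by auto
    obtain v where "(f has_vector_derivative v) (at s)" using F(5)[OF s'(1) c \<sigma>c[OF s'(2)]] unfolding f_def by blast
    then show ?thesis using s vector_derivative_at unfolding f'_def by fastforce
  qed
  have fc: "continuous_on {0..t} f"
    unfolding f_def o_def
    by (rule continuous_on_compose2[OF chart(3)[OF c] continuous_on_subset[OF F(3)]]) (use t \<sigma>c in auto)
  have "(f' has_integral (f t - f 0)) {0..t}"
    by (rule fundamental_theorem_of_calculus_interior_strong[OF F(1) t(1) fd fc])
  then have int: "((\<lambda>s. sqrt l *\<^sub>R f' s) has_integral sqrt l *\<^sub>R (f t - f 0)) {0..t}"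
    by (rule has_integral_cmul)
  have "norm (integral {0..t} (\<lambda>s. sqrt l *\<^sub>R f' s)) \<le> integral {0..t} (curve_speed A \<sigma>)"
  proof (rule integral_norm_bound_integral)
    show "(\<lambda>s. sqrt l *\<^sub>R f' s) integrable_on {0..t}" using int by blast
    show "curve_speed A \<sigma> integrable_on {0..t}" by (rule integrable_subinterval_real[OF F(2)]) (use t in auto)
    fix s assume s: "s \<in> {0..t}"
    show "norm (sqrt l *\<^sub>R f' s) \<le> curve_speed A \<sigma> s"
    proof (cases "s \<in> {0<..<t} - F")
      case True
      then have s': "s \<in> {0<..<1} - F" using t by auto
      have "curve_speed A \<sigma> s = sqrt (chart_metric c (chart_map c (\<sigma> s)) (f' s) (f' s))"
        using curve_speed_eq[where c = c and \<sigma> = \<sigma> and t = s, OF c \<sigma>c[OF s]] F(4)[OF s'] fd[OF True] unfolding f_def by blast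
      moreover have "sqrt (l * (norm (f' s))\<^sup>2) \<le> sqrt (chart_metric c (chart_map c (\<sigma> s)) (f' s) (f' s))"
        using low[OF s] by simp
      ultimately show ?thesis using l by (simp add: real_sqrt_mult)
    next
      case False
      then have "f' s = 0" unfolding f'_def by auto
      then show ?thesis using curve_speed_nonneg by simp
    qed
  qed
  then show ?thesis using l unfolding integral_unique[OF int] by (simp add: f_def)
qed

text \<open>Up to its first exit the curve would have to cover the coordinate distance
  \<open>\<tau> - \<rho>\<close>, which costs more than its whole length.\<close>

lemma short_curve_in_chart:
  assumes c: "c \<in> A" and \<sigma>: "piecewise_C1_curve A \<sigma>" and l: "0 \<le> l" and \<tau>: "cball p \<tau> \<subseteq> img c"
    and low: "\<And>q v. q \<in> cball p \<tau> \<Longrightarrow> l * (norm v)\<^sup>2 \<le> chart_metric c q v v"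
    and \<rho>: "\<sigma> 0 \<in> chart_dom c" "norm (chart_map c (\<sigma> 0) - p) \<le> \<rho>" "\<rho> < \<tau>"
    and len: "curve_length A \<sigma> < sqrt l * (\<tau> - \<rho>)" and t: "t \<in> {0..1}"
  shows "\<sigma> t \<in> chart_dom c \<and> chart_map c (\<sigma> t) \<in> ball p \<tau>"
proof (rule ccontr)
  assume nt: "\<not> ?thesis"
  obtain F where \<sigma>c: "continuous_on {0..1} \<sigma>" and int: "curve_speed A \<sigma> integrable_on {0..1}"
    by (rule piecewise_C1_facts[OF \<sigma>]) blast
  define N where "N = chart_map c -` ball p \<tau> \<inter> chart_dom c"
  \<comment> \<open>The curve might leave the chart without meeting the boundary of the coordinate
    ball. This is excluded because \<open>K\<close> is compact, hence closed: the exit point is a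
    limit of points of \<open>K\<close>, so it still has coordinates.\<close>
  define K where "K = coord c ` cball p \<tau>"
  have N: "open N" unfolding N_def
    using continuous_on_open_vimage[OF chart(1)[OF c]] chart(3)[OF c] open_ball by blast
  have "compact K" unfolding K_def by (rule compact_continuous_image[OF continuous_on_subset[OF chart(4)[OF c] \<tau>] compact_cball])
  then have K: "closed K" by (rule compact_imp_closed)
  have NK: "N \<subseteq> K"
  proof
    fix x assume "x \<in> N"
    then have "x = coord c (chart_map c x)" "chart_map c x \<in> cball p \<tau>" using chart(5)[OF c] by (auto simp: N_def)
    then show "x \<in> K" unfolding K_def by blast
  qed
  define T where "T = \<sigma> -` (- N) \<inter> {0..1}"
  have "closed T" unfolding T_def using continuous_on_closed_vimage[of "{0..1}" \<sigma>] \<sigma>c N by blast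
  then have "compact T" using compact_Int_closed[of "{0..1::real}" T] unfolding T_def by (simp add: Int_commute Int_left_commute)
  moreover have "T \<noteq> {}" using nt t unfolding T_def N_def by auto
  ultimately obtain t1 where t1: "t1 \<in> T" "\<And>s. s \<in> T \<Longrightarrow> t1 \<le> s" using compact_attains_inf[of T] by auto
  have t1': "0 \<le> t1" "t1 \<le> 1" "\<sigma> t1 \<notin> N" using t1(1) unfolding T_def by auto
  have "\<sigma> 0 \<in> N" using \<rho> by (simp add: N_def dist_norm norm_minus_commute)
  then have t10: "0 < t1" using t1' by (cases "t1 = 0") auto
  have before: "\<sigma> s \<in> N" if "s \<in> {0..<t1}" for s using t1(2)[of s] that t1' unfolding T_def by force
  have "closed (\<sigma> -` K \<inter> {0..1})" using continuous_on_closed_vimage[of "{0..1}" \<sigma>] \<sigma>c K by blast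
  moreover have "{0..<t1} \<subseteq> \<sigma> -` K \<inter> {0..1}" using before subsetD[OF NK] t1' by auto
  ultimately have "closure {0..<t1} \<subseteq> \<sigma> -` K \<inter> {0..1}" by (intro closure_minimal)
  then have inK: "\<sigma> s \<in> K" if "s \<in> {0..t1}" for s using that t10 by auto
  have sK: "\<sigma> s \<in> chart_dom c" "chart_map c (\<sigma> s) \<in> cball p \<tau>" if s: "s \<in> {0..t1}" for s
  proof -
    obtain q where q: "q \<in> cball p \<tau>" "\<sigma> s = coord c q" using inK[OF s] unfolding K_def by blast
    then have "q \<in> img c" using \<tau> by blast
    then show "\<sigma> s \<in> chart_dom c" "chart_map c (\<sigma> s) \<in> cball p \<tau>" using chart(6,7)[OF c] q by simp_all
  qed
  have t1m: "t1 \<in> {0..t1}" using t1' by simp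
  have "chart_map c (\<sigma> t1) \<notin> ball p \<tau>" using t1'(3) sK(1)[OF t1m] by (auto simp: N_def)
  then have "\<tau> \<le> norm (chart_map c (\<sigma> t1) - p)" by (simp add: dist_norm norm_minus_commute)
  also have "\<dots> \<le> norm (chart_map c (\<sigma> t1) - chart_map c (\<sigma> 0)) + norm (chart_map c (\<sigma> 0) - p)"
    using norm_triangle_ineq[of "chart_map c (\<sigma> t1) - chart_map c (\<sigma> 0)" "chart_map c (\<sigma> 0) - p"] by simp
  finally have "\<tau> - \<rho> \<le> norm (chart_map c (\<sigma> t1) - chart_map c (\<sigma> 0))" using \<rho>(2) by linarith
  then have "sqrt l * (\<tau> - \<rho>) \<le> sqrt l * norm (chart_map c (\<sigma> t1) - chart_map c (\<sigma> 0))"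
    using l by (intro mult_left_mono) auto
  also have "\<dots> \<le> integral {0..t1} (curve_speed A \<sigma>)"
    by (rule coordinate_displacement_le[OF c \<sigma> t1'(1,2) l sK(1) low[OF sK(2)]])
  also have "\<dots> \<le> curve_length A \<sigma>"
    unfolding curve_length_def
    by (rule integral_subset_le[OF _ integrable_subinterval_real[OF int] int]) (use t1' curve_speed_nonneg in auto)
  finally show False using len by simp
qed

end

section \<open>Distance, inequality and reflection in a chart\<close>

locale nonpos_chart = riemannian A
  for A :: "('a::metric_space, 'e::euclidean_space) rchart set" +
  fixes c :: "('a, 'e) rchart"
  assumes c: "c \<in> A"
    and nonpos: "q \<in> img c \<Longrightarrow> u \<noteq> v \<Longrightarrow> independent {u, v} \<Longrightarrow> sectional_curvature (chart_metric c) q u v \<le> 0"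
begin

sublocale local_metric "img c" "chart_metric c" "christoffel (chart_metric c)"
  "\<lambda>q h u v. frechet_derivative (\<lambda>q. christoffel (chart_metric c) q u v) (at q) h"
  by (rule smooth_metric.nonpos_local_metric[OF chart(8)[OF c] nonpos])

text \<open>The solution of the boundary value problem is itself a curve, so the distance is at most
  its length. A shorter curve could not leave the coordinate ball of radius \<open>\<tau>0\<close>,
  and inside that ball \<open>geodesic_minimizes_length\<close> excludes it.\<close>

lemma local_distance:
  assumes P: "P \<in> chart_dom c"
  defines "p \<equiv> chart_map c P"
  obtains \<rho> k v where "0 < \<rho>" "cball p (8 * \<rho>) \<subseteq> img c" "8 * \<rho> \<le> 1"
    "\<And>x y. x \<in> ball p \<rho> \<Longrightarrow> y \<in> ball p \<rho> \<Longrightarrow> geodesic (k x y) (v x y) \<and> k x y 0 = x \<and> k x y 1 = y"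
    "\<And>x y t. x \<in> ball p \<rho> \<Longrightarrow> y \<in> ball p \<rho> \<Longrightarrow> t \<in> {0..1} \<Longrightarrow> k x y t \<in> cball p (4 * \<rho>) \<and> norm (v x y t) \<le> 4 * \<rho>"
    "\<And>x y x' y' t. x \<in> ball p \<rho> \<Longrightarrow> y \<in> ball p \<rho> \<Longrightarrow> x' \<in> ball p \<rho> \<Longrightarrow> y' \<in> ball p \<rho> \<Longrightarrow> t \<in> {0..1} \<Longrightarrow>
      norm (k x y t - k x' y' t) \<le> 2 * (norm (x - x') + norm (y - y')) \<and>
      norm (v x y t - v x' y' t) \<le> 2 * (norm (x - x') + norm (y - y'))"
    "\<And>x y t. x \<in> ball p \<rho> \<Longrightarrow> y \<in> ball p \<rho> \<Longrightarrow> t \<in> {0..1} \<Longrightarrow>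
      norm (k x y t - x) \<le> 2 * norm (x - y) \<and> norm (v x y t) \<le> 2 * norm (x - y)"
    "\<And>x y. x \<in> ball p \<rho> \<Longrightarrow> y \<in> ball p \<rho> \<Longrightarrow> (dist (coord c x) (coord c y))\<^sup>2 = chart_metric c x (v x y 0) (v x y 0)"
proof -
  have p: "p \<in> img c" using P by (simp add: p_def)
  obtain r l C where b: "0 < r" "0 < l" "0 < C" "cball p r \<subseteq> img c"
    "\<And>q v. q \<in> cball p r \<Longrightarrow> l * (norm v)\<^sup>2 \<le> chart_metric c q v v"
    "\<And>q v w. q \<in> cball p r \<Longrightarrow> \<bar>chart_metric c q v w\<bar> \<le> C * norm v * norm w"
    by (rule local_bounds[OF p]) blast
  obtain \<rho>1 \<kappa> where min: "0 < \<rho>1" "0 < \<kappa>" "cball p (2 * \<rho>1) \<subseteq> img c"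
    "\<And>c' v \<sigma> \<sigma>' sp F. geodesic c' v \<Longrightarrow> (\<And>t. t \<in> {0..1} \<Longrightarrow> c' t \<in> cball p \<rho>1 \<and> norm (v t) \<le> \<rho>1) \<Longrightarrow>
      continuous_on {0..1} \<sigma> \<Longrightarrow> \<sigma> 0 = c' 0 \<Longrightarrow> \<sigma> 1 = c' 1 \<Longrightarrow> (\<And>t. t \<in> {0..1} \<Longrightarrow> \<sigma> t \<in> cball p \<rho>1) \<Longrightarrow> finite F \<Longrightarrow>
      (\<And>t. t \<in> {0<..<1} - F \<Longrightarrow> (\<sigma> has_vector_derivative \<sigma>' t) (at t) \<and> sp t = sqrt (chart_metric c (\<sigma> t) (\<sigma>' t) (\<sigma>' t)) \<and> continuous (at t) sp) \<Longrightarrow>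
      sp integrable_on {0..1} \<Longrightarrow> (\<And>t. 0 \<le> sp t) \<Longrightarrow> integral {0..1} sp < \<kappa> \<Longrightarrow>
      sqrt (chart_metric c (c' 0) (v 0) (v 0)) \<le> integral {0..1} sp"
    by (rule geodesic_minimizes_length[OF p]) blast
  define \<tau>0 where "\<tau>0 = min \<rho>1 r"
  have \<tau>0: "0 < \<tau>0" "\<tau>0 \<le> \<rho>1" "\<tau>0 \<le> r" using min b by (auto simp: \<tau>0_def)
  \<comment> \<open>The last two entries make the length of the geodesic, at most
    \<open>sqrt C * \<tau>\<close>, smaller than \<kappa> and than the cost
    \<open>sqrt l * (\<tau>0 / 2)\<close> of leaving the ball. The entry \<open>1/2\<close> yields
    \<open>8 * \<rho> \<le> 1\<close>.\<close>
  define \<tau> where "\<tau> = Min {\<tau>0 / 2, 1/2, \<kappa> / (2 * sqrt C), sqrt l * \<tau>0 / (4 * sqrt C)}"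
  have \<tau>: "0 < \<tau>" "\<tau> \<le> \<tau>0 / 2" "\<tau> \<le> 1/2" "\<tau> \<le> \<kappa> / (2 * sqrt C)" "\<tau> \<le> sqrt l * \<tau>0 / (4 * sqrt C)"
    unfolding \<tau>_def using \<tau>0 min b by auto
  have \<tau>C: "sqrt C * \<tau> < \<kappa>" "sqrt C * \<tau> < sqrt l * (\<tau>0 / 2)"
  proof -
    have sC: "0 < sqrt C" using b(3) by simp
    have "sqrt C * \<tau> \<le> sqrt C * (\<kappa> / (2 * sqrt C))" using \<tau>(4) sC by (intro mult_left_mono) auto
    also have "\<dots> = \<kappa> / 2" using sC by (simp add: field_simps)
    finally show "sqrt C * \<tau> < \<kappa>" using min(2) by simp
    have "sqrt C * \<tau> \<le> sqrt C * (sqrt l * \<tau>0 / (4 * sqrt C))" using \<tau>(5) sC by (intro mult_left_mono) auto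
    also have "\<dots> = sqrt l * (\<tau>0 / 4)" using sC by (simp add: field_simps)
    also have "\<dots> < sqrt l * (\<tau>0 / 2)" using b(2) \<tau>0 by simp
    finally show "sqrt C * \<tau> < sqrt l * (\<tau>0 / 2)" .
  qed
  obtain \<rho> k v where bvp: "0 < \<rho>" "4 * \<rho> \<le> \<tau>" "cball p (4 * \<rho>) \<subseteq> img c"
    "\<And>x y. x \<in> ball p \<rho> \<Longrightarrow> y \<in> ball p \<rho> \<Longrightarrow> geodesic (k x y) (v x y) \<and> k x y 0 = x \<and> k x y 1 = y"
    "\<And>x y t. x \<in> ball p \<rho> \<Longrightarrow> y \<in> ball p \<rho> \<Longrightarrow> t \<in> {0..1} \<Longrightarrow> k x y t \<in> cball p (4 * \<rho>) \<and> norm (v x y t) \<le> 4 * \<rho>"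
    "\<And>x y x' y' t. x \<in> ball p \<rho> \<Longrightarrow> y \<in> ball p \<rho> \<Longrightarrow> x' \<in> ball p \<rho> \<Longrightarrow> y' \<in> ball p \<rho> \<Longrightarrow> t \<in> {0..1} \<Longrightarrow>
      norm (k x y t - k x' y' t) \<le> 2 * (norm (x - x') + norm (y - y')) \<and>
      norm (v x y t - v x' y' t) \<le> 2 * (norm (x - x') + norm (y - y'))"
    "\<And>x y t. x \<in> ball p \<rho> \<Longrightarrow> y \<in> ball p \<rho> \<Longrightarrow> t \<in> {0..1} \<Longrightarrow>
      norm (k x y t - x) \<le> 2 * norm (x - y) \<and> norm (v x y t) \<le> 2 * norm (x - y)"
    by (rule bvp_local[OF p \<tau>(1)]) blast
  have "cball p (8 * \<rho>) \<subseteq> cball p (2 * \<rho>1)" using bvp(2) \<tau>(2) \<tau>0(2) min(1) by (intro subset_cball) linarith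
  then have r8: "cball p (8 * \<rho>) \<subseteq> img c" using min(3) by blast
  have dist: "dist (coord c x) (coord c y) = sqrt (chart_metric c x (v x y 0) (v x y 0))"
    if x: "x \<in> ball p \<rho>" and y: "y \<in> ball p \<rho>" for x y
  proof -
    note geo = bvp(4)[OF x y]
    note inb = bvp(5)[OF x y]
    have gk: "geodesic (k x y) (v x y)" "k x y 0 = x" "k x y 1 = y" using geo by auto
    have xi: "x \<in> img c" "y \<in> img c" using geodesicD(1)[OF gk(1), of 0] geodesicD(1)[OF gk(1), of 1] gk by auto
    define L where "L = sqrt (chart_metric c x (v x y 0) (v x y 0))"
    have L: "L \<le> sqrt C * \<tau>"
    proof -
      have "x \<in> cball p r" using x bvp(1,2) \<tau>(2) \<tau>0 by (auto simp: mem_ball mem_cball)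
      from b(6)[OF this, of "v x y 0" "v x y 0"]
      have "chart_metric c x (v x y 0) (v x y 0) \<le> C * (norm (v x y 0))\<^sup>2" by (simp add: power2_eq_square mult.assoc)
      also have "\<dots> \<le> C * \<tau>\<^sup>2" using inb[of 0] bvp(2) b(3) by (intro mult_left_mono power_mono) auto
      finally have "L \<le> sqrt (C * \<tau>\<^sup>2)" unfolding L_def by simp
      then show ?thesis using \<tau>(1) by (simp add: real_sqrt_mult)
    qed
    have "curve_length A (coord c \<circ> k x y) = integral {0..1} (\<lambda>t. sqrt (chart_metric c (k x y t) (v x y t) (v x y t)))"
      "piecewise_C1_curve A (coord c \<circ> k x y)"
      using chart_curve[OF c geodesicD(2)[OF gk(1)] geodesic_continuous(2,3)[OF gk(1)]] by auto
    moreover have "integral {0..1} (\<lambda>t. sqrt (chart_metric c (k x y t) (v x y t) (v x y t))) = integral {0..1} (\<lambda>_::real. L)"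
      by (rule integral_cong) (use geodesic_constant_speed[OF gk(1)] gk(2) in \<open>simp add: L_def\<close>)
    ultimately have up: "dist (coord c x) (coord c y) \<le> L"
      using dist_le_curve_length[of "coord c \<circ> k x y"] gk(2,3) by simp
    have "L \<le> dist (coord c x) (coord c y)"
    proof (rule ccontr)
      assume "\<not> ?thesis"
      then have "0 < L - dist (coord c x) (coord c y)" by simp
      from short_curve[OF this, of "coord c x" "coord c y"] obtain \<sigma> where \<sigma>: "piecewise_C1_curve A \<sigma>" "\<sigma> 0 = coord c x" "\<sigma> 1 = coord c y" "curve_length A \<sigma> < L"
        by auto
      obtain F where F: "finite F" "curve_speed A \<sigma> integrable_on {0..1}" "continuous_on {0..1} \<sigma>"
        "\<And>t. t \<in> {0<..<1} - F \<Longrightarrow> continuous (at t) (curve_speed A \<sigma>) \<and> continuous (at t) \<sigma>"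
        "\<And>t c. t \<in> {0<..<1} - F \<Longrightarrow> c \<in> A \<Longrightarrow> \<sigma> t \<in> chart_dom c \<Longrightarrow> \<exists>v. ((chart_map c \<circ> \<sigma>) has_vector_derivative v) (at t)"
        by (rule piecewise_C1_facts[OF \<sigma>(1)]) blast
      have e0: "chart_map c (\<sigma> 0) = x" "chart_map c (\<sigma> 1) = y" "\<sigma> 0 \<in> chart_dom c" using chart(6,7)[OF c] xi \<sigma>(2,3) by auto
      have stay: "\<sigma> t \<in> chart_dom c \<and> chart_map c (\<sigma> t) \<in> ball p \<tau>0" if t: "t \<in> {0..1}" for t
      proof (rule short_curve_in_chart[OF c \<sigma>(1), of l p \<tau>0 \<rho>, OF _ _ _ _ _ _ _ t])
        show "0 \<le> l" using b(2) by simp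
        show "cball p \<tau>0 \<subseteq> img c" using b(4) \<tau>0(3) by (meson order_trans subset_cball)
        show "l * (norm v)\<^sup>2 \<le> chart_metric c q v v" if "q \<in> cball p \<tau>0" for q v using b(5)[of q v] that \<tau>0(3) by simp
        show "\<sigma> 0 \<in> chart_dom c" by (rule e0(3))
        show "norm (chart_map c (\<sigma> 0) - p) \<le> \<rho>" using x e0(1) by (simp add: dist_norm norm_minus_commute)
        show r: "\<rho> < \<tau>0" using bvp(1,2) \<tau>(2) \<tau>0(1) by linarith
        have "sqrt l * (\<tau>0 / 2) \<le> sqrt l * (\<tau>0 - \<rho>)" using bvp(1,2) \<tau>(2) b(2) by (intro mult_left_mono) auto
        then show "curve_length A \<sigma> < sqrt l * (\<tau>0 - \<rho>)" using \<sigma>(4) L \<tau>C(2) by linarith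
      qed
      have "sqrt (chart_metric c (k x y 0) (v x y 0) (v x y 0)) \<le> integral {0..1} (curve_speed A \<sigma>)"
      proof (rule min(4)[OF gk(1), of "chart_map c \<circ> \<sigma>" F "\<lambda>t. vector_derivative (chart_map c \<circ> \<sigma>) (at t)" "curve_speed A \<sigma>"])
        show "k x y t \<in> cball p \<rho>1 \<and> norm (v x y t) \<le> \<rho>1" if "t \<in> {0..1}" for t
          using inb[OF that] bvp(2) \<tau>(2) \<tau>0(1,2) by auto
        show "continuous_on {0..1} (chart_map c \<circ> \<sigma>)"
          unfolding o_def by (rule continuous_on_compose2[OF chart(3)[OF c] F(3)]) (use stay in auto)
        show "(chart_map c \<circ> \<sigma>) 0 = k x y 0" "(chart_map c \<circ> \<sigma>) 1 = k x y 1" using e0 gk by simp_all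
        show "(chart_map c \<circ> \<sigma>) t \<in> cball p \<rho>1" if "t \<in> {0..1}" for t using stay[OF that] \<tau>0(2) by auto
        show "finite F" "curve_speed A \<sigma> integrable_on {0..1}" by (rule F(1), rule F(2))
        show "0 \<le> curve_speed A \<sigma> t" for t by (rule curve_speed_nonneg)
        show "integral {0..1} (curve_speed A \<sigma>) < \<kappa>" using \<sigma>(4) L \<tau>C(1) unfolding curve_length_def by linarith
        fix t assume t: "t \<in> {0<..<1} - F"
        then have st: "\<sigma> t \<in> chart_dom c" using stay[of t] by auto
        obtain w where w: "((chart_map c \<circ> \<sigma>) has_vector_derivative w) (at t)" using F(5)[OF t c st] by blast
        have ct: "continuous (at t) \<sigma>" using F(4)[OF t] by blast
        show "((chart_map c \<circ> \<sigma>) has_vector_derivative vector_derivative (chart_map c \<circ> \<sigma>) (at t)) (at t) \<and>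
          curve_speed A \<sigma> t = sqrt (chart_metric c ((chart_map c \<circ> \<sigma>) t) (vector_derivative (chart_map c \<circ> \<sigma>) (at t))
            (vector_derivative (chart_map c \<circ> \<sigma>) (at t))) \<and> continuous (at t) (curve_speed A \<sigma>)"
          using curve_speed_eq[where c = c and \<sigma> = \<sigma> and t = t, OF c st ct w] w F(4)[OF t] unfolding vector_derivative_at[OF w] by simp
      qed
      then show False using \<sigma>(4) gk(2) unfolding L_def curve_length_def by simp
    qed
    then show ?thesis using up unfolding L_def by linarith
  qed
  have "(dist (coord c x) (coord c y))\<^sup>2 = chart_metric c x (v x y 0) (v x y 0)" if x: "x \<in> ball p \<rho>" and y: "y \<in> ball p \<rho>" for x y
  proof -
    have "x \<in> cball p r" using x bvp(1,2) \<tau>(2) \<tau>0 by (auto simp: mem_ball mem_cball)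
    then have "0 \<le> chart_metric c x (v x y 0) (v x y 0)" using b(2) b(5)[of x "v x y 0"] by (meson mult_nonneg_nonneg less_imp_le order_trans zero_le_power2)
    then show ?thesis unfolding dist[OF that] by simp
  qed
  moreover have "8 * \<rho> \<le> 1" using bvp(2) \<tau>(3) by linarith
  ultimately show thesis by - (rule that[OF bvp(1) r8 _ bvp(4-7)]; assumption)
qed

lemma chart_nhd:
  assumes P: "P \<in> chart_dom c" and d: "0 < d"
  obtains r where "0 < r" "\<And>X. X \<in> cball P r \<Longrightarrow> X \<in> chart_dom c \<and> chart_map c X \<in> ball (chart_map c P) d"
proof -
  define N where "N = chart_map c -` ball (chart_map c P) d \<inter> chart_dom c"
  have "open N" unfolding N_def
    using continuous_on_open_vimage[OF chart(1)[OF c]] chart(3)[OF c] open_ball by blast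
  moreover have "P \<in> N" using P d by (simp add: N_def)
  ultimately obtain r where "0 < r" "cball P r \<subseteq> N" using open_contains_cball by blast
  then show thesis using that[of r] unfolding N_def by blast
qed

lemma chart_cn:
  assumes P: "P \<in> chart_dom c"
  shows "\<exists>r>0. cn_ball P r"
proof -
  let ?p = "chart_map c P"
  obtain \<rho> k v where \<rho>: "0 < \<rho>" "cball ?p (8 * \<rho>) \<subseteq> img c" "8 * \<rho> \<le> 1"
    and geo: "\<And>x y. x \<in> ball ?p \<rho> \<Longrightarrow> y \<in> ball ?p \<rho> \<Longrightarrow> geodesic (k x y) (v x y) \<and> k x y 0 = x \<and> k x y 1 = y"
    and inb: "\<And>x y t. x \<in> ball ?p \<rho> \<Longrightarrow> y \<in> ball ?p \<rho> \<Longrightarrow> t \<in> {0..1} \<Longrightarrow> k x y t \<in> cball ?p (4 * \<rho>) \<and> norm (v x y t) \<le> 4 * \<rho>"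
    and stab: "\<And>x y x' y' t. x \<in> ball ?p \<rho> \<Longrightarrow> y \<in> ball ?p \<rho> \<Longrightarrow> x' \<in> ball ?p \<rho> \<Longrightarrow> y' \<in> ball ?p \<rho> \<Longrightarrow> t \<in> {0..1} \<Longrightarrow>
      norm (k x y t - k x' y' t) \<le> 2 * (norm (x - x') + norm (y - y')) \<and>
      norm (v x y t - v x' y' t) \<le> 2 * (norm (x - x') + norm (y - y'))"
    and lin: "\<And>x y t. x \<in> ball ?p \<rho> \<Longrightarrow> y \<in> ball ?p \<rho> \<Longrightarrow> t \<in> {0..1} \<Longrightarrow>
      norm (k x y t - x) \<le> 2 * norm (x - y) \<and> norm (v x y t) \<le> 2 * norm (x - y)"
    and dist: "\<And>x y. x \<in> ball ?p \<rho> \<Longrightarrow> y \<in> ball ?p \<rho> \<Longrightarrow> (dist (coord c x) (coord c y))\<^sup>2 = chart_metric c x (v x y 0) (v x y 0)"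
    by (rule local_distance[OF P]) blast
  \<comment> \<open>With both ends within \<open>\<rho> / 5\<close> of the centre, the geodesic
    strays from \<open>x\<close> by at most \<open>2 * norm (x - y)\<close>, less than
    \<open>4 * \<rho> / 5\<close>, and so stays in the ball of radius \<rho>.\<close>
  obtain r where r: "0 < r" "\<And>X. X \<in> cball P r \<Longrightarrow> X \<in> chart_dom c \<and> chart_map c X \<in> ball ?p (\<rho> / 5)"
    by (rule chart_nhd[OF P, of "\<rho> / 5"]) (use \<rho> in auto)
  have "\<exists>m. \<forall>Z\<in>ball P r. (dist Z m)\<^sup>2 \<le> (dist Z X)\<^sup>2 / 2 + (dist Z Y)\<^sup>2 / 2 - (dist X Y)\<^sup>2 / 4"
    if X: "X \<in> ball P r" and Y: "Y \<in> ball P r" for X Y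
  proof (intro exI ballI)
    fix Z assume Z: "Z \<in> ball P r"
    have co: "coord c (chart_map c W) = W" "chart_map c W \<in> ball ?p \<rho>" "chart_map c W \<in> ball ?p (\<rho> / 5)" if "W \<in> ball P r" for W
    proof -
      have W: "W \<in> chart_dom c" "chart_map c W \<in> ball ?p (\<rho> / 5)" using r(2)[of W] that by auto
      then show "coord c (chart_map c W) = W" "chart_map c W \<in> ball ?p \<rho>" "chart_map c W \<in> ball ?p (\<rho> / 5)"
        using chart(5)[OF c] \<rho>(1) by auto
    qed
    define x y z where xyz: "x = chart_map c X" "y = chart_map c Y" "z = chart_map c Z"
    have b: "x \<in> ball ?p \<rho>" "y \<in> ball ?p \<rho>" "z \<in> ball ?p \<rho>" using co(2) X Y Z by (auto simp: xyz)
    have kb: "k x y t \<in> ball ?p \<rho>" if t: "t \<in> {0..1}" for t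
    proof -
      have 1: "norm (k x y t - x) \<le> 2 * norm (x - y)" using lin[OF b(1,2) t] by blast
      have 2: "norm (x - ?p) < \<rho> / 5" "norm (y - ?p) < \<rho> / 5" using co(3)[OF X] co(3)[OF Y] by (auto simp: xyz dist_norm norm_minus_commute)
      have 3: "norm (x - y) \<le> norm (x - ?p) + norm (y - ?p)" using norm_triangle_ineq4[of "x - ?p" "y - ?p"] by simp
      have "norm (k x y t - ?p) \<le> norm (k x y t - x) + norm (x - ?p)" using norm_triangle_ineq[of "k x y t - x" "x - ?p"] by simp
      then have "norm (k x y t - ?p) < \<rho>" using 1 2 3 by argo
      then show ?thesis by (simp add: dist_norm norm_minus_commute)
    qed
    have m: "k x y (1/2) \<in> ball ?p \<rho>" using kb by simp
    have "chart_metric c z (v z (k x y (1/2)) 0) (v z (k x y (1/2)) 0)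
      \<le> chart_metric c z (v z x 0) (v z x 0) / 2 + chart_metric c z (v z y 0) (v z y 0) / 2 - chart_metric c x (v x y 0) (v x y 0) / 4"
      by (rule coordinate_cn[OF \<rho> geo inb stab b kb])
    then show "(dist Z (coord c (k (chart_map c X) (chart_map c Y) (1/2))))\<^sup>2 \<le> (dist Z X)\<^sup>2 / 2 + (dist Z Y)\<^sup>2 / 2 - (dist X Y)\<^sup>2 / 4"
      using dist[OF b(3) m] dist[OF b(3) b(1)] dist[OF b(3) b(2)] dist[OF b(1) b(2)]
      unfolding xyz using co(1)[OF X] co(1)[OF Y] co(1)[OF Z] by simp
  qed
  then show ?thesis unfolding cn_ball_def using r(1) by blast
qed

lemma chart_loc_compact:
  assumes P: "P \<in> chart_dom c"
  shows "\<exists>r>0. compact (cball P r)"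
proof -
  let ?p = "chart_map c P"
  have "?p \<in> img c" using P by blast
  then obtain d where d: "0 < d" "cball ?p d \<subseteq> img c" using chart(2)[OF c] open_contains_cball by blast
  obtain r where r: "0 < r" "\<And>X. X \<in> cball P r \<Longrightarrow> X \<in> chart_dom c \<and> chart_map c X \<in> ball ?p d"
    by (rule chart_nhd[OF P d(1)]) blast
  have "compact (coord c ` cball ?p d)" by (rule compact_continuous_image[OF continuous_on_subset[OF chart(4)[OF c] d(2)] compact_cball])
  then have "compact (coord c ` cball ?p d \<inter> cball P r)" by (rule compact_Int_closed) simp
  moreover have "X \<in> coord c ` cball ?p d" if "X \<in> cball P r" for X
    using r(2)[OF that] chart(5)[OF c, of X] by (intro image_eqI[of _ _ "chart_map c X"]) auto
  then have "coord c ` cball ?p d \<inter> cball P r = cball P r" by blast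
  ultimately show ?thesis using r(1) by auto
qed

text \<open>The acceleration of a geodesic is quadratic in its velocity, so the initial velocity
  from \<open>x\<close> to \<open>y\<close> differs from \<open>y - x\<close> by a term of second
  order; and the metric at \<open>x\<close> is close to the one at \<open>p\<close>. To first order,
  distances are those of the constant metric at \<open>p\<close>.\<close>

lemma distance_estimate:
  assumes P: "P \<in> chart_dom c" and \<epsilon>: "0 < \<epsilon>"
  defines "p \<equiv> chart_map c P"
  obtains \<delta> where "0 < \<delta>" "ball p \<delta> \<subseteq> img c"
    "\<And>x y. x \<in> ball p \<delta> \<Longrightarrow> y \<in> ball p \<delta> \<Longrightarrow>
      \<bar>(dist (coord c x) (coord c y))\<^sup>2 - chart_metric c p (y - x) (y - x)\<bar> \<le> \<epsilon> * chart_metric c p (y - x) (y - x)"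
proof -
  have p: "p \<in> img c" using P by (simp add: p_def)
  obtain r l C where b: "0 < r" "0 < l" "0 < C" "cball p r \<subseteq> img c"
    "\<And>q v. q \<in> cball p r \<Longrightarrow> l * (norm v)\<^sup>2 \<le> chart_metric c q v v"
    "\<And>q v w. q \<in> cball p r \<Longrightarrow> \<bar>chart_metric c q v w\<bar> \<le> C * norm v * norm w"
    "\<And>q v w. q \<in> cball p r \<Longrightarrow> norm (christoffel (chart_metric c) q v w) \<le> C * norm v * norm w"
    by (rule local_bounds[OF p]) blast
  obtain \<rho> k v where \<rho>: "0 < \<rho>" "cball p (8 * \<rho>) \<subseteq> img c" "8 * \<rho> \<le> 1"
    and geo: "\<And>x y. x \<in> ball p \<rho> \<Longrightarrow> y \<in> ball p \<rho> \<Longrightarrow> geodesic (k x y) (v x y) \<and> k x y 0 = x \<and> k x y 1 = y"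
    and lin: "\<And>x y t. x \<in> ball p \<rho> \<Longrightarrow> y \<in> ball p \<rho> \<Longrightarrow> t \<in> {0..1} \<Longrightarrow>
      norm (k x y t - x) \<le> 2 * norm (x - y) \<and> norm (v x y t) \<le> 2 * norm (x - y)"
    and dist: "\<And>x y. x \<in> ball p \<rho> \<Longrightarrow> y \<in> ball p \<rho> \<Longrightarrow> (dist (coord c x) (coord c y))\<^sup>2 = chart_metric c x (v x y 0) (v x y 0)"
    by (rule local_distance[OF P, folded p_def]) blast
  \<comment> \<open>\<open>5 * \<delta>\<close> bounds the excursion of the geodesics from
    \<open>p\<close>. The 26 is 24 from replacing the initial velocity by \<open>y - x\<close>, plus
    2 from moving the metric from \<open>x\<close> to \<open>p\<close>.\<close>
  define \<delta> where "\<delta> = Min {\<rho>, r / 5, \<epsilon> * l / (26 * C\<^sup>2)}"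
  have \<delta>: "0 < \<delta>" "\<delta> \<le> \<rho>" "5 * \<delta> \<le> r" "\<delta> \<le> \<epsilon> * l / (26 * C\<^sup>2)" unfolding \<delta>_def using \<rho>(1) b(1-3) \<epsilon> by auto
  have C26: "26 * C\<^sup>2 * \<delta> \<le> \<epsilon> * l" using \<delta>(4) b(3) by (simp add: field_simps)
  have sub: "ball p \<delta> \<subseteq> cball p r" using \<delta> by auto
  show thesis
  proof (rule that[OF \<delta>(1)])
    show "ball p \<delta> \<subseteq> img c" using sub b(4) by blast
    fix x y assume x: "x \<in> ball p \<delta>" and y: "y \<in> ball p \<delta>"
    define d where "d = y - x"
    have xy: "x \<in> ball p \<rho>" "y \<in> ball p \<rho>" using x y \<delta>(2) by auto
    have xS: "x \<in> img c" and xr: "x \<in> cball p r" using x sub b(4) by auto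
    have gk: "geodesic (k x y) (v x y)" "k x y 0 = x" "k x y 1 = y" using geo[OF xy] by auto
    have nxy: "norm (x - p) < \<delta>" "norm (y - p) < \<delta>" using x y by (auto simp: dist_norm norm_minus_commute)
    have nd: "norm d \<le> 2 * \<delta>" using norm_triangle_ineq4[of "y - p" "x - p"] nxy unfolding d_def by simp
    have d': "norm (x - y) = norm d" by (simp add: d_def norm_minus_commute)
    have kr: "k x y t \<in> cball p r" if t: "t \<in> {0..1}" for t
    proof -
      have "norm (k x y t - p) \<le> norm (k x y t - x) + norm (x - p)" using norm_triangle_ineq[of "k x y t - x" "x - p"] by simp
      then have "norm (k x y t - p) \<le> r" using lin[OF xy t] nxy(1) nd \<delta>(3) unfolding d' by argo
      then show ?thesis by (simp add: dist_norm norm_minus_commute)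
    qed
    have acc: "norm (christoffel (chart_metric c) (k x y t) (v x y t) (v x y t)) \<le> 4 * C * (norm d)\<^sup>2" if t: "t \<in> {0..1}" for t
    proof -
      have "norm (v x y t) * norm (v x y t) \<le> (2 * norm d) * (2 * norm d)" using lin[OF xy t] unfolding d' by (intro mult_mono) auto
      then have "C * (norm (v x y t) * norm (v x y t)) \<le> C * ((2 * norm d) * (2 * norm d))" using b(3) by (intro mult_left_mono) auto
      then show ?thesis using b(7)[OF kr[OF t], of "v x y t" "v x y t"] by (simp add: power2_eq_square mult.assoc)
    qed
    have v0: "norm (v x y t - v x y 0) \<le> 4 * C * (norm d)\<^sup>2" if t: "t \<in> {0<..<1}" for t
    proof -
      obtain s where s: "s \<in> {0<..<t}" "norm (v x y t - v x y 0) \<le> t * norm (- christoffel (chart_metric c) (k x y s) (v x y s) (v x y s))"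
        by (rule vector_mean_value[of t "v x y", OF _ _ geodesicD(3)[OF gk(1)]]) (use t in auto)
      have "t * norm (christoffel (chart_metric c) (k x y s) (v x y s) (v x y s)) \<le> 1 * (4 * C * (norm d)\<^sup>2)"
        using t s(1) acc[of s] by (intro mult_mono) auto
      then show ?thesis using s(2) by simp
    qed
    define w where "w = v x y 0 - d"
    have w: "norm w \<le> 4 * C * (norm d)\<^sup>2"
    proof -
      \<comment> \<open>Subtracting the uniform motion with the initial velocity leaves a curve
        whose total displacement is \<open>- w\<close>.\<close>
      let ?f = "\<lambda>t. k x y t - t *\<^sub>R v x y 0"
      have "(?f has_vector_derivative v x y s - v x y 0) (at s within {0..1})" if "s \<in> {0..1}" for s
        using geodesicD(2)[OF gk(1) that] by (auto intro!: derivative_eq_intros)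
      then obtain s where s: "s \<in> {0<..<1}" "norm (?f 1 - ?f 0) \<le> 1 * norm (v x y s - v x y 0)"
        by (rule vector_mean_value[of 1 ?f, rotated 2]) auto
      have "?f 1 - ?f 0 = - w" using gk(2,3) by (simp add: w_def d_def)
      then show ?thesis using s(2) v0[OF s(1)] by simp
    qed
    have "chart_metric c x (v x y 0) (v x y 0) - chart_metric c x d d = chart_metric c x w (v x y 0 + d)"
      using g_sym[OF xS, of d "v x y 0"] by (simp add: w_def lin_simps xS)
    then have "\<bar>chart_metric c x (v x y 0) (v x y 0) - chart_metric c x d d\<bar> \<le> C * norm w * norm (v x y 0 + d)" using b(6)[OF xr] by simp
    also have "\<dots> \<le> C * (4 * C * (norm d)\<^sup>2) * (3 * norm d)"
    proof (intro mult_mono w)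
      show "norm (v x y 0 + d) \<le> 3 * norm d" using norm_triangle_ineq[of "v x y 0" d] lin[OF xy, of 0] unfolding d' by simp
    qed (use b(3) in auto)
    also have "\<dots> = (12 * C\<^sup>2 * (norm d)\<^sup>2) * norm d" by (simp add: power2_eq_square)
    also have "\<dots> \<le> (12 * C\<^sup>2 * (norm d)\<^sup>2) * (2 * \<delta>)" using nd by (intro mult_left_mono) auto
    finally have 1: "\<bar>chart_metric c x (v x y 0) (v x y 0) - chart_metric c x d d\<bar> \<le> 24 * C\<^sup>2 * \<delta> * (norm d)\<^sup>2" by (simp add: algebra_simps)
    have "norm (chart_metric c x d d - chart_metric c p d d) \<le> 2 * C\<^sup>2 * (norm d)\<^sup>2 * norm (x - p)"
    proof (rule differentiable_bound[of "ball p \<delta>"])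
      fix q assume q: "q \<in> ball p \<delta>"
      then have qr: "q \<in> cball p r" and qS: "q \<in> img c" using sub b(4) by auto
      let ?D = "\<lambda>h. chart_metric c q (christoffel (chart_metric c) q h d) d + chart_metric c q d (christoffel (chart_metric c) q h d)"
      show "((\<lambda>q. chart_metric c q d d) has_derivative ?D) (at q within ball p \<delta>)" by (rule has_derivative_at_withinI[OF g_deriv[OF qS]])
      show "onorm ?D \<le> 2 * C\<^sup>2 * (norm d)\<^sup>2"
      proof (rule onorm_bound)
        fix h
        have "C * norm (christoffel (chart_metric c) q h d) * norm d \<le> C * (C * norm h * norm d) * norm d"
          using b(3) b(7)[OF qr] by (intro mult_mono) auto
        then have "\<bar>chart_metric c q (christoffel (chart_metric c) q h d) d\<bar> \<le> C * (C * norm h * norm d) * norm d"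
          using b(6)[OF qr, of "christoffel (chart_metric c) q h d" d] by linarith
        then have "\<bar>?D h\<bar> \<le> 2 * (C * (C * norm h * norm d) * norm d)" unfolding g_sym[OF qS, of d] by linarith
        then show "norm (?D h) \<le> 2 * C\<^sup>2 * (norm d)\<^sup>2 * norm h" by (simp add: power2_eq_square algebra_simps)
      qed simp
    qed (use x \<delta>(1) in auto)
    also have "\<dots> \<le> 2 * C\<^sup>2 * (norm d)\<^sup>2 * \<delta>" using nxy(1) by (intro mult_left_mono) auto
    finally have 2: "\<bar>chart_metric c x d d - chart_metric c p d d\<bar> \<le> 2 * C\<^sup>2 * \<delta> * (norm d)\<^sup>2" by (simp add: algebra_simps)
    have "\<bar>chart_metric c x (v x y 0) (v x y 0) - chart_metric c p d d\<bar> \<le> 26 * C\<^sup>2 * \<delta> * (norm d)\<^sup>2"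
      using 1 2 by (simp add: algebra_simps abs_le_iff)
    also have "\<dots> \<le> \<epsilon> * l * (norm d)\<^sup>2" using C26 by (intro mult_right_mono) auto
    also have "\<dots> \<le> \<epsilon> * chart_metric c p d d" using b(1,5) \<epsilon> by (simp add: mult.assoc)
    finally show "\<bar>(dist (coord c x) (coord c y))\<^sup>2 - chart_metric c p (y - x) (y - x)\<bar> \<le> \<epsilon> * chart_metric c p (y - x) (y - x)"
      unfolding dist[OF xy] d_def .
  qed
qed

text \<open>The point \<open>q\<close> opposite to \<open>x\<close> in coordinates has squared
  distance \<open>N\<close> from the centre and \<open>4 * N\<close> from \<open>x\<close>, up to
  factors between \<open>1 - \<epsilon>\<close> and \<open>1 + \<epsilon>\<close>. With
  \<open>\<epsilon> = \<theta> / 4\<close>, quotients of such factors lie between the squares of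
  \<open>1 - \<theta>\<close> and \<open>1 + \<theta>\<close>.\<close>

lemma chart_reflect:
  assumes P: "P \<in> chart_dom c" and \<eta>: "0 < \<eta>"
  shows "\<exists>r>0. \<forall>X\<in>ball P r. \<exists>Q. dist P Q \<le> (1 + \<eta>) * dist P X \<and> 2 * (1 - \<eta>) * dist P X \<le> dist X Q"
proof -
  \<comment> \<open>Capped at 1, so that in both comparisons of factors the higher powers of
    \<theta> are dominated by \<theta>.\<close>
  define \<theta> where "\<theta> = min \<eta> 1"
  have \<theta>: "0 < \<theta>" "\<theta> \<le> 1" "\<theta> \<le> \<eta>" using \<eta> by (auto simp: \<theta>_def)
  define \<epsilon> where "\<epsilon> = \<theta> / 4"
  have \<epsilon>: "0 < \<epsilon>" "\<epsilon> < 1" using \<theta> by (auto simp: \<epsilon>_def)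
  let ?p = "chart_map c P"
  obtain \<delta> where \<delta>: "0 < \<delta>" "ball ?p \<delta> \<subseteq> img c"
    "\<And>x y. x \<in> ball ?p \<delta> \<Longrightarrow> y \<in> ball ?p \<delta> \<Longrightarrow>
      \<bar>(dist (coord c x) (coord c y))\<^sup>2 - chart_metric c ?p (y - x) (y - x)\<bar> \<le> \<epsilon> * chart_metric c ?p (y - x) (y - x)"
    by (rule distance_estimate[OF P \<epsilon>(1)]) blast
  obtain r where r: "0 < r" "\<And>X. X \<in> cball P r \<Longrightarrow> X \<in> chart_dom c \<and> chart_map c X \<in> ball ?p \<delta>"
    by (rule chart_nhd[OF P \<delta>(1)]) blast
  have "\<exists>Q. dist P Q \<le> (1 + \<eta>) * dist P X \<and> 2 * (1 - \<eta>) * dist P X \<le> dist X Q" if X: "X \<in> ball P r" for X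
  proof (intro exI conjI)
    have Xc: "X \<in> chart_dom c" "chart_map c X \<in> ball ?p \<delta>" using r(2)[of X] X by auto
    define x where "x = chart_map c X"
    define q where "q = ?p + (?p - x)"
    have pb: "?p \<in> ball ?p \<delta>" and xb: "x \<in> ball ?p \<delta>" and qb: "q \<in> ball ?p \<delta>"
      using \<delta>(1) Xc(2) by (auto simp: x_def q_def dist_norm norm_minus_commute)
    have co: "coord c ?p = P" "coord c x = X" using chart(5)[OF c] P Xc(1) by (auto simp: x_def)
    have pS: "?p \<in> img c" using P by blast
    define N where "N = chart_metric c ?p (?p - x) (?p - x)"
    have N0: "0 \<le> N" unfolding N_def using g_pos[OF pS, of "?p - x"] linear_0[OF g_lin[OF pS]] by (cases "?p - x = 0") auto
    have e1: "chart_metric c ?p (x - ?p) (x - ?p) = N" 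
      using linear_neg[OF g_lin[OF pS]] linear_neg[OF g_lin'[OF pS]] unfolding N_def by (metis minus_diff_eq minus_minus)
    have e2: "chart_metric c ?p (q - x) (q - x) = 4 * N"
    proof -
      have "q - x = 2 *\<^sub>R (?p - x)" by (simp add: q_def scaleR_2)
      then show ?thesis unfolding N_def using linear_cmul[OF g_lin[OF pS]] linear_cmul[OF g_lin'[OF pS]] by simp
    qed
    have PX: "(1 - \<epsilon>) * N \<le> (dist P X)\<^sup>2" "(dist P X)\<^sup>2 \<le> (1 + \<epsilon>) * N"
      using \<delta>(3)[OF pb xb] unfolding co e1 by (auto simp: abs_le_iff algebra_simps)
    have PQ: "(dist P (coord c q))\<^sup>2 \<le> (1 + \<epsilon>) * N"
    proof -
      have "q - ?p = ?p - x" by (simp add: q_def)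
      then have "chart_metric c ?p (q - ?p) (q - ?p) = N" by (simp add: N_def)
      then show ?thesis using \<delta>(3)[OF pb qb] unfolding co by (simp add: abs_le_iff algebra_simps)
    qed
    have XQ: "(1 - \<epsilon>) * (4 * N) \<le> (dist X (coord c q))\<^sup>2"
      using \<delta>(3)[OF xb qb] unfolding co e2 by (auto simp: abs_le_iff algebra_simps)
    have th2: "\<theta>\<^sup>2 \<le> \<theta>" "0 \<le> \<theta>\<^sup>2" "0 \<le> \<theta> ^ 3" "\<theta> ^ 3 \<le> \<theta>\<^sup>2"
      using \<theta> by (auto simp: power2_eq_square power3_eq_cube mult_left_le)
    have "(1 + \<epsilon>) \<le> (1 + \<theta>)\<^sup>2 * (1 - \<epsilon>)"
    proof -
      have "(1 + \<theta>)\<^sup>2 * (1 - \<epsilon>) - (1 + \<epsilon>) = (6 * \<theta> + 2 * \<theta>\<^sup>2 - \<theta> ^ 3) / 4"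
        by (simp add: \<epsilon>_def power2_eq_square power3_eq_cube algebra_simps)
      moreover have "0 \<le> (6 * \<theta> + 2 * \<theta>\<^sup>2 - \<theta> ^ 3) / 4" using th2 \<theta>(1) zero_le_power2[of \<theta>] by (simp only: zero_le_divide_iff) linarith
      ultimately show ?thesis by linarith
    qed
    then have "(1 + \<epsilon>) * N \<le> (1 + \<theta>)\<^sup>2 * (1 - \<epsilon>) * N" using N0 by (rule mult_right_mono)
    also have "\<dots> \<le> (1 + \<theta>)\<^sup>2 * (dist P X)\<^sup>2" using PX(1) by (simp add: mult.assoc mult_left_mono)
    finally have "(dist P (coord c q))\<^sup>2 \<le> ((1 + \<theta>) * dist P X)\<^sup>2" using PQ by (simp add: power_mult_distrib)
    then have "dist P (coord c q) \<le> (1 + \<theta>) * dist P X" by (rule power2_le_imp_le) (use \<theta> in simp)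
    also have "\<dots> \<le> (1 + \<eta>) * dist P X" using \<theta> by (intro mult_right_mono) auto
    finally show "dist P (coord c q) \<le> (1 + \<eta>) * dist P X" .
    have "(1 - \<theta>)\<^sup>2 * (1 + \<epsilon>) \<le> 1 - \<epsilon>"
    proof -
      have "1 - \<epsilon> - (1 - \<theta>)\<^sup>2 * (1 + \<epsilon>) = (6 * \<theta> - 2 * \<theta>\<^sup>2 - \<theta> ^ 3) / 4"
        by (simp add: \<epsilon>_def power2_eq_square power3_eq_cube algebra_simps)
      then show ?thesis using th2 \<theta>(1) by simp
    qed
    then have "(1 - \<theta>)\<^sup>2 * (1 + \<epsilon>) * (4 * N) \<le> (1 - \<epsilon>) * (4 * N)" using N0 by (intro mult_right_mono) auto
    moreover have "(1 - \<theta>)\<^sup>2 * (dist P X)\<^sup>2 \<le> (1 - \<theta>)\<^sup>2 * ((1 + \<epsilon>) * N)" using PX(2) by (intro mult_left_mono) auto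
    ultimately have "(2 * (1 - \<theta>) * dist P X)\<^sup>2 \<le> (dist X (coord c q))\<^sup>2" using XQ unfolding power_mult_distrib[of _ "dist P X"] power_mult_distrib[of 2] by simp
    then have "2 * (1 - \<theta>) * dist P X \<le> dist X (coord c q)" by (rule power2_le_imp_le) simp
    moreover have "2 * (1 - \<eta>) * dist P X \<le> 2 * (1 - \<theta>) * dist P X" using \<theta> by (intro mult_right_mono) auto
    ultimately show "2 * (1 - \<eta>) * dist P X \<le> dist X (coord c q)" by linarith
  qed
  then show ?thesis using r(1) by blast
qed

end

section \<open>Hadamard manifolds as metric spaces, and the formulas for the quotient\<close>

lemma nonpos_space_hadamard:
  fixes A :: "('a::metric_space, 'e::euclidean_space) rchart set"
  assumes A: "hadamard_space A"
  shows "nonpos_space TYPE('a)"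
proof -
  interpret riemannian A by (rule riemannian.intro) (use A in \<open>simp add: hadamard_space_def\<close>)
  have chart: "\<exists>c. nonpos_chart A c \<and> P \<in> chart_dom c" for P
  proof -
    obtain c where c: "c \<in> A" "P \<in> chart_dom c" using chart_ex by blast
    then have "nonpos_chart A c"
      using A unfolding hadamard_space_def nonpositively_curved_def
      by (intro nonpos_chart.intro nonpos_chart_axioms.intro riemannian_axioms) auto
    then show ?thesis using c by blast
  qed
  show ?thesis
  proof (rule nonpos_space.intro)
    show "complete (UNIV :: 'a set)" "simply_connected (UNIV :: 'a set)" using A by (auto simp: hadamard_space_def)
    show "\<exists>r>0. compact (cball P r)" for P :: 'a using chart[of P] nonpos_chart.chart_loc_compact by blast
    show "\<exists>r>0. cn_ball P r" for P :: 'a using chart[of P] nonpos_chart.chart_cn by blast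
    show "\<exists>r>0. \<forall>X\<in>ball P r. \<exists>Q. dist P Q \<le> (1 + \<eta>) * dist P X \<and> 2 * (1 - \<eta>) * dist P X \<le> dist X Q"
      if "0 < \<eta>" for P :: 'a and \<eta> using chart[of P] nonpos_chart.chart_reflect[OF _ _ that] by blast
  qed (rule short_path)
qed

theorem theorem24:
  fixes A :: "('a::metric_space, 'e::euclidean_space) rchart set"
    and G :: "('a \<Rightarrow> 'a) set"
    and \<alpha> :: "real \<Rightarrow> 'a set"
    and \<gamma> :: "real \<Rightarrow> 'a"
  assumes "hadamard_space A"
    and "regular_group G"
    and "quasi_ray setdist \<alpha>"
    and "is_lift G \<alpha> \<gamma>"
  shows "(\<forall>x y.
            busemann setdist \<alpha> (orbit G x) (orbit G y) =
            signed_dist_horoballs \<gamma> (max_horoball G \<gamma> x) (max_horoball G \<gamma> y)) \<and>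
         (\<forall>y.
            ereal (busemann setdist \<alpha> (\<alpha> 0) (orbit G y)) =
              (SUP g\<in>G. ereal (busemann dist \<gamma> (\<gamma> 0) (g y))) - length_excess setdist \<alpha> \<and>
            ereal (busemann setdist \<alpha> (\<alpha> 0) (orbit G y)) =
              ereal (signed_dist_point \<gamma> (\<gamma> 0) (max_horoball G \<gamma> y)) - length_excess setdist \<alpha>) \<and>
         (ray setdist \<alpha> \<longrightarrow> (\<forall>y.
            ereal (busemann setdist \<alpha> (\<alpha> 0) (orbit G y)) =
              (SUP g\<in>G. ereal (busemann dist \<gamma> (\<gamma> 0) (g y))) \<and>
            busemann setdist \<alpha> (\<alpha> 0) (orbit G y) =
              signed_dist_point \<gamma> (\<gamma> 0) (max_horoball G \<gamma> y)))"
  proof -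
  interpret nonpos_space "TYPE('a)" by (rule nonpos_space_hadamard[OF assms(1)])
  interpret nonpos_quotient "TYPE('a)" G \<alpha> \<gamma> by unfold_locales (rule assms(2-4))+
  show ?thesis
  proof (intro conjI allI impI)
    show "busemann setdist \<alpha> (orbit G x) (orbit G y) =
      signed_dist_horoballs \<gamma> (max_horoball G \<gamma> x) (max_horoball G \<gamma> y)" for x y
      by (rule busemann_quotient)
    fix y
    show "ereal (busemann setdist \<alpha> (\<alpha> 0) (orbit G y)) =
        (SUP g\<in>G. ereal (busemann dist \<gamma> (\<gamma> 0) (g y))) - length_excess setdist \<alpha>"
      "ereal (busemann setdist \<alpha> (\<alpha> 0) (orbit G y)) =
        ereal (signed_dist_point \<gamma> (\<gamma> 0) (max_horoball G \<gamma> y)) - length_excess setdist \<alpha>"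
      by (rule busemann_origin)+
  next
    fix y assume "ray setdist \<alpha>"
    then have "length_excess setdist \<alpha> = 0" by (simp add: ray_def)
    then have o: "ereal (busemann setdist \<alpha> (\<alpha> 0) (orbit G y)) = (SUP g\<in>G. ereal (busemann dist \<gamma> (\<gamma> 0) (g y)))"
      "ereal (busemann setdist \<alpha> (\<alpha> 0) (orbit G y)) = ereal (signed_dist_point \<gamma> (\<gamma> 0) (max_horoball G \<gamma> y))"
      using busemann_origin[of y] by simp_all
    show "ereal (busemann setdist \<alpha> (\<alpha> 0) (orbit G y)) = (SUP g\<in>G. ereal (busemann dist \<gamma> (\<gamma> 0) (g y)))"
      "busemann setdist \<alpha> (\<alpha> 0) (orbit G y) = signed_dist_point \<gamma> (\<gamma> 0) (max_horoball G \<gamma> y)"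
      by (rule o(1)) (use o(2) in simp)
  qed
qed

end
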